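(* Let $k(x,y)=\psi(\|x-y\|)$ be a positive definite radial kernel on $\mathbb R^d$ with $\psi$ analytic at $0$ and finite regularity index $r\ge1$. Let $\{x_1,\dots,x_n\}\subset\mathbb R^d$ be a set of $n$ points with $\mathrm{rank}\,V_{\le r-1}<n$, let $K(\varepsilon)=[\psi(\varepsilon\|x_i-x_j\|)]_{i,j=1}^n$, and let $A\in\mathbb R^{n\times c}$, $c=n-\mathrm{rank}\,V_{\le r-1}$, be an arbitrary full column rank matrix such that the columns of $[V_{\le r-1}\ A]$ span $\mathbb R^n$. 1. For $j\le r-1$, if $V_{\le j}$ has full column rank, then the number of eigenvalues of $K(\varepsilon)$ of order $\varepsilon^{2j}$ is exactly $\mathcal H_{j,d}=\binom{j+d-1}{d-1}$, and the expressions for the Schur complement are as in the smooth case: $S_0=R_{0,0}W_{0,0}R_{0,0}^T$ and, for $j>0$, $S_j=R_{j,j}\left(W_{j,j}-W_{j,<j}(W_{<j,<j})^{-1}W_{<j,j}\right)R_{j,j}^T$; the leading coefficients of these eigenvalues are the eigenvalues of $S_j$, and the limiting eigenvectors are given by the eigenvectors of the coefficient of $\varepsilon^{2j}$ in the asymptotic spectral equivalent of $K$, $$Q_jS_jQ_j^T=\begin{cases}V_0W_{0,0}V_0^T,& j=0,\\ Q_jQ_j^TV_j\left(W_{j,j}-W_{j,<j}(W_{<j,<j})^{-1}W_{<j,j}\right)V_j^TQ_jQ_j^T,& j>0.\end{cases}$$ 2. If, in addition, $V_{\le r-1}$ has full column rank, then there are exactly $n-\mathcal P_{r-1,d}$ eigenvalues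 of order $\varepsilon^{2r-1}$, where $\mathcal P_{r-1,d}=\binom{r-1+d}{d}$, corresponding to the term $\psi_{2r-1}AA^\dagger D^{(2r-1)}AA^\dagger$ (coefficient of $\varepsilon^{2r-1}$) of the asymptotic spectral equivalent of $K$, where $D^{(2r-1)}=[\|x_i-x_j\|^{2r-1}]_{i,j=1}^n$.
   Context: Vandermonde matrices: for $\alpha\in\mathbb N^d$, $x^\alpha=\prod x_i^{\alpha_i}$, $|\alpha|=\sum\alpha_i$, $\alpha!=\prod\alpha_i!$. $V_s=[x_i^{\alpha}]_{1\le i\le n,\,|\alpha|=s}$, $V_{\le s}=(V_0\cdots V_s)$, with a fixed ordering of monomials of each degree. Kernels: a positive definite kernel is a symmetric function on $\mathbb R^d\times\mathbb R^d$ whose kernel matrices at finitely many distinct points are positive definite. With $\psi(s)=\sum_m\psi_ms^m$ near $0$, the regularity index is the integer $r$ with $\psi_{2r-1}\ne0$ and $\psi_{2c-1}=0$ for $1\le c<r$. $K(\varepsilon)$ is regarded as analytic in $\varepsilon$ via the power series of $\psi$. Wronskian: for $i+l\le2r-2$, $W_{i,l}=\left[\frac{1}{\alpha!\beta!}\partial_x^\alpha\partial_y^\beta k(x,y)|_{x=y=0}\right]_{|\alpha|=i,|\beta|=l}$ (ordering as in $V_i,V_l$); $W_{<j,<j}=(W_{i,l})_{i,l<j}$, $W_{j,<j}=(W_{j,0}\cdots W_{j,j-1})$, $W_{<j,j}=W_{j,<j}^T$. Block QR: with $b_i=\mathrm{rank}\,V_{\le i}-\mathrm{rank}\,V_{\le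 i-1}$ ($\mathrm{rank}\,V_{\le-1}=0$), $V_{\le r-1}=QR$ where $Q=(Q_0\cdots Q_{r-1})$ has orthonormal columns, $Q_i\in\mathbb R^{n\times b_i}$, and $R$ is block upper triangular with blocks $R_{i,l}\in\mathbb R^{b_i\times\mathcal H_{l,d}}$. Schur complements: $S_j$ is the $j$-th Schur complement of $H=(H_{i,l})_{i,l=0}^{r-1}$, $H_{i,l}=R_{i,i}W_{i,l}R_{l,l}^T$, i.e. $S_0=H_{0,0}$, $S_j=H_{j,j}-H_{j,<j}(H_{<j,<j})^{-1}H_{<j,j}$ with the same block notation as for $W$. $A^\dagger$ is the Moore–Penrose pseudoinverse. Spectral asymptotics: for a real symmetric $K(\varepsilon)$ analytic near $0$, take analytic eigenvalues $\lambda_k(\varepsilon)$ and analytic orthonormal eigenvectors $u_k(\varepsilon)$ (Rellich). If $\lambda_k\not\equiv0$, write $\lambda_k=\varepsilon^{a}(\tilde\lambda_k+O(\varepsilon))$, $\tilde\lambda_k\ne0$: $\lambda_k$ is of order $\varepsilon^a$, with leading coefficient $\tilde\lambda_k$, $\mathrm{lt}(\lambda_k)=\tilde\lambda_k\varepsilon^a$, and limiting eigenvector $u_k(0)$; if $\lambda_k\equiv 0$, $\mathrm{lt}(\lambda_k)=0$. The asymptotic spectral equivalent is $\underline K(\varepsilon)=\sum_k\mathrm{lt}(\lambda_k)(\varepsilon)\,u_k(0)u_k(0)^T$. "Given by the eigenvectors" means that the limiting eigenvectors of the group are eigenvectors of that matrix for its nonzero eigenvalues.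
   Formalization: In part 2 the formula with AA† is false for arbitrary A (e.g. ψ=e^{-s}, points 0,1, A=(1,0)^T); it is proved with A replaced by its component orthogonal to the columns of V_{≤r-1}, and with A itself when V_{≤r-1}^T A=0, which is exactly when it holds. *)

theory Defs
  imports
    "HOL-Analysis.Analysis"
    "HOL-Library.Landau_Symbols"
    "Jordan_Normal_Form.Char_Poly"
    "Jordan_Normal_Form.Gauss_Jordan_Elimination"
    "Jordan_Normal_Form.DL_Rank"
begin

text \<open>
  Points live in \<open>real ^ 'd\<close>; matrices, whose sizes vary inside the statement, are those of
  \<open>Jordan_Normal_Form\<close>.  Points, eigenvalues and block indices are numbered from \<open>0\<close>.
\<close>

subsection \<open>Matrices\<close>

definition append_cols :: "real mat \<Rightarrow> real mat \<Rightarrow> real mat" where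
  "append_cols A B = four_block_mat A B (0\<^sub>m 0 (dim_col A)) (0\<^sub>m 0 (dim_col B))"

text \<open>The empty matrix \<open>0\<^sub>m 0 0\<close> is neutral when it is appended last, so the size of the
  concatenation is the right one for every nonempty list of compatible matrices.\<close>

definition hcat :: "real mat list \<Rightarrow> real mat" where
  "hcat Ms = foldr append_cols Ms (0\<^sub>m 0 0)"

definition vcat :: "real mat list \<Rightarrow> real mat" where
  "vcat Ms = foldr append_rows Ms (0\<^sub>m 0 0)"

definition block_mat :: "nat list \<Rightarrow> nat list \<Rightarrow> (nat \<Rightarrow> nat \<Rightarrow> real mat) \<Rightarrow> real mat" where
  "block_mat I L M = vcat (map (\<lambda>i. hcat (map (M i) L)) I)"

definition mat_rank :: "real mat \<Rightarrow> nat" where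
  "mat_rank A = vec_space.rank (dim_row A) A"

definition full_column_rank :: "real mat \<Rightarrow> bool" where
  "full_column_rank A \<longleftrightarrow> mat_rank A = dim_col A"

definition col_span :: "real mat \<Rightarrow> real Matrix.vec set" where
  "col_span A =
     LinearCombinations.module.span class_ring (module_vec TYPE(real) (dim_row A)) (set (cols A))"

definition mat_inv :: "real mat \<Rightarrow> real mat" where
  "mat_inv A = the (mat_inverse A)"

definition is_pseudoinverse :: "real mat \<Rightarrow> real mat \<Rightarrow> bool" where
  "is_pseudoinverse A X \<longleftrightarrow>
     X \<in> carrier_mat (dim_col A) (dim_row A) \<and>
     A * X * A = A \<and> X * A * X = X \<and>
     transpose_mat (A * X) = A * X \<and> transpose_mat (X * A) = X * A"

definition pseudoinverse :: "real mat \<Rightarrow> real mat" where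
  "pseudoinverse A = (THE X. is_pseudoinverse A X)"

text \<open>The component of the columns of \<open>A\<close> orthogonal to the span of the orthonormal columns of
  \<open>Q\<close>.  For a complement \<open>A\<close> of \<open>V\<^sub>\<le>\<^sub>r\<^sub>-\<^sub>1 = Q R\<close> that is not orthogonal, \<open>A A\<^sup>\<dagger>\<close> is not the
  projection onto the orthogonal complement of the columns of \<open>V\<^sub>\<le>\<^sub>r\<^sub>-\<^sub>1\<close>; with \<open>A\<close> replaced by its
  orthogonal component it is.\<close>

definition orthogonal_component :: "real mat \<Rightarrow> real mat \<Rightarrow> real mat" where
  "orthogonal_component Q A = (1\<^sub>m (dim_row A) - Q * transpose_mat Q) * A"

text \<open>The \<open>j\<close>-th Schur complement
  \<open>M\<^sub>j\<^sub>,\<^sub>j - M\<^sub>j\<^sub>,\<^sub><\<^sub>j (M\<^sub><\<^sub>j\<^sub>,\<^sub><\<^sub>j)\<^sup>-\<^sup>1 M\<^sub><\<^sub>j\<^sub>,\<^sub>j\<close> of a symmetric block matrix, so that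
  \<open>M\<^sub><\<^sub>j\<^sub>,\<^sub>j\<close> is the transpose of \<open>M\<^sub>j\<^sub>,\<^sub><\<^sub>j\<close>.\<close>

definition schur_complement :: "(nat \<Rightarrow> nat \<Rightarrow> real mat) \<Rightarrow> nat \<Rightarrow> real mat" where
  "schur_complement M j =
     (if j = 0 then M 0 0
      else M j j - block_mat [j] [0..<j] M * mat_inv (block_mat [0..<j] [0..<j] M)
                     * transpose_mat (block_mat [j] [0..<j] M))"

subsection \<open>Monomials and Vandermonde matrices\<close>

definition hdim :: "nat \<Rightarrow> nat \<Rightarrow> nat" where
  "hdim j d = (j + d - 1) choose (d - 1)"

definition pdim :: "nat \<Rightarrow> nat \<Rightarrow> nat" where
  "pdim j d = (j + d) choose d"

text \<open>\<open>mons s\<close> lists the multi-indices of degree \<open>s\<close> in the chosen order.\<close>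

definition monomial_ordering :: "(nat \<Rightarrow> ('d::finite \<Rightarrow> nat) list) \<Rightarrow> bool" where
  "monomial_ordering mons \<longleftrightarrow>
     (\<forall>s. distinct (mons s) \<and> set (mons s) = {\<alpha>. (\<Sum>i\<in>UNIV. \<alpha> i) = s})"

definition monomial :: "('d::finite \<Rightarrow> nat) \<Rightarrow> real ^ 'd \<Rightarrow> real" where
  "monomial \<alpha> z = (\<Prod>i\<in>UNIV. vec_nth z i ^ \<alpha> i)"

definition vandermonde ::
  "nat \<Rightarrow> (nat \<Rightarrow> real ^ 'd::finite) \<Rightarrow> (nat \<Rightarrow> ('d \<Rightarrow> nat) list) \<Rightarrow> nat \<Rightarrow> real mat" where
  "vandermonde n x mons s =
     Matrix.mat n (length (mons s)) (\<lambda>(i, a). monomial (mons s ! a) (x i))"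

definition vandermonde_le ::
  "nat \<Rightarrow> (nat \<Rightarrow> real ^ 'd::finite) \<Rightarrow> (nat \<Rightarrow> ('d \<Rightarrow> nat) list) \<Rightarrow> nat \<Rightarrow> real mat" where
  "vandermonde_le n x mons s = hcat (map (vandermonde n x mons) [0..<Suc s])"

text \<open>\<open>Vle i\<close> stands for \<open>V\<^sub>\<le>\<^sub>i\<close>.\<close>

definition rank_increment :: "(nat \<Rightarrow> real mat) \<Rightarrow> nat \<Rightarrow> nat" where
  "rank_increment Vle i = mat_rank (Vle i) - (if i = 0 then 0 else mat_rank (Vle (i - 1)))"

text \<open>Some of the blocks \<open>Q i\<close> may have no columns.\<close>

definition block_qr ::
  "nat \<Rightarrow> nat \<Rightarrow> nat \<Rightarrow> (nat \<Rightarrow> real mat) \<Rightarrow> (nat \<Rightarrow> real mat) \<Rightarrow> (nat \<Rightarrow> nat \<Rightarrow> real mat) \<Rightarrow> bool"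
where
  "block_qr d n r Vle Q R \<longleftrightarrow>
     (\<forall>i<r. Q i \<in> carrier_mat n (rank_increment Vle i)) \<and>
     (\<forall>i<r. \<forall>l<r. R i l \<in> carrier_mat (rank_increment Vle i) (hdim l d)) \<and>
     (\<forall>i<r. \<forall>l<i. R i l = 0\<^sub>m (rank_increment Vle i) (hdim l d)) \<and>
     (let Qf = hcat (map Q [0..<r]) in
        transpose_mat Qf * Qf = 1\<^sub>m (dim_col Qf) \<and>
        Vle (r - 1) = Qf * block_mat [0..<r] [0..<r] R)"

subsection \<open>Kernels and Wronskian matrices\<close>

definition positive_definite_kernel :: "('a \<Rightarrow> 'a \<Rightarrow> real) \<Rightarrow> bool" where
  "positive_definite_kernel k \<longleftrightarrow>
     (\<forall>y z. k y z = k z y) \<and>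
     (\<forall>X c. finite X \<and> (\<exists>y\<in>X. c y \<noteq> 0) \<longrightarrow> (\<Sum>y\<in>X. \<Sum>z\<in>X. c y * c z * k y z) > 0)"

definition regularity_index :: "real fps \<Rightarrow> nat \<Rightarrow> bool" where
  "regularity_index \<Psi> r \<longleftrightarrow>
     r \<ge> 1 \<and> fps_nth \<Psi> (2 * r - 1) \<noteq> 0 \<and> (\<forall>c. 1 \<le> c \<and> c < r \<longrightarrow> fps_nth \<Psi> (2 * c - 1) = 0)"

definition partial :: "'d::finite \<Rightarrow> (real ^ 'd \<Rightarrow> real) \<Rightarrow> real ^ 'd \<Rightarrow> real" where
  "partial i f z = deriv (\<lambda>t. f (z + t *\<^sub>R axis i 1)) 0"

text \<open>\<open>\<partial>\<^sup>\<alpha> = \<partial>\<^sub>1\<^bsup>\<alpha>\<^sub>1\<^esup> \<dots> \<partial>\<^sub>d\<^bsup>\<alpha>\<^sub>d\<^esup>\<close>; the linear order on the index type only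
  serves to fix the order in which the partial derivatives are taken.\<close>

definition mpartial ::
  "('d::{finite,linorder} \<Rightarrow> nat) \<Rightarrow> (real ^ 'd::{finite,linorder} \<Rightarrow> real) \<Rightarrow> real ^ 'd::{finite,linorder} \<Rightarrow> real" where
  "mpartial \<alpha> f = foldr (\<lambda>i. partial i ^^ \<alpha> i) (sorted_list_of_set UNIV) f"

definition mfact :: "('d::finite \<Rightarrow> nat) \<Rightarrow> real" where
  "mfact \<alpha> = (\<Prod>i\<in>UNIV. fact (\<alpha> i))"

definition wronskian ::
  "(real ^ 'd::{finite,linorder} \<Rightarrow> real ^ 'd::{finite,linorder} \<Rightarrow> real) \<Rightarrow> (nat \<Rightarrow> ('d \<Rightarrow> nat) list) \<Rightarrow>
   nat \<Rightarrow> nat \<Rightarrow> real mat" where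
  "wronskian k mons i l =
     Matrix.mat (length (mons i)) (length (mons l))
       (\<lambda>(a, b). mpartial (mons i ! a) (\<lambda>y. mpartial (mons l ! b) (\<lambda>z. k y z) 0) 0
                   / (mfact (mons i ! a) * mfact (mons l ! b)))"

subsection \<open>Spectral asymptotics\<close>

text \<open>Eigenvalues and orthonormal eigenvectors that are analytic at \<open>0\<close>, as in
  Rellich's theorem.\<close>

definition analytic_eigensystem ::
  "nat \<Rightarrow> (real \<Rightarrow> real mat) \<Rightarrow> (nat \<Rightarrow> real \<Rightarrow> real) \<Rightarrow> (nat \<Rightarrow> real \<Rightarrow> real Matrix.vec) \<Rightarrow> bool" where
  "analytic_eigensystem n K ev u \<longleftrightarrow>
     (\<forall>k<n. \<exists>F. ev k has_fps_expansion F) \<and>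
     (\<forall>k<n. \<forall>i<n. \<exists>F. (\<lambda>\<epsilon>. vec_index (u k \<epsilon>) i) has_fps_expansion F) \<and>
     (\<forall>\<^sub>F \<epsilon> in nhds 0.
        (\<forall>k<n. u k \<epsilon> \<in> carrier_vec n \<and> K \<epsilon> *\<^sub>v u k \<epsilon> = ev k \<epsilon> \<cdot>\<^sub>v u k \<epsilon>) \<and>
        (\<forall>k<n. \<forall>l<n. scalar_prod (u k \<epsilon>) (u l \<epsilon>) = (if k = l then 1 else 0)))"

definition has_leading_term :: "(real \<Rightarrow> real) \<Rightarrow> nat \<Rightarrow> real \<Rightarrow> bool" where
  "has_leading_term f a c \<longleftrightarrow>
     c \<noteq> 0 \<and>
     (\<exists>g. g \<in> O[at 0](\<lambda>\<epsilon>. \<epsilon>) \<and> (\<forall>\<^sub>F \<epsilon> in at 0. f \<epsilon> = \<epsilon> ^ a * (c + g \<epsilon>)))"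

definition of_order :: "(real \<Rightarrow> real) \<Rightarrow> nat \<Rightarrow> bool" where
  "of_order f a \<longleftrightarrow> (\<exists>c. has_leading_term f a c)"

definition leading_coefficient :: "(real \<Rightarrow> real) \<Rightarrow> real" where
  "leading_coefficient f = (THE c. \<exists>a. has_leading_term f a c)"

text \<open>The leading term and the asymptotic spectral equivalent are polynomials in \<open>\<epsilon>\<close>.\<close>

definition leading_term :: "(real \<Rightarrow> real) \<Rightarrow> real poly" where
  "leading_term f =
     (if \<forall>\<^sub>F \<epsilon> in nhds 0. f \<epsilon> = 0 then 0 else Polynomial.monom (leading_coefficient f) (THE a. of_order f a))"

definition spectral_equivalent ::
  "nat \<Rightarrow> (nat \<Rightarrow> real \<Rightarrow> real) \<Rightarrow> (nat \<Rightarrow> real \<Rightarrow> real Matrix.vec) \<Rightarrow> real poly mat" where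
  "spectral_equivalent n ev u =
     Matrix.mat n n (\<lambda>(i, j). 
       \<Sum>k<n. Polynomial.smult (vec_index (u k 0) i * vec_index (u k 0) j) (leading_term (ev k)))"

definition mat_coeff :: "real poly mat \<Rightarrow> nat \<Rightarrow> real mat" where
  "mat_coeff P m = map_mat (\<lambda>p. Polynomial.coeff p m) P"

end

theory Submission
  imports Defs
begin

text \<open>
  Expanding \<open>K(\<epsilon>)\<close> in powers of \<open>\<epsilon>\<close> gives the forms \<open>\<psi>\<^sub>m \<Sum> v\<^sub>i w\<^sub>j \<parallel>x\<^sub>i - x\<^sub>j\<parallel>\<^sup>m\<close>, which for
  \<open>m \<le> 2r - 2\<close> are polynomial and expressed by the blocks of the Wronskian.  They vanish if \<open>v\<close>
  annihilates the monomials of degree less than \<open>i\<close>, \<open>w\<close> those of degree less than \<open>l\<close>, and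
  \<open>m < i + l\<close>.  The form built from the blocks \<open>H\<^sub>i\<^sub>,\<^sub>l\<close> is definite: at a null vector the form of
  \<open>K(\<epsilon>)\<close> at \<open>\<Sum>\<^sub>l \<epsilon>\<^sup>-\<^sup>l q\<^sub>l\<close> tends to \<open>0\<close>, so by Cauchy--Schwarz against a point mass at
  \<open>z\<close> a Taylor polynomial of \<open>\<psi>(\<parallel>z - y\<parallel>)\<close> is annihilated, and the odd term of degree \<open>2r - 1\<close>
  forces the top component to annihilate one more degree.  Cauchy--Schwarz against a finite
  difference of order \<open>2r\<close> shows that \<open>\<psi>\<^bsub>2r-1\<^esub> D\<^bsup>(2r-1)\<^esup>\<close> is definite on the orthogonal complement
  of \<open>V\<^bsub>\<le>r-1\<^esub>\<close>.

  Since the eigenvalues are positive, comparing coefficients in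
  \<open>\<langle>v, K(\<epsilon>) v\<rangle> = \<Sum> \<lambda>\<^sub>k \<langle>u\<^sub>k, v\<rangle>\<^sup>2\<close> makes the limiting eigenvectors of order below \<open>2i\<close> orthogonal to
  all \<open>v\<close> that annihilate the degrees less than \<open>i\<close>, while definiteness excludes the other orders;
  hence the limiting eigenvectors of order \<open>2i\<close> span the columns of \<open>Q\<^sub>i\<close>.  The coefficients of the
  eigenvalue equation along \<open>Q\<^sub>0, \<dots>, Q\<^sub>j\<close> form a block linear system with matrix \<open>H\<close>, and eliminating
  the first \<open>j\<close> blocks leaves the eigenvalue equation of \<open>S\<^sub>j\<close>.
\<close>

subsection \<open>Power series in the distance\<close>

text \<open>Positive definiteness survives a limit in \<epsilon> only as semidefiniteness, so the
  invertibility of the blocks of \<open>H\<close> and \<open>W\<close>, which is not assumed, has to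
  come from the first odd coefficient of \<psi>. A null vector gives an identity in the position z =
  t \<theta> of the point mass. Multiplied by a power of t it is a power series in t, and one of its
  coefficients, averaged over \<theta> and -\<theta>, contains only psi_(2r-1), with factors
  (2r-1)/2 - i for i < r - 1. These factors are positive. Taking the data points themselves for
  \<theta> therefore yields a vanishing positive combination of Gram forms of powers of the inner
  product, so every one of them vanishes. All of this concerns quadratic forms at the given points;
  invertibility of the Wronskian blocks is pulled back from \<open>H\<close> through the diagonal
  blocks of \<open>R\<close>, which are invertible when the Vandermonde matrix has full column rank.
  Positivity of the eigenvalues excludes cancellation: a sum of series with positive leading
  coefficients vanishes to some order only if each summand does.\<close>

lemma has_fps_expansion_factor:
  fixes f :: "real \<Rightarrow> real"
  assumes f: "f has_fps_expansion F" and z: "\<And>q. q < m \<Longrightarrow> fps_nth F q = 0"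
  obtains g where "g has_fps_expansion fps_shift m F" "\<forall>\<^sub>F t in nhds 0. f t = t ^ m * g t"
proof
  have r: "fps_conv_radius F > 0" using f by (simp add: has_fps_expansion_def)
  show "eval_fps (fps_shift m F) has_fps_expansion fps_shift m F"
    using r by (intro eval_fps_has_fps_expansion) simp
  have eq: "F = fps_X ^ m * fps_shift m F"
    by (rule fps_ext) (simp add: fps_X_power_mult_nth z)
  have "\<forall>\<^sub>F t in nhds 0. t \<in> eball 0 (fps_conv_radius F)"
    using r by (intro eventually_nhds_in_open) (auto simp: zero_ereal_def)
  moreover have "\<forall>\<^sub>F t in nhds 0. eval_fps F t = f t"
    using f by (simp add: has_fps_expansion_def)
  ultimately show "\<forall>\<^sub>F t in nhds 0. f t = t ^ m * eval_fps (fps_shift m F) t"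
  proof eventually_elim
    case (elim t)
    hence t: "ereal (norm t) < fps_conv_radius F" by simp
    have "f t = eval_fps (fps_X ^ m * fps_shift m F) t" using elim eq by metis
    also have "\<dots> = t ^ m * eval_fps (fps_shift m F) t"
      using t by (subst eval_fps_mult) auto
    finally show ?case .
  qed
qed

lemma has_fps_expansion_tendsto_nth:
  fixes f :: "real \<Rightarrow> real"
  assumes f: "f has_fps_expansion F" and z: "\<And>q. q < m \<Longrightarrow> fps_nth F q = 0"
  shows "((\<lambda>t. f t / t ^ m) \<longlongrightarrow> fps_nth F m) (at 0)"
proof -
  obtain g where g: "g has_fps_expansion fps_shift m F"
    and e: "\<forall>\<^sub>F t in nhds 0. f t = t ^ m * g t"
    using has_fps_expansion_factor[OF f z] by blast
  have "isCont g 0" using has_fps_expansion_imp_continuous[OF g] .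
  moreover have "g 0 = fps_nth F m"
    using g eventually_nhds_x_imp_x[of "\<lambda>z. eval_fps (fps_shift m F) z = g z" 0]
    by (simp add: has_fps_expansion_def eval_fps_at_0)
  ultimately have "(g \<longlongrightarrow> fps_nth F m) (at 0)" by (simp add: isCont_def)
  moreover have "\<forall>\<^sub>F t in at 0. f t / t ^ m = g t"
    using e[unfolded eventually_nhds_conv_at] eventually_at_ball'[of 1 0 UNIV]
    by (auto elim!: eventually_elim2)
  ultimately show ?thesis by (simp add: tendsto_cong)
qed

text \<open>The lowest nonzero coefficient would be the limit of f t / t ^ m, which can be taken
  from the right. One side has to suffice, since the identities in the length t of a vector are
  available for t > 0 only.\<close>

lemma fps_expansion_eq_0_at_right:
  fixes f :: "real \<Rightarrow> real"
  assumes f: "f has_fps_expansion F" and z: "\<forall>\<^sub>F t in at_right 0. f t = 0"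
  shows "F = 0"
proof (rule ccontr)
  assume "F \<noteq> 0"
  define m where "m = subdegree F"
  have "((\<lambda>t. f t / t ^ m) \<longlongrightarrow> fps_nth F m) (at 0)"
    by (rule has_fps_expansion_tendsto_nth[OF f]) (auto simp: m_def)
  hence "((\<lambda>t. f t / t ^ m) \<longlongrightarrow> fps_nth F m) (at_right 0)"
    by (rule filterlim_mono) (auto simp: at_le)
  moreover have "((\<lambda>t. f t / t ^ m) \<longlongrightarrow> 0) (at_right 0)"
    by (rule tendsto_eventually) (use z in \<open>auto elim!: eventually_mono\<close>)
  ultimately have "fps_nth F m = 0"
    using tendsto_unique trivial_limit_at_right_real by blast
  thus False using \<open>F \<noteq> 0\<close> by (simp add: m_def)
qed

lemma fps_expansion_unique_at_right:
  fixes f g :: "real \<Rightarrow> real"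
  assumes "f has_fps_expansion F" "g has_fps_expansion G" "\<forall>\<^sub>F t in at_right 0. f t = g t"
  shows "F = G"
proof -
  have "(\<lambda>t. f t - g t) has_fps_expansion F - G" using assms by (intro fps_expansion_intros)
  moreover have "\<forall>\<^sub>F t in at_right 0. f t - g t = 0" using assms(3) by eventually_elim simp
  ultimately show ?thesis using fps_expansion_eq_0_at_right by fastforce
qed

lemma fps_expansion_unique_nhds:
  fixes f g :: "real \<Rightarrow> real"
  assumes "f has_fps_expansion F" "g has_fps_expansion G" "\<forall>\<^sub>F t in nhds 0. f t = g t"
  shows "F = G"
  using assms fps_expansion_unique_at_right
  by (metis eventually_nhds_conv_at eventually_at_split)

lemma has_fps_expansion_bigo:
  fixes f :: "real \<Rightarrow> real"
  assumes f: "f has_fps_expansion F" and z: "\<And>q. q < m \<Longrightarrow> fps_nth F q = 0"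
  obtains C \<delta> where "\<delta> > 0" "C \<ge> 0" "\<And>t. \<bar>t\<bar> < \<delta> \<Longrightarrow> \<bar>f t\<bar> \<le> C * \<bar>t\<bar> ^ m"
proof -
  obtain g where g: "g has_fps_expansion fps_shift m F"
    and e: "\<forall>\<^sub>F t in nhds 0. f t = t ^ m * g t"
    using has_fps_expansion_factor[OF f z] by blast
  have "isCont g 0" using has_fps_expansion_imp_continuous[OF g] .
  hence "(g \<longlongrightarrow> g 0) (nhds 0)" by (simp add: isCont_def tendsto_nhds_iff)
  hence "\<forall>\<^sub>F t in nhds 0. dist (g t) (g 0) < 1" by (rule tendstoD) simp
  with e have "\<forall>\<^sub>F t in nhds 0. \<bar>f t\<bar> \<le> (\<bar>g 0\<bar> + 1) * \<bar>t\<bar> ^ m"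
  proof eventually_elim
    case (elim t)
    have "\<bar>g t\<bar> \<le> \<bar>g 0\<bar> + 1" using elim by (simp add: dist_real_def)
    then show ?case using elim by (simp add: abs_mult power_abs mult.commute[of _ "\<bar>t\<bar> ^ m"] mult_left_mono)
  qed
  then obtain \<delta> where "\<delta> > 0" "\<And>t. dist t 0 < \<delta> \<Longrightarrow> \<bar>f t\<bar> \<le> (\<bar>g 0\<bar> + 1) * \<bar>t\<bar> ^ m"
    unfolding eventually_nhds_metric by blast
  then show ?thesis using that[of \<delta> "\<bar>g 0\<bar> + 1"] by simp
qed

text \<open>With t = sqrt s, the m-th derivative of s^(q/2) in s is a falling factorial of q/2 times
  t^q / s^m. Only the numerator is kept as a series: t^(q - 2m) may have a negative exponent, so the
  division by s^m is left to \<open>radial\<close>.\<close>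

definition radial_fps :: "real fps \<Rightarrow> nat \<Rightarrow> real fps" where
  "radial_fps \<Psi> m = Abs_fps (\<lambda>q. (\<Prod>i<m. real q / 2 - real i) * fps_nth \<Psi> q)"

text \<open>The \<open>m\<close>-th derivative of \<open>s \<mapsto> \<Psi>(\<surd>s)\<close>.\<close>

definition radial :: "real fps \<Rightarrow> nat \<Rightarrow> real \<Rightarrow> real" where
  "radial \<Psi> m s = eval_fps (radial_fps \<Psi> m) (sqrt s) / s ^ m"

lemma radial_fps_nth: "fps_nth (radial_fps \<Psi> m) q = (\<Prod>i<m. real q / 2 - real i) * fps_nth \<Psi> q"
  by (simp add: radial_fps_def)

lemma radial_fps_0 [simp]: "radial_fps \<Psi> 0 = \<Psi>"
  by (simp add: radial_fps_def fps_ext)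

text \<open>Half the Euler operator X d/dX multiplies the coefficient of degree q by q/2 and so
  produces the new factor q/2 - m. In this form the convergence radius is bounded by induction, and
  the right side is the numerator that the quotient rule gives.\<close>

lemma radial_fps_Suc:
  "radial_fps \<Psi> (Suc m) = fps_const (1/2) * (fps_X * fps_deriv (radial_fps \<Psi> m))
     - fps_const (real m) * radial_fps \<Psi> m"
proof (rule fps_ext)
  fix q
  show "fps_nth (radial_fps \<Psi> (Suc m)) q =
      fps_nth (fps_const (1/2) * (fps_X * fps_deriv (radial_fps \<Psi> m))
     - fps_const (real m) * radial_fps \<Psi> m) q"
    by (cases q) (auto simp: radial_fps_nth algebra_simps)
qed

lemma fps_conv_radius_const_mult: "fps_conv_radius (fps_const c * F) \<ge> fps_conv_radius (F :: real fps)"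
  using fps_conv_radius_mult[of "fps_const c" F] by simp

lemma conv_radius_radial: "fps_conv_radius (radial_fps \<Psi> m) \<ge> fps_conv_radius \<Psi>"
proof (induction m)
  case (Suc m)
  have "fps_conv_radius (fps_X * fps_deriv (radial_fps \<Psi> m)) \<ge> fps_conv_radius \<Psi>"
    using fps_conv_radius_mult[of fps_X "fps_deriv (radial_fps \<Psi> m)"]
      fps_conv_radius_deriv[of "radial_fps \<Psi> m"] Suc by simp
  then have "fps_conv_radius (fps_const (1/2) * (fps_X * fps_deriv (radial_fps \<Psi> m))) \<ge> fps_conv_radius \<Psi>"
    using fps_conv_radius_const_mult order_trans by blast
  moreover have "fps_conv_radius (fps_const (real m) * radial_fps \<Psi> m) \<ge> fps_conv_radius \<Psi>"
    using fps_conv_radius_const_mult order_trans Suc by blast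
  ultimately show ?case unfolding radial_fps_Suc
    using fps_conv_radius_diff order_trans by (metis (no_types, lifting) min.boundedI)
qed simp

lemma radial_0: "radial \<Psi> 0 s = eval_fps \<Psi> (sqrt s)"
  by (simp add: radial_def)

lemma DERIV_radial:
  assumes s: "s > 0" "ereal (sqrt s) < fps_conv_radius \<Psi>"
  shows "(radial \<Psi> m has_real_derivative radial \<Psi> (Suc m) s) (at s)"
proof -
  let ?F = "radial_fps \<Psi> m"
  have c: "ereal (norm (sqrt s)) < fps_conv_radius ?F"
    using s conv_radius_radial[of \<Psi> m] by (simp add: less_le_trans)
  have cd: "ereal (norm (sqrt s)) < fps_conv_radius (fps_deriv ?F)"
    using c fps_conv_radius_deriv[of ?F] less_le_trans by blast
  have d1: "((\<lambda>s. eval_fps ?F (sqrt s)) has_real_derivative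
      eval_fps (fps_deriv ?F) (sqrt s) * (inverse (sqrt s) / 2)) (at s)"
    by (rule DERIV_chain2[OF has_field_derivative_eval_fps[OF c] DERIV_real_sqrt[OF s(1)]])
  have e: "eval_fps (radial_fps \<Psi> (Suc m)) (sqrt s) =
      1/2 * (sqrt s * eval_fps (fps_deriv ?F) (sqrt s)) - real m * eval_fps ?F (sqrt s)"
  proof -
    have cx: "ereal (norm (sqrt s)) < fps_conv_radius (fps_X * fps_deriv ?F)"
      using fps_conv_radius_mult[of fps_X "fps_deriv ?F"] cd by (simp add: less_le_trans)
    show ?thesis unfolding radial_fps_Suc
      apply (subst eval_fps_diff)
        apply (rule less_le_trans[OF cx fps_conv_radius_const_mult])
       apply (rule less_le_trans[OF c fps_conv_radius_const_mult])
      apply (subst eval_fps_mult, simp, rule cx)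
      apply (subst eval_fps_mult, simp, rule cd)
      apply (subst eval_fps_mult, simp, rule c)
      by simp
  qed
  have "((\<lambda>s. eval_fps ?F (sqrt s) / s ^ m) has_real_derivative
     (eval_fps (fps_deriv ?F) (sqrt s) * (inverse (sqrt s) / 2) * s ^ m
        - eval_fps ?F (sqrt s) * (real m * s ^ (m - 1))) / (s ^ m * s ^ m)) (at s)"
    using s by (auto intro!: derivative_eq_intros d1)
  also have "(eval_fps (fps_deriv ?F) (sqrt s) * (inverse (sqrt s) / 2) * s ^ m
        - eval_fps ?F (sqrt s) * (real m * s ^ (m - 1))) / (s ^ m * s ^ m) = radial \<Psi> (Suc m) s"
  proof -
    have i: "inverse (sqrt s) = sqrt s / s"
      using s by (simp add: field_simps real_sqrt_mult_self)
    show ?thesis unfolding radial_def e i using s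
      by (cases m) (simp_all add: field_simps)
  qed
  finally show ?thesis unfolding radial_def[abs_def] .
qed

text \<open>Lagrange's remainder on a compact interval around s0, on which the derivative of order p
  + 1 is bounded. In general s -> \<Psi>(sqrt s) is not smooth at 0, hence the expansion point is
  positive.\<close>

lemma radial_Taylor:
  assumes s0: "s0 > 0" "ereal (sqrt s0) < fps_conv_radius \<Psi>"
  obtains C \<eta> where "\<eta> > 0"
    "\<And>h. \<bar>h\<bar> < \<eta> \<Longrightarrow> \<bar>eval_fps \<Psi> (sqrt (s0 + h)) - (\<Sum>m\<le>p. radial \<Psi> m s0 / fact m * h ^ m)\<bar>
          \<le> C * \<bar>h\<bar> ^ Suc p"
proof -
  obtain b where b: "sqrt s0 < b" "ereal b < fps_conv_radius \<Psi>"
    using ereal_dense2[OF s0(2)] by auto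
  \<comment> \<open>Half the distances from s0 to 0 and to b^2: the closed interval stays where s >
    0 and sqrt s <= b, which is below the radius of convergence.\<close>
  define \<eta> where "\<eta> = min (s0 / 2) ((b\<^sup>2 - s0) / 2)"
  have "(sqrt s0)\<^sup>2 < b\<^sup>2" using b s0 by (intro power_strict_mono) auto
  hence b2: "s0 < b\<^sup>2" using s0 by simp
  have \<eta>: "\<eta> > 0" using s0 b2 by (auto simp: \<eta>_def)
  have good: "s > 0 \<and> ereal (sqrt s) < fps_conv_radius \<Psi>" if "s \<in> {s0 - \<eta>..s0 + \<eta>}" for s
  proof
    show "s > 0" using that s0 by (auto simp: \<eta>_def)
    have "\<eta> \<le> (b\<^sup>2 - s0) / 2" unfolding \<eta>_def by (rule min.cobounded2)
    hence "s \<le> b\<^sup>2" using that b2 by (simp add: field_simps)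
    moreover have "b > 0" using b(1) real_sqrt_gt_zero[OF s0(1)] by linarith
    ultimately have "sqrt s \<le> b" by (intro real_le_lsqrt) auto
    thus "ereal (sqrt s) < fps_conv_radius \<Psi>" using b(2)
      by (meson ereal_less_eq(3) order.strict_trans1)
  qed
  have "continuous_on {s0 - \<eta>..s0 + \<eta>} (radial \<Psi> (Suc p))"
    by (rule DERIV_continuous_on[where D = "radial \<Psi> (Suc (Suc p))"])
       (metis DERIV_radial good has_field_derivative_at_within)
  hence "bounded (radial \<Psi> (Suc p) ` {s0 - \<eta>..s0 + \<eta>})"
    by (intro compact_imp_bounded compact_continuous_image) auto
  then obtain M where M: "\<And>s. s \<in> {s0 - \<eta>..s0 + \<eta>} \<Longrightarrow> \<bar>radial \<Psi> (Suc p) s\<bar> \<le> M"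
    unfolding bounded_iff by fastforce
  have M0: "M \<ge> 0" using M[of s0] \<eta> by fastforce
  show ?thesis
  proof (rule that[OF \<eta>, of "M / fact (Suc p)"])
    fix h assume h: "\<bar>h\<bar> < \<eta>"
    show "\<bar>eval_fps \<Psi> (sqrt (s0 + h)) - (\<Sum>m\<le>p. radial \<Psi> m s0 / fact m * h ^ m)\<bar>
          \<le> M / fact (Suc p) * \<bar>h\<bar> ^ Suc p"
    proof (cases "h = 0")
      case True
      then show ?thesis by (simp add: radial_0 sum.atMost_shift)
    next
      case False
      have "\<exists>t. (if s0 + h < s0 then s0 + h < t \<and> t < s0 else s0 < t \<and> t < s0 + h) \<and>
        radial \<Psi> 0 (s0 + h) = (\<Sum>m<Suc p. (radial \<Psi> m s0 / fact m) * (s0 + h - s0)^m)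
         + (radial \<Psi> (Suc p) t / fact (Suc p)) * (s0 + h - s0)^Suc p"
        by (rule Taylor[where a = "s0 - \<eta>" and b = "s0 + \<eta>"])
           (use h \<eta> False good DERIV_radial in auto)
      then obtain t where t: "(if h < 0 then s0 + h < t \<and> t < s0 else s0 < t \<and> t < s0 + h)"
        "eval_fps \<Psi> (sqrt (s0 + h)) = (\<Sum>m\<le>p. (radial \<Psi> m s0 / fact m) * h^m)
         + (radial \<Psi> (Suc p) t / fact (Suc p)) * h^Suc p"
        unfolding lessThan_Suc_atMost radial_0 by auto
      have "t \<in> {s0 - \<eta>..s0 + \<eta>}" using t(1) h by (auto split: if_splits)
      hence "\<bar>radial \<Psi> (Suc p) t\<bar> \<le> M" by (rule M)
      hence "\<bar>(radial \<Psi> (Suc p) t / fact (Suc p)) * h^Suc p\<bar> \<le> M / fact (Suc p) * \<bar>h\<bar> ^ Suc p"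
        by (simp add: abs_mult power_abs divide_right_mono mult_right_mono del: fact_Suc power_Suc)
      then show ?thesis using t(2) by simp
    qed
  qed
qed

subsection \<open>Homogeneous polynomials and annihilating vectors\<close>

definition mdeg :: "('d::finite \<Rightarrow> nat) \<Rightarrow> nat" where
  "mdeg \<alpha> = (\<Sum>i\<in>UNIV. \<alpha> i)"

definition multi_indices :: "nat \<Rightarrow> ('d::finite \<Rightarrow> nat) set" where
  "multi_indices s = {\<alpha>. mdeg \<alpha> = s}"

definition munit :: "'d \<Rightarrow> 'd::finite \<Rightarrow> nat" where
  "munit i = (\<lambda>j. if j = i then 1 else 0)"

lemma mdeg_0 [simp]: "mdeg (\<lambda>_. 0) = 0" by (simp add: mdeg_def)

lemma mdeg_add: "mdeg (\<lambda>i. \<alpha> i + \<beta> i) = mdeg \<alpha> + mdeg \<beta>"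
  by (simp add: mdeg_def sum.distrib)

lemma mdeg_munit [simp]: "mdeg (munit i) = 1"
  by (simp add: mdeg_def munit_def)

lemma le_mdeg: "\<alpha> i \<le> mdeg \<alpha>"
  unfolding mdeg_def by (rule member_le_sum) auto

lemma finite_multi_indices [simp]: "finite (multi_indices s :: ('d::finite \<Rightarrow> nat) set)"
proof (rule finite_subset)
  show "multi_indices s \<subseteq> Pi\<^sub>E UNIV (\<lambda>_::'d. {..s})"
    by (auto simp: multi_indices_def le_mdeg)
qed (simp add: finite_PiE)

lemma multi_indices_0: "multi_indices 0 = {\<lambda>_. 0}"
  by (auto simp: multi_indices_def mdeg_def)

lemma mdeg_Suc_E:
  assumes "mdeg \<alpha> = Suc s"
  obtains i \<beta> where "mdeg \<beta> = s" "\<alpha> = (\<lambda>j. munit i j + \<beta> j)"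
proof -
  obtain i where i: "\<alpha> i > 0" using assms by (metis gr0I mdeg_def nat.distinct(1) sum.neutral)
  define \<beta> where "\<beta> = (\<lambda>j. \<alpha> j - munit i j)"
  have "\<alpha> = (\<lambda>j. munit i j + \<beta> j)" using i by (auto simp: \<beta>_def munit_def)
  moreover from this have "mdeg \<alpha> = 1 + mdeg \<beta>" using mdeg_add[of "munit i" \<beta>] by simp
  ultimately show ?thesis using that assms by simp
qed

lemma monomial_0 [simp]: "monomial (\<lambda>_. 0) z = 1"
  by (simp add: monomial_def)

lemma monomial_add: "monomial (\<lambda>i. \<alpha> i + \<beta> i) z = monomial \<alpha> z * monomial \<beta> z"
  by (simp add: monomial_def power_add prod.distrib)

lemma monomial_munit [simp]: "monomial (munit i) z = vec_nth z i"
proof -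
  have "monomial (munit i) z = (\<Prod>j\<in>UNIV. if j = i then vec_nth z j else 1)"
    unfolding monomial_def munit_def by (intro prod.cong) auto
  thus ?thesis by simp
qed

lemma monomial_scaleR: "monomial \<alpha> (t *\<^sub>R z) = t ^ mdeg \<alpha> * monomial \<alpha> z"
  by (simp add: monomial_def mdeg_def power_mult_distrib prod.distrib power_sum)

lemma abs_monomial_le: "\<bar>monomial \<alpha> z\<bar> \<le> norm z ^ mdeg \<alpha>"
proof -
  have "\<bar>monomial \<alpha> z\<bar> = (\<Prod>i\<in>UNIV. \<bar>vec_nth z i\<bar> ^ \<alpha> i)"
    by (simp add: monomial_def abs_prod power_abs)
  also have "\<dots> \<le> (\<Prod>i\<in>UNIV. norm z ^ \<alpha> i)"
    by (intro prod_mono) (auto intro!: power_mono component_le_norm_cart)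
  finally show ?thesis by (simp add: mdeg_def power_sum)
qed

definition homogeneous_poly :: "nat \<Rightarrow> (real ^ 'd::finite \<Rightarrow> real) \<Rightarrow> bool" where
  "homogeneous_poly s f \<longleftrightarrow> (\<exists>c. \<forall>z. f z = (\<Sum>\<alpha>\<in>multi_indices s. c \<alpha> * monomial \<alpha> z))"

lemma homogeneous_poly_add:
  assumes "homogeneous_poly s f" "homogeneous_poly s g"
  shows "homogeneous_poly s (\<lambda>z. f z + g z)"
proof -
  obtain c e where "\<And>z. f z = (\<Sum>\<alpha>\<in>multi_indices s. c \<alpha> * monomial \<alpha> z)"
    "\<And>z. g z = (\<Sum>\<alpha>\<in>multi_indices s. e \<alpha> * monomial \<alpha> z)"
    using assms unfolding homogeneous_poly_def by blast
  then show ?thesis unfolding homogeneous_poly_def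
    by (intro exI[of _ "\<lambda>\<alpha>. c \<alpha> + e \<alpha>"]) (simp add: sum.distrib distrib_right)
qed

lemma homogeneous_poly_cmult:
  assumes "homogeneous_poly s f"
  shows "homogeneous_poly s (\<lambda>z. a * f z)"
proof -
  obtain c where "\<And>z. f z = (\<Sum>\<alpha>\<in>multi_indices s. c \<alpha> * monomial \<alpha> z)"
    using assms unfolding homogeneous_poly_def by blast
  then show ?thesis unfolding homogeneous_poly_def
    by (intro exI[of _ "\<lambda>\<alpha>. a * c \<alpha>"]) (simp add: sum_distrib_left mult.assoc)
qed

lemma homogeneous_poly_zero: "homogeneous_poly s (\<lambda>z. 0)"
  unfolding homogeneous_poly_def by (intro exI[of _ "\<lambda>_. 0"]) simp

lemma homogeneous_poly_sum:
  assumes "\<And>i. i \<in> I \<Longrightarrow> homogeneous_poly s (f i)"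
  shows "homogeneous_poly s (\<lambda>z. \<Sum>i\<in>I. f i z)"
  using assms
  by (induction I rule: infinite_finite_induct) (auto intro!: homogeneous_poly_add homogeneous_poly_zero)

lemma homogeneous_poly_monomial:
  assumes "mdeg \<alpha> = s"
  shows "homogeneous_poly s (\<lambda>z. monomial \<alpha> z)"
  unfolding homogeneous_poly_def
proof (intro exI[of _ "\<lambda>\<beta>. if \<beta> = \<alpha> then 1 else 0"] allI)
  fix z :: "real ^ 'a"
  have mem: "\<alpha> \<in> multi_indices s" using assms by (simp add: multi_indices_def)
  have "(\<Sum>\<beta>\<in>multi_indices s. (if \<beta> = \<alpha> then 1 else 0) * monomial \<beta> z) =
      (\<Sum>\<beta>\<in>multi_indices s. if \<beta> = \<alpha> then monomial \<beta> z else 0)" by (intro sum.cong) auto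
  also have "\<dots> = monomial \<alpha> z" using mem by simp
  finally show "monomial \<alpha> z = (\<Sum>\<beta>\<in>multi_indices s. (if \<beta> = \<alpha> then 1 else 0) * monomial \<beta> z)" ..
qed

lemma homogeneous_poly_mult:
  assumes "homogeneous_poly s f" "homogeneous_poly t g"
  shows "homogeneous_poly (s + t) (\<lambda>z. f z * g z)"
proof -
  obtain c e where fg: "\<And>z. f z = (\<Sum>\<alpha>\<in>multi_indices s. c \<alpha> * monomial \<alpha> z)"
    "\<And>z. g z = (\<Sum>\<alpha>\<in>multi_indices t. e \<alpha> * monomial \<alpha> z)"
    using assms unfolding homogeneous_poly_def by blast
  have "(\<lambda>z. f z * g z) = (\<lambda>z. \<Sum>\<alpha>\<in>multi_indices s. \<Sum>\<beta>\<in>multi_indices t.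
      (c \<alpha> * e \<beta>) * monomial (\<lambda>i. \<alpha> i + \<beta> i) z)"
    by (auto simp: fun_eq_iff fg sum_product monomial_add intro!: sum.cong)
  moreover have "homogeneous_poly (s + t) (\<lambda>z. \<Sum>\<alpha>\<in>multi_indices s. \<Sum>\<beta>\<in>multi_indices t.
      (c \<alpha> * e \<beta>) * monomial (\<lambda>i. \<alpha> i + \<beta> i) z)"
    by (intro homogeneous_poly_sum homogeneous_poly_cmult homogeneous_poly_monomial)
       (auto simp: multi_indices_def mdeg_add)
  ultimately show ?thesis by simp
qed

lemma homogeneous_poly_power:
  assumes "homogeneous_poly s f"
  shows "homogeneous_poly (s * k) (\<lambda>z. f z ^ k)"
proof (induction k)
  case 0
  show ?case using homogeneous_poly_monomial[of "\<lambda>_. 0" 0] by simp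
next
  case (Suc k)
  show ?case using homogeneous_poly_mult[OF assms Suc] by simp
qed

lemma homogeneous_poly_component: "homogeneous_poly 1 (\<lambda>z. vec_nth z i)"
  using homogeneous_poly_monomial[of "munit i" 1] by simp

lemma homogeneous_poly_inner: "homogeneous_poly 1 (\<lambda>z. inner z y)"
proof -
  have "(\<lambda>z. inner z y) = (\<lambda>z. \<Sum>i\<in>UNIV. vec_nth y i * vec_nth z i)"
    by (simp add: inner_vec_def mult.commute)
  moreover have "homogeneous_poly 1 (\<lambda>z. \<Sum>i\<in>UNIV. vec_nth y i * vec_nth z i)"
    by (intro homogeneous_poly_sum homogeneous_poly_cmult homogeneous_poly_component)
  ultimately show ?thesis by simp
qed

lemma homogeneous_poly_norm_even: "homogeneous_poly (2 * k) (\<lambda>z. norm z ^ (2 * k))"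
proof -
  have "(\<lambda>z::real^'a. norm z ^ 2) = (\<lambda>z. \<Sum>i\<in>UNIV. vec_nth z i * vec_nth z i)"
    unfolding power2_norm_eq_inner inner_vec_def by simp
  moreover have "homogeneous_poly (1 + 1) (\<lambda>z::real^'a. \<Sum>i\<in>UNIV. vec_nth z i * vec_nth z i)"
    by (intro homogeneous_poly_sum homogeneous_poly_mult homogeneous_poly_component)
  ultimately have "homogeneous_poly 2 (\<lambda>z::real^'a. norm z ^ 2)" by (simp add: numeral_2_eq_2)
  from homogeneous_poly_power[OF this, of k] show ?thesis by (simp add: power_mult)
qed

text \<open>For s > 0 and the data points this says that v lies in the kernel of the transpose of
  V_(<= s-1). The index set is left general because the same notion is used for the nodes of a
  finite difference and for disjoint sums of families.\<close>

definition annihilates :: "'i set \<Rightarrow> ('i \<Rightarrow> real ^ 'd::finite) \<Rightarrow> nat \<Rightarrow> ('i \<Rightarrow> real) \<Rightarrow> bool" where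
  "annihilates J x s v \<longleftrightarrow> (\<forall>\<alpha>. mdeg \<alpha> < s \<longrightarrow> (\<Sum>a\<in>J. v a * monomial \<alpha> (x a)) = 0)"

lemma annihilates_homogeneous_poly:
  assumes "annihilates J x s v" "homogeneous_poly t f" "t < s"
  shows "(\<Sum>a\<in>J. v a * f (x a)) = 0"
proof -
  obtain c where c: "\<And>z. f z = (\<Sum>\<alpha>\<in>multi_indices t. c \<alpha> * monomial \<alpha> z)"
    using assms unfolding homogeneous_poly_def by blast
  have "(\<Sum>a\<in>J. v a * f (x a)) = (\<Sum>\<alpha>\<in>multi_indices t. c \<alpha> * (\<Sum>a\<in>J. v a * monomial \<alpha> (x a)))"
    unfolding c sum_distrib_left by (subst sum.swap) (simp add: algebra_simps)
  also have "\<dots> =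
      0" using assms by (intro sum.neutral) (auto simp: annihilates_def multi_indices_def)
  finally show ?thesis .
qed

lemma annihilates_cmult:
  assumes "annihilates J x s v"
  shows "annihilates J x s (\<lambda>a. c * v a)"
  using assms by (simp add: annihilates_def mult.assoc flip: sum_distrib_left)

lemma annihilates_0: "annihilates J x 0 v"
  by (simp add: annihilates_def)

lemma annihilates_sum:
  assumes "\<And>i. i \<in> I \<Longrightarrow> annihilates J x s (v i)"
  shows "annihilates J x s (\<lambda>a. \<Sum>i\<in>I. v i a)"
  unfolding annihilates_def
proof (intro allI impI)
  fix \<alpha> :: "'c \<Rightarrow> nat" assume "mdeg \<alpha> < s"
  have "(\<Sum>a\<in>J. (\<Sum>i\<in>I. v i a) * monomial \<alpha> (x a)) = (\<Sum>i\<in>I. \<Sum>a\<in>J. v i a * monomial \<alpha> (x a))"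
    by (simp add: sum_distrib_right) (rule sum.swap)
  thus "(\<Sum>a\<in>J. (\<Sum>i\<in>I. v i a) * monomial \<alpha> (x a)) = 0"
    using assms \<open>mdeg \<alpha> < s\<close> by (simp add: annihilates_def)
qed

section \<open>Gram forms of powers of the inner product\<close>

lemma gram_power_Suc:
  "(\<Sum>i\<in>J. \<Sum>l\<in>J. w i * w l * inner (x i) (x l :: real^'d::finite) ^ Suc a) =
   (\<Sum>c\<in>UNIV. \<Sum>i\<in>J. \<Sum>l\<in>J. (w i * vec_nth (x i) c) * (w l * vec_nth (x l) c) * inner (x i) (x l) ^ a)"
proof -
  have "(\<Sum>i\<in>J. \<Sum>l\<in>J. w i * w l * inner (x i) (x l) ^ Suc a) =
     (\<Sum>i\<in>J. \<Sum>l\<in>J. \<Sum>c\<in>UNIV. (w i * vec_nth (x i) c) * (w l * vec_nth (x l) c) * inner (x i) (x l) ^ a)"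
  proof (intro sum.cong refl)
    fix i l
    have "inner (x i) (x l) ^ Suc a =
        (\<Sum>c\<in>UNIV. vec_nth (x i) c * vec_nth (x l) c) * inner (x i) (x l) ^ a"
      by (simp only: power_Suc) (simp only: inner_vec_def inner_real_def)
    thus "w i * w l * inner (x i) (x l) ^ Suc a =
      (\<Sum>c\<in>UNIV. (w i * vec_nth (x i) c) * (w l * vec_nth (x l) c) * inner (x i) (x l) ^ a)"
      by (simp only: sum_distrib_left sum_distrib_right mult_ac)
  qed
  also have "\<dots> =
      (\<Sum>i\<in>J. \<Sum>c\<in>UNIV. \<Sum>l\<in>J. (w i * vec_nth (x i) c) * (w l * vec_nth (x l) c) * inner (x i) (x l) ^ a)"
    by (intro sum.cong refl) (rule sum.swap)
  also have "\<dots> =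
      (\<Sum>c\<in>UNIV. \<Sum>i\<in>J. \<Sum>l\<in>J. (w i * vec_nth (x i) c) * (w l * vec_nth (x l) c) * inner (x i) (x l) ^ a)"
    by (rule sum.swap)
  finally show ?thesis .
qed

text \<open>An instance of the Schur product theorem: splitting one factor of the inner product into
  coordinates replaces the weights w_i by w_i (x_i)_c and lowers the exponent, down to a plain
  square.\<close>

lemma gram_power_nonneg:
  "(\<Sum>i\<in>J. \<Sum>l\<in>J. w i * w l * inner (x i) (x l :: real^'d::finite) ^ a) \<ge> 0"
proof (induction a arbitrary: w)
  case 0
  have "(\<Sum>i\<in>J. \<Sum>l\<in>J. w i * w l) = (\<Sum>i\<in>J. w i)\<^sup>2" by (simp add: power2_eq_square sum_product)
  then show ?case by simp
next
  case (Suc a)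
  show ?case unfolding gram_power_Suc by (intro sum_nonneg Suc)
qed

text \<open>In the same recursion every nonnegative summand must vanish, so the coordinates can be
  chosen to spell out \<alpha>; at exponent 0 the square of the moment of \<alpha> remains.\<close>

lemma gram_power_eq_0:
  assumes "(\<Sum>i\<in>J. \<Sum>l\<in>J. w i * w l * inner (x i) (x l :: real^'d::finite) ^ a) = 0" "mdeg \<alpha> = a"
  shows "(\<Sum>i\<in>J. w i * monomial \<alpha> (x i)) = 0"
  using assms
proof (induction a arbitrary: w \<alpha>)
  case 0
  have "(\<Sum>i\<in>J. w i)\<^sup>2 = 0" using 0 by (simp add: power2_eq_square sum_product)
  moreover have "\<alpha> = (\<lambda>_. 0)" using 0(2) multi_indices_0 by (auto simp: multi_indices_def)
  ultimately show ?case by simp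
next
  case (Suc a)
  obtain c \<beta> where b: "mdeg \<beta> = a" "\<alpha> = (\<lambda>j. munit c j + \<beta> j)" using mdeg_Suc_E[OF Suc.prems(2)] .
  have "(\<Sum>i\<in>J. \<Sum>l\<in>J. (w i * vec_nth (x i) c) * (w l * vec_nth (x l) c) * inner (x i) (x l) ^ a) = 0"
    using Suc.prems(1) unfolding gram_power_Suc
    by (subst (asm) sum_nonneg_eq_0_iff) (auto intro!: gram_power_nonneg)
  from Suc.IH[OF this b(1)] show ?case
    unfolding b(2) monomial_add monomial_munit by (simp add: mult.assoc)
qed

section \<open>Expansion of a homogeneous polynomial at a difference of two points\<close>

lemma vec_nth_diff_pow:
  "(a - b) ^ g = (\<Sum>k\<le>g. real (g choose k) * a ^ k * ((-1) ^ (g - k) * b ^ (g - k)))" for a b :: real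
  using binomial_ring[of a "-b" g] by (simp add: power_minus[of b])

lemma monomial_diff:
  fixes x y :: "real ^ 'd::finite"
  shows "monomial \<gamma> (x - y) = (\<Sum>\<alpha> | \<forall>i. \<alpha> i \<le> \<gamma> i. (\<Prod>i\<in>UNIV. real (\<gamma> i choose \<alpha> i)) *
     (-1) ^ mdeg (\<lambda>i. \<gamma> i - \<alpha> i) * monomial \<alpha> x * monomial (\<lambda>i. \<gamma> i - \<alpha> i) y)"
proof -
  have "monomial \<gamma> (x - y) = (\<Prod>i\<in>UNIV. \<Sum>k\<le>\<gamma> i. real (\<gamma> i choose k) * vec_nth x i ^ k *
      ((-1) ^ (\<gamma> i - k) * vec_nth y i ^ (\<gamma> i - k)))"
    by (simp add: monomial_def vec_nth_diff_pow)
  also have "\<dots> = (\<Sum>\<alpha>\<in>Pi\<^sub>E UNIV (\<lambda>i. {..\<gamma> i}). \<Prod>i\<in>UNIV. real (\<gamma> i choose \<alpha> i) * vec_nth x i ^ \<alpha> i *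
      ((-1) ^ (\<gamma> i - \<alpha> i) * vec_nth y i ^ (\<gamma> i - \<alpha> i)))"
    by (rule prod_sum_PiE) auto
  also have "Pi\<^sub>E UNIV (\<lambda>i. {..\<gamma> i}) = {\<alpha>. \<forall>i. \<alpha> i \<le> \<gamma> i}" by auto
  finally show ?thesis
    by (simp add: prod.distrib monomial_def mdeg_def power_sum mult_ac)
qed

lemma mbinomial: "(\<Prod>i\<in>UNIV. real ((\<alpha> i + \<beta> i) choose \<alpha> i)) = mfact (\<lambda>i. \<alpha> i +
    \<beta> i) / (mfact \<alpha> * mfact \<beta>)"
proof -
  have "real ((\<alpha> i + \<beta> i) choose \<alpha> i) = fact (\<alpha> i + \<beta> i) / (fact (\<alpha> i) * fact (\<beta> i))" for i
    by (subst binomial_fact) auto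
  thus ?thesis unfolding mfact_def by (simp add: prod_dividef prod.distrib)
qed

text \<open>The multi-index binomial theorem sorted by the degree s in x. The binomial coefficients
  are written with the factorials of \<alpha> + \<beta>, so that the coefficients have the shape of
  mixed partial derivatives at 0 divided by \<alpha>! \<beta>!, as in the Wronskian.\<close>

lemma homogeneous_poly_diff:
  fixes x y :: "real ^ 'd::finite"
  shows "(\<Sum>\<gamma>\<in>multi_indices M. P \<gamma> * monomial \<gamma> (x - y)) =
    (\<Sum>s\<le>M. \<Sum>\<alpha>\<in>multi_indices s. \<Sum>\<beta>\<in>multi_indices (M - s).
       (-1) ^ mdeg \<beta> * mfact (\<lambda>i. \<alpha> i + \<beta> i) * P (\<lambda>i. \<alpha> i + \<beta> i) / (mfact \<alpha> * mfact \<beta>)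
         * monomial \<alpha> x * monomial \<beta> y)"
proof -
  let ?t = "\<lambda>\<alpha> \<beta>. (-1) ^ mdeg \<beta> * mfact (\<lambda>i. \<alpha> i + \<beta> i) * P (\<lambda>i. \<alpha> i + \<beta> i) / (mfact \<alpha> * mfact \<beta>)
         * monomial \<alpha> x * monomial \<beta> y"
  let ?S = "SIGMA \<gamma>:multi_indices M. {\<alpha>. \<forall>i. \<alpha> i \<le> \<gamma> i}"
  let ?T = "SIGMA s:{..M}. multi_indices s \<times> multi_indices (M - s)"
  have fin: "finite {\<alpha>. \<forall>i. \<alpha> i \<le> \<gamma> i}" for \<gamma> :: "'d \<Rightarrow> nat"
  proof -
    have "{\<alpha>. \<forall>i. \<alpha> i \<le> \<gamma> i} = Pi\<^sub>E UNIV (\<lambda>i. {..\<gamma> i})" by auto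
    thus ?thesis by (simp add: finite_PiE)
  qed
  have "(\<Sum>\<gamma>\<in>multi_indices M. P \<gamma> * monomial \<gamma> (x - y)) =
    (\<Sum>\<gamma>\<in>multi_indices M. \<Sum>\<alpha> | \<forall>i. \<alpha> i \<le> \<gamma> i. ?t \<alpha> (\<lambda>i. \<gamma> i - \<alpha> i))"
  proof (intro sum.cong refl)
    fix \<gamma> :: "'d \<Rightarrow> nat"
    show "P \<gamma> * monomial \<gamma> (x - y) = (\<Sum>\<alpha> | \<forall>i. \<alpha> i \<le> \<gamma> i. ?t \<alpha> (\<lambda>i. \<gamma> i - \<alpha> i))"
      unfolding monomial_diff sum_distrib_left
    proof (intro sum.cong refl)
      fix \<alpha> assume "\<alpha> \<in> {\<alpha>. \<forall>i. \<alpha> i \<le> \<gamma> i}"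
      hence e: "(\<lambda>i. \<alpha> i + (\<gamma> i - \<alpha> i)) = \<gamma>" by (auto simp: fun_eq_iff)
      have "(\<Prod>i\<in>UNIV. real (\<gamma> i choose \<alpha> i)) = mfact \<gamma> / (mfact \<alpha> * mfact (\<lambda>i. \<gamma> i - \<alpha> i))"
        using mbinomial[of \<alpha> "\<lambda>i. \<gamma> i - \<alpha> i"] fun_cong[OF e] e by simp
      thus "P \<gamma> * ((\<Prod>i\<in>UNIV. real (\<gamma> i choose \<alpha> i)) * (- 1) ^ mdeg (\<lambda>i. \<gamma> i - \<alpha> i) * monomial \<alpha> x *
          monomial (\<lambda>i. \<gamma> i - \<alpha> i) y) = ?t \<alpha> (\<lambda>i. \<gamma> i - \<alpha> i)"
        unfolding e by simp
    qed
  qed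
  also have "\<dots> = (\<Sum>(\<gamma>, \<alpha>)\<in>?S. ?t \<alpha> (\<lambda>i. \<gamma> i - \<alpha> i))"
    by (subst sum.Sigma) (auto simp: fin)
  \<comment> \<open>A pair (\<gamma>, \<alpha>) corresponds to the degree of \<alpha>, \<alpha>
    itself and \<gamma> - \<alpha>; the truncated subtraction is exact because \<alpha> <= \<gamma>
    in every coordinate.\<close>
  also have "\<dots> = (\<Sum>(s, \<alpha>, \<beta>)\<in>?T. ?t \<alpha> \<beta>)"
    by (rule sum.reindex_bij_witness[where
          i = "\<lambda>(s, \<alpha>, \<beta>). ((\<lambda>i. \<alpha> i + \<beta> i), \<alpha>)" and j = "\<lambda>(\<gamma>, \<alpha>). (mdeg \<alpha>, \<alpha>, (\<lambda>i. \<gamma> i - \<alpha> i))"])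
       (auto simp: multi_indices_def mdeg_add fun_eq_iff mdeg_def sum_subtractf_nat intro!: sum_mono)
  also have "\<dots> = (\<Sum>s\<le>M. \<Sum>(\<alpha>, \<beta>)\<in>multi_indices s \<times> multi_indices (M - s). ?t \<alpha> \<beta>)"
    by (subst sum.Sigma) auto
  finally show ?thesis by (simp add: sum.cartesian_product)
qed

subsection \<open>Quadratic forms of the kernel\<close>

text \<open>The part of degree \<open>l\<close> in \<open>y\<close> of
  \<open>\<psi>(\<parallel>z - y\<parallel>) = G(\<parallel>z\<parallel>\<^sup>2 + (\<parallel>y\<parallel>\<^sup>2 - 2\<langle>y, z\<rangle>))\<close>, where \<open>G s = \<psi>(\<surd>s)\<close> is expanded at
  \<open>\<parallel>z\<parallel>\<^sup>2\<close> up to order \<open>p\<close>.\<close>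

definition taylor_coeff :: "real fps \<Rightarrow> nat \<Rightarrow> real ^ 'd::finite \<Rightarrow> nat \<Rightarrow> real ^ 'd \<Rightarrow> real" where
  "taylor_coeff \<Psi> p z l y = (\<Sum>m\<le>p. \<Sum>k\<le>m. if m + k = l then
      radial \<Psi> m ((norm z)\<^sup>2) / fact m * real (m choose k) * ((-2) * inner y z) ^ (m - k) * norm y ^ (2 * k)
    else 0)"

lemma homogeneous_poly_taylor_coeff: "homogeneous_poly l (taylor_coeff \<Psi> p z l)"
  unfolding taylor_coeff_def[abs_def]
proof (intro homogeneous_poly_sum)
  fix m k :: nat assume k: "k \<in> {..m}"
  show "homogeneous_poly l (\<lambda>y. if m + k = l then
      radial \<Psi> m ((norm z)\<^sup>2) / fact m * real (m choose k) * ((-2) * inner y z) ^ (m - k) * norm y ^ (2 * k)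
    else 0)"
  proof (cases "m + k = l")
    case True
    have "homogeneous_poly (1 * (m - k) +
        2 * k) (\<lambda>y. (radial \<Psi> m ((norm z)\<^sup>2) / fact m * real (m choose k)) *
       (((-2) * inner y z) ^ (m - k) * norm y ^ (2 * k)))"
      by (intro homogeneous_poly_cmult homogeneous_poly_mult homogeneous_poly_power
          homogeneous_poly_inner homogeneous_poly_norm_even)
    moreover have "1 * (m - k) + 2 * k = l" using k True by auto
    ultimately show ?thesis using True by (simp only: mult.assoc if_True simp_thms)
  qed (simp add: homogeneous_poly_zero)
qed

lemma taylor_coeff_scaleR:
  assumes "l \<le> p"
  shows "taylor_coeff \<Psi> p z l (c *\<^sub>R y) = c ^ l * taylor_coeff \<Psi> p z l y"
proof -
  obtain e where e: "\<And>y. taylor_coeff \<Psi> p z l y = (\<Sum>\<alpha>\<in>multi_indices l. e \<alpha> * monomial \<alpha> y)"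
    using homogeneous_poly_taylor_coeff[of l \<Psi> p z] unfolding homogeneous_poly_def by blast
  show ?thesis unfolding e sum_distrib_left
    by (intro sum.cong refl) (simp add: monomial_scaleR multi_indices_def)
qed

text \<open>The squared norm is |z|^2 + h with h = O(\<epsilon>). Taylor's remainder in h is
  O(\<epsilon>^(p+1)), and the Taylor polynomial in h differs from the claimed polynomial in
  \<epsilon> only by terms with m + k > p.\<close>

lemma taylor_at_nonzero:
  fixes z y :: "real ^ 'd::finite"
  assumes z: "z \<noteq> 0" "ereal (norm z) < fps_conv_radius \<Psi>"
  shows "((\<lambda>\<epsilon>. (eval_fps \<Psi> (norm (\<epsilon> *\<^sub>R y - z)) - (\<Sum>l\<le>p. taylor_coeff \<Psi> p z l y * \<epsilon> ^ l)) / \<epsilon> ^ p)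
          \<longlongrightarrow> 0) (at_right 0)"
proof -
  define c where "c m = radial \<Psi> m ((norm z)\<^sup>2) / fact m" for m
  define u where "u = (-2) * inner y z"
  define h where "h \<epsilon> = \<epsilon> * (u + \<epsilon> * (norm y)\<^sup>2)" for \<epsilon> :: real
  define t where "t m k = c m * real (m choose k) * u ^ (m - k) * norm y ^ (2 * k)" for m k
  have z2: "(norm z)\<^sup>2 > 0" "ereal (sqrt ((norm z)\<^sup>2)) < fps_conv_radius \<Psi>"
    using z by auto
  obtain C \<eta> where \<eta>: "\<eta> > 0" and C: "\<And>h. \<bar>h\<bar> < \<eta> \<Longrightarrow>
      \<bar>eval_fps \<Psi> (sqrt ((norm z)\<^sup>2 + h)) - (\<Sum>m\<le>p. c m * h ^ m)\<bar> \<le> C * \<bar>h\<bar> ^ Suc p"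
    unfolding c_def by (rule radial_Taylor[OF z2, of p]) blast
  have n: "norm (\<epsilon> *\<^sub>R y - z) = sqrt ((norm z)\<^sup>2 + h \<epsilon>)" for \<epsilon>
    unfolding norm_eq_sqrt_inner[of "_ - _"] h_def u_def power2_norm_eq_inner
    by (simp add: inner_diff_left inner_diff_right inner_commute algebra_simps)
  have h0: "(h \<longlongrightarrow> 0) (at_right 0)"
    unfolding h_def by (auto intro!: tendsto_eq_intros)
  have first: "((\<lambda>\<epsilon>. (eval_fps \<Psi> (sqrt ((norm z)\<^sup>2 +
      h \<epsilon>)) - (\<Sum>m\<le>p. c m * h \<epsilon> ^ m)) / \<epsilon> ^ p) \<longlongrightarrow> 0) (at_right 0)"
  proof (rule Lim_null_comparison)
    have "\<forall>\<^sub>F \<epsilon> in at_right 0. \<bar>h \<epsilon>\<bar> < \<eta>"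
      using tendstoD[OF h0 \<eta>] by (simp add: dist_real_def)
    moreover have "\<forall>\<^sub>F \<epsilon>::real in at_right 0. \<epsilon> > 0" by (simp add: eventually_at_right_less)
    ultimately show "\<forall>\<^sub>F \<epsilon> in at_right 0. norm ((eval_fps \<Psi> (sqrt ((norm z)\<^sup>2 +
        h \<epsilon>)) - (\<Sum>m\<le>p. c m * h \<epsilon> ^ m)) / \<epsilon> ^ p)
        \<le> C * \<bar>u + \<epsilon> * (norm y)\<^sup>2\<bar> ^ Suc p * \<epsilon>"
    proof eventually_elim
      case (elim \<epsilon>)
      have "\<bar>h \<epsilon>\<bar> ^ Suc p = \<bar>u + \<epsilon> * (norm y)\<^sup>2\<bar> ^ Suc p * \<epsilon> * \<epsilon> ^ p"
        using elim by (simp add: h_def abs_mult power_mult_distrib)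
      with C[OF elim(1)] elim show ?case by (simp add: field_simps)
    qed
    show "((\<lambda>\<epsilon>. C * \<bar>u + \<epsilon> * (norm y)\<^sup>2\<bar> ^ Suc p * \<epsilon>) \<longlongrightarrow> 0) (at_right 0)"
      by (auto intro!: tendsto_eq_intros)
  qed
  have hm: "c m * h \<epsilon> ^ m = (\<Sum>k\<le>m. t m k * \<epsilon> ^ (m + k))" for m \<epsilon>
  proof -
    have "c m * h \<epsilon> ^ m = c m * \<epsilon> ^ m * (\<epsilon> * (norm y)\<^sup>2 + u) ^ m"
      by (simp add: h_def power_mult_distrib add.commute)
    also have "\<dots> = (\<Sum>k\<le>m. c m * \<epsilon> ^ m * (real (m choose k) * (\<epsilon> * (norm y)\<^sup>2) ^ k * u ^ (m - k)))"
      by (simp only: binomial_ring sum_distrib_left)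
    also have "\<dots> = (\<Sum>k\<le>m. t m k * \<epsilon> ^ (m + k))"
      by (intro sum.cong refl) (simp add: t_def power_mult_distrib power_add flip: power_mult)
    finally show ?thesis .
  qed
  have tc: "(\<Sum>l\<le>p. taylor_coeff \<Psi> p z l y * \<epsilon> ^ l) = (\<Sum>m\<le>p. \<Sum>k\<le>m. if m + k \<le> p then t m k * \<epsilon> ^ (m +
      k) else 0)" for \<epsilon>
  proof -
    have "(\<Sum>l\<le>p. taylor_coeff \<Psi> p z l y * \<epsilon> ^ l) =
        (\<Sum>l\<le>p. \<Sum>m\<le>p. \<Sum>k\<le>m. if m + k = l then t m k * \<epsilon> ^ (m + k) else 0)"
      unfolding taylor_coeff_def sum_distrib_right t_def c_def u_def
      by (intro sum.cong refl) auto
    also have "\<dots> = (\<Sum>m\<le>p. \<Sum>l\<le>p. \<Sum>k\<le>m. if m + k = l then t m k * \<epsilon> ^ (m + k) else 0)"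
      by (rule sum.swap)
    also have "\<dots> = (\<Sum>m\<le>p. \<Sum>k\<le>m. \<Sum>l\<le>p. if m + k = l then t m k * \<epsilon> ^ (m + k) else 0)"
      by (rule sum.cong[OF refl]) (rule sum.swap)
    also have "\<dots> = (\<Sum>m\<le>p. \<Sum>k\<le>m. if m + k \<le> p then t m k * \<epsilon> ^ (m + k) else 0)"
      by (intro sum.cong refl) simp
    finally show ?thesis .
  qed
  have second: "((\<lambda>\<epsilon>. ((\<Sum>m\<le>p. c m * h \<epsilon> ^ m) - (\<Sum>l\<le>p. taylor_coeff \<Psi> p z l y * \<epsilon> ^ l)) / \<epsilon> ^ p) \<longlongrightarrow> 0) (at_right 0)"
  proof -
    have "\<forall>\<^sub>F \<epsilon> in at_right 0. (\<Sum>m\<le>p. \<Sum>k\<le>m. if m + k \<le> p then 0 else t m k * \<epsilon> ^ (m + k - p)) =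
       ((\<Sum>m\<le>p. c m * h \<epsilon> ^ m) - (\<Sum>l\<le>p. taylor_coeff \<Psi> p z l y * \<epsilon> ^ l)) / \<epsilon> ^ p"
      using eventually_at_right_less[of 0]
    proof eventually_elim
      case (elim \<epsilon>)
      show ?case unfolding hm tc sum_subtractf[symmetric] sum_divide_distrib
        by (intro sum.cong refl) (use elim in \<open>auto simp: power_diff\<close>)
    qed
    moreover have "((\<lambda>\<epsilon>. \<Sum>m\<le>p. \<Sum>k\<le>m. if m + k \<le> p then 0 else t m k * \<epsilon> ^ (m +
        k - p)) \<longlongrightarrow> 0) (at_right 0)"
    proof (intro tendsto_null_sum)
      fix m k :: nat
      show "((\<lambda>\<epsilon>. if m + k \<le> p then 0 else t m k * \<epsilon> ^ (m + k - p)) \<longlongrightarrow> 0) (at_right 0)"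
        by (cases "m + k \<le> p") (auto intro!: tendsto_eq_intros)
    qed
    ultimately show ?thesis using tendsto_cong by fast
  qed
  show ?thesis unfolding n using tendsto_add[OF first second]
    by (simp add: add_divide_distrib[symmetric] diff_divide_distrib[symmetric])
qed

lemma fps_expansion_compose_scale:
  fixes \<psi> :: "real \<Rightarrow> real"
  assumes "\<psi> has_fps_expansion \<Psi>"
  shows "(\<lambda>\<epsilon>. \<psi> (\<epsilon> * c)) has_fps_expansion Abs_fps (\<lambda>m. fps_nth \<Psi> m * c ^ m)"
\<comment> \<open>For c = 0 the series is a constant; otherwise its radius of convergence is that of
  \<Psi> divided by |c|.\<close>
proof (cases "c = 0")
  case True
  have "\<psi> 0 = fps_nth \<Psi> 0"
    using assms eventually_nhds_x_imp_x[of "\<lambda>z. eval_fps \<Psi> z = \<psi> z" 0]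
    by (auto simp: has_fps_expansion_def eval_fps_at_0)
  moreover have "Abs_fps (\<lambda>m. fps_nth \<Psi> m * c ^ m) = fps_const (fps_nth \<Psi> 0)"
    using True by (intro fps_ext) (auto simp: power_0_left)
  ultimately show ?thesis using True by simp
next
  case False
  have r: "fps_conv_radius \<Psi> > 0" using assms by (simp add: has_fps_expansion_def)
  have "fps_conv_radius (Abs_fps (\<lambda>m. fps_nth \<Psi> m * c ^ m)) = fps_conv_radius \<Psi> / ereal (norm c)"
    unfolding fps_conv_radius_def fps_nth_Abs_fps using False by (rule conv_radius_mult_power_right)
  also have "\<dots> > 0" using r False by (cases "fps_conv_radius \<Psi>") auto
  finally have R: "fps_conv_radius (Abs_fps (\<lambda>m. fps_nth \<Psi> m * c ^ m)) > 0" .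
  have "\<forall>\<^sub>F t in nhds 0. eval_fps \<Psi> t = \<psi> t" using assms by (simp add: has_fps_expansion_def)
  moreover have "((\<lambda>\<epsilon>. \<epsilon> * c) \<longlongrightarrow> 0) (nhds 0)"
    using tendsto_mult_left_zero[OF filterlim_ident, of c] by simp
  ultimately have "\<forall>\<^sub>F \<epsilon> in nhds 0. eval_fps \<Psi> (\<epsilon> * c) = \<psi> (\<epsilon> * c)"
    using eventually_compose_filterlim by blast
  moreover have "eval_fps (Abs_fps (\<lambda>m. fps_nth \<Psi> m * c ^ m)) \<epsilon> = eval_fps \<Psi> (\<epsilon> * c)" for \<epsilon>
    unfolding eval_fps_def by (simp add: power_mult_distrib mult_ac)
  ultimately show ?thesis using R by (simp add: has_fps_expansion_def)
qed

text \<open>The coefficient of \<epsilon>^m in the bilinear form v^T K(\<epsilon>) w.\<close>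

definition kernel_form :: "real fps \<Rightarrow> 'i set \<Rightarrow> ('i \<Rightarrow> real ^ 'd::finite) \<Rightarrow> nat \<Rightarrow> ('i \<Rightarrow> real) \<Rightarrow> ('i \<Rightarrow> real) \<Rightarrow> real" where
  "kernel_form \<Psi> J x m v w = (\<Sum>a\<in>J. \<Sum>b\<in>J. v a * w b * (fps_nth \<Psi> m * norm (x a - x b) ^ m))"

lemma kernel_form_commute: "kernel_form \<Psi> J x m v w = kernel_form \<Psi> J x m w v"
  unfolding kernel_form_def by (subst sum.swap) (simp add: norm_minus_commute mult_ac)

lemma kernel_form_expansion:
  assumes "\<psi> has_fps_expansion \<Psi>"
  shows "(\<lambda>\<epsilon>. \<Sum>a\<in>J. \<Sum>b\<in>J. v a * w b * \<psi> (\<epsilon> * norm (x a - x b))) has_fps_expansion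
     Abs_fps (\<lambda>m. kernel_form \<Psi> J x m v w)"
proof -
  have "(\<lambda>\<epsilon>. \<Sum>a\<in>J. \<Sum>b\<in>J. v a * w b * \<psi> (\<epsilon> * norm (x a - x b))) has_fps_expansion
     (\<Sum>a\<in>J. \<Sum>b\<in>J. fps_const (v a * w b) * Abs_fps (\<lambda>m. fps_nth \<Psi> m * norm (x a - x b) ^ m))"
    by (intro has_fps_expansion_sum has_fps_expansion_cmult_left fps_expansion_compose_scale assms)
  moreover have "(\<Sum>a\<in>J. \<Sum>b\<in>J. fps_const (v a * w b) * Abs_fps (\<lambda>m. fps_nth \<Psi> m * norm (x a - x b) ^ m))
     = Abs_fps (\<lambda>m. kernel_form \<Psi> J x m v w)"
    by (rule fps_ext) (simp add: fps_sum_nth kernel_form_def)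
  ultimately show ?thesis by simp
qed

lemma sum_swap_pair:
  "(\<Sum>a\<in>J. \<Sum>b\<in>J. \<Sum>t\<in>T. F t a b) = (\<Sum>t\<in>T. \<Sum>a\<in>J. \<Sum>b\<in>J. F t a b)"
proof -
  have "(\<Sum>a\<in>J. \<Sum>b\<in>J. \<Sum>t\<in>T. F t a b) = (\<Sum>a\<in>J. \<Sum>t\<in>T. \<Sum>b\<in>J. F t a b)"
    by (intro sum.cong refl) (rule sum.swap)
  also have "\<dots> = (\<Sum>t\<in>T. \<Sum>a\<in>J. \<Sum>b\<in>J. F t a b)" by (rule sum.swap)
  finally show ?thesis .
qed

text \<open>Merges the weights of coinciding points, so that positive definiteness, which is stated
  for sets of points, can be applied to families with repetitions.\<close>

lemma sum_group_image:
  fixes w :: "'a \<Rightarrow> real"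
  assumes "finite J"
  shows "(\<Sum>a\<in>J. w a * g (y a)) = (\<Sum>z\<in>y ` J. (\<Sum>a | a \<in> J \<and> y a = z. w a) * g z)"
  by (subst sum.image_gen[OF assms, of _ y]) (auto simp: sum_distrib_right intro!: sum.cong)

text \<open>For odd m in this range the coefficient of \<Psi> vanishes. For even m the distance
  power is a polynomial whose terms have degrees s in x_a and m - s in x_b; since m < i + l, either
  s < i or m - s < l, and v or w kills the term.\<close>

lemma kernel_form_eq_0:
  fixes x :: "'i \<Rightarrow> real ^ 'd::finite"
  assumes r: "regularity_index \<Psi> r"
    and v: "annihilates J x i v" and w: "annihilates J x l w"
    and m: "m < i + l" "m \<le> 2 * r - 2"
  shows "kernel_form \<Psi> J x m v w = 0"
proof (cases "even m")
  case False
  then obtain c where "m = 2 * c + 1" by (elim oddE)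
  hence "m = 2 * Suc c - 1" "Suc c < r" using m r by (auto simp: regularity_index_def)
  hence "fps_nth \<Psi> m = 0" using r unfolding regularity_index_def
    by (metis One_nat_def Suc_le_mono le0)
  thus ?thesis by (simp add: kernel_form_def)
next
  case True
  then obtain k where k: "m = 2 * k" by blast
  obtain P where P: "\<And>z :: real ^ 'd. norm z ^ m = (\<Sum>\<gamma>\<in>multi_indices m. P \<gamma> * monomial \<gamma> z)"
    using homogeneous_poly_norm_even[of k] unfolding homogeneous_poly_def k by blast
  define C where "C \<alpha> \<beta> = (-1) ^ mdeg \<beta> * mfact (\<lambda>i. \<alpha> i + \<beta> i) * P (\<lambda>i. \<alpha> i +
      \<beta> i) / (mfact \<alpha> * mfact \<beta>)" for \<alpha> \<beta>
  have "(\<Sum>a\<in>J. \<Sum>b\<in>J. v a * w b * norm (x a - x b) ^ m) =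
    (\<Sum>a\<in>J. \<Sum>b\<in>J. \<Sum>s\<le>m. \<Sum>\<alpha>\<in>multi_indices s. \<Sum>\<beta>\<in>multi_indices (m - s).
       C \<alpha> \<beta> * (v a * monomial \<alpha> (x a)) * (w b * monomial \<beta> (x b)))"
    unfolding P homogeneous_poly_diff C_def sum_distrib_left
    by (intro sum.cong refl) (simp add: mult_ac)
  also have "\<dots> = (\<Sum>s\<le>m. \<Sum>\<alpha>\<in>multi_indices s. \<Sum>\<beta>\<in>multi_indices (m - s). \<Sum>a\<in>J. \<Sum>b\<in>J.
       C \<alpha> \<beta> * (v a * monomial \<alpha> (x a)) * (w b * monomial \<beta> (x b)))"
    by (simp only: sum_swap_pair[where J = J])
  also have "\<dots> = (\<Sum>s\<le>m. \<Sum>\<alpha>\<in>multi_indices s. \<Sum>\<beta>\<in>multi_indices (m - s).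
       C \<alpha> \<beta> * (\<Sum>a\<in>J. v a * monomial \<alpha> (x a)) * (\<Sum>b\<in>J. w b * monomial \<beta> (x b)))"
  proof (intro sum.cong refl)
    fix s and \<alpha> \<beta> :: "'d \<Rightarrow> nat"
    have e: "(\<Sum>a\<in>J. v a * monomial \<alpha> (x a)) * (\<Sum>b\<in>J. w b * monomial \<beta> (x b)) =
       (\<Sum>a\<in>J. \<Sum>b\<in>J. (v a * monomial \<alpha> (x a)) * (w b * monomial \<beta> (x b)))"
      by (rule sum_product)
    show "(\<Sum>a\<in>J. \<Sum>b\<in>J. C \<alpha> \<beta> * (v a * monomial \<alpha> (x a)) * (w b * monomial \<beta> (x b))) =
       C \<alpha> \<beta> * (\<Sum>a\<in>J. v a * monomial \<alpha> (x a)) * (\<Sum>b\<in>J. w b * monomial \<beta> (x b))"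
      unfolding mult.assoc[of "C \<alpha> \<beta>"] e by (simp only: sum_distrib_left)
  qed
  also have "\<dots> = 0"
  proof (intro sum.neutral ballI)
    fix s and \<alpha> \<beta> :: "'d \<Rightarrow> nat" assume s: "s \<in> {..m}" "\<alpha> \<in> multi_indices s" "\<beta> \<in> multi_indices (m - s)"
    hence "mdeg \<alpha> < i \<or> mdeg \<beta> < l" using m by (auto simp: multi_indices_def)
    thus "C \<alpha> \<beta> * (\<Sum>a\<in>J. v a * monomial \<alpha> (x a)) * (\<Sum>b\<in>J. w b * monomial \<beta> (x b)) = 0"
      using v w by (auto simp: annihilates_def)
  qed
  finally have "(\<Sum>a\<in>J. \<Sum>b\<in>J. v a * w b * norm (x a - x b) ^ m) = 0" .
  moreover have "kernel_form \<Psi> J x m v w =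
      fps_nth \<Psi> m * (\<Sum>a\<in>J. \<Sum>b\<in>J. v a * w b * norm (x a - x b) ^ m)"
    by (simp add: kernel_form_def sum_distrib_left mult_ac)
  ultimately show ?thesis by simp
qed

section \<open>Consequences of positive definiteness\<close>

lemma nonneg_quadratic_imp_le:
  fixes A B C :: real
  assumes "\<And>\<tau>. A + 2 * \<tau> * B + \<tau>\<^sup>2 * C \<ge> 0"
  shows "B\<^sup>2 \<le> A * C"
proof (cases "C = 0")
  case True
  have "B = 0"
  proof (rule ccontr)
    assume "B \<noteq> 0"
    have "A + 2 * (-(A + 1) / (2 * B)) * B \<ge> 0" using assms[of "-(A + 1) / (2 * B)"] True by simp
    moreover have "2 * (-(A + 1) / (2 * B)) * B = -(A + 1)" using \<open>B \<noteq> 0\<close> by simp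
    ultimately show False by linarith
  qed
  thus ?thesis using True by simp
next
  case False
  have A: "A \<ge> 0" using assms[of 0] by simp
  have "C > 0"
  proof (rule ccontr)
    assume "\<not> C > 0"
    hence C: "C < 0" using False by simp
    have "A + A - 2 * B * 0 + 1 > 0" using A by simp
    have p: "A + 2 * \<tau> * B + \<tau>\<^sup>2 * C + (A + 2 * (-\<tau>) * B + (-\<tau>)\<^sup>2 * C) \<ge> 0" for \<tau>
      using assms[of \<tau>] assms[of "-\<tau>"] by linarith
    \<comment> \<open>For this value of \<tau>, A + \<tau>^2 C = -1, while adding the hypotheses for
      \<tau> and -\<tau> shows that twice this number is nonnegative.\<close>
    have "(sqrt ((A + 1) / - C))\<^sup>2 * C = -(A + 1)" using A C by (simp add: field_simps)
    thus False using p[of "sqrt ((A + 1) / - C)"] by simp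
  qed
  have "A + 2 * (- B / C) * B + (- B / C)\<^sup>2 * C \<ge> 0" by (rule assms)
  moreover have "(- B / C)\<^sup>2 * C = B\<^sup>2 / C" "2 * (- B / C) * B = - 2 * (B\<^sup>2 / C)"
    using False by (simp_all add: power2_eq_square field_simps)
  ultimately have "A - B\<^sup>2 / C \<ge> 0" by linarith
  thus ?thesis using \<open>C > 0\<close> by (simp add: field_simps)
qed

locale radial_kernel =
  fixes \<psi> :: "real \<Rightarrow> real" and \<Psi> :: "real fps" and r :: nat
    and k :: "real ^ 'd::finite \<Rightarrow> real ^ 'd \<Rightarrow> real"
  assumes k_def: "k = (\<lambda>y z. \<psi> (norm (y - z)))"
    and pd: "positive_definite_kernel k"
    and expansion: "\<psi> has_fps_expansion \<Psi>"
    and regularity: "regularity_index \<Psi> r"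
begin

lemma r_pos: "r \<ge> 1" and lead_nonzero: "fps_nth \<Psi> (2 * r - 1) \<noteq> 0"
  using regularity by (auto simp: regularity_index_def)

lemma odd_coeff_eq_0:
  assumes "odd m" "m < 2 * r - 1"
  shows "fps_nth \<Psi> m = 0"
proof -
  obtain c where "m = 2 * c + 1" using assms(1) by (elim oddE)
  hence "m = 2 * Suc c - 1" "Suc c < r" using assms r_pos by auto
  thus ?thesis using regularity unfolding regularity_index_def
    by (metis One_nat_def Suc_le_mono le0)
qed

text \<open>After merging equal points the weights may cancel, so only semidefiniteness is left.
  Repetitions must be allowed because a test point may coincide with a data point.\<close>

lemma psd:
  fixes y :: "'i \<Rightarrow> real ^ 'd"
  assumes "finite J"
  shows "(\<Sum>a\<in>J. \<Sum>b\<in>J. w a * w b * \<psi> (norm (y a - y b))) \<ge> 0"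
proof -
  define c where "c z = (\<Sum>a | a \<in> J \<and> y a = z. w a)" for z
  have "(\<Sum>a\<in>J. \<Sum>b\<in>J. w a * w b * \<psi> (norm (y a - y b))) = (\<Sum>a\<in>J. w a * (\<Sum>b\<in>J. w b * k (y a) (y b)))"
    by (simp add: k_def sum_distrib_left mult_ac)
  also have "\<dots> = (\<Sum>a\<in>J. w a * (\<Sum>z'\<in>y ` J. c z' * k (y a) z'))"
    using sum_group_image[OF assms, where g = "k _"] by (simp add: c_def)
  also have "\<dots> = (\<Sum>z\<in>y ` J. c z * (\<Sum>z'\<in>y ` J. c z' * k z z'))"
    unfolding c_def by (rule sum_group_image[OF assms])
  also have "\<dots> = (\<Sum>z\<in>y ` J. \<Sum>z'\<in>y ` J. c z * c z' * k z z')"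
    by (simp add: sum_distrib_left mult_ac)
  also have "\<dots> \<ge> 0"
  proof (cases "\<exists>z\<in>y ` J. c z \<noteq> 0")
    case True
    thus ?thesis using pd assms unfolding positive_definite_kernel_def
      by (intro less_imp_le) blast
  qed (simp add: sum.neutral)
  finally show ?thesis .
qed

text \<open>The form of the family enlarged by z with weight \<tau> is nonnegative for every \<tau>;
  the claim is the discriminant inequality.\<close>

lemma cauchy_schwarz:
  fixes y :: "'i \<Rightarrow> real ^ 'd"
  assumes "finite J"
  shows "(\<Sum>a\<in>J. w a * \<psi> (norm (y a - z)))\<^sup>2 \<le> (\<Sum>a\<in>J. \<Sum>b\<in>J. w a * w b * \<psi> (norm (y a - y b))) * \<psi> 0"
proof (rule nonneg_quadratic_imp_le)
  fix \<tau> :: real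
  let ?w = "case_sum w (\<lambda>_::unit. \<tau>)" and ?y = "case_sum y (\<lambda>_. z)"
  have "0 \<le> (\<Sum>a\<in>J <+> {()}. \<Sum>b\<in>J <+> {()}. ?w a * ?w b * \<psi> (norm (?y a - ?y b)))"
    using assms by (intro psd) auto
  also have "\<dots> = (\<Sum>a\<in>J. \<Sum>b\<in>J. w a * w b * \<psi> (norm (y a - y b)))
     + (\<Sum>a\<in>J. w a * \<tau> * \<psi> (norm (y a - z))) + (\<Sum>a\<in>J. \<tau> * w a * \<psi> (norm (z - y a))) + \<tau> * \<tau> * \<psi> 0"
    using assms by (simp add: sum.Plus sum.distrib)
  also have "\<dots> = (\<Sum>a\<in>J. \<Sum>b\<in>J. w a * w b * \<psi> (norm (y a - y b)))
     + 2 * \<tau> * (\<Sum>a\<in>J. w a * \<psi> (norm (y a - z))) + \<tau>\<^sup>2 * \<psi> 0"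
    by (simp add: norm_minus_commute[of z] sum_distrib_left power2_eq_square mult_ac)
  finally show "0 \<le> \<dots>" .
qed

end

section \<open>Definiteness of the forms of even degree\<close>

context radial_kernel
begin

text \<open>The coefficients of degree at most 2r - 2 vanish for such weights, so the form is the
  limit of a nonnegative quantity divided by \<epsilon>^(2r-1); the limit is taken from the right
  because the exponent is odd.\<close>

lemma kernel_form_lead_nonneg:
  fixes x :: "'i \<Rightarrow> real ^ 'd"
  assumes J: "finite J" and w: "annihilates J x r w"
  shows "kernel_form \<Psi> J x (2 * r - 1) w w \<ge> 0"
proof -
  let ?f = "\<lambda>\<epsilon>. \<Sum>a\<in>J. \<Sum>b\<in>J. w a * w b * \<psi> (\<epsilon> * norm (x a - x b))"
  have "((\<lambda>\<epsilon>. ?f \<epsilon> / \<epsilon> ^ (2 * r - 1)) \<longlongrightarrow>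
      fps_nth (Abs_fps (\<lambda>m. kernel_form \<Psi> J x m w w)) (2 * r - 1)) (at 0)"
    by (rule has_fps_expansion_tendsto_nth[OF kernel_form_expansion[OF expansion]])
       (use r_pos in \<open>auto intro!: kernel_form_eq_0[OF regularity w w]\<close>)
  hence "((\<lambda>\<epsilon>. ?f \<epsilon> / \<epsilon> ^ (2 * r - 1)) \<longlongrightarrow> kernel_form \<Psi> J x (2 * r - 1) w w) (at_right 0)"
    by (simp add: filterlim_at_split)
  moreover have "\<forall>\<^sub>F \<epsilon> in at_right 0. ?f \<epsilon> / \<epsilon> ^ (2 * r - 1) \<ge> 0"
    using eventually_at_right_less[of 0]
  proof eventually_elim
    case (elim \<epsilon>)
    have "?f \<epsilon> \<ge> 0" using psd[OF J, of w "\<lambda>a. \<epsilon> *\<^sub>R x a"] elim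
      by (simp flip: scaleR_diff_right)
    thus ?case using elim by simp
  qed
  ultimately show ?thesis by (rule tendsto_lowerbound) simp
qed

text \<open>The limit of \<open>K(\<epsilon>)\<close> tested against \<open>\<Sum>\<^sub>l \<epsilon>\<^sup>-\<^sup>l q\<^sub>l\<close> vanishes, hence by Cauchy--Schwarz so does
  its value against the point mass at any \<open>z \<noteq> 0\<close>.\<close>

lemma null_form_imp_taylor:
  fixes x :: "'i \<Rightarrow> real ^ 'd" and z :: "real ^ 'd"
  assumes J: "finite J" and p: "p \<le> r - 1"
    and q: "\<And>l. l \<le> p \<Longrightarrow> annihilates J x l (q l)"
    and null: "(\<Sum>l\<le>p. \<Sum>m\<le>p. kernel_form \<Psi> J x (l + m) (q l) (q m)) = 0"
    and \<delta>: "ereal \<delta> \<le> fps_conv_radius \<Psi>" "\<And>t. \<bar>t\<bar> < \<delta> \<Longrightarrow> eval_fps \<Psi> t = \<psi> t"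
    and z: "z \<noteq> 0" "norm z < \<delta>"
  shows "(\<Sum>l\<le>p. \<Sum>a\<in>J. q l a * taylor_coeff \<Psi> p z l (x a)) = 0"
proof -
  let ?A = "\<lambda>\<epsilon>. \<Sum>a\<in>J. \<Sum>b\<in>J. (\<Sum>l\<le>p. q l a / \<epsilon> ^ l) * (\<Sum>m\<le>p. q m b / \<epsilon> ^ m) * \<psi> (\<epsilon> * norm (x a - x b))"
  let ?f = "\<lambda>l m \<epsilon>. \<Sum>a\<in>J. \<Sum>b\<in>J. q l a * q m b * \<psi> (\<epsilon> * norm (x a - x b))"
  let ?\<beta> = "\<lambda>\<epsilon>. \<Sum>a\<in>J. (\<Sum>l\<le>p. q l a / \<epsilon> ^ l) * \<psi> (norm (\<epsilon> *\<^sub>R x a - z))"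
  have A: "?A \<epsilon> = (\<Sum>l\<le>p. \<Sum>m\<le>p. ?f l m \<epsilon> / \<epsilon> ^ (l + m))" for \<epsilon>
  proof -
    have "?A \<epsilon> = (\<Sum>a\<in>J. \<Sum>b\<in>J. \<Sum>l\<le>p. \<Sum>m\<le>p. q l a * q m b * \<psi> (\<epsilon> * norm (x a - x b)) / \<epsilon> ^ (l + m))"
    proof (intro sum.cong refl)
      fix a b
      show "(\<Sum>l\<le>p. q l a / \<epsilon> ^ l) * (\<Sum>m\<le>p. q m b / \<epsilon> ^ m) * \<psi> (\<epsilon> * norm (x a - x b)) =
        (\<Sum>l\<le>p. \<Sum>m\<le>p. q l a * q m b * \<psi> (\<epsilon> * norm (x a - x b)) / \<epsilon> ^ (l + m))"
        unfolding sum_product unfolding sum_distrib_right by (simp add: power_add)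
    qed
    also have "\<dots> = (\<Sum>l\<le>p. \<Sum>m\<le>p. \<Sum>a\<in>J. \<Sum>b\<in>J. q l a * q m b * \<psi> (\<epsilon> * norm (x a - x b)) / \<epsilon> ^ (l + m))"
      by (simp only: sum_swap_pair[where J = J])
    finally show ?thesis by (simp only: sum_divide_distrib)
  qed
  \<comment> \<open>The entry for l and m is divided by \<epsilon>^(l+m), which is exactly the
    degree at which its expansion can start, so no entry blows up and the limit is the null
    sum.\<close>
  have "(?A \<longlongrightarrow> (\<Sum>l\<le>p. \<Sum>m\<le>p. kernel_form \<Psi> J x (l + m) (q l) (q m))) (at_right 0)"
    unfolding A
  proof (intro tendsto_sum)
    fix l m assume lm: "l \<in> {..p}" "m \<in> {..p}"
    have "((\<lambda>\<epsilon>. ?f l m \<epsilon> / \<epsilon> ^ (l + m)) \<longlongrightarrow>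
        fps_nth (Abs_fps (\<lambda>s. kernel_form \<Psi> J x s (q l) (q m))) (l + m)) (at 0)"
      by (rule has_fps_expansion_tendsto_nth[OF kernel_form_expansion[OF expansion]])
         (use lm p in \<open>auto intro!: kernel_form_eq_0[OF regularity q q]\<close>)
    thus "((\<lambda>\<epsilon>. ?f l m \<epsilon> / \<epsilon> ^ (l + m)) \<longlongrightarrow> kernel_form \<Psi> J x (l + m) (q l) (q m)) (at_right 0)"
      by (simp add: filterlim_at_split)
  qed
  hence "(?A \<longlongrightarrow> 0) (at_right 0)" using null by simp
  hence "((\<lambda>\<epsilon>. ?A \<epsilon> * \<psi> 0) \<longlongrightarrow> 0) (at_right 0)" by (rule tendsto_mult_left_zero)
  moreover have "\<forall>\<^sub>F \<epsilon> in at_right 0. norm ((?\<beta> \<epsilon>)\<^sup>2) \<le> ?A \<epsilon> * \<psi> 0"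
    using eventually_at_right_less[of 0]
  proof eventually_elim
    case (elim \<epsilon>)
    show ?case using cauchy_schwarz[OF J, of "\<lambda>a. \<Sum>l\<le>p. q l a / \<epsilon> ^ l" "\<lambda>a. \<epsilon> *\<^sub>R x a" z] elim
      by (simp flip: scaleR_diff_right)
  qed
  ultimately have "((\<lambda>\<epsilon>. (?\<beta> \<epsilon>)\<^sup>2) \<longlongrightarrow> 0) (at_right 0)" by (rule Lim_null_comparison[rotated])
  hence b0: "(?\<beta> \<longlongrightarrow> 0) (at_right 0)" by simp
  \<comment> \<open>The remainder is measured against \<epsilon>^p, so it still tends to 0 after
    multiplication by \<epsilon>^p / \<epsilon>^l with l <= p.\<close>
  define e where "e a \<epsilon> =
      (eval_fps \<Psi> (norm (\<epsilon> *\<^sub>R x a - z)) - (\<Sum>l\<le>p. taylor_coeff \<Psi> p z l (x a) * \<epsilon> ^ l)) / \<epsilon> ^ p" for a \<epsilon>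
  have "ereal (norm z) < fps_conv_radius \<Psi>" using z \<delta>(1)
    by (metis ereal_less_eq(3) less_ereal.simps(1) less_le_trans)
  hence e0: "(e a \<longlongrightarrow> 0) (at_right 0)" for a
    unfolding e_def using taylor_at_nonzero[OF z(1)] by blast
  have near: "\<forall>\<^sub>F \<epsilon> in at_right 0. \<forall>a\<in>J. \<psi> (norm (\<epsilon> *\<^sub>R x a - z)) = eval_fps \<Psi> (norm (\<epsilon> *\<^sub>R x a - z))"
  proof (rule eventually_ball_finite[OF J], rule ballI)
    fix a
    have "((\<lambda>\<epsilon>. norm (\<epsilon> *\<^sub>R x a - z)) \<longlongrightarrow> norm (0 *\<^sub>R x a - z)) (at_right 0)"
      by (intro tendsto_intros)
    hence "((\<lambda>\<epsilon>. norm (\<epsilon> *\<^sub>R x a - z)) \<longlongrightarrow> norm z) (at_right 0)" by simp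
    hence "\<forall>\<^sub>F \<epsilon> in at_right 0. norm (\<epsilon> *\<^sub>R x a - z) < \<delta>" using z(2) by (rule order_tendstoD)
    thus "\<forall>\<^sub>F \<epsilon> in at_right 0. \<psi> (norm (\<epsilon> *\<^sub>R x a - z)) = eval_fps \<Psi> (norm (\<epsilon> *\<^sub>R x a - z))"
      by eventually_elim (simp add: \<delta>(2))
  qed
  let ?c = "\<lambda>l m. \<Sum>a\<in>J. q l a * taylor_coeff \<Psi> p z m (x a)"
  \<comment> \<open>This removes the negative powers of \<epsilon>: the Taylor part of degree m < l
    is a homogeneous polynomial that q_l annihilates. In the limit only m = l contributes.\<close>
  have c0: "?c l m = 0" if "m < l" "l \<le> p" for l m
    using annihilates_homogeneous_poly[OF q[OF that(2)] homogeneous_poly_taylor_coeff that(1)] .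
  let ?g = "\<lambda>\<epsilon>. \<Sum>l\<le>p. ((\<Sum>m\<le>p. if m < l then 0 else ?c l m * \<epsilon> ^ (m - l)) +
      (\<Sum>a\<in>J. q l a * (e a \<epsilon> * \<epsilon> ^ (p - l))))"
  have "\<forall>\<^sub>F \<epsilon> in at_right 0. ?\<beta> \<epsilon> = ?g \<epsilon>"
    using near eventually_at_right_less[of 0]
  proof eventually_elim
    case (elim \<epsilon>)
    have "?\<beta> \<epsilon> = (\<Sum>l\<le>p. \<Sum>a\<in>J. q l a / \<epsilon> ^ l * \<psi> (norm (\<epsilon> *\<^sub>R x a - z)))"
      unfolding sum_distrib_right by (rule sum.swap)
    also have "\<dots> = (\<Sum>l\<le>p. \<Sum>a\<in>J. q l a / \<epsilon> ^ l * ((\<Sum>m\<le>p. taylor_coeff \<Psi> p z m (x a) * \<epsilon> ^ m) +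
        e a \<epsilon> * \<epsilon> ^ p))"
      using elim by (intro sum.cong refl) (simp add: e_def)
    also have "\<dots> = ?g \<epsilon>"
    proof (rule sum.cong[OF refl])
      fix l assume l: "l \<in> {..p}"
      have "(\<Sum>a\<in>J. q l a / \<epsilon> ^ l * ((\<Sum>m\<le>p. taylor_coeff \<Psi> p z m (x a) * \<epsilon> ^ m) + e a \<epsilon> * \<epsilon> ^ p)) =
         (\<Sum>a\<in>J. \<Sum>m\<le>p. q l a * taylor_coeff \<Psi> p z m (x a) * (\<epsilon> ^ m / \<epsilon> ^ l))
          + (\<Sum>a\<in>J. q l a * (e a \<epsilon> * (\<epsilon> ^ p / \<epsilon> ^ l)))"
        by (simp add: distrib_left sum.distrib sum_distrib_left mult_ac)
      also have "(\<Sum>a\<in>J. \<Sum>m\<le>p. q l a * taylor_coeff \<Psi> p z m (x a) * (\<epsilon> ^ m / \<epsilon> ^ l)) =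
          (\<Sum>m\<le>p. ?c l m * (\<epsilon> ^ m / \<epsilon> ^ l))"
        by (subst sum.swap) (simp only: sum_distrib_right)
      also have "\<dots> = (\<Sum>m\<le>p. if m < l then 0 else ?c l m * \<epsilon> ^ (m - l))"
        using elim l by (intro sum.cong refl) (auto simp: c0 power_diff)
      also have "\<epsilon> ^ p / \<epsilon> ^ l = \<epsilon> ^ (p - l)" using elim l by (simp add: power_diff)
      finally show "(\<Sum>a\<in>J. q l a / \<epsilon> ^ l * ((\<Sum>m\<le>p. taylor_coeff \<Psi> p z m (x a) * \<epsilon> ^ m) +
          e a \<epsilon> * \<epsilon> ^ p)) =
        (\<Sum>m\<le>p. if m < l then 0 else ?c l m * \<epsilon> ^ (m - l)) + (\<Sum>a\<in>J. q l a * (e a \<epsilon> * \<epsilon> ^ (p - l)))" .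
    qed
    finally show ?case .
  qed
  moreover have "(?g \<longlongrightarrow> (\<Sum>l\<le>p. ((\<Sum>m\<le>p. if m = l then ?c l m else 0) + (\<Sum>a\<in>J. 0)))) (at_right 0)"
  proof (intro tendsto_sum tendsto_add)
    fix l m assume "l \<in> {..p}" "m \<in> {..p}"
    show "((\<lambda>\<epsilon>. if m < l then 0 else ?c l m * \<epsilon> ^ (m - l)) \<longlongrightarrow> (if m =
        l then ?c l m else 0)) (at_right 0)"
    proof (cases "l < m")
      case True
      hence "((\<lambda>\<epsilon>. ?c l m * \<epsilon> ^ (m - l)) \<longlongrightarrow> ?c l m * 0 ^ (m - l)) (at_right 0)"
        by (intro tendsto_intros)
      with True show ?thesis by (simp add: power_0_left)
    qed (cases "m = l"; simp)
  next
    fix l a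
    have "((\<lambda>\<epsilon>. q l a * (e a \<epsilon> * \<epsilon> ^ (p - l))) \<longlongrightarrow> q l a * (0 * 0 ^ (p - l))) (at_right 0)"
      by (intro tendsto_intros e0)
    thus "((\<lambda>\<epsilon>. q l a * (e a \<epsilon> * \<epsilon> ^ (p - l))) \<longlongrightarrow> 0) (at_right 0)" by simp
  qed
  ultimately have "(?\<beta> \<longlongrightarrow> (\<Sum>l\<le>p. ((\<Sum>m\<le>p. if m = l then ?c l m else 0) + (\<Sum>a\<in>J. 0)))) (at_right 0)"
    using tendsto_cong by fast
  from tendsto_unique[OF _ this b0] show ?thesis by simp
qed

lemma expansion_radius:
  obtains \<delta> where "\<delta> > 0" "ereal \<delta> \<le> fps_conv_radius \<Psi>" "\<And>t. \<bar>t\<bar> < \<delta> \<Longrightarrow> eval_fps \<Psi> t = \<psi> t"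
proof -
  have "fps_conv_radius \<Psi> > 0" using expansion by (simp add: has_fps_expansion_def)
  then obtain \<delta>1 where d1: "0 < \<delta>1" "ereal \<delta>1 < fps_conv_radius \<Psi>"
    using ereal_dense2[of 0 "fps_conv_radius \<Psi>"] by (auto simp: zero_ereal_def)
  have "\<forall>\<^sub>F t in nhds 0. eval_fps \<Psi> t = \<psi> t" using expansion by (simp add: has_fps_expansion_def)
  then obtain \<delta>2 where d2: "\<delta>2 > 0" "\<And>t. dist t 0 < \<delta>2 \<Longrightarrow> eval_fps \<Psi> t = \<psi> t"
    unfolding eventually_nhds_metric by blast
  have "ereal (min \<delta>1 \<delta>2) \<le> fps_conv_radius \<Psi>"
    using d1(2) by (meson ereal_less_eq(3) less_imp_le min.cobounded1 order_trans)
  with that[of "min \<delta>1 \<delta>2"] d1 d2 show ?thesis by (simp add: dist_real_def)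
qed

text \<open>Comparing the singular coefficients in \<open>t\<close> of the Taylor coefficients at \<open>z = t \<theta>\<close>: since
  \<open>\<psi>\<^bsub>2r-1\<^esub>\<close> is the first odd coefficient, only terms of top degree \<open>p\<close> survive
  after averaging over \<open>\<plusminus>\<theta>\<close>.\<close>

lemma null_form_imp_unit:
  fixes x :: "'i \<Rightarrow> real ^ 'd" and \<theta> :: "real ^ 'd"
  assumes J: "finite J" and p: "p \<le> r - 1"
    and q: "\<And>l. l \<le> p \<Longrightarrow> annihilates J x l (q l)"
    and null: "(\<Sum>l\<le>p. \<Sum>m\<le>p. kernel_form \<Psi> J x (l + m) (q l) (q m)) = 0"
    and \<theta>: "norm \<theta> = 1"
  shows "(\<Sum>m\<le>p. \<Sum>k\<le>m. if m + k = p then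
      real (m choose k) / fact m * (\<Prod>i<m. real (2 * r - 1) / 2 - real i) * 2 ^ (m - k) *
        (\<Sum>a\<in>J. q p a * (inner (x a) \<theta> ^ (m - k) * norm (x a) ^ (2 * k)))
    else 0) = 0"
proof -
  define M where "M \<theta> m k = (\<Sum>a\<in>J. q (m +
      k) a * (((-2) * inner (x a) \<theta>) ^ (m - k) * norm (x a) ^ (2 * k)))" for \<theta> m k
  define c where "c m k = real (m choose k) / fact m" for m k :: nat
  define ff where "ff m s = (\<Prod>i<m. real s / 2 - real i)" for m s :: nat
  \<comment> \<open>The coefficient of t^(2r-1+p) in the series \<open>?F\<close> below. A term of
    degree m + k involves the coefficient of \<Psi> with index 2r - 1 - (p - (m + k)), so the terms
    of degree p involve index 2r - 1.\<close>
  define X where "X \<theta> = (\<Sum>m\<le>p. \<Sum>k\<le>m. if m + k \<le> p then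
      c m k * M \<theta> m k * (ff m (2 * r - 1 - (p - (m + k))) * fps_nth \<Psi> (2 * r - 1 - (p - (m + k)))) else 0)" for \<theta>
  have X0: "X \<theta> = 0" if \<theta>: "norm \<theta> = 1" for \<theta>
  proof -
    obtain \<delta> where \<delta>: "\<delta> > 0" "ereal \<delta> \<le> fps_conv_radius \<Psi>" "\<And>t. \<bar>t\<bar> < \<delta> \<Longrightarrow> eval_fps \<Psi> t = \<psi> t"
      using expansion_radius by blast
    let ?L = "\<lambda>t. \<Sum>m\<le>p. \<Sum>k\<le>m. if m + k \<le> p then c m k * M \<theta> m k * (t ^ (2 * p - (m +
        k)) * eval_fps (radial_fps \<Psi> m) t) else 0"
    let ?F = "\<Sum>m\<le>p. \<Sum>k\<le>m. if m + k \<le> p then fps_const (c m k * M \<theta> m k) * (fps_X ^ (2 * p - (m +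
        k)) * radial_fps \<Psi> m) else 0"
    have "?L has_fps_expansion ?F"
    proof (intro has_fps_expansion_sum)
      fix m k :: nat
      have "eval_fps (radial_fps \<Psi> m) has_fps_expansion radial_fps \<Psi> m"
        using expansion conv_radius_radial[of \<Psi> m]
        by (intro eval_fps_has_fps_expansion) (auto simp: has_fps_expansion_def intro: less_le_trans)
      hence "(\<lambda>t. c m k * M \<theta> m k * (t ^ (2 * p - (m +
          k)) * eval_fps (radial_fps \<Psi> m) t)) has_fps_expansion
        fps_const (c m k * M \<theta> m k) * (fps_X ^ (2 * p - (m + k)) * radial_fps \<Psi> m)"
        by (intro fps_expansion_intros)
      thus "(\<lambda>t. if m + k \<le> p then c m k * M \<theta> m k * (t ^ (2 * p - (m +
          k)) * eval_fps (radial_fps \<Psi> m) t) else 0)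
         has_fps_expansion (if m + k \<le> p then fps_const (c m k * M \<theta> m k) * (fps_X ^ (2 * p - (m + k)) * radial_fps \<Psi> m) else 0)"
        by simp
    qed
    moreover have "\<forall>\<^sub>F t in at_right 0. ?L t = 0"
    proof -
      have "\<forall>\<^sub>F t in at_right 0. t < \<delta>" using \<delta>(1)
        by (simp add: eventually_at_right_less order_tendstoD(2)[OF tendsto_ident_at])
      with eventually_at_right_less[of 0] show ?thesis
      proof eventually_elim
        case (elim t)
        have n: "norm (t *\<^sub>R \<theta>) = t" using elim \<theta> by simp
        have "\<theta> \<noteq> 0" using \<theta> by force
        \<comment> \<open>The inner products contribute t^(m-k) and \<open>radial\<close>
          contributes 1/t^(2m), together t to the power -(m+k) with m + k <= p. The factor t^(2p)
          makes every exponent nonnegative.\<close>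
        have "0 = t ^ (2 * p) * (\<Sum>l\<le>p. \<Sum>a\<in>J. q l a * taylor_coeff \<Psi> p (t *\<^sub>R \<theta>) l (x a))"
          using null_form_imp_taylor[OF J p q null \<delta>(2,3), of "t *\<^sub>R \<theta>"] elim \<theta> n \<open>\<theta> \<noteq> 0\<close> by auto
        also have "\<dots> = t ^ (2 * p) * (\<Sum>l\<le>p. \<Sum>m\<le>p. \<Sum>k\<le>m. if m + k = l then
           c m k * radial \<Psi> m (t\<^sup>2) * t ^ (m - k) * M \<theta> m k else 0)"
        proof -
          have "(\<Sum>a\<in>J. q l a * taylor_coeff \<Psi> p (t *\<^sub>R \<theta>) l (x a)) = (\<Sum>m\<le>p. \<Sum>k\<le>m. if m + k = l then
             c m k * radial \<Psi> m (t\<^sup>2) * t ^ (m - k) * M \<theta> m k else 0)" for l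
          proof -
            have "(\<Sum>a\<in>J. q l a * taylor_coeff \<Psi> p (t *\<^sub>R \<theta>) l (x a)) =
              (\<Sum>m\<le>p. \<Sum>k\<le>m. \<Sum>a\<in>J. q l a * (if m + k = l then radial \<Psi> m (t\<^sup>2) / fact m * real (m choose k) *
                 ((-2) * inner (x a) (t *\<^sub>R \<theta>)) ^ (m - k) * norm (x a) ^ (2 * k) else 0))"
              unfolding taylor_coeff_def n sum_distrib_left
                by (subst sum.swap, rule sum.cong[OF refl], rule sum.swap)
            also have "\<dots> = (\<Sum>m\<le>p. \<Sum>k\<le>m. if m + k =
                l then c m k * radial \<Psi> m (t\<^sup>2) * t ^ (m - k) * M \<theta> m k else 0)"
            proof (intro sum.cong refl)
              fix m k
              have pw: "((-2) * inner (x a) (t *\<^sub>R \<theta>)) ^ (m - k) =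
                  t ^ (m - k) * ((-2) * inner (x a) \<theta>) ^ (m - k)" for a
                unfolding power_mult_distrib[symmetric] by (simp add: mult_ac)
              show "(\<Sum>a\<in>J. q l a * (if m + k = l then radial \<Psi> m (t\<^sup>2) / fact m * real (m choose k) *
                 ((-2) * inner (x a) (t *\<^sub>R \<theta>)) ^ (m - k) * norm (x a) ^ (2 * k) else 0)) =
                 (if m + k = l then c m k * radial \<Psi> m (t\<^sup>2) * t ^ (m - k) * M \<theta> m k else 0)"
                unfolding pw by (auto simp: M_def c_def sum_distrib_left mult_ac)
            qed
            finally show ?thesis .
          qed
          thus ?thesis by simp
        qed
        also have "\<dots> = t ^ (2 * p) * (\<Sum>m\<le>p. \<Sum>k\<le>m. \<Sum>l\<le>p. if m + k = l then
           c m k * radial \<Psi> m (t\<^sup>2) * t ^ (m - k) * M \<theta> m k else 0)"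
          by (subst sum.swap, rule arg_cong[where f = "(*) (t ^ (2 * p))"], rule sum.cong[OF refl], rule sum.swap)
        also have "\<dots> = ?L t"
        proof (subst sum_distrib_left, rule sum.cong[OF refl], subst sum_distrib_left, rule sum.cong[OF refl])
          fix m k assume mk: "m \<in> {..p}" "k \<in> {..m}"
          have E: "t ^ (2 * p) * t ^ (m - k) = t ^ (2 * p - (m + k)) * t ^ (2 * m)" if "m + k \<le> p"
            unfolding power_add[symmetric] using mk that
              by (intro arg_cong[where f = "\<lambda>n. t ^ n"]) auto
          have R: "radial \<Psi> m (t\<^sup>2) = eval_fps (radial_fps \<Psi> m) t / t ^ (2 * m)"
            using elim by (simp add: radial_def power_mult)
          have "t ^ (2 * p) * (c m k * radial \<Psi> m (t\<^sup>2) * t ^ (m - k) * M \<theta> m k) =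
              c m k * M \<theta> m k * (t ^ (2 * p - (m + k)) * eval_fps (radial_fps \<Psi> m) t)" if "m + k \<le> p"
          proof -
            have "t ^ (2 * p) * (c m k * radial \<Psi> m (t\<^sup>2) * t ^ (m - k) * M \<theta> m k) =
              (t ^ (2 * p) * t ^ (m - k)) * (c m k * eval_fps (radial_fps \<Psi> m) t * M \<theta> m k) / t ^ (2 * m)"
              unfolding R by (simp add: mult_ac)
            thus ?thesis unfolding E[OF that] using elim by simp
          qed
          thus "t ^ (2 * p) * (\<Sum>l\<le>p. if m + k =
              l then c m k * radial \<Psi> m (t\<^sup>2) * t ^ (m - k) * M \<theta> m k else 0)
             = (if m + k \<le> p then c m k * M \<theta> m k * (t ^ (2 * p - (m + k)) * eval_fps (radial_fps \<Psi> m) t) else 0)"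
            by simp
        qed
        finally show ?case by simp
      qed
    qed
    ultimately have "?F = 0" by (rule fps_expansion_eq_0_at_right)
    hence "0 = fps_nth ?F (2 * r - 1 + p)" by simp
    also have "\<dots> = X \<theta>" unfolding X_def fps_sum_nth
    proof (intro sum.cong refl)
      fix m k :: nat
      have "2 * r - 1 + p - (2 * p - (m + k)) = 2 * r - 1 - (p - (m + k))" if "m + k \<le> p"
        using that p r_pos by linarith
      moreover have "\<not> 2 * r - 1 + p < 2 * p - (m + k)" using p r_pos by linarith
      ultimately show "fps_nth (if m + k \<le> p then fps_const (c m k * M \<theta> m k) * (fps_X ^ (2 * p - (m +
          k)) * radial_fps \<Psi> m) else 0) (2 * r - 1 + p)
        = (if m + k \<le> p then c m k * M \<theta> m k * (ff m (2 * r - 1 - (p - (m + k))) * fps_nth \<Psi> (2 * r - 1 - (p - (m + k)))) else 0)"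
        by (simp add: fps_X_power_mult_nth radial_fps_nth ff_def)
    qed
    finally show ?thesis ..
  qed
  have Mm: "M (-\<theta>) m k = (-1) ^ (m + k) * M \<theta> m k" if "k \<le> m" for m k
  proof -
    have "(- 2 * inner (x a) (- \<theta>)) ^ (m - k) = (-1) ^ (m + k) * (- 2 * inner (x a) \<theta>) ^ (m - k)"
      for a
    proof -
      have "(- 2 * inner (x a) (- \<theta>)) ^ (m - k) = (-1) ^ (m - k) * (- 2 * inner (x a) \<theta>) ^ (m - k)"
        unfolding power_mult_distrib[symmetric] by simp
      moreover have "(-1::real) ^ (m - k) = (-1) ^ (m + k)" using that
        by (simp add: minus_one_power_iff)
      ultimately show ?thesis by simp
    qed
    thus ?thesis by (simp add: M_def sum_distrib_left mult_ac)
  qed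
  \<comment> \<open>Under \<theta> -> -\<theta> the moments change by (-1)^(m+k). Terms with p - (m
    + k) odd therefore cancel; those with p - (m + k) even and positive carry an odd coefficient of
    \<Psi> below 2r - 1, which is 0; those with m + k = p double.\<close>
  have "0 = X \<theta> + (-1) ^ p * X (-\<theta>)" using X0[of \<theta>] X0[of "-\<theta>"] \<theta> by simp
  also have "\<dots> = (\<Sum>m\<le>p. \<Sum>k\<le>m. if m + k =
      p then 2 * (c m k * M \<theta> m k * (ff m (2 * r - 1) * fps_nth \<Psi> (2 * r - 1))) else 0)"
    unfolding X_def sum_distrib_left sum.distrib[symmetric]
  proof (intro sum.cong refl)
    fix m k assume mk: "m \<in> {..p}" "k \<in> {..m}"
    consider "m + k > p" | "m + k = p" | "m + k < p" "odd (p - (m + k))" | "m + k < p" "even (p - (m +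
        k))" by linarith
    thus "(if m + k \<le> p then c m k * M \<theta> m k * (ff m (2 * r - 1 - (p - (m +
        k))) * fps_nth \<Psi> (2 * r - 1 - (p - (m + k)))) else 0) +
      (- 1) ^ p * (if m + k \<le> p then c m k * M (- \<theta>) m k * (ff m (2 * r - 1 - (p - (m + k))) * fps_nth \<Psi> (2 * r - 1 - (p - (m + k)))) else 0)
      = (if m + k = p then 2 * (c m k * M \<theta> m k * (ff m (2 * r - 1) * fps_nth \<Psi> (2 * r - 1))) else 0)"
    proof cases
      case 2
      have "(-1) ^ p * M (- \<theta>) m k = M \<theta> m k" using Mm[of k m] mk 2
        by (simp flip: power_add mult.assoc)
      then show ?thesis using 2 by (simp add: mult.left_commute[of "(-1) ^ p"] mult.commute[of "M (- \<theta>) m k" "(-1) ^ p"])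
    next
      case 3
      have opk: "odd (p + (m + k))" using 3 by presburger
      have "(-1) ^ p * M (- \<theta>) m k = (-1) ^ (p + (m + k)) * M \<theta> m k" using Mm[of k m] mk
        by (simp flip: power_add mult.assoc)
      also have "(-1) ^ (p + (m + k)) * M \<theta> m k = - M \<theta> m k" using opk by simp
      finally have e: "(-1) ^ p * M (- \<theta>) m k = - M \<theta> m k" .
      have "(-1) ^ p * (c m k * M (- \<theta>) m k * Z) = c m k * ((-1) ^ p * M (- \<theta>) m k) * Z" for Z
        by (simp only: mult_ac)
      then show ?thesis using 3 unfolding e by simp
    next
      case 4
      have "odd (2 * r - 1 - (p - (m + k)))" "2 * r - 1 - (p - (m + k)) < 2 * r - 1" using 4 r_pos p
        by auto
      hence "fps_nth \<Psi> (2 * r - 1 - (p - (m + k))) = 0" by (rule odd_coeff_eq_0)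
      then show ?thesis using 4 by simp
    qed simp
  qed
  also have "\<dots> = (2 * (-1) ^ p * fps_nth \<Psi> (2 * r - 1)) * (\<Sum>m\<le>p. \<Sum>k\<le>m. if m + k = p then
      real (m choose k) / fact m * (\<Prod>i<m. real (2 * r - 1) / 2 - real i) * 2 ^ (m - k) *
        (\<Sum>a\<in>J. q p a * (inner (x a) \<theta> ^ (m - k) * norm (x a) ^ (2 * k)))
    else 0)"
    unfolding sum_distrib_left[of "2 * _ * _"]
  proof (intro sum.cong refl)
    fix m k assume mk: "m \<in> {..p}" "k \<in> {..m}"
    have "M \<theta> m k =
        (-1) ^ p * 2 ^ (m - k) * (\<Sum>a\<in>J. q p a * (inner (x a) \<theta> ^ (m - k) * norm (x a) ^ (2 * k)))" if "m + k = p"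
    proof -
      have "(-1::real) ^ (m - k) = (-1) ^ p" using mk that by (auto simp: minus_one_power_iff)
      moreover have "((-2) * inner (x a) \<theta>) ^ (m - k) =
          (-1) ^ (m - k) * 2 ^ (m - k) * inner (x a) \<theta> ^ (m - k)" for a
        unfolding power_mult_distrib[symmetric] by simp
      ultimately show ?thesis unfolding M_def that by (simp add: sum_distrib_left mult_ac)
    qed
    thus "(if m + k =
        p then 2 * (c m k * M \<theta> m k * (ff m (2 * r - 1) * fps_nth \<Psi> (2 * r - 1))) else 0) =
      2 * (-1) ^ p * fps_nth \<Psi> (2 * r - 1) * (if m + k = p then
      real (m choose k) / fact m * (\<Prod>i<m. real (2 * r - 1) / 2 - real i) * 2 ^ (m - k) *
        (\<Sum>a\<in>J. q p a * (inner (x a) \<theta> ^ (m - k) * norm (x a) ^ (2 * k))) else 0)"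
      by (simp add: c_def ff_def)
  qed
  finally show ?thesis using lead_nonzero by simp
qed

text \<open>The identity for unit vectors extends by homogeneity to all \<theta>. Inserting the data
  points for \<theta> turns it into a vanishing sum of nonnegative Gram forms with positive factors,
  and the one with exponent p controls all moments of degree p.\<close>

lemma null_form_imp_annihilates:
  fixes x :: "'i \<Rightarrow> real ^ 'd"
  assumes J: "finite J" and p: "p \<le> r - 1"
    and q: "\<And>l. l \<le> p \<Longrightarrow> annihilates J x l (q l)"
    and null: "(\<Sum>l\<le>p. \<Sum>m\<le>p. kernel_form \<Psi> J x (l + m) (q l) (q m)) = 0"
  shows "annihilates J x (Suc p) (q p)"
proof -
  define w where "w m k =
      real (m choose k) / fact m * (\<Prod>i<m. real (2 * r - 1) / 2 - real i) * 2 ^ (m - k)" for m k :: nat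
  \<comment> \<open>The product runs over i < m <= p <= r - 1, so every factor (2r-1)/2 - i is
    positive. The bound p <= r - 1 enters here.\<close>
  have w: "w m k > 0" if "m \<le> p" "k \<le> m" for m k
    unfolding w_def using that p r_pos by (intro mult_pos_pos divide_pos_pos prod_pos) (auto simp: field_simps)
  have all: "(\<Sum>m\<le>p. \<Sum>k\<le>m. if m + k = p then w m k *
        (\<Sum>a\<in>J. q p a * (inner (x a) \<theta> ^ (m - k) * norm (x a) ^ (2 * k) * norm \<theta> ^ (2 * k))) else 0) = 0" for \<theta> :: "real ^ 'd"
  proof -
    obtain \<theta>' s where th: "\<theta> = s *\<^sub>R \<theta>'" "norm \<theta>' = 1"
    proof (cases "\<theta> = 0")
      case True
      show ?thesis by (rule that[of 0 "axis undefined 1"]) (use True in auto)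
    next
      case False
      show ?thesis by (rule that[of "norm \<theta>" "\<theta> /\<^sub>R norm \<theta>"]) (use False in auto)
    qed
    have "(\<Sum>m\<le>p. \<Sum>k\<le>m. if m + k = p then w m k *
        (\<Sum>a\<in>J. q p a * (inner (x a) \<theta> ^ (m - k) * norm (x a) ^ (2 * k) * norm \<theta> ^ (2 * k))) else 0) =
       s ^ p * (\<Sum>m\<le>p. \<Sum>k\<le>m. if m + k = p then w m k *
        (\<Sum>a\<in>J. q p a * (inner (x a) \<theta>' ^ (m - k) * norm (x a) ^ (2 * k))) else 0)"
      unfolding sum_distrib_left[of "s ^ p"]
    proof (intro sum.cong refl)
      fix m k assume mk: "m \<in> {..p}" "k \<in> {..m}"
      have e: "inner (x a) \<theta> ^ (m - k) * norm (x a) ^ (2 * k) * norm \<theta> ^ (2 * k) =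
          s ^ p * (inner (x a) \<theta>' ^ (m - k) * norm (x a) ^ (2 * k))" if "m + k = p" for a
      proof -
        have "s ^ p = s ^ (m - k) * s ^ (2 * k)" using mk that
          by (auto simp: add.commute simp flip: power_add)
        thus ?thesis by (simp add: th power_mult_distrib power_even_abs)
      qed
      have "(\<Sum>a\<in>J. q p a * (inner (x a) \<theta> ^ (m - k) * norm (x a) ^ (2 * k) * norm \<theta> ^ (2 * k))) =
         s ^ p * (\<Sum>a\<in>J. q p a * (inner (x a) \<theta>' ^ (m - k) * norm (x a) ^ (2 * k)))" if "m + k = p"
        unfolding e[OF that] sum_distrib_left[of "s ^ p"]
          by (rule sum.cong[OF refl]) (rule mult.left_commute)
      thus "(if m + k =
          p then w m k * (\<Sum>a\<in>J. q p a * (inner (x a) \<theta> ^ (m - k) * norm (x a) ^ (2 * k) * norm \<theta> ^ (2 * k))) else 0) =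
        s ^ p * (if m + k = p then w m k * (\<Sum>a\<in>J. q p a * (inner (x a) \<theta>' ^ (m - k) * norm (x a) ^ (2 * k))) else 0)"
        by simp
    qed
    also have "\<dots> = 0"
      using null_form_imp_unit[OF J p q null th(2)] unfolding w_def by simp
    finally show ?thesis .
  qed
  let ?G = "\<lambda>m k. \<Sum>a\<in>J. \<Sum>b\<in>J. (q p a * norm (x a) ^ (2 * k)) * (q p b * norm (x b) ^ (2 * k)) * inner (x a) (x b) ^ (m - k)"
  \<comment> \<open>The identity is taken at \<theta> = x_b, weighted by q_p(b) and summed over
    b.\<close>
  have "0 = (\<Sum>b\<in>J. q p b * (\<Sum>m\<le>p. \<Sum>k\<le>m. if m + k = p then w m k *
        (\<Sum>a\<in>J. q p a * (inner (x a) (x b) ^ (m - k) * norm (x a) ^ (2 * k) * norm (x b) ^ (2 * k))) else 0))"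
    by (simp only: all) simp
  also have "\<dots> = (\<Sum>m\<le>p. \<Sum>k\<le>m. \<Sum>b\<in>J. q p b * (if m + k = p then w m k *
        (\<Sum>a\<in>J. q p a * (inner (x a) (x b) ^ (m - k) * norm (x a) ^ (2 * k) * norm (x b) ^ (2 * k))) else 0))"
    unfolding sum_distrib_left[of "q p _"]
      by (subst sum.swap, rule sum.cong[OF refl], rule sum.swap)
  also have "\<dots> = (\<Sum>m\<le>p. \<Sum>k\<le>m. if m + k = p then w m k * ?G m k else 0)"
  proof (intro sum.cong refl)
    fix m k :: nat
    have "(\<Sum>b\<in>J. q p b * (w m k * (\<Sum>a\<in>J. q p a * (inner (x a) (x b) ^ (m - k) * norm (x a) ^ (2 * k) * norm (x b) ^ (2 * k))))) = w m k * ?G m k"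
      unfolding sum_distrib_left by (subst sum.swap) (intro sum.cong refl, simp add: mult_ac)
    thus "(\<Sum>b\<in>J. q p b * (if m + k = p then w m k *
        (\<Sum>a\<in>J. q p a * (inner (x a) (x b) ^ (m - k) * norm (x a) ^ (2 * k) * norm (x b) ^ (2 * k))) else 0)) =
        (if m + k = p then w m k * ?G m k else 0)" by simp
  qed
  finally have sum0: "(\<Sum>m\<le>p. \<Sum>k\<le>m. if m + k = p then w m k * ?G m k else 0) = 0" ..
  have nn: "(if m + k = p then w m k * ?G m k else 0) \<ge> 0" if "m \<in> {..p}" "k \<in> {..m}" for m k
    using w[of m k] that by (auto intro!: mult_nonneg_nonneg gram_power_nonneg)
  have "\<forall>m\<in>{..p}. (\<Sum>k\<le>m. if m + k = p then w m k * ?G m k else 0) = 0"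
    using sum0 by (subst (asm) sum_nonneg_eq_0_iff) (auto intro!: sum_nonneg nn)
  hence "(\<Sum>k\<le>p. if p + k = p then w p k * ?G p k else 0) = 0" by (rule bspec) simp
  hence "\<forall>k\<in>{..p}. (if p + k = p then w p k * ?G p k else 0) = 0"
    by (subst (asm) sum_nonneg_eq_0_iff) (auto intro!: mult_nonneg_nonneg gram_power_nonneg less_imp_le[OF w])
  \<comment> \<open>The term m = p, k = 0 carries no powers of the norms and is the Gram form of the
    p-th power for the weights q_p themselves.\<close>
  hence "(if p + 0 = p then w p 0 * ?G p 0 else 0) = 0" by (rule bspec) simp
  hence "?G p 0 = 0" using w[of p 0] by simp
  hence g: "(\<Sum>a\<in>J. \<Sum>b\<in>J. q p a * q p b * inner (x a) (x b) ^ p) = 0" by simp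
  show ?thesis unfolding annihilates_def
  proof (intro allI impI)
    fix \<alpha> :: "'d \<Rightarrow> nat" assume "mdeg \<alpha> < Suc p"
    then consider "mdeg \<alpha> < p" | "mdeg \<alpha> = p" by linarith
    thus "(\<Sum>a\<in>J. q p a * monomial \<alpha> (x a)) = 0"
    proof cases
      case 1
      then show ?thesis using q[of p] by (simp add: annihilates_def)
    next
      case 2
      show ?thesis by (rule gram_power_eq_0[OF g 2])
    qed
  qed
qed

end

subsection \<open>Definiteness of the odd distance power\<close>

text \<open>The sum is k! times the coefficient of X^k in (1 - exp X)^N, a series that starts at
  degree N.\<close>

lemma alternating_binomial_power:
  assumes "k < N"
  shows "(\<Sum>m\<le>N. (-1) ^ m * real (N choose m) * real m ^ k) = 0"
proof -
  have "(1 - fps_exp (1::real)) ^ N = (- fps_exp 1 + 1) ^ N" by simp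
  also have "\<dots> = (\<Sum>m\<le>N. of_nat (N choose m) * (- fps_exp 1) ^ m)"
    by (subst binomial_ring) simp
  also have "\<dots> = (\<Sum>m\<le>N. fps_const ((-1) ^ m * real (N choose m)) * fps_exp (real m))"
  proof (intro sum.cong refl)
    fix m
    have "(-1 :: real fps) ^ m = fps_const ((-1) ^ m)"
      by (metis fps_const_neg fps_const_1_eq_1 fps_const_power)
    thus "of_nat (N choose m) * (- fps_exp 1) ^ m =
        fps_const ((-1) ^ m * real (N choose m)) * fps_exp (real m)"
      unfolding fps_const_mult[symmetric] fps_of_nat
      by (simp add: power_minus[of "fps_exp 1"] fps_exp_power_mult mult_ac)
  qed
  finally have "fps_nth ((1 - fps_exp (1::real)) ^ N) k =
      (\<Sum>m\<le>N. (-1) ^ m * real (N choose m) * (real m ^ k / fact k))"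
    by (simp add: fps_sum_nth)
  moreover have "fps_nth ((1 - fps_exp (1::real)) ^ N) k = 0"
    using startsby_zero_power_prefix[of "1 - fps_exp (1::real)" N] assms by simp
  ultimately have "(\<Sum>m\<le>N. (-1) ^ m * real (N choose m) * real m ^ k) / fact k = 0"
    by (simp add: sum_divide_distrib)
  thus ?thesis by simp
qed

lemma alternating_binomial_poly:
  assumes "degree p < N"
  shows "(\<Sum>m\<le>N. (-1) ^ m * real (N choose m) * poly p (real m)) = 0"
proof -
  have "(\<Sum>m\<le>N. (-1) ^ m * real (N choose m) * poly p (real m)) =
     (\<Sum>k\<le>degree p. poly.coeff p k * (\<Sum>m\<le>N. (-1) ^ m * real (N choose m) * real m ^ k))"
    unfolding poly_altdef sum_distrib_left by (subst sum.swap) (simp add: mult_ac)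
  also have "\<dots> = 0" using assms by (intro sum.neutral) (auto simp: alternating_binomial_power)
  finally show ?thesis .
qed

context radial_kernel
begin

text \<open>A null vector of the semidefinite form is orthogonal to every finite difference of order
  2r placed near x_a0. Divided by h^p with p = 2r - 1, the difference of |x_a - y|^p tends to 0
  where this function is smooth, that is for a different from a0, but the singularity at x_a0 itself
  leaves the constant 2. Hence 2 v(a0) = 0.\<close>

lemma lead_form_definite:
  fixes x :: "'i \<Rightarrow> real ^ 'd"
  assumes J: "finite J" and inj: "inj_on x J" and v: "annihilates J x r v"
    and null: "kernel_form \<Psi> J x (2 * r - 1) v v = 0" and a0: "a0 \<in> J"
  shows "v a0 = 0"
proof -
  define p where "p = 2 * r - 1"
  have p: "odd p" "p < 2 * r" using r_pos by (auto simp: p_def)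
  define \<theta> :: "real ^ 'd" where "\<theta> = axis undefined 1"
  have \<theta>: "norm \<theta> = 1" by (simp add: \<theta>_def)
  \<comment> \<open>The nodes m = 0, ..., 2r are shifted so that m = p falls on x_a0 and only m =
    2r, where c = 1, lies on the positive side.\<close>
  define c where "c m = real m - real p" for m
  define y where "y h m = x a0 + (h * c m) *\<^sub>R \<theta>" for h m
  define w where "w m = (-1) ^ m * real ((2 * r) choose m)" for m :: nat
  have wc: "(\<Sum>m\<le>2*r. w m * c m ^ l) = 0" if "l \<le> p" for l
  proof -
    have "degree ([:- real p, 1:] ^ l) < 2 * r"
      using that p degree_power_le[of "[:- real p, 1:]" l] by simp
    from alternating_binomial_poly[OF this] show ?thesis by (simp add: w_def c_def)
  qed
  have ann: "annihilates {..2*r} (y h) r w" for h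
    unfolding annihilates_def
  proof (intro allI impI)
    fix \<alpha> :: "'d \<Rightarrow> nat" assume \<alpha>: "mdeg \<alpha> < r"
    define P where "P =
        (\<Prod>i\<in>UNIV. [:vec_nth (x a0) i - h * real p * vec_nth \<theta> i, h * vec_nth \<theta> i:] ^ \<alpha> i)"
    have "degree P \<le>
        (\<Sum>i\<in>UNIV. degree ([:vec_nth (x a0) i - h * real p * vec_nth \<theta> i, h * vec_nth \<theta> i:] ^ \<alpha> i))"
      unfolding P_def by (rule degree_prod_sum_le[unfolded o_def]) simp
    also have "\<dots> \<le> (\<Sum>i\<in>UNIV. 1 * \<alpha> i)"
      by (intro sum_mono order_trans[OF degree_power_le] mult_right_mono) auto
    finally have "degree P < 2 * r" using \<alpha> by (simp add: mdeg_def)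
    moreover have "monomial \<alpha> (y h m) = poly P (real m)" for m
      unfolding monomial_def P_def poly_prod y_def c_def
      by (intro prod.cong refl) (simp add: algebra_simps)
    ultimately show "(\<Sum>a\<le>2*r. w a * monomial \<alpha> (y h a)) = 0"
      using alternating_binomial_poly[of P "2 * r"] by (simp add: w_def)
  qed
  \<comment> \<open>Cauchy--Schwarz for the leading form, again through a discriminant. The families
    are joined as a disjoint sum because the node m = p coincides with x_a0.\<close>
  have X: "(\<Sum>a\<in>J. v a * (\<Sum>m\<le>2*r. w m * norm (x a - y h m) ^ p)) = 0" for h
  proof -
    define B where "B = fps_nth \<Psi> p * (\<Sum>a\<in>J. \<Sum>m\<le>2*r. v a * w m * norm (x a - y h m) ^ p)"
    have "B\<^sup>2 \<le> kernel_form \<Psi> J x p v v * kernel_form \<Psi> {..2*r} (y h) p w w"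
    proof (rule nonneg_quadratic_imp_le)
      fix \<tau> :: real
      let ?J = "J <+> {..2*r}" and ?v = "case_sum v (\<lambda>m. \<tau> * w m)" and ?y = "case_sum x (y h)"
      have "annihilates ?J ?y r ?v"
        using v annihilates_cmult[OF ann[of h], of \<tau>] J by (simp add: annihilates_def sum.Plus)
      hence "0 \<le> kernel_form \<Psi> ?J ?y p ?v ?v"
        unfolding p_def using J by (intro kernel_form_lead_nonneg) auto
      also have "\<dots> = kernel_form \<Psi> J x p v v +
          (\<Sum>a\<in>J. \<Sum>m\<le>2*r. v a * (\<tau> * w m) * (fps_nth \<Psi> p * norm (x a - y h m) ^ p))
         + (\<Sum>m\<le>2*r. \<Sum>a\<in>J. (\<tau> * w m) * v a * (fps_nth \<Psi> p * norm (y h m - x a) ^ p))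
         + (\<Sum>m\<le>2*r. \<Sum>m'\<le>2*r. (\<tau> * w m) * (\<tau> * w m') * (fps_nth \<Psi> p * norm (y h m - y h m') ^ p))"
        using J unfolding kernel_form_def by (simp add: sum.Plus sum.distrib)
      also have "(\<Sum>m\<le>2*r. \<Sum>a\<in>J. (\<tau> * w m) * v a * (fps_nth \<Psi> p * norm (y h m - x a) ^ p)) =
         (\<Sum>a\<in>J. \<Sum>m\<le>2*r. v a * (\<tau> * w m) * (fps_nth \<Psi> p * norm (x a - y h m) ^ p))"
        by (subst sum.swap) (simp add: norm_minus_commute mult_ac)
      also have "(\<Sum>a\<in>J. \<Sum>m\<le>2*r. v a * (\<tau> * w m) * (fps_nth \<Psi> p * norm (x a - y h m) ^ p)) = \<tau> * B"
        unfolding B_def sum_distrib_left by (intro sum.cong refl) (simp add: mult_ac)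
      also have "(\<Sum>m\<le>2*r. \<Sum>m'\<le>2*r. (\<tau> * w m) * (\<tau> * w m') * (fps_nth \<Psi> p * norm (y h m - y h m') ^ p)) =
         \<tau>\<^sup>2 * kernel_form \<Psi> {..2*r} (y h) p w w"
        unfolding kernel_form_def sum_distrib_left
          by (intro sum.cong refl) (simp add: mult_ac power2_eq_square)
      finally show "0 \<le> kernel_form \<Psi> J x p v v + 2 * \<tau> * B +
          \<tau>\<^sup>2 * kernel_form \<Psi> {..2*r} (y h) p w w"
        by (simp add: algebra_simps)
    qed
    hence "B = 0" using null by (simp add: p_def)
    hence "(\<Sum>a\<in>J. \<Sum>m\<le>2*r. v a * w m * norm (x a - y h m) ^ p) = 0"
      using lead_nonzero by (simp add: B_def p_def)
    thus ?thesis by (simp add: sum_distrib_left mult.assoc)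
  qed
  have lim: "((\<lambda>h. v a * ((\<Sum>m\<le>2*r. w m * norm (x a - y h m) ^ p) / h ^ p)) \<longlongrightarrow> v a * (if a =
      a0 then 2 else 0)) (at_right 0)"
    if a: "a \<in> J" for a
  proof (intro tendsto_mult_left, cases "a = a0")
    case True
    \<comment> \<open>Since p is odd, |c|^p equals -c^p except at the single positive node. The
      polynomial part is killed by the difference, and the exception contributes twice the last
      weight, which is 1.\<close>
    have "\<bar>c m\<bar> ^ p = - (c m ^ p) + (if m = 2 * r then 2 else 0)" if "m \<le> 2 * r" for m
    proof (cases "m = 2 * r")
      case True
      then show ?thesis using r_pos by (simp add: c_def p_def)
    next
      case False
      hence "c m \<le> 0" using that by (simp add: c_def p_def)
      thus ?thesis using False p by (simp add: power_minus_odd)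
    qed
    hence "(\<Sum>m\<le>2*r. w m * \<bar>c m\<bar> ^ p) = (\<Sum>m\<le>2*r. w m * (- (c m ^ p) + (if m = 2 * r then 2 else 0)))"
      by (intro sum.cong refl) auto
    also have "\<dots> = - (\<Sum>m\<le>2*r. w m * c m ^ p) + (\<Sum>m\<le>2*r. if m = 2 * r then w m * 2 else 0)"
      unfolding sum_negf[symmetric] sum.distrib[symmetric]
      by (intro sum.cong refl) (simp add: algebra_simps)
    also have "\<dots> = 2" using wc[of p] by (simp add: w_def)
    finally have s: "(\<Sum>m\<le>2*r. w m * \<bar>c m\<bar> ^ p) = 2" .
    have "\<forall>\<^sub>F h in at_right 0. (\<Sum>m\<le>2*r. w m * norm (x a - y h m) ^ p) / h ^ p = 2"
      using eventually_at_right_less[of 0]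
    proof eventually_elim
      case (elim h)
      have "norm (x a - y h m) = h * \<bar>c m\<bar>" for m
        using elim \<theta> True by (simp add: y_def abs_mult)
      hence "(\<Sum>m\<le>2*r. w m * norm (x a - y h m) ^ p) = h ^ p * (\<Sum>m\<le>2*r. w m * \<bar>c m\<bar> ^ p)"
        by (simp add: sum_distrib_left power_mult_distrib mult_ac)
      thus ?case using elim s by simp
    qed
    hence "((\<lambda>h. (\<Sum>m\<le>2*r. w m * norm (x a - y h m) ^ p) / h ^ p) \<longlongrightarrow> 2) (at_right 0)"
      by (rule tendsto_eventually)
    with True show "((\<lambda>h. (\<Sum>m\<le>2*r. w m * norm (x a - y h m) ^ p) / h ^ p) \<longlongrightarrow> (if a =
        a0 then 2 else 0)) (at_right 0)"
      by simp
  next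
    case False
    define z where "z = x a - x a0"
    have z: "z \<noteq> 0" using False inj a a0 by (auto simp: z_def inj_on_def)
    \<comment> \<open>The Taylor expansion of the kernel profile is reused for the distance power
      alone, whose series is X^p; the difference of order p + 1 kills the polynomial of degree at
      most p.\<close>
    define E where "E m h = (norm (h *\<^sub>R (c m *\<^sub>R \<theta>) - z) ^ p -
        (\<Sum>l\<le>p. taylor_coeff (fps_X ^ p) p z l (c m *\<^sub>R \<theta>) * h ^ l)) / h ^ p" for m h
    have E: "(E m \<longlongrightarrow> 0) (at_right 0)" for m
      using taylor_at_nonzero[OF z, of "fps_X ^ p" "c m *\<^sub>R \<theta>" p] by (simp add: E_def[abs_def])
    have "\<forall>\<^sub>F h in at_right 0. (\<Sum>m\<le>2*r. w m * E m h) =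
        (\<Sum>m\<le>2*r. w m * norm (x a - y h m) ^ p) / h ^ p"
      using eventually_at_right_less[of 0]
    proof eventually_elim
      case (elim h)
      have n: "norm (x a - y h m) = norm (h *\<^sub>R (c m *\<^sub>R \<theta>) - z)" for m
        unfolding z_def y_def by (subst norm_minus_commute) (simp add: algebra_simps)
      have "(\<Sum>m\<le>2*r. w m * (\<Sum>l\<le>p. taylor_coeff (fps_X ^ p) p z l (c m *\<^sub>R \<theta>) * h ^ l)) =
         (\<Sum>m\<le>2*r. \<Sum>l\<le>p. (taylor_coeff (fps_X ^ p) p z l \<theta> * h ^ l) * (w m * c m ^ l))"
        unfolding sum_distrib_left by (intro sum.cong refl) (simp add: taylor_coeff_scaleR mult_ac)
      also have "\<dots> = (\<Sum>l\<le>p. (taylor_coeff (fps_X ^ p) p z l \<theta> * h ^ l) * (\<Sum>m\<le>2*r. w m * c m ^ l))"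
        unfolding sum_distrib_left by (rule sum.swap)
      also have "\<dots> = 0" by (simp add: wc)
      finally have t: "(\<Sum>m\<le>2*r. w m * (\<Sum>l\<le>p. taylor_coeff (fps_X ^ p) p z l (c m *\<^sub>R \<theta>) * h ^ l)) =
          0" .
      have "(\<Sum>m\<le>2*r. w m * E m h) = ((\<Sum>m\<le>2*r. w m * norm (x a - y h m) ^ p) -
          (\<Sum>m\<le>2*r. w m * (\<Sum>l\<le>p. taylor_coeff (fps_X ^ p) p z l (c m *\<^sub>R \<theta>) * h ^ l))) / h ^ p"
        unfolding E_def n sum_subtractf[symmetric] sum_divide_distrib right_diff_distrib[symmetric]
          by simp
      thus ?case unfolding t by simp
    qed
    moreover have "((\<lambda>h. \<Sum>m\<le>2*r. w m * E m h) \<longlongrightarrow> 0) (at_right 0)"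
      by (intro tendsto_null_sum tendsto_mult_right_zero E)
    ultimately show "((\<lambda>h. (\<Sum>m\<le>2*r. w m * norm (x a - y h m) ^ p) / h ^ p) \<longlongrightarrow> (if a =
        a0 then 2 else 0)) (at_right 0)"
      using False tendsto_cong by fastforce
  qed
  have "((\<lambda>h. \<Sum>a\<in>J. v a * ((\<Sum>m\<le>2*r. w m * norm (x a - y h m) ^ p) / h ^ p)) \<longlongrightarrow>
      (\<Sum>a\<in>J. v a * (if a = a0 then 2 else 0))) (at_right 0)"
    by (intro tendsto_sum lim)
  moreover have "(\<Sum>a\<in>J. v a * ((\<Sum>m\<le>2*r. w m * norm (x a - y h m) ^ p) / h ^ p)) = 0" for h
    using X[of h] by (simp add: sum_divide_distrib[symmetric])
  ultimately have "((\<lambda>h::real. 0::real) \<longlongrightarrow> (\<Sum>a\<in>J. v a * (if a = a0 then 2 else 0))) (at_right 0)"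
    by (simp only:)
  from tendsto_unique[OF _ this tendsto_const]
  have "(\<Sum>a\<in>J. v a * (if a = a0 then 2 else 0)) = 0" by simp
  moreover have "(\<Sum>a\<in>J. v a * (if a = a0 then 2 else 0)) = (\<Sum>a\<in>J. if a = a0 then v a * 2 else 0)"
    by (intro sum.cong refl) simp
  ultimately show ?thesis using J a0 by simp
qed

end

subsection \<open>Orders of the eigenvalues\<close>

text \<open>At the first degree where some summand is nonzero, all coefficients are nonnegative, so
  nothing cancels. The induction over m shows that degrees below N contain no such first
  degree.\<close>

lemma fps_sum_nonneg_eq_0:
  fixes f :: "'i \<Rightarrow> real fps"
  assumes fin: "finite S" and pos: "\<And>i. i \<in> S \<Longrightarrow> f i = 0 \<or> fps_nth (f i) (subdegree (f i)) > 0"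
    and z: "\<And>m. m < N \<Longrightarrow> fps_nth (\<Sum>i\<in>S. f i) m = 0" and i: "i \<in> S"
  shows "m < N \<Longrightarrow> fps_nth (f i) m = 0"
  using i
proof (induction m arbitrary: i rule: less_induct)
  case (less m)
  have nn: "fps_nth (f i) m \<ge> 0" if "i \<in> S" for i
  proof (cases "f i = 0")
    case False
    have "m \<le> subdegree (f i)"
      using less.IH[OF _ _ that] less.prems(1) False
        by (metis leI nth_subdegree_nonzero order.strict_trans)
    then consider "m = subdegree (f i)" | "m < subdegree (f i)" by linarith
    thus ?thesis by cases (use pos[OF that] False in auto)
  qed simp
  have "(\<Sum>i\<in>S. fps_nth (f i) m) = 0" using z[OF less.prems(1)] by (simp add: fps_sum_nth)
  thus ?case using sum_nonneg_eq_0_iff[OF fin, of "\<lambda>i. fps_nth (f i) m"] nn less.prems(2) by simp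
qed

lemma kernel_form_sum_left:
  "kernel_form \<Psi> J x m (\<lambda>a. \<Sum>s\<in>S. c s * v s a) w = (\<Sum>s\<in>S. c s * kernel_form \<Psi> J x m (v s) w)"
proof -
  have "kernel_form \<Psi> J x m (\<lambda>a. \<Sum>s\<in>S. c s * v s a) w =
    (\<Sum>a\<in>J. \<Sum>b\<in>J. \<Sum>s\<in>S. c s * (v s a * w b * (fps_nth \<Psi> m * norm (x a - x b) ^ m)))"
    unfolding kernel_form_def by (intro sum.cong refl) (simp add: sum_distrib_right mult.assoc)
  also have "\<dots> = (\<Sum>s\<in>S. \<Sum>a\<in>J. \<Sum>b\<in>J. c s * (v s a * w b * (fps_nth \<Psi> m * norm (x a - x b) ^ m)))"
    by (rule sum_swap_pair)
  finally show ?thesis by (simp only: kernel_form_def sum_distrib_left)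
qed

lemma kernel_form_sum_right:
  "kernel_form \<Psi> J x m w (\<lambda>a. \<Sum>s\<in>S. c s * v s a) = (\<Sum>s\<in>S. c s * kernel_form \<Psi> J x m w (v s))"
  by (subst (1 2) kernel_form_commute) (rule kernel_form_sum_left)

lemma kernel_form_add_right:
  "kernel_form \<Psi> J x m w (\<lambda>a. v a + v' a) = kernel_form \<Psi> J x m w v + kernel_form \<Psi> J x m w v'"
  unfolding kernel_form_def by (simp add: distrib_left distrib_right sum.distrib)

lemma kernel_form_zero_right:
  assumes "\<And>a. a \<in> J \<Longrightarrow> v a = 0"
  shows "kernel_form \<Psi> J x m w v = 0"
  unfolding kernel_form_def using assms by (intro sum.neutral ballI) auto

lemma kernel_form_cong_right:
  assumes "\<And>a. a \<in> J \<Longrightarrow> v a = v' a"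
  shows "kernel_form \<Psi> J x m w v = kernel_form \<Psi> J x m w v'"
  unfolding kernel_form_def using assms by (intro sum.cong refl) auto

text \<open>The orthonormal vectors \<open>e s\<close> are the columns of \<open>Q\<^sub>0, \<dots>, Q\<^sub>j\<close>, where \<open>dg s\<close> is the index
  of the block, and \<open>E\<close>, \<open>U\<close> are the power series of the eigenvalues and eigenvectors.\<close>

locale kernel_spectrum = radial_kernel \<psi> \<Psi> r k
  for \<psi> :: "real \<Rightarrow> real" and \<Psi> :: "real fps" and r :: nat
    and k :: "real ^ 'd::finite \<Rightarrow> real ^ 'd \<Rightarrow> real" +
  fixes n :: nat and x :: "nat \<Rightarrow> real ^ 'd" and I :: "'e set" and e :: "'e \<Rightarrow> nat \<Rightarrow> real"
    and dg :: "'e \<Rightarrow> nat" and j :: nat and E :: "nat \<Rightarrow> real fps" and U :: "nat \<Rightarrow> nat \<Rightarrow> real fps"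
  assumes inj: "inj_on x {..<n}"
    and j: "j \<le> r - 1" and fin: "finite I" and dg: "\<And>s. s \<in> I \<Longrightarrow> dg s \<le> j"
    and orth: "\<And>s t. s \<in> I \<Longrightarrow> t \<in> I \<Longrightarrow> (\<Sum>a<n. e s a * e t a) = (if s = t then 1 else 0)"
    and ann: "\<And>s. s \<in> I \<Longrightarrow> annihilates {..<n} x (dg s) (e s)"
    and comp: "\<And>i v. i \<le> j \<Longrightarrow> (\<And>s. s \<in> I \<Longrightarrow> dg s \<le> i \<Longrightarrow> (\<Sum>a<n. e s a * v a) = 0) \<Longrightarrow>
       annihilates {..<n} x (Suc i) v"
    and nondeg: "\<And>i c s. annihilates {..<n} x (Suc i) (\<lambda>a. \<Sum>s | s \<in> I \<and> dg s = i. c s * e s a) \<Longrightarrow>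
       s \<in> I \<Longrightarrow> dg s = i \<Longrightarrow> c s = 0"
    and eig: "\<And>l a. l < n \<Longrightarrow> a < n \<Longrightarrow>
       (\<Sum>b<n. Abs_fps (\<lambda>m. fps_nth \<Psi> m * norm (x a - x b) ^ m) * U l b) = E l * U l a"
    and compl: "\<And>a b. a < n \<Longrightarrow> b < n \<Longrightarrow> (\<Sum>l<n. U l a * U l b) = (if a = b then 1 else 0)"
    and orthU: "\<And>l m. l < n \<Longrightarrow> m < n \<Longrightarrow> (\<Sum>a<n. U l a * U m a) = (if l = m then 1 else 0)"
    and E_pos: "\<And>l. l < n \<Longrightarrow> E l \<noteq> 0 \<and> fps_nth (E l) (subdegree (E l)) > 0"
begin

abbreviation "form \<equiv> kernel_form \<Psi> {..<n} x"
abbreviation "ann_upto \<equiv> annihilates {..<n} x"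

definition "u0 l a = fps_nth (U l a) 0"
definition "ord l = subdegree (E l)"
definition "lead l = fps_nth (E l) (ord l)"
definition "lvls p = {s \<in> I. dg s \<le> p}"
definition "lvl p = {s \<in> I. dg s = p}"
definition "coord l s = (\<Sum>a<n. fps_const (e s a) * U l a)"

lemma finite_lvls [simp]: "finite (lvls p)" and finite_lvl [simp]: "finite (lvl p)"
  using fin by (auto simp: lvls_def lvl_def)

lemma coord_nth: "fps_nth (coord l s) q = (\<Sum>a<n. e s a * fps_nth (U l a) q)"
  by (simp add: coord_def fps_sum_nth)

lemma coord_nth_0: "fps_nth (coord l s) 0 = (\<Sum>a<n. e s a * u0 l a)"
  by (simp add: coord_nth u0_def)

lemma u0_orth: "l < n \<Longrightarrow> m < n \<Longrightarrow> (\<Sum>a<n. u0 l a * u0 m a) = (if l = m then 1 else 0)"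
  using arg_cong[OF orthU, of l m "\<lambda>F. fps_nth F 0"]
    by (auto simp: fps_sum_nth u0_def split: if_splits)

lemma u0_compl: "a < n \<Longrightarrow> b < n \<Longrightarrow> (\<Sum>l<n. u0 l a * u0 l b) = (if a = b then 1 else 0)"
  using arg_cong[OF compl, of a b "\<lambda>F. fps_nth F 0"]
    by (auto simp: fps_sum_nth u0_def split: if_splits)

lemma E_nth_below: "q < ord l \<Longrightarrow> fps_nth (E l) q = 0"
  unfolding ord_def by (rule nth_less_subdegree_zero)

lemma lead_pos: "l < n \<Longrightarrow> lead l > 0"
  using E_pos by (simp add: lead_def ord_def)

text \<open>Descent on the top level: nullity makes the component of level p annihilate one more
  degree, nondegeneracy of that level then forces its coefficients to be 0, and the form reduces to
  the lower levels.\<close>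

lemma null_form_imp_0:
  assumes "p \<le> j"
    and "(\<Sum>l\<le>p. \<Sum>m\<le>p. form (l + m) (\<lambda>a. \<Sum>s\<in>lvl l. c s * e s a) (\<lambda>a. \<Sum>s\<in>lvl m. c s * e s a)) = 0"
    and "s \<in> lvls p"
  shows "c s = 0"
  using assms
proof (induction p arbitrary: s)
  case 0
  let ?q = "\<lambda>l a. \<Sum>s\<in>lvl l. c s * e s a"
  have "annihilates {..<n} x (Suc 0) (?q 0)"
    by (rule null_form_imp_annihilates[where q = ?q]) (use 0 in \<open>auto intro: annihilates_0\<close>)
  thus ?case using nondeg[of 0 c s] 0 by (auto simp: lvl_def lvls_def)
next
  case (Suc p)
  let ?q = "\<lambda>l a. \<Sum>s\<in>lvl l. c s * e s a"
  have annq: "ann_upto l (?q l)" for l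
    by (intro annihilates_sum annihilates_cmult) (use ann in \<open>auto simp: lvl_def\<close>)
  have "annihilates {..<n} x (Suc (Suc p)) (?q (Suc p))"
    by (rule null_form_imp_annihilates[where q = ?q], simp) (use Suc.prems(1) j in simp, rule annq, rule Suc.prems(2))
  hence top: "c s = 0" if "s \<in> lvl (Suc p)" for s
    using nondeg[of "Suc p" c s] that by (auto simp: lvl_def)
  hence q0: "?q (Suc p) a = 0" for a by simp
  have "(\<Sum>l\<le>p. \<Sum>m\<le>p. form (l + m) (?q l) (?q m)) = 0"
  proof -
    have "form m (?q l) (?q (Suc p)) = 0" "form m (?q (Suc p)) (?q l) = 0" for l m
      by (rule kernel_form_zero_right[OF q0]) (subst kernel_form_commute, rule kernel_form_zero_right[OF q0])
    thus ?thesis using Suc.prems(2) by simp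
  qed
  from Suc.IH[OF _ this] have "c s = 0" if "s \<in> lvls p" for s using that Suc.prems(1) by simp
  thus ?case using top[of s] Suc.prems(3) by (cases "dg s = Suc p") (auto simp: lvls_def lvl_def)
qed

lemma sum_lvls: "(\<Sum>l\<le>p. \<Sum>s\<in>lvl l. f s) = (\<Sum>s\<in>lvls p. f s)"
proof -
  have "lvl l = {s \<in> lvls p. dg s = l}" if "l \<le> p" for l using that by (auto simp: lvl_def lvls_def)
  hence "(\<Sum>l\<le>p. \<Sum>s\<in>lvl l. f s) = (\<Sum>l\<le>p. \<Sum>s\<in>{s \<in> lvls p. dg s = l}. f s)" by simp
  also have "\<dots> = (\<Sum>s\<in>lvls p. f s)" by (rule sum.group) (auto simp: lvls_def fin)
  finally show ?thesis .
qed

text \<open>Pairing the linear system with c itself gives the null form, so definiteness yields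
  injectivity. In block language this is the invertibility of the leading blocks of
  \<open>H\<close>.\<close>

lemma gram_nondegenerate:
  assumes "p \<le> j"
    and H: "\<And>t. t \<in> lvls p \<Longrightarrow> (\<Sum>s\<in>lvls p. form (dg t + dg s) (e t) (e s) * c s) = 0"
    and s: "s \<in> lvls p"
  shows "c s = 0"
proof (rule null_form_imp_0[OF assms(1) _ s])
  have "(\<Sum>l\<le>p. \<Sum>m\<le>p. form (l + m) (\<lambda>a. \<Sum>s\<in>lvl l. c s * e s a) (\<lambda>a. \<Sum>s\<in>lvl m. c s * e s a)) =
    (\<Sum>l\<le>p. \<Sum>m\<le>p. \<Sum>t\<in>lvl l. \<Sum>s\<in>lvl m. c t * (form (dg t + dg s) (e t) (e s) * c s))"
    unfolding kernel_form_sum_left kernel_form_sum_right sum_distrib_left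
    by (intro sum.cong refl) (simp add: lvl_def)
  also have "\<dots> = (\<Sum>l\<le>p. \<Sum>t\<in>lvl l. \<Sum>m\<le>p. \<Sum>s\<in>lvl m. c t * (form (dg t + dg s) (e t) (e s) * c s))"
    by (rule sum.cong[OF refl]) (rule sum.swap)
  also have "\<dots> = (\<Sum>t\<in>lvls p. c t * (\<Sum>s\<in>lvls p. form (dg t + dg s) (e t) (e s) * c s))"
    unfolding sum_lvls sum_distrib_left ..
  also have "\<dots> = 0" using H by simp
  finally show "(\<Sum>l\<le>p. \<Sum>m\<le>p. form (l + m) (\<lambda>a. \<Sum>s\<in>lvl l. c s * e s a) (\<lambda>a. \<Sum>s\<in>lvl m. c s * e s a)) =
      0" .
qed

section \<open>Coefficients of the eigenvalue equation\<close>

lemma nth_eigen_form: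
  assumes "l < n"
  shows "fps_nth (E l * (\<Sum>a<n. fps_const (v a) * U l a)) N =
      (\<Sum>q\<le>N. form (N - q) v (\<lambda>b. fps_nth (U l b) q))"
proof -
  have "E l * (\<Sum>a<n. fps_const (v a) * U l a) = (\<Sum>a<n. fps_const (v a) * (E l * U l a))"
    by (simp add: sum_distrib_left mult_ac)
  also have "\<dots> =
      (\<Sum>a<n. \<Sum>b<n. fps_const (v a) * (U l b * Abs_fps (\<lambda>m. fps_nth \<Psi> m * norm (x a - x b) ^ m)))"
    using assms by (simp add: eig[symmetric] sum_distrib_left mult_ac)
  finally have E: "E l * (\<Sum>a<n. fps_const (v a) * U l a) =
     (\<Sum>a<n. \<Sum>b<n. fps_const (v a) * (U l b * Abs_fps (\<lambda>m. fps_nth \<Psi> m * norm (x a - x b) ^ m)))" .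
  have "fps_nth (E l * (\<Sum>a<n. fps_const (v a) * U l a)) N =
      (\<Sum>a<n. \<Sum>b<n. \<Sum>q=0..N. v a * (fps_nth (U l b) q * (fps_nth \<Psi> (N - q) * norm (x a - x b) ^ (N - q))))"
  proof -
    have "fps_nth (U l b * Abs_fps (\<lambda>m. fps_nth \<Psi> m * norm (x a - x b) ^ m)) N =
      (\<Sum>q=0..N. fps_nth (U l b) q * (fps_nth \<Psi> (N - q) * norm (x a - x b) ^ (N - q)))" for a b
      by (simp add: fps_mult_nth)
    thus ?thesis unfolding E by (simp add: fps_sum_nth sum_distrib_left)
  qed
  also have "\<dots> =
      (\<Sum>q=0..N. \<Sum>a<n. \<Sum>b<n. v a * (fps_nth (U l b) q * (fps_nth \<Psi> (N - q) * norm (x a - x b) ^ (N - q))))"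
    by (rule sum_swap_pair)
  finally show ?thesis by (simp add: kernel_form_def mult_ac atLeast0AtMost)
qed

text \<open>The part of a Taylor coefficient of the eigenvector orthogonal to the levels up to p. By
  \<open>comp\<close> it annihilates the degrees up to p and so drops out of all forms met
  below.\<close>

definition "rest p l q b = fps_nth (U l b) q - (\<Sum>s\<in>lvls p. fps_nth (coord l s) q * e s b)"

lemma rest_orth:
  assumes "t \<in> lvls p"
  shows "(\<Sum>a<n. e t a * rest p l q a) = 0"
proof -
  have t: "t \<in> I" using assms by (simp add: lvls_def)
  have "(\<Sum>a<n. e t a * (\<Sum>s\<in>lvls p. fps_nth (coord l s) q * e s a)) =
     (\<Sum>s\<in>lvls p. fps_nth (coord l s) q * (\<Sum>a<n. e t a * e s a))"
    unfolding sum_distrib_left by (subst sum.swap) (simp add: mult_ac)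
  also have "\<dots> = (\<Sum>s\<in>lvls p. if s = t then fps_nth (coord l s) q else 0)"
    by (intro sum.cong refl) (auto simp: orth t lvls_def)
  also have "\<dots> = fps_nth (coord l t) q" using assms by simp
  finally show ?thesis
    by (simp add: rest_def right_diff_distrib sum_subtractf coord_nth)
qed

lemma rest_ann: "p \<le> j \<Longrightarrow> ann_upto (Suc p) (rest p l q)"
  by (rule comp) (auto simp: rest_orth lvls_def)

lemma form_split:
  "form m v (\<lambda>b. fps_nth (U l b) q) = (\<Sum>s\<in>lvls p. fps_nth (coord l s) q * form m v (e s)) +
      form m v (rest p l q)"
  unfolding kernel_form_sum_right[symmetric] kernel_form_add_right[symmetric]
  by (simp add: rest_def)

text \<open>In degree dg t + p the coefficient q of the coordinate s meets the form of degree dg t +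
  p - q. That form vanishes when q > p - dg s, and the coordinate vanishes by \<open>van\<close>
  when q < p - dg s, so a single q remains.\<close>

lemma coord_form:
  assumes l: "l < n" and p: "p \<le> j" and t: "t \<in> lvls p"
    and van: "\<And>s q. s \<in> lvls p \<Longrightarrow> q + dg s < p \<Longrightarrow> fps_nth (coord l s) q = 0"
  shows "fps_nth (E l * coord l t) (dg t + p) =
    (\<Sum>s\<in>lvls p. form (dg t + dg s) (e t) (e s) * fps_nth (coord l s) (p - dg s))"
proof -
  have tI: "t \<in> I" "dg t \<le> p" using t by (auto simp: lvls_def)
  have r2: "2 * p \<le> 2 * r - 2" using p j r_pos by linarith
  have "fps_nth (E l * coord l t) (dg t + p) = (\<Sum>q\<le>dg t + p. form (dg t +
      p - q) (e t) (\<lambda>b. fps_nth (U l b) q))"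
    unfolding coord_def by (rule nth_eigen_form[OF l])
  also have "\<dots> = (\<Sum>q\<le>dg t + p. \<Sum>s\<in>lvls p. fps_nth (coord l s) q * form (dg t + p - q) (e t) (e s))"
  proof (intro sum.cong refl)
    fix q
    have "form (dg t + p - q) (e t) (rest p l q) = 0"
      by (rule kernel_form_eq_0[OF regularity ann[OF tI(1)] rest_ann[OF p]]) (use r2 tI in auto)
    thus "form (dg t + p - q) (e t) (\<lambda>b. fps_nth (U l b) q) =
        (\<Sum>s\<in>lvls p. fps_nth (coord l s) q * form (dg t + p - q) (e t) (e s))"
      using form_split[of _ _ l q p] by simp
  qed
  also have "\<dots> = (\<Sum>s\<in>lvls p. \<Sum>q\<le>dg t + p. fps_nth (coord l s) q * form (dg t + p - q) (e t) (e s))"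
    by (rule sum.swap)
  also have "\<dots> = (\<Sum>s\<in>lvls p. form (dg t + dg s) (e t) (e s) * fps_nth (coord l s) (p - dg s))"
  proof (intro sum.cong refl)
    fix s assume s: "s \<in> lvls p"
    hence sI: "s \<in> I" "dg s \<le> p" by (auto simp: lvls_def)
    have "(\<Sum>q\<le>dg t + p. fps_nth (coord l s) q * form (dg t + p - q) (e t) (e s)) =
      (\<Sum>q\<le>dg t + p. if q = p - dg s then fps_nth (coord l s) q * form (dg t + p - q) (e t) (e s) else 0)"
    proof (intro sum.cong refl)
      fix q assume q: "q \<in> {..dg t + p}"
      consider "q + dg s < p" | "q = p - dg s" | "q + dg s > p" by linarith
      thus "fps_nth (coord l s) q * form (dg t + p - q) (e t) (e s) =
         (if q = p - dg s then fps_nth (coord l s) q * form (dg t + p - q) (e t) (e s) else 0)"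
      proof cases
        case 1 thus ?thesis using van[OF s] by simp
      next
        case 3
        have "form (dg t + p - q) (e t) (e s) = 0"
          by (rule kernel_form_eq_0[OF regularity ann[OF tI(1)] ann[OF sI(1)]]) (use 3 r2 tI sI q in auto)
        moreover have "q \<noteq> p - dg s" using 3 sI by auto
        ultimately show ?thesis by simp
      qed simp
    qed
    also have "\<dots> = form (dg t + dg s) (e t) (e s) * fps_nth (coord l s) (p - dg s)" using sI by simp
    finally show "(\<Sum>q\<le>dg t + p. fps_nth (coord l s) q * form (dg t + p - q) (e t) (e s)) =
      form (dg t + dg s) (e t) (e s) * fps_nth (coord l s) (p - dg s)" .
  qed
  finally show ?thesis .
qed

text \<open>An eigenvector whose eigenvalue has order at least 2P - 1 has coordinates
  O(\<epsilon>^(P-m)) along level m. Each step solves a homogeneous system with a nonsingular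
  matrix. The odd threshold lets the statement serve the eigenvalues of order 2r - 1 as well, with P
  = r.\<close>

lemma coord_vanish:
  assumes l: "l < n" and P: "P \<le> Suc j" and o: "2 * P - 1 \<le> ord l"
  shows "s \<in> I \<Longrightarrow> q + dg s < P \<Longrightarrow> fps_nth (coord l s) q = 0"
  using P o
proof (induction P arbitrary: s q)
  case (Suc p)
  have van: "fps_nth (coord l s) q = 0" if "s \<in> I" "q + dg s < p" for s q
    using Suc.IH[of s q] Suc.prems that by simp
  have p: "p \<le> j" using Suc.prems by simp
  have "fps_nth (coord l s) (p - dg s) = 0" if "s \<in> lvls p" for s
  proof (rule gram_nondegenerate[OF p _ that])
    fix t assume t: "t \<in> lvls p"
    \<comment> \<open>Here dg t + p <= 2p, which is less than 2 (p + 1) - 1 and hence below the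
      order of the eigenvalue.\<close>
    have "fps_nth (E l * coord l t) (dg t + p) = 0"
      unfolding fps_mult_nth using t Suc.prems
      by (intro sum.neutral ballI) (auto simp: lvls_def intro!: E_nth_below)
    moreover have "fps_nth (E l * coord l t) (dg t + p) =
      (\<Sum>s\<in>lvls p. form (dg t + dg s) (e t) (e s) * fps_nth (coord l s) (p - dg s))"
      by (rule coord_form[OF l p t]) (auto simp: van lvls_def)
    ultimately show "(\<Sum>s\<in>lvls p. form (dg t + dg s) (e t) (e s) * fps_nth (coord l s) (p - dg s)) =
        0" by simp
  qed
  hence "fps_nth (coord l s) q = 0" if "q = p - dg s" "dg s \<le> p" using that Suc.prems
    by (simp add: lvls_def)
  moreover have "q = p - dg s \<and> dg s \<le> p" if "\<not> q + dg s < p" using that Suc.prems by auto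
  ultimately show ?case using van[of s q] Suc.prems by blast
qed simp

section \<open>Limiting eigenvectors of even order\<close>

lemma kernel_decomposition:
  assumes "a < n" "b < n"
  shows "Abs_fps (\<lambda>m. fps_nth \<Psi> m * norm (x a - x b) ^ m) = (\<Sum>l<n. E l * U l a * U l b)"
proof -
  let ?K = "\<lambda>a b. Abs_fps (\<lambda>m. fps_nth \<Psi> m * norm (x a - x b) ^ m)"
  have "(\<Sum>l<n. E l * U l a * U l b) = (\<Sum>l<n. \<Sum>c<n. ?K a c * U l c * U l b)"
    using assms by (simp add: eig[symmetric] sum_distrib_right)
  also have "\<dots> = (\<Sum>c<n. ?K a c * (\<Sum>l<n. U l c * U l b))"
    by (subst sum.swap) (simp add: sum_distrib_left mult.assoc)
  also have "\<dots> = (\<Sum>c<n. if c = b then ?K a c else 0)"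
    using assms by (intro sum.cong refl) (auto simp: compl)
  finally show ?thesis using assms by simp
qed

text \<open>The series v^T K(\<epsilon>) v is the sum of the products of E_l with the square of v^T
  U_l, all with positive leading coefficients or zero. It vanishes below degree 2i, so every summand
  does; at degree \<open>ord l\<close> this leaves the squared inner product of v and the limiting
  eigenvector.\<close>

lemma ann_imp_u0_orth:
  assumes v: "ann_upto i v" and i: "i \<le> r" and l: "l < n" and o: "ord l < 2 * i" "ord l < 2 * r - 1"
  shows "(\<Sum>a<n. v a * u0 l a) = 0"
proof -
  let ?w = "\<lambda>l. \<Sum>a<n. fps_const (v a) * U l a"
  \<comment> \<open>The forms are controlled only up to degree 2r - 2, which matters when i =
    r.\<close>
  define N where "N = min (2 * i) (2 * r - 1)"
  have tot: "(\<Sum>l<n. E l * (?w l)\<^sup>2) =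
      (\<Sum>a<n. \<Sum>b<n. fps_const (v a * v b) * Abs_fps (\<lambda>m. fps_nth \<Psi> m * norm (x a - x b) ^ m))"
  proof -
    have "(\<Sum>l<n. E l * (?w l)\<^sup>2) = (\<Sum>l<n. \<Sum>a<n. \<Sum>b<n. fps_const (v a * v b) * (E l * U l a * U l b))"
      unfolding power2_eq_square sum_product unfolding sum_distrib_left
      by (intro sum.cong refl) (simp add: mult_ac flip: fps_const_mult)
    also have "\<dots> = (\<Sum>a<n. \<Sum>b<n. \<Sum>l<n. fps_const (v a * v b) * (E l * U l a * U l b))"
      by (rule sum_swap_pair[symmetric])
    finally show ?thesis by (simp add: kernel_decomposition sum_distrib_left)
  qed
  have "fps_nth (E l * (?w l)\<^sup>2) (ord l) = 0"
  proof (rule fps_sum_nonneg_eq_0[where S = "{..<n}" and N = N and f = "\<lambda>l. E l * (?w l)\<^sup>2"])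
    fix m assume l: "m \<in> {..<n}"
    show "E m * (?w m)\<^sup>2 = 0 \<or> fps_nth (E m * (?w m)\<^sup>2) (subdegree (E m * (?w m)\<^sup>2)) > 0"
    proof (cases "?w m = 0")
      case False
      have "fps_nth (E m * (?w m * ?w m)) (subdegree (E m * (?w m * ?w m))) =
          fps_nth (E m) (subdegree (E m)) * (fps_nth (?w m) (subdegree (?w m)) * fps_nth (?w m) (subdegree (?w m)))"
      proof -
        have s1: "subdegree (E m * (?w m * ?w m)) = subdegree (E m) + subdegree (?w m * ?w m)"
          using False E_pos[of m] l by (intro subdegree_mult) auto
        have s2: "subdegree (?w m * ?w m) = subdegree (?w m) + subdegree (?w m)"
          using False by (intro subdegree_mult) auto
        show ?thesis unfolding s1 nth_subdegree_mult unfolding s2 nth_subdegree_mult ..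
      qed
      moreover have "fps_nth (?w m) (subdegree (?w m)) * fps_nth (?w m) (subdegree (?w m)) > 0"
        using nth_subdegree_nonzero[OF False] not_real_square_gt_zero[of "fps_nth (?w m) (subdegree (?w m))"]
        by blast
      ultimately show ?thesis using E_pos[of m] l by (simp add: power2_eq_square)
    qed simp
  next
    fix m assume m: "m < N"
    have "fps_nth (\<Sum>l<n. E l * (?w l)\<^sup>2) m = form m v v"
      unfolding tot kernel_form_def by (simp add: fps_sum_nth)
    also have "\<dots> = 0"
      by (rule kernel_form_eq_0[OF regularity v v]) (use m in \<open>auto simp: N_def\<close>)
    finally show "fps_nth (\<Sum>l<n. E l * (?w l)\<^sup>2) m = 0" .
  qed (use l o in \<open>auto simp: N_def\<close>)
  moreover have "fps_nth (E l * (?w l)\<^sup>2) (ord l) = lead l * (fps_nth (?w l) 0)\<^sup>2"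
  proof -
    have "fps_nth (E l * (?w l)\<^sup>2) (ord l) = (\<Sum>q=0..ord l. if q =
        ord l then fps_nth (E l) q * fps_nth ((?w l)\<^sup>2) (ord l - q) else 0)"
      unfolding fps_mult_nth by (intro sum.cong refl) (auto simp: E_nth_below)
    thus ?thesis by (simp add: lead_def fps_power_zeroth)
  qed
  ultimately have "fps_nth (?w l) 0 = 0" using lead_pos[OF l] by simp
  thus ?thesis by (simp add: fps_sum_nth u0_def)
qed

lemma coord_0_eq_0:
  assumes "l < n" "i \<le> j" "ord l > 2 * i" "s \<in> lvls i"
  shows "(\<Sum>a<n. e s a * u0 l a) = 0"
  using coord_vanish[of l "Suc i" s 0] assms by (simp add: coord_nth_0 lvls_def)

text \<open>The component of the limiting eigenvector orthogonal to the levels up to i annihilates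
  the degrees up to i, so it is orthogonal to the limiting eigenvector by positivity, and to the
  other component by construction. It is thus orthogonal to itself.\<close>

lemma u0_in_span:
  assumes l: "l < n" and i: "i \<le> j" and o: "ord l \<le> 2 * i" and b: "b < n"
  shows "u0 l b = (\<Sum>s\<in>lvls i. (\<Sum>a<n. e s a * u0 l a) * e s b)"
proof -
  let ?v = "rest i l 0"
  have v: "?v a = u0 l a - (\<Sum>s\<in>lvls i. (\<Sum>a<n. e s a * u0 l a) * e s a)" for a
    by (simp add: rest_def u0_def coord_nth)
  have "(\<Sum>a<n. ?v a * u0 l a) = 0"
    by (rule ann_imp_u0_orth[OF rest_ann[OF i]]) (use l o i j r_pos in auto)
  moreover have "(\<Sum>a<n. ?v a * (\<Sum>s\<in>lvls i. (\<Sum>a<n. e s a * u0 l a) * e s a)) = 0"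
  proof -
    have "(\<Sum>a<n. ?v a * (\<Sum>s\<in>lvls i. (\<Sum>a<n. e s a * u0 l a) * e s a)) =
      (\<Sum>s\<in>lvls i. (\<Sum>a<n. e s a * u0 l a) * (\<Sum>a<n. e s a * ?v a))"
      unfolding sum_distrib_left[of "?v _"] by (subst sum.swap) (simp add: sum_distrib_left mult_ac)
    thus ?thesis by (simp add: rest_orth)
  qed
  ultimately have "(\<Sum>a<n. ?v a * ?v a) = 0"
    by (subst (2) v) (simp add: right_diff_distrib sum_subtractf)
  hence "?v b * ?v b = 0" using b by (subst (asm) sum_nonneg_eq_0_iff) auto
  thus ?thesis by (simp add: v)
qed

text \<open>Two different reasons: for larger orders the nonsingular system kills the coordinate,
  for smaller orders the positivity argument does.\<close>

lemma block_coord_eq_0: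
  assumes l: "l < n" and i: "i \<le> j" and o: "ord l \<noteq> 2 * i" and s: "s \<in> lvl i"
  shows "(\<Sum>a<n. e s a * u0 l a) = 0"
proof (cases "ord l > 2 * i")
  case True
  thus ?thesis using coord_0_eq_0[OF l i] s by (simp add: lvls_def lvl_def)
next
  case False
  hence "ord l < 2 * i" using o by simp
  thus ?thesis using s ann_imp_u0_orth[of i "e s" l] ann[of s] l i j r_pos by (auto simp: lvl_def)
qed

lemma block_projection_u0:
  assumes l: "l < n" and i: "i \<le> j" and b: "b < n"
  shows "(\<Sum>s\<in>lvl i. (\<Sum>a<n. e s a * u0 l a) * e s b) = (if ord l = 2 * i then u0 l b else 0)"
proof (cases "ord l = 2 * i")
  case True
  have "(\<Sum>s\<in>lvls i. (\<Sum>a<n. e s a * u0 l a) * e s b) = (\<Sum>s\<in>lvl i. (\<Sum>a<n. e s a * u0 l a) * e s b)"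
  proof (rule sum.mono_neutral_right)
    show "\<forall>s\<in>lvls i - lvl i. (\<Sum>a<n. e s a * u0 l a) * e s b = 0"
    proof
      fix s assume s: "s \<in> lvls i - lvl i"
      hence "s \<in> lvls (i - 1)" "i > 0" by (auto simp: lvls_def lvl_def)
      thus "(\<Sum>a<n. e s a * u0 l a) * e s b = 0"
        using coord_0_eq_0[of l "i - 1" s] l i True by simp
    qed
  qed (auto simp: lvls_def lvl_def fin)
  thus ?thesis using u0_in_span[OF l i _ b] True by simp
next
  case False
  thus ?thesis using block_coord_eq_0[OF l i False] by simp
qed

lemma expand_u0:
  assumes b: "b < n"
  shows "e s b = (\<Sum>l<n. (\<Sum>c<n. e s c * u0 l c) * u0 l b)"
proof -
  have "(\<Sum>l<n. (\<Sum>c<n. e s c * u0 l c) * u0 l b) = (\<Sum>c<n. e s c * (\<Sum>l<n. u0 l c * u0 l b))"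
    unfolding sum_distrib_left sum_distrib_right by (subst sum.swap) (simp add: mult_ac)
  also have "\<dots> = (\<Sum>c<n. if c = b then e s c else 0)"
    using assms by (intro sum.cong refl) (auto simp: u0_compl)
  finally show ?thesis using assms by simp
qed

text \<open>Both sides are the orthogonal projection onto the same space: the left through the
  columns of Q_i, the right through the limiting eigenvectors of order 2i.\<close>

lemma block_projection:
  assumes "i \<le> j" "a < n" "b < n"
  shows "(\<Sum>s\<in>lvl i. e s a * e s b) = (\<Sum>l | l < n \<and> ord l = 2 * i. u0 l a * u0 l b)"
proof -
  have "e s b = (\<Sum>l<n. (\<Sum>c<n. e s c * u0 l c) * u0 l b)" for s
    by (rule expand_u0) (rule assms)
  hence "(\<Sum>s\<in>lvl i. e s a * e s b) = (\<Sum>s\<in>lvl i. \<Sum>l<n. e s a * ((\<Sum>c<n. e s c * u0 l c) * u0 l b))"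
    by (simp add: sum_distrib_left[symmetric])
  also have "\<dots> = (\<Sum>l<n. (\<Sum>s\<in>lvl i. (\<Sum>c<n. e s c * u0 l c) * e s a) * u0 l b)"
    by (subst sum.swap) (simp add: sum_distrib_right sum_distrib_left mult_ac)
  also have "\<dots> = (\<Sum>l<n. if ord l = 2 * i then u0 l a * u0 l b else 0)"
    using assms by (intro sum.cong refl) (simp add: block_projection_u0)
  also have "\<dots> = (\<Sum>l | l < n \<and> ord l = 2 * i. u0 l a * u0 l b)"
    by (subst sum.inter_filter[symmetric]) auto
  finally show ?thesis .
qed

text \<open>The trace of an orthogonal projection is its rank, computed in both orthonormal
  bases.\<close>

lemma card_ord:
  assumes "i \<le> j"
  shows "card {l. l < n \<and> ord l = 2 * i} = card (lvl i)"
proof -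
  have "real (card (lvl i)) = (\<Sum>s\<in>lvl i. \<Sum>a<n. e s a * e s a)"
    by (simp add: lvl_def orth)
  also have "\<dots> = (\<Sum>a<n. \<Sum>l | l < n \<and> ord l = 2 * i. u0 l a * u0 l a)"
    by (subst sum.swap) (simp add: block_projection assms)
  also have "\<dots> = (\<Sum>l | l < n \<and> ord l = 2 * i. \<Sum>a<n. u0 l a * u0 l a)" by (rule sum.swap)
  also have "\<dots> = real (card {l. l < n \<and> ord l = 2 * i})" by (simp add: u0_orth)
  finally show ?thesis by simp
qed

text \<open>The witness uses the coefficient of degree i - m along level m, the first one that
  \<open>coord_vanish\<close> leaves free. On level i this is the limiting eigenvector itself. In
  the rows of lower levels the degree dg t + i is below the order 2i, which explains the zero right
  side.\<close>

lemma block_eigen: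
  assumes l: "l < n" and i: "i \<le> j" and o: "ord l = 2 * i"
  obtains c where "\<And>t. t \<in> lvl i \<Longrightarrow> c t = (\<Sum>a<n. e t a * u0 l a)"
    "\<And>t. t \<in> lvls i \<Longrightarrow> (\<Sum>s\<in>lvls i. form (dg t + dg s) (e t) (e s) * c s)
       = (if t \<in> lvl i then lead l * c t else 0)"
proof (rule that[of "\<lambda>s. fps_nth (coord l s) (i - dg s)"])
  show "fps_nth (coord l t) (i - dg t) = (\<Sum>a<n. e t a * u0 l a)" if "t \<in> lvl i" for t
    using that by (simp add: lvl_def coord_nth_0)
next
  fix t assume t: "t \<in> lvls i"
  have van: "fps_nth (coord l s) q = 0" if "s \<in> lvls i" "q + dg s < i" for s q
    using coord_vanish[OF l, of i s q] that i o by (simp add: lvls_def)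
  have "fps_nth (E l * coord l t) (dg t + i) =
      (if t \<in> lvl i then lead l * fps_nth (coord l t) (i - dg t) else 0)"
  proof (cases "t \<in> lvl i")
    case True
    have "fps_nth (E l * coord l t) (ord l) = (\<Sum>q=0..ord l. if q =
        ord l then fps_nth (E l) q * fps_nth (coord l t) (ord l - q) else 0)"
      unfolding fps_mult_nth by (intro sum.cong refl) (auto simp: E_nth_below)
    thus ?thesis using True o by (simp add: lvl_def lead_def mult_2)
  next
    case False
    hence "dg t + i < ord l" using t o by (auto simp: lvls_def lvl_def)
    thus ?thesis using False by (auto simp: fps_mult_nth intro!: sum.neutral E_nth_below)
  qed
  thus "(\<Sum>s\<in>lvls i. form (dg t + dg s) (e t) (e s) * fps_nth (coord l s) (i - dg s)) =
      (if t \<in> lvl i then lead l * fps_nth (coord l t) (i - dg t) else 0)"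
    using coord_form[OF l i t van] by simp
qed

section \<open>The eigenvalues of order 2r - 1\<close>

lemma lvls_j: "lvls j = I"
  using dg by (auto simp: lvls_def)

text \<open>In degree 2r - 1 the coefficients with q > 0 contribute nothing: the remainder
  annihilates the degrees below r, and along level m either the coordinate vanishes, when q + m < r,
  or the form does, since then 2r - 1 - q < r + m.\<close>

lemma top_eigen:
  assumes l: "l < n" and jr: "j = r - 1" and o: "ord l \<ge> 2 * r - 1" and v: "ann_upto r v"
  shows "fps_nth (E l) (2 * r - 1) * (\<Sum>a<n. v a * u0 l a) = form (2 * r - 1) v (u0 l)"
proof -
  have van: "fps_nth (coord l s) q = 0" if "s \<in> I" "q + dg s < r" for s q
    using coord_vanish[OF l, of r s q] that jr o r_pos by simp
  let ?w = "\<Sum>a<n. fps_const (v a) * U l a"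
  have "fps_nth (E l * ?w) (2 * r - 1) = (\<Sum>q=0..2 * r - 1. if q =
      2 * r - 1 then fps_nth (E l) q * fps_nth ?w (2 * r - 1 - q) else 0)"
    unfolding fps_mult_nth using o by (intro sum.cong refl) (auto simp: E_nth_below)
  hence "fps_nth (E l) (2 * r - 1) * fps_nth ?w 0 = fps_nth (E l * ?w) (2 * r - 1)" by simp
  also have "\<dots> = (\<Sum>q\<le>2 * r - 1. form (2 * r - 1 - q) v (\<lambda>b. fps_nth (U l b) q))"
    by (rule nth_eigen_form[OF l])
  also have "\<dots> = (\<Sum>q\<le>2 * r - 1. if q = 0 then form (2 * r - 1) v (u0 l) else 0)"
  proof (intro sum.cong refl)
    fix q assume q: "q \<in> {..2 * r - 1}"
    show "form (2 * r - 1 - q) v (\<lambda>b. fps_nth (U l b) q) = (if q =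
        0 then form (2 * r - 1) v (u0 l) else 0)"
    proof (cases "q = 0")
      case False
      have "form (2 * r - 1 - q) v (rest j l q) = 0"
        by (rule kernel_form_eq_0[OF regularity v rest_ann[OF order_refl]]) (use False jr r_pos in auto)
      moreover have "fps_nth (coord l s) q * form (2 * r - 1 - q) v (e s) = 0" if s: "s \<in> I" for s
      proof (cases "q + dg s < r")
        case True thus ?thesis using van s by simp
      next
        case ge: False
        have "form (2 * r - 1 - q) v (e s) = 0"
          by (rule kernel_form_eq_0[OF regularity v ann[OF s]]) (use ge False q r_pos in auto)
        thus ?thesis by simp
      qed
      ultimately show ?thesis using False form_split[of _ v l q j] by (simp add: lvls_j)
    qed (simp add: u0_def[abs_def])
  qed
  also have "\<dots> = form (2 * r - 1) v (u0 l)" by simp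
  finally show ?thesis by (simp add: fps_sum_nth u0_def)
qed

lemma top_u0_ann:
  assumes l: "l < n" and jr: "j = r - 1" and o: "ord l \<ge> 2 * r - 1"
  shows "ann_upto r (u0 l)"
proof -
  have "ann_upto (Suc j) (u0 l)"
    by (rule comp) (use coord_0_eq_0[OF l order_refl] o jr r_pos in \<open>auto simp: lvls_def\<close>)
  thus ?thesis using jr r_pos by simp
qed

text \<open>A larger order would make the limiting eigenvector a null vector of the leading form,
  against its definiteness and the normalisation.\<close>

lemma ord_le_top:
  assumes l: "l < n" and jr: "j = r - 1"
  shows "ord l \<le> 2 * r - 1"
proof (rule ccontr)
  assume "\<not> ord l \<le> 2 * r - 1"
  hence o: "ord l > 2 * r - 1" by simp
  have an: "ann_upto r (u0 l)" using top_u0_ann[OF l jr] o by simp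
  have "form (2 * r - 1) (u0 l) (u0 l) = 0"
    using top_eigen[OF l jr _ an] o E_nth_below[OF o] by simp
  hence "u0 l a = 0" if "a < n" for a
    using lead_form_definite[OF _ inj an] that by simp
  hence "(\<Sum>a<n. u0 l a * u0 l a) = 0" by simp
  thus False using u0_orth[OF l l] by simp
qed

lemma low_projection_u0:
  assumes l: "l < n" and jr: "j = r - 1" and b: "b < n"
  shows "(\<Sum>s\<in>I. (\<Sum>a<n. e s a * u0 l a) * e s b) = (if ord l = 2 * r - 1 then 0 else u0 l b)"
proof (cases "ord l = 2 * r - 1")
  case True
  hence o: "ord l > 2 * j" using jr r_pos by simp
  have "(\<Sum>a<n. e s a * u0 l a) = 0" if "s \<in> I" for s
    using coord_0_eq_0[OF l order_refl o] that by (simp add: lvls_j)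
  thus ?thesis using True by simp
next
  case False
  hence "ord l \<le> 2 * j" using ord_le_top[OF l jr] jr by simp
  thus ?thesis using u0_in_span[OF l order_refl _ b] False by (simp add: lvls_j)
qed

lemma top_projection:
  assumes jr: "j = r - 1" and "a < n" "b < n"
  shows "(if a = b then 1 else 0) - (\<Sum>s\<in>I. e s a * e s b) = (\<Sum>l | l < n \<and> ord l =
      2 * r - 1. u0 l a * u0 l b)"
proof -
  have "e s b = (\<Sum>l<n. (\<Sum>c<n. e s c * u0 l c) * u0 l b)" for s
    by (rule expand_u0) (rule assms)
  hence "(\<Sum>s\<in>I. e s a * e s b) = (\<Sum>s\<in>I. \<Sum>l<n. e s a * ((\<Sum>c<n. e s c * u0 l c) * u0 l b))"
    by (simp add: sum_distrib_left[symmetric])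
  also have "\<dots> = (\<Sum>l<n. (\<Sum>s\<in>I. (\<Sum>c<n. e s c * u0 l c) * e s a) * u0 l b)"
    by (subst sum.swap) (simp add: sum_distrib_right sum_distrib_left mult_ac)
  also have "\<dots> = (\<Sum>l<n. if ord l = 2 * r - 1 then 0 else u0 l a * u0 l b)"
    using assms by (intro sum.cong refl) (simp add: low_projection_u0)
  finally have "(if a = b then 1 else 0) - (\<Sum>s\<in>I. e s a * e s b) =
      (\<Sum>l<n. u0 l a * u0 l b) - (\<Sum>l<n. if ord l = 2 * r - 1 then 0 else u0 l a * u0 l b)"
    using assms u0_compl by simp
  also have "\<dots> = (\<Sum>l<n. if ord l = 2 * r - 1 then u0 l a * u0 l b else 0)"
    unfolding sum_subtractf[symmetric] by (intro sum.cong refl) simp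
  also have "\<dots> = (\<Sum>l | l < n \<and> ord l = 2 * r - 1. u0 l a * u0 l b)"
    by (subst sum.inter_filter[symmetric]) auto
  finally show ?thesis .
qed

lemma card_top:
  assumes jr: "j = r - 1"
  shows "card {l. l < n \<and> ord l = 2 * r - 1} = n - card I"
proof -
  have "real (card {l. l < n \<and> ord l = 2 * r - 1}) = (\<Sum>l | l < n \<and> ord l =
      2 * r - 1. \<Sum>a<n. u0 l a * u0 l a)"
    by (simp add: u0_orth)
  also have "\<dots> = (\<Sum>a<n. (if a = a then 1 else 0) - (\<Sum>s\<in>I. e s a * e s a))"
    by (subst sum.swap, rule sum.cong[OF refl], rule top_projection[OF jr, symmetric]) auto
  also have "\<dots> = real n - (\<Sum>s\<in>I. \<Sum>a<n. e s a * e s a)"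
    by (simp add: sum_subtractf) (rule sum.swap)
  also have "\<dots> = real n - real (card I)" by (simp add: orth)
  finally show ?thesis by simp
qed

text \<open>The rows of P annihilate the degrees below r, so \<open>top_eigen\<close> applies to
  them and shows that P diagonalises the distance form in the limiting eigenvectors of order 2r -
  1.\<close>

lemma top_form:
  assumes jr: "j = r - 1" and P: "\<And>a b. P a b = (if a = b then 1 else 0) - (\<Sum>s\<in>I. e s a * e s b)"
    and ab: "a < n" "b < n"
  shows "(\<Sum>c<n. \<Sum>d<n. P a c * (fps_nth \<Psi> (2 * r - 1) * norm (x c - x d) ^ (2 * r - 1)) * P d b)
     = (\<Sum>l | l < n \<and> ord l = 2 * r - 1. lead l * (u0 l a * u0 l b))"
proof -
  have Ps: "P a b = (\<Sum>l | l < n \<and> ord l = 2 * r - 1. u0 l a * u0 l b)" if "a < n" "b < n" for a b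
    using top_projection[OF jr that] P by simp
  have an: "ann_upto r (P a)"
    unfolding annihilates_def
  proof (intro allI impI)
    fix \<alpha> :: "'d \<Rightarrow> nat" assume m: "mdeg \<alpha> < r"
    have "(\<Sum>c<n. P a c * monomial \<alpha> (x c)) = (\<Sum>c<n. \<Sum>l | l < n \<and> ord l =
        2 * r - 1. u0 l a * (u0 l c * monomial \<alpha> (x c)))"
      using ab by (intro sum.cong refl) (simp add: Ps sum_distrib_right mult.assoc)
    also have "\<dots> = (\<Sum>l | l < n \<and> ord l = 2 * r - 1. u0 l a * (\<Sum>c<n. u0 l c * monomial \<alpha> (x c)))"
      by (subst sum.swap) (simp add: sum_distrib_left)
    also have "\<dots> = 0"
      using top_u0_ann[OF _ jr] m by (intro sum.neutral) (auto simp: annihilates_def)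
    finally show "(\<Sum>c<n. P a c * monomial \<alpha> (x c)) = 0" .
  qed
  have "(\<Sum>c<n. \<Sum>d<n. P a c * (fps_nth \<Psi> (2 * r - 1) * norm (x c - x d) ^ (2 * r - 1)) * P d b) =
    form (2 * r - 1) (P a) (\<lambda>d. P d b)"
    by (simp add: kernel_form_def mult_ac)
  also have "\<dots> = form (2 * r - 1) (P a) (\<lambda>d. \<Sum>l | l < n \<and> ord l = 2 * r - 1. u0 l b * u0 l d)"
    by (rule kernel_form_cong_right) (use ab in \<open>simp add: Ps mult.commute\<close>)
  also have "\<dots> = (\<Sum>l | l < n \<and> ord l = 2 * r - 1. u0 l b * form (2 * r - 1) (P a) (u0 l))"
    by (rule kernel_form_sum_right)
  also have "\<dots> = (\<Sum>l | l < n \<and> ord l = 2 * r - 1. lead l * (u0 l a * u0 l b))"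
  proof (intro sum.cong refl)
    fix l assume l: "l \<in> {l. l < n \<and> ord l = 2 * r - 1}"
    have "(\<Sum>c<n. P a c * u0 l c) = (\<Sum>c<n. \<Sum>m | m < n \<and> ord m =
        2 * r - 1. u0 m a * (u0 m c * u0 l c))"
      using ab by (intro sum.cong refl) (simp add: Ps sum_distrib_right mult.assoc)
    also have "\<dots> = (\<Sum>m | m < n \<and> ord m = 2 * r - 1. u0 m a * (\<Sum>c<n. u0 m c * u0 l c))"
      by (subst sum.swap) (simp add: sum_distrib_left)
    also have "\<dots> = (\<Sum>m | m < n \<and> ord m = 2 * r - 1. if m = l then u0 m a else 0)"
      using l by (intro sum.cong refl) (auto simp: u0_orth)
    also have "\<dots> = u0 l a" using l by simp
    finally show "u0 l b * form (2 * r - 1) (P a) (u0 l) = lead l * (u0 l a * u0 l b)"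
      using top_eigen[OF _ jr _ an, of l] l by (simp add: lead_def)
  qed
  finally show ?thesis .
qed

end

subsection \<open>Wronskian matrices\<close>

lemma norm_add_axis: "(norm (w + t *\<^sub>R axis i 1))\<^sup>2 = (norm (w :: real^'d::finite))\<^sup>2 +
    2 * t * vec_nth w i + t\<^sup>2"
  unfolding power2_norm_eq_inner
  by (simp add: inner_add_left inner_add_right inner_axis inner_axis' power2_eq_square algebra_simps)

section \<open>Derivatives of monomials and of radial functions\<close>

definition mdec :: "('d::finite \<Rightarrow> nat) \<Rightarrow> 'd \<Rightarrow> 'd \<Rightarrow> nat" where
  "mdec \<alpha> i = (\<lambda>j. \<alpha> j - munit i j)"

lemma munit_same [simp]: "munit i i = 1"
  by (simp add: munit_def)

lemma munit_mdec: "\<alpha> i > 0 \<Longrightarrow> (\<lambda>j. munit i j + mdec \<alpha> i j) = \<alpha>"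
  by (auto simp: mdec_def munit_def)

lemma mdec_munit: "mdec (\<lambda>j. munit i j + \<alpha> j) i = \<alpha>"
  by (simp add: mdec_def)

lemma mdec_same: "mdec \<alpha> i i = \<alpha> i - 1"
  by (simp add: mdec_def)

lemma mdeg_mdec: "\<alpha> i > 0 \<Longrightarrow> mdeg \<alpha> = Suc (mdeg (mdec \<alpha> i))"
proof -
  assume "\<alpha> i > 0"
  hence "\<alpha> = (\<lambda>j. munit i j + mdec \<alpha> i j)" by (auto simp: mdec_def munit_def)
  thus ?thesis using mdeg_add[of "munit i" "mdec \<alpha> i"] by simp
qed

lemma DERIV_monomial:
  fixes w :: "real ^ 'd::finite"
  shows "((\<lambda>t. monomial \<alpha> (w +
      t *\<^sub>R axis i 1)) has_real_derivative real (\<alpha> i) * monomial (mdec \<alpha> i) w) (at 0)"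
proof -
  define c where "c = (\<Prod>j\<in>UNIV - {i}. vec_nth w j ^ \<alpha> j)"
  have "monomial \<alpha> (w + t *\<^sub>R axis i 1) = (vec_nth w i + t) ^ \<alpha> i * c" for t
    unfolding monomial_def c_def
    by (subst prod.remove[of UNIV i]) (auto simp: axis_def intro!: prod.cong)
  moreover have "monomial (mdec \<alpha> i) w = vec_nth w i ^ (\<alpha> i - 1) * c"
    unfolding monomial_def c_def
    by (subst prod.remove[of UNIV i]) (auto simp: mdec_def munit_def intro!: prod.cong)
  moreover have "((\<lambda>t. (vec_nth w i +
      t) ^ \<alpha> i * c) has_real_derivative real (\<alpha> i) * (vec_nth w i ^ (\<alpha> i - 1) * c)) (at 0)"
    by (auto intro!: derivative_eq_intros)
  ultimately show ?thesis by simp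
qed

text \<open>Functions that are combinations of \<open>w\<^sup>\<alpha> G\<^sub>m(\<parallel>w\<parallel>\<^sup>2)\<close>, where \<open>G\<^sub>m\<close> is the \<open>m\<close>-th derivative of
  \<open>s \<mapsto> \<Phi>(\<surd>s)\<close>; if \<open>\<Phi>\<close> starts at degree \<open>L\<close>, they vanish to order \<open>p\<close> at \<open>0\<close>.\<close>

inductive radial_class :: "real fps \<Rightarrow> nat \<Rightarrow> nat \<Rightarrow> (real ^ 'd::finite \<Rightarrow> real) \<Rightarrow> bool" for \<Phi> L where
  zero: "radial_class \<Phi> L p (\<lambda>_. 0)"
| add: "radial_class \<Phi> L p f \<Longrightarrow> mdeg \<alpha> + L \<ge> 2 * m + p \<Longrightarrow>
    radial_class \<Phi> L p (\<lambda>w. f w + c * (monomial \<alpha> w * radial \<Phi> m ((norm w)\<^sup>2)))"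

lemma radial_class_cmult: "radial_class \<Phi> L p f \<Longrightarrow> radial_class \<Phi> L p (\<lambda>w. a * f w)"
proof (induction rule: radial_class.induct)
  case (add p f \<alpha> m c)
  have "radial_class \<Phi> L p (\<lambda>w. a * f w + (a * c) * (monomial \<alpha> w * radial \<Phi> m ((norm w)\<^sup>2)))"
    by (rule radial_class.add) (use add in auto)
  thus ?case by (simp add: distrib_left mult.assoc)
qed (auto intro: radial_class.zero)

text \<open>Differentiating the monomial lowers its degree by one; differentiating the radial factor
  raises m by one and the degree of the monomial by one. Either way the balance |\<alpha>| + L - 2m
  drops by exactly one.\<close>

lemma radial_class_deriv:
  assumes "radial_class \<Phi> L (Suc p) f"
  shows "\<exists>f'. radial_class \<Phi> L p f' \<and> (\<forall>w. w \<noteq> 0 \<and> ereal (norm w) < fps_conv_radius \<Phi> \<longrightarrow>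
     ((\<lambda>t. f (w + t *\<^sub>R axis i 1)) has_real_derivative f' w) (at 0))"
  using assms
proof (induction "Suc p" f rule: radial_class.induct)
  case zero
  show ?case by (intro exI[of _ "\<lambda>_. 0"]) (auto intro: radial_class.zero)
next
  case (add f \<alpha> m c)
  then obtain f' where f': "radial_class \<Phi> L p f'"
    "\<And>w. w \<noteq> 0 \<Longrightarrow> ereal (norm w) < fps_conv_radius \<Phi> \<Longrightarrow> ((\<lambda>t. f (w +
        t *\<^sub>R axis i 1)) has_real_derivative f' w) (at 0)"
    by blast
  define g where "g w = f' w + c * real (\<alpha> i) * (monomial (mdec \<alpha> i) w * radial \<Phi> m ((norm w)\<^sup>2))
     + 2 * c * (monomial (\<lambda>j. munit i j + \<alpha> j) w * radial \<Phi> (Suc m) ((norm w)\<^sup>2))" for w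
  have "radial_class \<Phi> L p (\<lambda>w. f' w +
      c * real (\<alpha> i) * (monomial (mdec \<alpha> i) w * radial \<Phi> m ((norm w)\<^sup>2)))"
  proof (cases "\<alpha> i = 0")
    case False
    thus ?thesis using add(3) mdeg_mdec[of \<alpha> i] by (intro radial_class.add f') auto
  qed (simp add: f')
  hence "radial_class \<Phi> L p g" unfolding g_def
    by (rule radial_class.add) (use add(3) in \<open>simp add: mdeg_add\<close>)
  moreover have "((\<lambda>t. f (w + t *\<^sub>R axis i 1) + c * (monomial \<alpha> (w +
      t *\<^sub>R axis i 1) * radial \<Phi> m ((norm (w + t *\<^sub>R axis i 1))\<^sup>2)))
      has_real_derivative g w) (at 0)" if w: "w \<noteq> 0" "ereal (norm w) < fps_conv_radius \<Phi>" for w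
  proof -
    have "(radial \<Phi> m has_real_derivative radial \<Phi> (Suc m) ((norm w)\<^sup>2)) (at ((norm w)\<^sup>2))"
      using w by (intro DERIV_radial) auto
    moreover have "((\<lambda>t. (norm w)\<^sup>2 + 2 * t * vec_nth w i +
        t\<^sup>2) has_real_derivative 2 * vec_nth w i) (at 0)"
      by (auto intro!: derivative_eq_intros)
    ultimately have "((\<lambda>t. radial \<Phi> m ((norm w)\<^sup>2 + 2 * t * vec_nth w i + t\<^sup>2)) has_real_derivative
        radial \<Phi> (Suc m) ((norm w)\<^sup>2) * (2 * vec_nth w i)) (at 0)"
      using DERIV_chain2[of "radial \<Phi> m" _ "\<lambda>t. (norm w)\<^sup>2 + 2 * t * vec_nth w i + t\<^sup>2" 0] by simp
    hence d: "((\<lambda>t. radial \<Phi> m ((norm (w + t *\<^sub>R axis i 1))\<^sup>2)) has_real_derivative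
        radial \<Phi> (Suc m) ((norm w)\<^sup>2) * (2 * vec_nth w i)) (at 0)"
      unfolding norm_add_axis .
    have "((\<lambda>t. f (w + t *\<^sub>R axis i 1) + c * (monomial \<alpha> (w + t *\<^sub>R axis i 1) * radial \<Phi> m ((norm (w +
        t *\<^sub>R axis i 1))\<^sup>2)))
      has_real_derivative f' w + c * (real (\<alpha> i) * monomial (mdec \<alpha> i) w * radial \<Phi> m ((norm (w + 0 *\<^sub>R axis i 1))\<^sup>2) +
        radial \<Phi> (Suc m) ((norm w)\<^sup>2) * (2 * vec_nth w i) * monomial \<alpha> (w + 0 *\<^sub>R axis i 1))) (at 0)"
      by (intro DERIV_add DERIV_cmult DERIV_mult f'(2)[OF w] d DERIV_monomial)
    thus ?thesis by (simp add: g_def monomial_add algebra_simps)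
  qed
  ultimately show ?case by blast
qed

lemma radial_class_at_0:
  assumes "radial_class \<Phi> L p f" "\<And>q. q < L \<Longrightarrow> fps_nth \<Phi> q = 0" "L \<ge> 1"
  shows "f 0 = 0"
  using assms by (induction rule: radial_class.induct) (auto simp: radial_def eval_fps_at_0 radial_fps_nth)

text \<open>The numerator of the m-th radial derivative is O(|w|^L), so a summand is of size |w| to
  the power |\<alpha>| + L - 2m, and this exponent is at least p.\<close>

lemma radial_class_bigo:
  fixes f :: "real ^ 'd::finite \<Rightarrow> real"
  assumes "radial_class \<Phi> L p f" "\<And>q. q < L \<Longrightarrow> fps_nth \<Phi> q = 0" "fps_conv_radius \<Phi> > 0"
  shows "\<exists>C \<eta>. C \<ge> 0 \<and> \<eta> > 0 \<and> (\<forall>w. w \<noteq> 0 \<and> norm w < \<eta> \<longrightarrow> \<bar>f w\<bar> \<le> C * norm w ^ p)"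
  using assms
proof (induction rule: radial_class.induct)
  case (zero p)
  show ?case by (intro exI[of _ 0] exI[of _ 1]) auto
next
  case (add p f \<alpha> m c)
  then obtain C \<eta> where C: "C \<ge> 0" "\<eta> > 0" "\<And>w. w \<noteq> 0 \<Longrightarrow> norm w < \<eta> \<Longrightarrow> \<bar>f w\<bar> \<le> C * norm w ^ p"
    by blast
  have "eval_fps (radial_fps \<Phi> m) has_fps_expansion radial_fps \<Phi> m"
    using add(5) conv_radius_radial[of \<Phi> m]
      by (intro eval_fps_has_fps_expansion) (auto intro: less_le_trans)
  then obtain D \<delta> where D: "\<delta> > 0" "D \<ge> 0" "\<And>t. \<bar>t\<bar> < \<delta> \<Longrightarrow> \<bar>eval_fps (radial_fps \<Phi> m) t\<bar> \<le>
      D * \<bar>t\<bar> ^ L"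
    by (rule has_fps_expansion_bigo[where m = L]) (auto simp: radial_fps_nth add(4))
  show ?case
  proof (rule exI[of _ "C + \<bar>c\<bar> * D"], rule exI[of _ "min 1 (min \<eta> \<delta>)"], intro conjI allI impI)
    fix w :: "real ^ 'd" assume "w \<noteq> 0 \<and> norm w < min 1 (min \<eta> \<delta>)"
    hence w: "w \<noteq> 0" "norm w < 1" "norm w < \<eta>" "norm w < \<delta>" by auto
    have "\<bar>monomial \<alpha> w * radial \<Phi> m ((norm w)\<^sup>2)\<bar> \<le>
        norm w ^ mdeg \<alpha> * (D * norm w ^ L / norm w ^ (2 * m))"
      unfolding abs_mult using w D(3)[of "norm w"]
      by (intro mult_mono abs_monomial_le) (auto simp: radial_def power_mult abs_divide divide_right_mono)
    also have "\<dots> = D * norm w ^ (mdeg \<alpha> + L - 2 * m)"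
      using w add(2) by (simp add: power_diff power_add)
    also have "\<dots> \<le> D * norm w ^ p"
      using w add(2) D(2) by (intro mult_left_mono power_decreasing) auto
    finally have "\<bar>c * (monomial \<alpha> w * radial \<Phi> m ((norm w)\<^sup>2))\<bar> \<le> \<bar>c\<bar> * (D * norm w ^ p)"
      unfolding abs_mult[of c] by (rule mult_left_mono) simp
    moreover have "\<bar>f w\<bar> \<le> C * norm w ^ p" using C(3) w by simp
    ultimately show "\<bar>f w + c * (monomial \<alpha> w * radial \<Phi> m ((norm w)\<^sup>2))\<bar> \<le> (C +
        \<bar>c\<bar> * D) * norm w ^ p"
      by (simp add: algebra_simps)
  qed (use C D in auto)
qed

text \<open>A polynomial with coefficients P plus a remainder that vanishes to order p, on the ball
  where \<psi> equals its series. Requiring P to vanish above degree N keeps the same finite sum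
  valid after differentiation.\<close>

definition taylor_repr ::
  "real fps \<Rightarrow> nat \<Rightarrow> real \<Rightarrow> nat \<Rightarrow> (('d::finite \<Rightarrow> nat) \<Rightarrow> real) \<Rightarrow> nat \<Rightarrow> (real ^ 'd \<Rightarrow> real) \<Rightarrow> bool"
    where
  "taylor_repr \<Phi> L \<delta> N P p f \<longleftrightarrow> (\<forall>\<gamma>. mdeg \<gamma> > N \<longrightarrow> P \<gamma> = 0) \<and>
     (\<exists>g. radial_class \<Phi> L p g \<and> (\<forall>w. norm w < \<delta> \<longrightarrow> f w = (\<Sum>\<gamma> | mdeg \<gamma> \<le> N. P \<gamma> * monomial \<gamma> w) + g w))"

definition coeff_shift :: "'d::finite \<Rightarrow> (('d::finite \<Rightarrow> nat) \<Rightarrow> real) \<Rightarrow> ('d \<Rightarrow> nat) \<Rightarrow> real" where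
  "coeff_shift i P \<gamma> = real (Suc (\<gamma> i)) * P (\<lambda>j. munit i j + \<gamma> j)"

lemma finite_mdeg_le [simp]: "finite {\<gamma> :: 'd::finite \<Rightarrow> nat. mdeg \<gamma> \<le> N}"
proof -
  have "{\<gamma> :: 'd \<Rightarrow> nat. mdeg \<gamma> \<le> N} = (\<Union>s\<le>N. multi_indices s)" by (auto simp: multi_indices_def)
  thus ?thesis by simp
qed

lemma sum_coeff_shift:
  fixes w :: "real ^ 'd::finite"
  assumes "\<And>\<gamma>. mdeg \<gamma> > N \<Longrightarrow> P \<gamma> = 0"
  shows "(\<Sum>\<gamma> | mdeg \<gamma> \<le> N. P \<gamma> * (real (\<gamma> i) * monomial (mdec \<gamma> i) w)) =
     (\<Sum>\<gamma> | mdeg \<gamma> \<le> N. coeff_shift i P \<gamma> * monomial \<gamma> w)"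
proof -
  have "(\<Sum>\<gamma> | mdeg \<gamma> \<le> N. P \<gamma> * (real (\<gamma> i) * monomial (mdec \<gamma> i) w)) =
      (\<Sum>\<gamma> | mdeg \<gamma> \<le> N \<and> \<gamma> i > 0. P \<gamma> * (real (\<gamma> i) * monomial (mdec \<gamma> i) w))"
    by (rule sum.mono_neutral_right) auto
  also have "\<dots> = (\<Sum>\<gamma> | mdeg \<gamma> < N. coeff_shift i P \<gamma> * monomial \<gamma> w)"
    by (rule sum.reindex_bij_witness[where i = "\<lambda>\<gamma> j. munit i j + \<gamma> j" and j = "\<lambda>\<gamma>. mdec \<gamma> i"])
       (auto simp: munit_mdec mdec_munit mdec_same mdeg_add mdeg_mdec coeff_shift_def)
  also have "\<dots> = (\<Sum>\<gamma> | mdeg \<gamma> \<le> N. coeff_shift i P \<gamma> * monomial \<gamma> w)"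
  proof (rule sum.mono_neutral_left)
    show "\<forall>\<gamma>\<in>{\<gamma>. mdeg \<gamma> \<le> N} - {\<gamma>. mdeg \<gamma> < N}. coeff_shift i P \<gamma> * monomial \<gamma> w = 0"
      by (auto simp: coeff_shift_def mdeg_add intro!: assms)
  qed auto
  finally show ?thesis .
qed

text \<open>Away from 0 the remainder is differentiated by its explicit form, at 0 by its size.
  Actual differentiability is stated as well, because \<open>deriv\<close> alone would not give a
  chain rule.\<close>

lemma partial_taylor_repr:
  fixes f :: "real ^ 'd::finite \<Rightarrow> real"
  assumes f: "taylor_repr \<Phi> L \<delta> N P (Suc p) f" and p: "p \<ge> 1"
    and \<delta>: "\<delta> > 0" "ereal \<delta> \<le> fps_conv_radius \<Phi>" and z: "\<And>q. q < L \<Longrightarrow> fps_nth \<Phi> q = 0" and L: "L \<ge> 1"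
  shows "taylor_repr \<Phi> L \<delta> N (coeff_shift i P) p (partial i f)"
    and "\<And>w. norm w < \<delta> \<Longrightarrow> ((\<lambda>t. f (w + t *\<^sub>R axis i 1)) has_real_derivative partial i f w) (at 0)"
proof -
  have P: "\<And>\<gamma>. mdeg \<gamma> > N \<Longrightarrow> P \<gamma> = 0" using f by (simp add: taylor_repr_def)
  obtain g where g: "radial_class \<Phi> L (Suc p) g"
    "\<And>w. norm w < \<delta> \<Longrightarrow> f w = (\<Sum>\<gamma> | mdeg \<gamma> \<le> N. P \<gamma> * monomial \<gamma> w) + g w"
    using f unfolding taylor_repr_def by blast
  obtain g' where g': "radial_class \<Phi> L p g'" "\<And>w. w \<noteq> 0 \<Longrightarrow> ereal (norm w) < fps_conv_radius \<Phi> \<Longrightarrow>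
      ((\<lambda>t. g (w + t *\<^sub>R axis i 1)) has_real_derivative g' w) (at 0)"
    using radial_class_deriv[OF g(1)] by blast
  have g0: "g 0 = 0" "g' 0 = 0" using radial_class_at_0[OF g(1) z L] radial_class_at_0[OF g'(1) z L]
    by auto
  have dg: "((\<lambda>t. g (w + t *\<^sub>R axis i 1)) has_real_derivative g' w) (at 0)" if w: "norm w < \<delta>" for w
  proof (cases "w = 0")
    case False
    have "ereal (norm w) < ereal \<delta>" using w by simp
    thus ?thesis using g'(2) False \<delta>(2) less_le_trans by blast
  next
    case True
    have "fps_conv_radius \<Phi> > 0" using \<delta> by (meson ereal_less(2) less_le_trans)
    then obtain C \<eta> where C: "C \<ge> 0" "\<eta> > 0" "\<And>w. w \<noteq> 0 \<Longrightarrow> norm w < \<eta> \<Longrightarrow> \<bar>g w\<bar> \<le> C * norm w ^ Suc p"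
      using radial_class_bigo[OF g(1) z] by blast
    \<comment> \<open>At the origin g = O(|w|^(p+1)), so the difference quotient is O(|h|^p) and
      tends to 0, as p >= 1.\<close>
    have "((\<lambda>h. g (h *\<^sub>R axis i 1) / h) \<longlongrightarrow> 0) (at 0)"
    proof (rule Lim_null_comparison)
      have "\<forall>\<^sub>F h::real in at 0. \<bar>h\<bar> < \<eta> \<and> h \<noteq> 0"
        using C(2) by (auto simp: eventually_at dist_real_def)
      thus "\<forall>\<^sub>F h in at 0. norm (g (h *\<^sub>R axis i 1) / h) \<le> C * \<bar>h\<bar> ^ p"
      proof eventually_elim
        case (elim h)
        have "\<bar>g (h *\<^sub>R axis i 1)\<bar> \<le> C * \<bar>h\<bar> ^ Suc p"
          using C(3)[of "h *\<^sub>R axis i 1"] elim by (auto simp: axis_eq_0_iff)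
        thus ?case using elim by (simp add: field_simps)
      qed
      show "((\<lambda>h. C * \<bar>h\<bar> ^ p) \<longlongrightarrow> 0) (at 0)"
        using p by (auto intro!: tendsto_eq_intros)
    qed
    thus ?thesis using True g0 by (simp add: DERIV_def)
  qed
  have D: "((\<lambda>t. f (w + t *\<^sub>R axis i 1)) has_real_derivative
     (\<Sum>\<gamma> | mdeg \<gamma> \<le> N. coeff_shift i P \<gamma> * monomial \<gamma> w) + g' w) (at 0)" if w: "norm w < \<delta>" for w
  proof -
    have sc: "(\<Sum>\<gamma> | mdeg \<gamma> \<le> N. P \<gamma> * (real (\<gamma> i) * monomial (mdec \<gamma> i) w)) =
       (\<Sum>\<gamma> | mdeg \<gamma> \<le> N. coeff_shift i P \<gamma> * monomial \<gamma> w)"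
      by (rule sum_coeff_shift) (rule P)
    have "((\<lambda>t. (\<Sum>\<gamma> | mdeg \<gamma> \<le> N. P \<gamma> * monomial \<gamma> (w + t *\<^sub>R axis i 1)) + g (w +
        t *\<^sub>R axis i 1)) has_real_derivative
       (\<Sum>\<gamma> | mdeg \<gamma> \<le> N. coeff_shift i P \<gamma> * monomial \<gamma> w) + g' w) (at 0)"
      unfolding sc[symmetric] by (intro DERIV_add DERIV_sum DERIV_cmult DERIV_monomial dg w)
    moreover have ev: "\<forall>\<^sub>F t in nhds 0. f (w + t *\<^sub>R axis i 1) =
       (\<Sum>\<gamma> | mdeg \<gamma> \<le> N. P \<gamma> * monomial \<gamma> (w + t *\<^sub>R axis i 1)) + g (w + t *\<^sub>R axis i 1)"
    proof -
      have "((\<lambda>t. norm (w + t *\<^sub>R axis i 1)) \<longlongrightarrow> norm (w + 0 *\<^sub>R axis i (1::real))) (nhds 0)"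
        by (intro tendsto_intros filterlim_ident)
      hence "\<forall>\<^sub>F t in nhds 0. norm (w + t *\<^sub>R axis i 1) < \<delta>" by (rule order_tendstoD) (simp add: w)
      thus ?thesis by eventually_elim (rule g(2))
    qed
    ultimately show ?thesis
      by (subst DERIV_cong_ev[OF refl ev refl])
  qed
  have pd: "partial i f w = (\<Sum>\<gamma> | mdeg \<gamma> \<le> N. coeff_shift i P \<gamma> * monomial \<gamma> w) + g' w"
    if "norm w < \<delta>" for w
    unfolding partial_def by (rule DERIV_imp_deriv[OF D[OF that]])
  show "\<And>w. norm w < \<delta> \<Longrightarrow> ((\<lambda>t. f (w + t *\<^sub>R axis i 1)) has_real_derivative partial i f w) (at 0)"
    using D pd by simp
  show "taylor_repr \<Phi> L \<delta> N (coeff_shift i P) p (partial i f)"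
    unfolding taylor_repr_def using g'(1) pd
    by (auto simp: coeff_shift_def mdeg_add intro!: P)
qed

lemma taylor_repr_at_0:
  fixes f :: "real ^ 'd::finite \<Rightarrow> real"
  assumes "taylor_repr \<Phi> L \<delta> N P p f" "\<delta> > 0" "\<And>q. q < L \<Longrightarrow> fps_nth \<Phi> q = 0" "L \<ge> 1"
  shows "f 0 = P (\<lambda>_. 0)"
proof -
  obtain g where g: "radial_class \<Phi> L p g"
    "\<And>w. norm w < \<delta> \<Longrightarrow> f w = (\<Sum>\<gamma> | mdeg \<gamma> \<le> N. P \<gamma> * monomial \<gamma> w) + g w"
    using assms unfolding taylor_repr_def by blast
  have m0: "monomial \<gamma> (0 :: real ^ 'd) = (if \<gamma> = (\<lambda>_. 0) then 1 else 0)" for \<gamma> :: "'d \<Rightarrow> nat"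
  proof (cases "\<gamma> = (\<lambda>_. 0)")
    case False
    then obtain i where "\<gamma> i > 0" by (auto simp: fun_eq_iff)
    hence "(\<Prod>i\<in>UNIV. vec_nth (0 :: real ^ 'd) i ^ \<gamma> i) = 0"
      by (intro prod_zero) (auto intro!: bexI[of _ i])
    thus ?thesis using False by (simp add: monomial_def)
  qed simp
  have "f 0 = (\<Sum>\<gamma> | mdeg \<gamma> \<le> N. P \<gamma> * monomial \<gamma> (0 :: real ^ 'd))"
    using g(2)[of 0] radial_class_at_0[OF g(1) assms(3,4)] assms(2) by simp
  also have "\<dots> = (\<Sum>\<gamma> | mdeg \<gamma> \<le> N. if \<gamma> = (\<lambda>_. 0) then P \<gamma> else 0)"
    by (intro sum.cong refl) (simp add: m0)
  finally show ?thesis by simp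
qed

lemma taylor_repr_cmult:
  assumes "taylor_repr \<Phi> L \<delta> N P p f" "\<And>w. norm w < \<delta> \<Longrightarrow> h w = a * f w"
  shows "taylor_repr \<Phi> L \<delta> N (\<lambda>\<gamma>. a * P \<gamma>) p h"
proof -
  obtain g where g: "radial_class \<Phi> L p g"
    "\<And>w. norm w < \<delta> \<Longrightarrow> f w = (\<Sum>\<gamma> | mdeg \<gamma> \<le> N. P \<gamma> * monomial \<gamma> w) + g w"
    using assms(1) unfolding taylor_repr_def by blast
  show ?thesis unfolding taylor_repr_def
    using assms radial_class_cmult[OF g(1), of a] g(2)
    by (auto simp: taylor_repr_def distrib_left sum_distrib_left mult.assoc intro!: exI[of _ "\<lambda>w. a * g w"])
qed

section \<open>Iterated partial derivatives at the origin\<close>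

lemma count_list_Cons_fun: "count_list (i # xs) = (\<lambda>j. munit i j + count_list xs j)"
  by (auto simp: munit_def)

lemma mfact_munit: "mfact (\<lambda>j. munit i j + \<gamma> j) = real (Suc (\<gamma> i)) * mfact \<gamma>"
proof -
  have "mfact (\<lambda>j. munit i j + \<gamma> j) = fact (Suc (\<gamma> i)) * (\<Prod>j\<in>UNIV - {i}. fact (\<gamma> j))"
    unfolding mfact_def by (subst prod.remove[of UNIV i]) (auto simp: munit_def intro!: prod.cong)
  moreover have "mfact \<gamma> = fact (\<gamma> i) * (\<Prod>j\<in>UNIV - {i}. fact (\<gamma> j))"
    unfolding mfact_def by (subst prod.remove[of UNIV i]) auto
  ultimately show ?thesis by simp
qed

text \<open>Multiplying by the factorial of \<gamma> makes each shift a mere translation of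
  multi-indices, so that only the number of occurrences of each direction matters.\<close>

lemma coeff_shift_foldr:
  "mfact \<gamma> * foldr coeff_shift xs P \<gamma> = mfact (\<lambda>j. count_list xs j + \<gamma> j) * P (\<lambda>j. count_list xs j +
      \<gamma> j)"
proof (induction xs arbitrary: \<gamma>)
  case (Cons i xs)
  have "mfact \<gamma> * foldr coeff_shift (i # xs) P \<gamma> =
     mfact (\<lambda>j. munit i j + \<gamma> j) * foldr coeff_shift xs P (\<lambda>j. munit i j + \<gamma> j)"
    by (simp add: coeff_shift_def mfact_munit)
  also have "\<dots> = mfact (\<lambda>j. count_list xs j + (munit i j + \<gamma> j)) * P (\<lambda>j. count_list xs j +
      (munit i j + \<gamma> j))"
    by (rule Cons.IH)
  also have "(\<lambda>j. count_list xs j + (munit i j + \<gamma> j)) = (\<lambda>j. count_list (i # xs) j + \<gamma> j)"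
    unfolding count_list_Cons_fun by (simp add: fun_eq_iff)
  finally show ?case .
qed simp

lemma partials_taylor_repr:
  fixes f :: "real ^ 'd::finite \<Rightarrow> real"
  assumes f: "taylor_repr \<Phi> L \<delta> N P p f"
    and \<delta>: "\<delta> > 0" "ereal \<delta> \<le> fps_conv_radius \<Phi>" and z: "\<And>q. q < L \<Longrightarrow> fps_nth \<Phi> q = 0" and L: "L \<ge> 1"
  shows "length xs < p \<Longrightarrow>
      taylor_repr \<Phi> L \<delta> N (foldr coeff_shift xs P) (p - length xs) (foldr partial xs f)"
proof (induction xs)
  case (Cons i xs)
  hence "taylor_repr \<Phi> L \<delta> N (foldr coeff_shift xs P) (Suc (p - length (i # xs))) (foldr partial xs f)"
    by (simp add: Suc_diff_Suc)
  from partial_taylor_repr(1)[OF this _ \<delta> z L] Cons.prems show ?case by simp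
qed (use f in simp)

text \<open>The kernel depends on z through y - z, so every derivative in z costs a sign. The chain
  rule needs the induction hypothesis in a whole neighbourhood of w, hence the quantification over
  w.\<close>

lemma partials_reflect:
  fixes f :: "real ^ 'd::finite \<Rightarrow> real"
  assumes f: "taylor_repr \<Phi> L \<delta> N P p f"
    and \<delta>: "\<delta> > 0" "ereal \<delta> \<le> fps_conv_radius \<Phi>" and z: "\<And>q. q < L \<Longrightarrow> fps_nth \<Phi> q = 0" and L: "L \<ge> 1"
  shows "length xs < p \<Longrightarrow> norm (y - w) < \<delta> \<Longrightarrow>
    foldr partial xs (\<lambda>w. f (y - w)) w = (-1) ^ length xs * foldr partial xs f (y - w)"
proof (induction xs arbitrary: w)
  case (Cons i xs)
  let ?F = "foldr partial xs f" and ?h = "foldr partial xs (\<lambda>w. f (y - w))"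
  have rep: "taylor_repr \<Phi> L \<delta> N (foldr coeff_shift xs P) (Suc (p - length (i # xs))) ?F"
    using partials_taylor_repr[OF f \<delta> z L, of xs] Cons.prems(1) by (simp add: Suc_diff_Suc)
  have "((\<lambda>t. ?F (y - w + t *\<^sub>R axis i 1)) has_real_derivative partial i ?F (y - w)) (at 0)"
    by (rule partial_taylor_repr(2)[OF rep _ \<delta> z L]) (use Cons.prems in auto)
  hence "((\<lambda>t. ?F (y - w +
      (- t) *\<^sub>R axis i 1)) has_real_derivative partial i ?F (y - w) * (-1)) (at 0)"
    by (intro DERIV_chain2[where g = uminus]) (auto intro!: derivative_eq_intros)
  hence "((\<lambda>t. (-1) ^ length xs * ?F (y - (w + t *\<^sub>R axis i 1))) has_real_derivative
      (-1) ^ length xs * (partial i ?F (y - w) * (-1))) (at 0)"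
    by (intro DERIV_cmult) (simp add: algebra_simps)
  moreover have ev: "\<forall>\<^sub>F t in nhds 0. ?h (w + t *\<^sub>R axis i 1) = (-1) ^ length xs * ?F (y - (w +
      t *\<^sub>R axis i 1))"
  proof -
    have "((\<lambda>t. norm (y - (w + t *\<^sub>R axis i 1))) \<longlongrightarrow> norm (y - (w + 0 *\<^sub>R axis i (1::real)))) (nhds 0)"
      by (intro tendsto_intros filterlim_ident)
    hence "\<forall>\<^sub>F t in nhds 0. norm (y - (w + t *\<^sub>R axis i 1)) < \<delta>"
      by (rule order_tendstoD) (use Cons.prems in simp)
    thus ?thesis by eventually_elim (rule Cons.IH, use Cons.prems in auto)
  qed
  ultimately have "((\<lambda>t. ?h (w + t *\<^sub>R axis i 1)) has_real_derivative
      (-1) ^ length xs * (partial i ?F (y - w) * (-1))) (at 0)"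
    by (subst DERIV_cong_ev[OF refl ev refl])
  hence "partial i ?h w = (-1) ^ length xs * (partial i ?F (y - w) * (-1))"
    unfolding partial_def[of i ?h] by (rule DERIV_imp_deriv)
  thus ?case by simp
qed simp

lemma mpartial_foldr:
  fixes \<alpha> :: "'d::{finite,linorder} \<Rightarrow> nat"
  obtains xs where "\<And>f. mpartial \<alpha> f = foldr partial xs f" "count_list xs = \<alpha>" "length xs = mdeg \<alpha>"
proof -
  define xs where "xs = concat (map (\<lambda>i. replicate (\<alpha> i) i) (sorted_list_of_set UNIV))"
  have "foldr (\<lambda>i. partial i ^^ \<alpha> i) ys f =
      foldr partial (concat (map (\<lambda>i. replicate (\<alpha> i) i) ys)) f" for ys and f :: "real ^ 'd::{finite,linorder} \<Rightarrow> real"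
    by (induction ys) (simp_all add: foldr_replicate)
  hence 1: "mpartial \<alpha> f = foldr partial xs f" for f by (simp add: mpartial_def xs_def)
  have "count_list (concat (map (\<lambda>i. replicate (\<alpha> i) i) ys)) j = (if j \<in> set ys then \<alpha> j else 0)"
    if "distinct ys" for ys j
    using that
  proof (induction ys)
    case (Cons a ys)
    have count_list_replicate: "count_list (replicate m a) j = (if j = a then m else 0)" for m
      by (induction m) auto
    have "count_list (replicate (\<alpha> a) a) j = (if j = a then \<alpha> a else 0)"
      by (simp add: count_list_replicate)
    thus ?case using Cons by auto
  qed simp
  hence "count_list xs j = \<alpha> j" for j by (simp add: xs_def)
  hence 2: "count_list xs = \<alpha>" by auto
  have "length xs = (\<Sum>i\<leftarrow>sorted_list_of_set UNIV. \<alpha> i)" by (simp add: xs_def length_concat o_def)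
  also have "\<dots> = mdeg \<alpha>" by (simp add: sum_list_distinct_conv_sum_set mdeg_def)
  finally show ?thesis using that 1 2 by blast
qed

text \<open>Stars and bars: listing the coordinates identifies multi-indices with lists of fixed
  length and sum s.\<close>

lemma card_multi_indices: "card (multi_indices s :: ('d::finite \<Rightarrow> nat) set) = hdim s CARD('d)"
proof -
  obtain xs :: "'d list" where xs: "set xs = UNIV" "distinct xs"
    using finite_distinct_list[of "UNIV :: 'd set"] by auto
  have len: "length xs = CARD('d)" using distinct_card[OF xs(2)] xs(1) by simp
  have ms: "mdeg \<alpha> = sum_list (map \<alpha> xs)" for \<alpha> :: "'d \<Rightarrow> nat"
    using xs by (simp add: mdeg_def sum_list_distinct_conv_sum_set)
  have "bij_betw (\<lambda>\<alpha>. map \<alpha> xs) (multi_indices s) {l. size l = CARD('d) \<and> sum_list l = s}"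
  proof (rule bij_betwI')
    fix \<alpha> \<beta> :: "'d \<Rightarrow> nat"
    show "(map \<alpha> xs = map \<beta> xs) = (\<alpha> = \<beta>)" using xs(1) by (auto simp: fun_eq_iff)
  next
    fix \<alpha> :: "'d \<Rightarrow> nat" assume "\<alpha> \<in> multi_indices s"
    thus "map \<alpha> xs \<in> {l. size l = CARD('d) \<and> sum_list l = s}"
      using ms[of \<alpha>] by (simp add: len multi_indices_def)
  next
    fix l :: "nat list" assume l: "l \<in> {l. size l = CARD('d) \<and> sum_list l = s}"
    define \<alpha> where "\<alpha> i = the (map_of (zip xs l) i)" for i
    have "map \<alpha> xs = l"
      using l xs(2) len by (intro nth_equalityI) (auto simp: \<alpha>_def map_of_zip_nth)
    moreover from this have "\<alpha> \<in> multi_indices s"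
      using l ms[of \<alpha>] by (simp add: multi_indices_def)
    ultimately show "\<exists>\<alpha>\<in>multi_indices s. l = map \<alpha> xs" by blast
  qed
  hence "card (multi_indices s :: ('d \<Rightarrow> nat) set) = (s + CARD('d) - 1) choose s"
    using card_length_sum_list by (simp add: bij_betw_same_card)
  also have "\<dots> = (s + CARD('d) - 1) choose (CARD('d) - 1)"
  proof -
    have c: "CARD('d) \<ge> 1" by (simp add: Suc_leI)
    have "s \<le> s + CARD('d) - 1" "s + CARD('d) - 1 - s = CARD('d) - 1" using c by linarith+
    thus ?thesis using binomial_symmetric[of s "s + CARD('d) - 1"] by simp
  qed
  finally show ?thesis by (simp add: hdim_def)
qed

lemma sum_hdim:
  assumes "d \<ge> 1"
  shows "(\<Sum>l\<le>j. hdim l d) = pdim j d"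
proof (induction j)
  case (Suc j)
  obtain m where m: "d = Suc m" using assms by (cases d) auto
  show ?case using Suc by (simp add: hdim_def pdim_def m)
qed (simp add: hdim_def pdim_def)

text \<open>\<open>P\<close> collects the coefficients of the even part of \<open>\<psi>(\<parallel>w\<parallel>)\<close>; the remaining part does not
  contribute to derivatives of order at most \<open>2r - 2\<close> at \<open>0\<close>.\<close>

lemma kernel_derivatives:
  fixes k :: "real ^ 'd::{finite,linorder} \<Rightarrow> real ^ 'd::{finite,linorder} \<Rightarrow> real"
  assumes "radial_kernel \<psi> \<Psi> r k"
  obtains P where
    "\<And>M w. M \<le> 2 * r - 2 \<Longrightarrow>
        (\<Sum>\<gamma>\<in>multi_indices M. P \<gamma> * monomial \<gamma> (w :: real ^ 'd::{finite,linorder})) = fps_nth \<Psi> M * norm w ^ M"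
    "\<And>\<alpha> \<beta>. mdeg \<alpha> + mdeg \<beta> \<le> 2 * r - 2 \<Longrightarrow>
       mpartial \<alpha> (\<lambda>y. mpartial \<beta> (\<lambda>z. k y z) 0) 0
         = (-1) ^ mdeg \<beta> * mfact (\<lambda>i. \<alpha> i + \<beta> i) * P (\<lambda>i. \<alpha> i + \<beta> i)"
proof -
  interpret radial_kernel \<psi> \<Psi> r k by fact
  define L where "L = 2 * r - 1"
  have L: "L \<ge> 1" using r_pos by (simp add: L_def)
  have "\<forall>M. \<exists>c. even M \<longrightarrow> (\<forall>w::real ^ 'd::{finite,linorder}. norm w ^ M =
      (\<Sum>\<gamma>\<in>multi_indices M. c \<gamma> * monomial \<gamma> w))"
  proof
    fix M :: nat
    have "\<exists>c. \<forall>w::real ^ 'd::{finite,linorder}. norm w ^ M =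
        (\<Sum>\<gamma>\<in>multi_indices M. c \<gamma> * monomial \<gamma> w)" if "even M"
      using that homogeneous_poly_norm_even[of "M div 2"] by (simp add: homogeneous_poly_def)
    thus "\<exists>c. even M \<longrightarrow> (\<forall>w::real ^ 'd::{finite,linorder}. norm w ^ M =
        (\<Sum>\<gamma>\<in>multi_indices M. c \<gamma> * monomial \<gamma> w))"
      by blast
  qed
  from choice[OF this] obtain c where
    c: "\<And>M w. even M \<Longrightarrow> norm (w::real ^ 'd::{finite,linorder}) ^ M =
        (\<Sum>\<gamma>\<in>multi_indices M. c M \<gamma> * monomial \<gamma> w)"
    by blast
  define P where "P \<gamma> = (if mdeg \<gamma> \<le>
      2 * r - 2 \<and> even (mdeg \<gamma>) then fps_nth \<Psi> (mdeg \<gamma>) * c (mdeg \<gamma>) \<gamma> else 0)" for \<gamma>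
  have P1: "(\<Sum>\<gamma>\<in>multi_indices M. P \<gamma> * monomial \<gamma> w) = fps_nth \<Psi> M * norm w ^ M" if "M \<le> 2 * r - 2"
    for M and w :: "real ^ 'd::{finite,linorder}"
  proof (cases "even M")
    case True
    have "(\<Sum>\<gamma>\<in>multi_indices M. P \<gamma> * monomial \<gamma> w) =
        fps_nth \<Psi> M * (\<Sum>\<gamma>\<in>multi_indices M. c M \<gamma> * monomial \<gamma> w)"
      unfolding sum_distrib_left using True that
        by (intro sum.cong refl) (simp add: P_def multi_indices_def)
    thus ?thesis using c[OF True] by simp
  next
    case False
    have "fps_nth \<Psi> M = 0" using False that r_pos by (intro odd_coeff_eq_0) auto
    thus ?thesis using False by (simp add: P_def multi_indices_def)
  qed
  \<comment> \<open>The tail of \<Psi> from degree 2r - 1 on. The lower part is an even polynomial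
    in the norm, whose coefficients are collected in P.\<close>
  define \<Phi> where "\<Phi> = fps_X ^ L * fps_shift L \<Psi>"
  have \<Phi>0: "fps_nth \<Phi> q = 0" if "q < L" for q using that by (simp add: \<Phi>_def fps_X_power_mult_nth)
  have rad: "fps_conv_radius \<Phi> \<ge> fps_conv_radius \<Psi>"
    unfolding \<Phi>_def using fps_conv_radius_mult[of "fps_X ^ L" "fps_shift L \<Psi>"] by simp
  obtain \<delta> where \<delta>: "\<delta> > 0" "ereal \<delta> \<le> fps_conv_radius \<Psi>" "\<And>t. \<bar>t\<bar> < \<delta> \<Longrightarrow> eval_fps \<Psi> t = \<psi> t"
    using expansion_radius by blast
  have \<delta>': "ereal \<delta> \<le> fps_conv_radius \<Phi>" using \<delta>(2) rad by (rule order_trans)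
  let ?f = "\<lambda>w::real ^ 'd::{finite,linorder}. \<psi> (norm w)"
  have rep: "taylor_repr \<Phi> L \<delta> (2 * r - 2) P L ?f"
    unfolding taylor_repr_def
  proof (intro conjI allI impI exI)
    show "P \<gamma> = 0" if "2 * r - 2 < mdeg \<gamma>" for \<gamma> using that by (simp add: P_def)
    have "radial_class \<Phi> L L (\<lambda>w::real ^ 'd::{finite,linorder}. 0 +
        1 * (monomial (\<lambda>_. 0) w * radial \<Phi> 0 ((norm w)\<^sup>2)))"
      by (intro radial_class.intros) simp
    thus "radial_class \<Phi> L L (\<lambda>w::real ^ 'd::{finite,linorder}. radial \<Phi> 0 ((norm w)\<^sup>2))" by simp
    fix w :: "real ^ 'd::{finite,linorder}" assume w: "norm w < \<delta>"
    have cw: "ereal (norm (norm w)) < fps_conv_radius \<Psi>"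
      using w \<delta>(2) less_le_trans[of "ereal (norm w)" "ereal \<delta>"] by simp
    have "?f w = eval_fps \<Psi> (norm w)" using w \<delta>(3) by simp
    also have "\<dots> = (\<Sum>n. fps_nth \<Psi> (n + L) * norm w ^ (n + L)) + (\<Sum>q<L. fps_nth \<Psi> q * norm w ^ q)"
      unfolding eval_fps_def by (rule suminf_split_initial_segment[OF summable_fps[OF cw]])
    also have "(\<Sum>n. fps_nth \<Psi> (n + L) * norm w ^ (n + L)) = eval_fps \<Phi> (norm w)"
    proof -
      have "eval_fps \<Phi> (norm w) = norm w ^ L * eval_fps (fps_shift L \<Psi>) (norm w)"
        unfolding \<Phi>_def using cw by (subst eval_fps_mult) auto
      also have "\<dots> = (\<Sum>n. norm w ^ L * (fps_nth \<Psi> (n + L) * norm w ^ n))"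
        unfolding eval_fps_def using summable_fps[of "norm w" "fps_shift L \<Psi>"] cw
        by (subst suminf_mult) auto
      finally show ?thesis by (simp add: power_add mult_ac)
    qed
    also have "(\<Sum>q<L. fps_nth \<Psi> q * norm w ^ q) =
        (\<Sum>q\<le>2 * r - 2. \<Sum>\<gamma>\<in>multi_indices q. P \<gamma> * monomial \<gamma> w)"
    proof -
      have "{..<L} = {..2 * r - 2}" using r_pos by (auto simp: L_def)
      thus ?thesis by (simp add: P1)
    qed
    also have "\<dots> = (\<Sum>q\<le>2 * r - 2. \<Sum>\<gamma>\<in>{\<gamma> \<in> {\<gamma>. mdeg \<gamma> \<le> 2 * r - 2}. mdeg \<gamma> = q}. P \<gamma> * monomial \<gamma> w)"
      by (intro sum.cong refl) (auto simp: multi_indices_def)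
    also have "\<dots> = (\<Sum>\<gamma> | mdeg \<gamma> \<le> 2 * r - 2. P \<gamma> * monomial \<gamma> w)"
      by (rule sum.group) auto
    finally show "?f w = (\<Sum>\<gamma> | mdeg \<gamma> \<le> 2 * r - 2. P \<gamma> * monomial \<gamma> w) + radial \<Phi> 0 ((norm w)\<^sup>2)"
      by (simp add: radial_0)
  qed
  have "mpartial \<alpha> (\<lambda>y. mpartial \<beta> (\<lambda>z. k y z) 0) 0
         = (-1) ^ mdeg \<beta> * mfact (\<lambda>i. \<alpha> i + \<beta> i) * P (\<lambda>i. \<alpha> i + \<beta> i)" if ab: "mdeg \<alpha> + mdeg \<beta> \<le> 2 * r - 2" for \<alpha> \<beta>
  proof -
    obtain xs where xs: "\<And>f. mpartial \<alpha> f = foldr partial xs f" "count_list xs = \<alpha>" "length xs =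
        mdeg \<alpha>"
      using mpartial_foldr by blast
    obtain ys where ys: "\<And>f. mpartial \<beta> f = foldr partial ys f" "count_list ys = \<beta>" "length ys =
        mdeg \<beta>"
      using mpartial_foldr by blast
    have lt: "length xs + length ys < L" using ab r_pos by (simp add: xs ys L_def)
    \<comment> \<open>The inner derivative at z = 0, as a function of y, is up to a sign an iterated
      derivative of \<psi>(|y|). It again has a Taylor representation, with enough order left for
      the derivatives in y, as the total order is below L.\<close>
    define G where "G y = mpartial \<beta> (\<lambda>z. k y z) 0" for y
    have G: "G y = (-1) ^ mdeg \<beta> * foldr partial ys ?f y" if "norm y < \<delta>" for y
      using partials_reflect[OF rep \<delta>(1) \<delta>' \<Phi>0 L, of ys y 0] that lt
      by (simp add: G_def k_def ys)
    have "taylor_repr \<Phi> L \<delta> (2 * r - 2) (\<lambda>\<gamma>. (-1) ^ mdeg \<beta> * foldr coeff_shift ys P \<gamma>) (L - length ys) G"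
      by (rule taylor_repr_cmult[OF partials_taylor_repr[OF rep \<delta>(1) \<delta>' \<Phi>0 L]]) (use lt G in auto)
    from partials_taylor_repr[OF this \<delta>(1) \<delta>' \<Phi>0 L, of xs]
    have "taylor_repr \<Phi> L \<delta> (2 * r - 2) (foldr coeff_shift xs (\<lambda>\<gamma>. (-1) ^ mdeg \<beta> * foldr coeff_shift ys P \<gamma>))
        (L - length ys - length xs) (foldr partial xs G)" using lt by simp
    from taylor_repr_at_0[OF this \<delta>(1) \<Phi>0 L]
    have "foldr partial xs G 0 =
        foldr coeff_shift xs (\<lambda>\<gamma>. (-1) ^ mdeg \<beta> * foldr coeff_shift ys P \<gamma>) (\<lambda>_. 0)" .
    also have "\<dots> =
        mfact (\<lambda>_::'d. 0) * foldr coeff_shift xs (\<lambda>\<gamma>. (-1) ^ mdeg \<beta> * foldr coeff_shift ys P \<gamma>) (\<lambda>_. 0)"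
      by (simp add: mfact_def)
    also have "\<dots> = (-1) ^ mdeg \<beta> * (mfact \<alpha> * foldr coeff_shift ys P \<alpha>)"
      unfolding coeff_shift_foldr[of _ xs] by (simp add: xs)
    also have "\<dots> = (-1) ^ mdeg \<beta> * (mfact (\<lambda>i. \<alpha> i + \<beta> i) * P (\<lambda>i. \<alpha> i + \<beta> i))"
      unfolding coeff_shift_foldr by (simp add: ys add.commute)
    finally show ?thesis unfolding xs G_def[symmetric] by simp
  qed
  with P1 show ?thesis using that by blast
qed

definition wronskian_coeff ::
  "(real ^ 'd::{finite,linorder} \<Rightarrow> real ^ 'd::{finite,linorder} \<Rightarrow> real) \<Rightarrow> ('d \<Rightarrow> nat) \<Rightarrow> ('d \<Rightarrow> nat) \<Rightarrow> real" where
  "wronskian_coeff k \<alpha> \<beta> = mpartial \<alpha> (\<lambda>y. mpartial \<beta> (\<lambda>z. k y z) 0) 0 / (mfact \<alpha> * mfact \<beta>)"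

text \<open>In the expansion by degrees (s, i + l - s) every term with s different from i is killed,
  since then one of the two degrees is below i or l respectively. The terms with s = i have the
  Wronskian entries as coefficients.\<close>

lemma kernel_form_wronskian:
  fixes k :: "real ^ 'd::{finite,linorder} \<Rightarrow> real ^ 'd::{finite,linorder} \<Rightarrow> real"
    and x :: "'i \<Rightarrow> real ^ 'd::{finite,linorder}"
  assumes "radial_kernel \<psi> \<Psi> r k" and v: "annihilates J x i v" and w: "annihilates J x l w"
    and il: "i + l \<le> 2 * r - 2"
  shows "kernel_form \<Psi> J x (i + l) v w = (\<Sum>\<alpha>\<in>multi_indices i. \<Sum>\<beta>\<in>multi_indices l.
     wronskian_coeff k \<alpha> \<beta> * (\<Sum>a\<in>J. v a * monomial \<alpha> (x a)) * (\<Sum>a\<in>J. w a * monomial \<beta> (x a)))"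
proof -
  obtain P where P: "\<And>M w. M \<le> 2 * r - 2 \<Longrightarrow>
      (\<Sum>\<gamma>\<in>multi_indices M. P \<gamma> * monomial \<gamma> (w :: real ^ 'd::{finite,linorder})) = fps_nth \<Psi> M * norm w ^ M"
    "\<And>\<alpha> \<beta>. mdeg \<alpha> + mdeg \<beta> \<le> 2 * r - 2 \<Longrightarrow> mpartial \<alpha> (\<lambda>y. mpartial \<beta> (\<lambda>z. k y z) 0) 0
         = (-1) ^ mdeg \<beta> * mfact (\<lambda>i. \<alpha> i + \<beta> i) * P (\<lambda>i. \<alpha> i + \<beta> i)"
    using kernel_derivatives[OF assms(1)] by blast
  let ?m = "i + l"
  let ?S = "\<lambda>v \<alpha>. \<Sum>a\<in>J. v a * monomial \<alpha> (x a)"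
  have exp: "fps_nth \<Psi> ?m * norm (y - z) ^ ?m =
      (\<Sum>s\<le>?m. \<Sum>\<alpha>\<in>multi_indices s. \<Sum>\<beta>\<in>multi_indices (?m - s).
       wronskian_coeff k \<alpha> \<beta> * (monomial \<alpha> y * monomial \<beta> z))" for y z :: "real ^ 'd::{finite,linorder}"
    unfolding P(1)[OF il, symmetric] homogeneous_poly_diff
    by (intro sum.cong refl) (use il in \<open>simp add: wronskian_coeff_def multi_indices_def P(2) mult_ac\<close>)
  have "kernel_form \<Psi> J x ?m v w =
      (\<Sum>a\<in>J. \<Sum>b\<in>J. \<Sum>s\<le>?m. \<Sum>\<alpha>\<in>multi_indices s. \<Sum>\<beta>\<in>multi_indices (?m - s).
       wronskian_coeff k \<alpha> \<beta> * ((v a * monomial \<alpha> (x a)) * (w b * monomial \<beta> (x b))))"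
    unfolding kernel_form_def exp unfolding sum_distrib_left
      by (intro sum.cong refl) (simp add: mult_ac)
  also have "\<dots> = (\<Sum>s\<le>?m. \<Sum>\<alpha>\<in>multi_indices s. \<Sum>\<beta>\<in>multi_indices (?m - s). \<Sum>a\<in>J. \<Sum>b\<in>J.
       wronskian_coeff k \<alpha> \<beta> * ((v a * monomial \<alpha> (x a)) * (w b * monomial \<beta> (x b))))"
    by (simp only: sum_swap_pair[where J = J])
  also have "\<dots> = (\<Sum>s\<le>?m. if s =
      i then (\<Sum>\<alpha>\<in>multi_indices i. \<Sum>\<beta>\<in>multi_indices l. wronskian_coeff k \<alpha> \<beta> * ?S v \<alpha> * ?S w \<beta>) else 0)"
  proof (rule sum.cong[OF refl])
    fix s assume s: "s \<in> {..?m}"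
    have e: "(\<Sum>a\<in>J. \<Sum>b\<in>J. wronskian_coeff k \<alpha> \<beta> * ((v a * monomial \<alpha> (x a)) * (w b * monomial \<beta> (x b)))) =
       wronskian_coeff k \<alpha> \<beta> * ?S v \<alpha> * ?S w \<beta>" for \<alpha> \<beta>
      unfolding mult.assoc[of "wronskian_coeff k \<alpha> \<beta>"] sum_product by (simp only: sum_distrib_left)
    show "(\<Sum>\<alpha>\<in>multi_indices s. \<Sum>\<beta>\<in>multi_indices (?m - s). \<Sum>a\<in>J. \<Sum>b\<in>J.
       wronskian_coeff k \<alpha> \<beta> * ((v a * monomial \<alpha> (x a)) * (w b * monomial \<beta> (x b)))) =
      (if s = i then (\<Sum>\<alpha>\<in>multi_indices i. \<Sum>\<beta>\<in>multi_indices l. wronskian_coeff k \<alpha> \<beta> * ?S v \<alpha> * ?S w \<beta>) else 0)"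
    proof (cases "s = i")
      case False
      have "wronskian_coeff k \<alpha> \<beta> * ?S v \<alpha> * ?S w \<beta> = 0"
        if "\<alpha> \<in> multi_indices s" "\<beta> \<in> multi_indices (?m - s)" for \<alpha> \<beta>
      proof -
        have "mdeg \<alpha> < i \<or> mdeg \<beta> < l" using False s that by (auto simp: multi_indices_def)
        thus ?thesis using v w by (auto simp: annihilates_def)
      qed
      thus ?thesis using False unfolding e by simp
    qed (simp add: e)
  qed
  finally show ?thesis by simp
qed

subsection \<open>Block matrices\<close>

text \<open>The position at which block i begins when the blocks have sizes w 0, w 1, and so on;
  blocks of size 0 are allowed.\<close>

definition offset :: "(nat \<Rightarrow> nat) \<Rightarrow> nat \<Rightarrow> nat" where
  "offset w i = (\<Sum>l<i. w l)"

lemma offset_Suc [simp]: "offset w (Suc i) = offset w i + w i"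
  by (simp add: offset_def)

lemma offset_mono: "i \<le> m \<Longrightarrow> offset w i \<le> offset w m"
  unfolding offset_def by (rule sum_mono2) auto

lemma offset_less: "i < m \<Longrightarrow> s < w i \<Longrightarrow> offset w i + s < offset w m"
  using offset_mono[of "Suc i" m w] by simp

lemma offset_cases:
  assumes "c < offset w m"
  obtains i s where "i < m" "s < w i" "c = offset w i + s"
  using assms
proof (induction m arbitrary: thesis)
  case (Suc m)
  show ?case
  proof (cases "c < offset w m")
    case True
    obtain i s where "i < m" "s < w i" "c = offset w i + s" using Suc.IH[OF _ True] by blast
    thus ?thesis using Suc.prems(1)[of i s] by simp
  next
    case False
    thus ?thesis using Suc.prems(1)[of m "c - offset w m"] Suc.prems(2) by simp
  qed
qed (simp add: offset_def)

lemma offset_inj: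
  assumes "offset w i + s = offset w l + t" "s < w i" "t < w l"
  shows "i = l \<and> s = t"
proof -
  have "\<not> i < l" using offset_less[of i l s w] assms by linarith
  moreover have "\<not> l < i" using offset_less[of l i t w] assms by linarith
  ultimately show ?thesis using assms by simp
qed

lemma sum_offset: "(\<Sum>c<offset w m. f c) = (\<Sum>i<m. \<Sum>s<w i. f (offset w i + s))"
proof (induction m)
  case (Suc m)
  have "(\<Sum>c<offset w (Suc m). f c) = (\<Sum>c<offset w m. f c) + (\<Sum>c\<in>{offset w m..<offset w m +
      w m}. f c)"
    by (simp flip: atLeast0LessThan add: sum.atLeastLessThan_concat)
  also have "(\<Sum>c\<in>{offset w m..<offset w m + w m}. f c) = (\<Sum>s<w m. f (offset w m + s))"
    by (rule sum.reindex_bij_witness[where i = "\<lambda>s. offset w m +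
        s" and j = "\<lambda>c. c - offset w m"]) auto
  finally show ?case using Suc by simp
qed (simp add: offset_def)

lemma offset_vec:
  fixes f :: "nat \<Rightarrow> nat \<Rightarrow> real"
  obtains v where "v \<in> carrier_vec (offset w m)"
    "\<And>i s. i < m \<Longrightarrow> s < w i \<Longrightarrow> vec_index v (offset w i + s) = f i s"
proof -
  \<comment> \<open>The block and the position inside it are uniquely determined by
    \<open>offset_inj\<close>, so the choice recovers them.\<close>
  define g where "g c = (SOME p. fst p < m \<and> snd p < w (fst p) \<and> c = offset w (fst p) + snd p)"
    for c
  define v where "v = vec (offset w m) (\<lambda>c. f (fst (g c)) (snd (g c)))"
  have "vec_index v (offset w i + s) = f i s" if "i < m" "s < w i" for i s
  proof -
    have "g (offset w i + s) = (i, s)" unfolding g_def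
      by (rule some_equality) (use that offset_inj[of w i s] in \<open>auto simp: prod_eq_iff\<close>)
    thus ?thesis using offset_less[of i m s w] that by (simp add: v_def)
  qed
  thus ?thesis using that[of v] by (simp add: v_def)
qed

section \<open>Entries of concatenated matrices\<close>

lemma hcat_list:
  assumes "Ms \<noteq> []" "\<And>M. M \<in> set Ms \<Longrightarrow> dim_row M = n"
  shows "dim_row (hcat Ms) = n" "dim_col (hcat Ms) = sum_list (map dim_col Ms)"
    "\<And>i a s. i < length Ms \<Longrightarrow> a < n \<Longrightarrow> s < dim_col (Ms ! i) \<Longrightarrow>
       hcat Ms $$ (a, sum_list (map dim_col (take i Ms)) + s) = Ms ! i $$ (a, s)"
proof -
  have col: "dim_col (hcat Ms) = sum_list (map dim_col Ms)" for Ms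
    by (induction Ms) (simp_all add: hcat_def append_cols_def)
  show "dim_col (hcat Ms) = sum_list (map dim_col Ms)" by (rule col)
  have row: "dim_row (hcat (M # Ms)) = dim_row M" for M Ms
    by (simp add: hcat_def append_cols_def)
  show "dim_row (hcat Ms) = n" using assms row by (cases Ms) auto
  show "hcat Ms $$ (a, sum_list (map dim_col (take i Ms)) + s) = Ms ! i $$ (a, s)"
    if "i < length Ms" "a < n" "s < dim_col (Ms ! i)" for i a s
    using that assms(2)
  proof (induction Ms arbitrary: i)
    case (Cons M Ms)
    have e: "hcat (M # Ms) = append_cols M (hcat Ms)" by (simp add: hcat_def)
    show ?case
    proof (cases i)
      case 0
      thus ?thesis using Cons.prems by (simp add: e append_cols_def)
    next
      case (Suc i')
      have IH: "hcat Ms $$ (a, sum_list (map dim_col (take i' Ms)) + s) = Ms ! i' $$ (a, s)"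
        using Cons.IH[of i'] Cons.prems Suc by simp
      have "sum_list (map dim_col (take i' Ms)) + s < dim_col (hcat Ms)"
      proof -
        have "Ms = take i' Ms @ Ms ! i' # drop (Suc i') Ms" using Cons.prems Suc
          by (simp add: id_take_nth_drop)
        hence "sum_list (map dim_col Ms) = sum_list (map dim_col (take i' Ms)) + dim_col (Ms ! i') +
            sum_list (map dim_col (drop (Suc i') Ms))"
          by (metis (no_types, lifting) add.assoc list.simps(9) map_append sum_list.Cons sum_list_append)
        thus ?thesis using Cons.prems Suc by (simp add: col)
      qed
      thus ?thesis using Cons.prems Suc IH by (simp add: e append_cols_def)
    qed
  qed simp
qed

lemma vcat_list:
  assumes "Ms \<noteq> []" "\<And>M. M \<in> set Ms \<Longrightarrow> dim_col M = n"
  shows "dim_col (vcat Ms) = n" "dim_row (vcat Ms) = sum_list (map dim_row Ms)"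
    "\<And>i a s. i < length Ms \<Longrightarrow> a < n \<Longrightarrow> s < dim_row (Ms ! i) \<Longrightarrow>
       vcat Ms $$ (sum_list (map dim_row (take i Ms)) + s, a) = Ms ! i $$ (s, a)"
proof -
  have row: "dim_row (vcat Ms) = sum_list (map dim_row Ms)" for Ms
    by (induction Ms) (simp_all add: vcat_def append_rows_def)
  show "dim_row (vcat Ms) = sum_list (map dim_row Ms)" by (rule row)
  have col: "dim_col (vcat (M # Ms)) = dim_col M" for M Ms
    by (simp add: vcat_def append_rows_def)
  show "dim_col (vcat Ms) = n" using assms col by (cases Ms) auto
  show "vcat Ms $$ (sum_list (map dim_row (take i Ms)) + s, a) = Ms ! i $$ (s, a)"
    if "i < length Ms" "a < n" "s < dim_row (Ms ! i)" for i a s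
    using that assms(2)
  proof (induction Ms arbitrary: i)
    case (Cons M Ms)
    have e: "vcat (M # Ms) = append_rows M (vcat Ms)" by (simp add: vcat_def)
    show ?case
    proof (cases i)
      case 0
      thus ?thesis using Cons.prems by (simp add: e append_rows_def)
    next
      case (Suc i')
      have IH: "vcat Ms $$ (sum_list (map dim_row (take i' Ms)) + s, a) = Ms ! i' $$ (s, a)"
        using Cons.IH[of i'] Cons.prems Suc by simp
      have "sum_list (map dim_row (take i' Ms)) + s < dim_row (vcat Ms)"
      proof -
        have "Ms = take i' Ms @ Ms ! i' # drop (Suc i') Ms" using Cons.prems Suc
          by (simp add: id_take_nth_drop)
        hence "sum_list (map dim_row Ms) = sum_list (map dim_row (take i' Ms)) + dim_row (Ms ! i') +
            sum_list (map dim_row (drop (Suc i') Ms))"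
          by (metis (no_types, lifting) add.assoc list.simps(9) map_append sum_list.Cons sum_list_append)
        thus ?thesis using Cons.prems Suc by (simp add: row)
      qed
      thus ?thesis using Cons.prems Suc IH by (simp add: e append_rows_def)
    qed
  qed simp
qed

lemma sum_list_take_offset: "i \<le> m \<Longrightarrow> sum_list (map f (take i (map g [0..<m]))) =
    offset (\<lambda>l. f (g l)) i"
proof -
  assume "i \<le> m"
  hence "take i (map g [0..<m]) = map g [0..<i]" by (simp add: take_map take_upt)
  thus ?thesis by (simp add: offset_def interv_sum_list_conv_sum_set_nat o_def atLeast0LessThan)
qed

lemma offset_cong: "(\<And>l. l < i \<Longrightarrow> f l = g l) \<Longrightarrow> offset f i = offset g i"
  by (simp add: offset_def)

lemma hcat_blocks:
  assumes "m > 0" "\<And>i. i < m \<Longrightarrow> M i \<in> carrier_mat n (w i)"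
  shows "hcat (map M [0..<m]) \<in> carrier_mat n (offset w m)"
    "\<And>i a s. i < m \<Longrightarrow> a < n \<Longrightarrow> s < w i \<Longrightarrow> hcat (map M [0..<m]) $$ (a, offset w i + s) = M i $$ (a, s)"
proof -
  let ?Ms = "map M [0..<m]"
  have 1: "?Ms \<noteq> []" "\<And>M'. M' \<in> set ?Ms \<Longrightarrow> dim_row M' = n"
    using assms(1) assms(2)[THEN carrier_matD(1)] by auto
  have o: "sum_list (map dim_col (take i ?Ms)) = offset w i" if "i \<le> m" for i
    using that assms(2)[THEN carrier_matD(2)]
      by (subst sum_list_take_offset) (auto intro!: offset_cong)
  show "hcat ?Ms \<in> carrier_mat n (offset w m)"
    using hcat_list(1,2)[OF 1] o[of m] by auto
  show "hcat ?Ms $$ (a, offset w i + s) = M i $$ (a, s)" if "i < m" "a < n" "s < w i" for i a s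
    using hcat_list(3)[OF 1, of i a s] o[of i] that assms(2)[of i] by auto
qed

lemma vcat_blocks:
  assumes "m > 0" "\<And>i. i < m \<Longrightarrow> M i \<in> carrier_mat (w i) n"
  shows "vcat (map M [0..<m]) \<in> carrier_mat (offset w m) n"
    "\<And>i a s. i < m \<Longrightarrow> a < n \<Longrightarrow> s < w i \<Longrightarrow> vcat (map M [0..<m]) $$ (offset w i + s, a) = M i $$ (s, a)"
proof -
  let ?Ms = "map M [0..<m]"
  have 1: "?Ms \<noteq> []" "\<And>M'. M' \<in> set ?Ms \<Longrightarrow> dim_col M' = n"
    using assms(1) assms(2)[THEN carrier_matD(2)] by auto
  have o: "sum_list (map dim_row (take i ?Ms)) = offset w i" if "i \<le> m" for i
    using that assms(2)[THEN carrier_matD(1)]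
      by (subst sum_list_take_offset) (auto intro!: offset_cong)
  show "vcat ?Ms \<in> carrier_mat (offset w m) n"
    using vcat_list(1,2)[OF 1] o[of m] by auto
  show "vcat ?Ms $$ (offset w i + s, a) = M i $$ (s, a)" if "i < m" "a < n" "s < w i" for i a s
    using vcat_list(3)[OF 1, of i a s] o[of i] that assms(2)[of i] by auto
qed

lemma block_mat_blocks:
  assumes "p > 0" "m > 0" "\<And>i l. i < p \<Longrightarrow> l < m \<Longrightarrow> M i l \<in> carrier_mat (h i) (w l)"
  shows "block_mat [0..<p] [0..<m] M \<in> carrier_mat (offset h p) (offset w m)"
    "\<And>i l s t. i < p \<Longrightarrow> l < m \<Longrightarrow> s < h i \<Longrightarrow> t < w l \<Longrightarrow>
       block_mat [0..<p] [0..<m] M $$ (offset h i + s, offset w l + t) = M i l $$ (s, t)"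
proof -
  have r: "hcat (map (M i) [0..<m]) \<in> carrier_mat (h i) (offset w m)" if "i < p" for i
    using hcat_blocks(1)[OF assms(2), of "M i"] assms(3) that by blast
  show "block_mat [0..<p] [0..<m] M \<in> carrier_mat (offset h p) (offset w m)"
    unfolding block_mat_def by (rule vcat_blocks(1)[OF assms(1) r])
  fix i l s t assume *: "i < p" "l < m" "s < h i" "t < w l"
  have "block_mat [0..<p] [0..<m] M $$ (offset h i + s, offset w l + t) =
      hcat (map (M i) [0..<m]) $$ (s, offset w l + t)"
    unfolding block_mat_def by (rule vcat_blocks(2)[OF assms(1) r]) (use * offset_less[of l m t w] in auto)
  also have "\<dots> = M i l $$ (s, t)"
    by (rule hcat_blocks(2)[OF assms(2)]) (use * assms(3) in auto)
  finally show "block_mat [0..<p] [0..<m] M $$ (offset h i + s, offset w l + t) = M i l $$ (s, t)" .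
qed

lemma block_row_blocks:
  assumes "m > 0" "\<And>l. l < m \<Longrightarrow> M j l \<in> carrier_mat h (w l)"
  shows "block_mat [j] [0..<m] M \<in> carrier_mat h (offset w m)"
    "\<And>l s t. l < m \<Longrightarrow> s < h \<Longrightarrow> t < w l \<Longrightarrow>
       block_mat [j] [0..<m] M $$ (s, offset w l + t) = M j l $$ (s, t)"
proof -
  have r: "hcat (map (M j) [0..<m]) \<in> carrier_mat h (offset w m)"
    using hcat_blocks(1)[OF assms(1), of "M j"] assms(2) by blast
  let ?H = "hcat (map (M j) [0..<m])"
  have b: "block_mat [j] [0..<m] M = vcat [?H]" by (simp add: block_mat_def)
  show "block_mat [j] [0..<m] M \<in> carrier_mat h (offset w m)"
    using vcat_list(1,2)[of "[?H]" "offset w m"] r unfolding b by auto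
  fix l s t assume *: "l < m" "s < h" "t < w l"
  have "block_mat [j] [0..<m] M $$ (s, offset w l + t) = ?H $$ (s, offset w l + t)"
    using vcat_list(3)[of "[?H]" "offset w m" 0 "offset w l + t" s] r * offset_less[of l m t w]
      unfolding b by auto
  also have "\<dots> = M j l $$ (s, t)"
    by (rule hcat_blocks(2)[OF assms(1)]) (use * assms(2) in auto)
  finally show "block_mat [j] [0..<m] M $$ (s, offset w l + t) = M j l $$ (s, t)" .
qed

subsection \<open>Schur complements and pseudoinverses\<close>

lemma mult_mat_unit_vec:
  assumes "(A :: real mat) \<in> carrier_mat n m" "j < m"
  shows "A *\<^sub>v unit_vec m j = col A j"
  by (rule eq_vecI) (use assms in auto)

text \<open>The library speaks of linear independence of the set of columns, which forgets
  repetitions; both directions therefore first establish that the columns are distinct.\<close>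

lemma full_column_rank_iff:
  assumes A: "A \<in> carrier_mat n nc"
  shows "full_column_rank A \<longleftrightarrow> (\<forall>v\<in>carrier_vec nc. A *\<^sub>v v = 0\<^sub>v n \<longrightarrow> v = 0\<^sub>v nc)"
proof -
  interpret vec_space "TYPE(real)" n .
  have fc: "full_column_rank A \<longleftrightarrow> rank A = nc" using A
    by (auto simp: full_column_rank_def mat_rank_def)
  have len: "length (cols A) = nc" using A by simp
  show ?thesis
  proof
    assume "full_column_rank A"
    hence r: "rank A = nc" using fc by simp
    \<comment> \<open>The rank is the size of a maximal independent subset of the set of columns. If
      it equals the number of columns, this set cannot be smaller.\<close>
    have "distinct (cols A)"
    proof -
      have "{} \<subseteq> set (cols A) \<and> lin_indpt {}" by (simp add: lin_dep_def)
      then obtain S where S: "maximal S (\<lambda>T. T \<subseteq> set (cols A) \<and> lin_indpt T)"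
        using maximal_exists_superset[of "set (cols A)" "\<lambda>T. T \<subseteq> set (cols A) \<and> lin_indpt T" "{}"]
          by auto
      hence "nc = card S" using rank_card_indpt[OF A S] r by simp
      also have "\<dots> \<le> card (set (cols A))" using S by (intro card_mono) (auto simp: maximal_def)
      finally show ?thesis using card_length[of "cols A"] len by (intro card_distinct) simp
    qed
    thus "\<forall>v\<in>carrier_vec nc. A *\<^sub>v v = 0\<^sub>v n \<longrightarrow> v = 0\<^sub>v nc"
      using full_rank_lin_indpt[OF A r] lin_depI[OF A] by blast
  next
    assume inj: "\<forall>v\<in>carrier_vec nc. A *\<^sub>v v = 0\<^sub>v n \<longrightarrow> v = 0\<^sub>v nc"
    have d: "distinct (cols A)"
    proof (rule ccontr)
      assume "\<not> distinct (cols A)"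
      then obtain i j where ij: "i < nc" "j < nc" "i \<noteq> j" "col A i = col A j"
        using len A by (auto simp: distinct_conv_nth)
      define v where "v = unit_vec nc i - (unit_vec nc j :: real Matrix.vec)"
      have "A *\<^sub>v v = A *\<^sub>v unit_vec nc i - A *\<^sub>v unit_vec nc j"
        unfolding v_def by (rule mult_minus_distrib_mat_vec[OF A]) auto
      also have "\<dots> = 0\<^sub>v n" using ij A by (simp add: mult_mat_unit_vec[OF A])
      finally have "v = 0\<^sub>v nc" using inj by (simp add: v_def)
      hence "vec_index v i = 0" using ij by simp
      thus False using ij by (simp add: v_def)
    qed
    have "lin_indpt (set (cols A))"
    proof (rule ccontr)
      assume "\<not> lin_indpt (set (cols A))"
      hence "lin_dep (set (cols A))" by simp
      then obtain v where "v \<in> carrier_vec nc" "v \<noteq> 0\<^sub>v nc" "A *\<^sub>v v = 0\<^sub>v n"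
        using lin_depE[OF A _ d] by blast
      thus False using inj by blast
    qed
    thus "full_column_rank A" using lin_indpt_full_rank[OF A d] fc by simp
  qed
qed

lemma mult_mat_vec_offset:
  assumes A: "A \<in> carrier_mat n (offset w m)" and v: "v \<in> carrier_vec (offset w m)" and a: "a < n"
  shows "vec_index (A *\<^sub>v v) a = (\<Sum>l<m. \<Sum>t<w l. A $$ (a, offset w l + t) * vec_index v (offset w l +
      t))"
proof -
  have "vec_index (A *\<^sub>v v) a = (\<Sum>c<offset w m. A $$ (a, c) * vec_index v c)"
    using A v a by (simp add: scalar_prod_def atLeast0LessThan)
  thus ?thesis by (simp add: sum_offset)
qed

lemma offset_vec_eq:
  assumes "u \<in> carrier_vec (offset w m)" "v \<in> carrier_vec (offset w m)"
    "\<And>i s. i < m \<Longrightarrow> s < w i \<Longrightarrow> vec_index u (offset w i + s) = vec_index v (offset w i + s)"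
  shows "u = v"
proof (rule eq_vecI)
  fix c assume "c < dim_vec v"
  hence "c < offset w m" using assms(2) by auto
  then obtain i s where "i < m" "s < w i" "c = offset w i + s" using offset_cases by metis
  thus "vec_index u c = vec_index v c" using assms(3) by simp
qed (use assms in auto)

lemma full_column_rank_blocks:
  assumes m: "m > 0" and M: "\<And>i. i < m \<Longrightarrow> M i \<in> carrier_mat n (w i)"
  shows "full_column_rank (hcat (map M [0..<m])) \<longleftrightarrow>
    (\<forall>f. (\<forall>a<n. (\<Sum>l<m. \<Sum>t<w l. M l $$ (a, t) * f l t) = 0) \<longrightarrow> (\<forall>l<m. \<forall>t<w l. f l t = 0))"
    (is "?L \<longleftrightarrow> ?R")
proof -
  let ?A = "hcat (map M [0..<m])"
  have A: "?A \<in> carrier_mat n (offset w m)" by (rule hcat_blocks(1)[OF m M])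
  have Ae: "?A $$ (a, offset w i + s) = M i $$ (a, s)" if "i < m" "a < n" "s < w i" for i a s
    using hcat_blocks(2)[where M = M and m = m and w = w and n = n and i = i and a = a and s = s] m M that by blast
  have mv: "vec_index (?A *\<^sub>v v) a = (\<Sum>l<m. \<Sum>t<w l. M l $$ (a, t) * vec_index v (offset w l + t))"
    if "v \<in> carrier_vec (offset w m)" "a < n" for v a
    using mult_mat_vec_offset[OF A that] Ae that by simp
  show ?thesis unfolding full_column_rank_iff[OF A]
  proof
    assume inj: "\<forall>v\<in>carrier_vec (offset w m). ?A *\<^sub>v v = 0\<^sub>v n \<longrightarrow> v = 0\<^sub>v (offset w m)"
    show ?R
    proof (intro allI impI)
      fix f :: "nat \<Rightarrow> nat \<Rightarrow> real" and l t
      assume z: "\<forall>a<n. (\<Sum>l<m. \<Sum>t<w l. M l $$ (a, t) * f l t) = 0" and lt: "l < m" "t < w l"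
      obtain v where v: "v \<in> carrier_vec (offset w m)"
        "\<And>i s. i < m \<Longrightarrow> s < w i \<Longrightarrow> vec_index v (offset w i + s) = f i s"
        using offset_vec[of w m f] by blast
      have "?A *\<^sub>v v = 0\<^sub>v n"
      proof (rule eq_vecI)
        fix a assume "a < dim_vec (0\<^sub>v n :: real Matrix.vec)"
        hence a: "a < n" by simp
        have "(\<Sum>l<m. \<Sum>t<w l. M l $$ (a, t) * vec_index v (offset w l + t)) =
            (\<Sum>l<m. \<Sum>t<w l. M l $$ (a, t) * f l t)"
          by (intro sum.cong refl) (simp add: v(2))
        thus "vec_index (?A *\<^sub>v v) a = vec_index (0\<^sub>v n) a" using mv[OF v(1) a] z a by simp
      qed (use A in auto)
      hence "v = 0\<^sub>v (offset w m)" using inj v(1) by blast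
      thus "f l t = 0" using v(2)[OF lt] offset_less[of l m t w] lt by simp
    qed
  next
    assume R: ?R
    show "\<forall>v\<in>carrier_vec (offset w m). ?A *\<^sub>v v = 0\<^sub>v n \<longrightarrow> v = 0\<^sub>v (offset w m)"
    proof (intro ballI impI)
      fix v assume v: "v \<in> carrier_vec (offset w m)" and z: "?A *\<^sub>v v = 0\<^sub>v n"
      have "\<forall>a<n. (\<Sum>l<m. \<Sum>t<w l. M l $$ (a, t) * vec_index v (offset w l + t)) = 0"
      proof (intro allI impI)
        fix a assume "a < n"
        thus "(\<Sum>l<m. \<Sum>t<w l. M l $$ (a, t) * vec_index v (offset w l + t)) = 0"
          using mv[OF v, of a] z by simp
      qed
      hence "\<forall>l<m. \<forall>t<w l. vec_index v (offset w l + t) = 0"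
        using R[rule_format, of "\<lambda>l t. vec_index v (offset w l + t)"] by blast
      thus "v = 0\<^sub>v (offset w m)"
        by (intro offset_vec_eq[OF v]) (auto simp: offset_less)
    qed
  qed
qed

section \<open>Linear systems written block by block\<close>

lemma det_nonzero_iff_injective:
  assumes "A \<in> carrier_mat n n"
  shows "det (A :: real mat) \<noteq> 0 \<longleftrightarrow> (\<forall>v\<in>carrier_vec n. A *\<^sub>v v = 0\<^sub>v n \<longrightarrow> v = 0\<^sub>v n)"
  using det_0_iff_vec_prod_zero[OF assms] by blast

lemma mat_inv_det_nonzero:
  assumes A: "A \<in> carrier_mat n n" and d: "det A \<noteq> 0"
  shows "mat_inv A \<in> carrier_mat n n" "A * mat_inv A = 1\<^sub>m n" "mat_inv A * A =
      1\<^sub>m n" "invertible_mat A"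
proof -
  have "mat_inverse A \<noteq> None"
    using mat_inverse(1)[OF A, where b = "()"] det_non_zero_imp_unit[OF A d, where b = "()"]
      by blast
  then obtain B where "mat_inverse A = Some B" by blast
  with mat_inverse(2)[OF A this]
  show 1: "mat_inv A \<in> carrier_mat n n" "A * mat_inv A = 1\<^sub>m n" "mat_inv A * A = 1\<^sub>m n"
    by (auto simp: mat_inv_def)
  show "invertible_mat A"
    unfolding invertible_mat_def inverts_mat_def using 1 A by (auto intro!: exI[of _ "mat_inv A"])
qed

lemma block_mat_mult_vec:
  assumes "p > 0" "m > 0" "\<And>i l. i < p \<Longrightarrow> l < m \<Longrightarrow> M i l \<in> carrier_mat (h i) (w l)"
    and v: "v \<in> carrier_vec (offset w m)" and ist: "i < p" "s < h i"
  shows "vec_index (block_mat [0..<p] [0..<m] M *\<^sub>v v) (offset h i + s) =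
     (\<Sum>l<m. \<Sum>t<w l. M i l $$ (s, t) * vec_index v (offset w l + t))"
proof -
  note B = block_mat_blocks[of p m M h w, OF assms(1-3)]
  have "offset h i + s < offset h p" using ist by (rule offset_less)
  from mult_mat_vec_offset[OF B(1) v this] show ?thesis using B(2) ist by simp
qed

lemma det_block_mat_nonzero_iff:
  assumes m: "m > 0" and M: "\<And>i l. i < m \<Longrightarrow> l < m \<Longrightarrow> M i l \<in> carrier_mat (w i) (w l)"
  shows "det (block_mat [0..<m] [0..<m] M) \<noteq> 0 \<longleftrightarrow>
    (\<forall>f. (\<forall>i<m. \<forall>s<w i. (\<Sum>l<m. \<Sum>t<w l. M i l $$ (s, t) * f l t) = 0) \<longrightarrow> (\<forall>i<m. \<forall>s<w i. f i s = 0))"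
    (is "?L \<longleftrightarrow> ?R")
proof -
  let ?B = "block_mat [0..<m] [0..<m] M" and ?p = "offset w m"
  have B: "?B \<in> carrier_mat ?p ?p" by (rule block_mat_blocks(1)[OF m m M])
  have Bv: "vec_index (?B *\<^sub>v v) (offset w i + s) =
      (\<Sum>l<m. \<Sum>t<w l. M i l $$ (s, t) * vec_index v (offset w l + t))"
    if "v \<in> carrier_vec ?p" "i < m" "s < w i" for v i s
    using block_mat_mult_vec[where M = M and h = w and w = w and p = m and m = m and v = v and i = i and s = s] m M that by blast
  show ?thesis unfolding det_nonzero_iff_injective[OF B]
  proof
    assume inj: "\<forall>v\<in>carrier_vec ?p. ?B *\<^sub>v v = 0\<^sub>v ?p \<longrightarrow> v = 0\<^sub>v ?p"
    show ?R
    proof (intro allI impI)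
      fix f :: "nat \<Rightarrow> nat \<Rightarrow> real" and l t
      assume z: "\<forall>i<m. \<forall>s<w i. (\<Sum>l<m. \<Sum>t<w l. M i l $$ (s, t) * f l t) = 0"
        and lt: "l < m" "t < w l"
      obtain v where v: "v \<in> carrier_vec ?p"
        "\<And>i s. i < m \<Longrightarrow> s < w i \<Longrightarrow> vec_index v (offset w i + s) = f i s"
        using offset_vec[of w m f] by blast
      have "?B *\<^sub>v v = 0\<^sub>v ?p"
      proof (rule offset_vec_eq)
        fix i s assume ist: "i < m" "s < w i"
        have "vec_index (?B *\<^sub>v v) (offset w i + s) = (\<Sum>l<m. \<Sum>t<w l. M i l $$ (s, t) * f l t)"
          unfolding Bv[OF v(1) ist] by (intro sum.cong refl) (simp add: v(2))
        thus "vec_index (?B *\<^sub>v v) (offset w i + s) = vec_index (0\<^sub>v ?p) (offset w i + s)"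
          using z ist by (simp add: offset_less)
      qed (use B v in auto)
      hence "v = 0\<^sub>v ?p" using inj v(1) by blast
      thus "f l t = 0" using v(2)[OF lt] offset_less[of l m t w] lt by simp
    qed
  next
    assume R: ?R
    show "\<forall>v\<in>carrier_vec ?p. ?B *\<^sub>v v = 0\<^sub>v ?p \<longrightarrow> v = 0\<^sub>v ?p"
    proof (intro ballI impI)
      fix v assume v: "v \<in> carrier_vec ?p" and z: "?B *\<^sub>v v = 0\<^sub>v ?p"
      have "\<forall>i<m. \<forall>s<w i. (\<Sum>l<m. \<Sum>t<w l. M i l $$ (s, t) * vec_index v (offset w l + t)) = 0"
      proof (intro allI impI)
        fix i s assume ist: "i < m" "s < w i"
        show "(\<Sum>l<m. \<Sum>t<w l. M i l $$ (s, t) * vec_index v (offset w l + t)) = 0"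
          using Bv[OF v ist] z offset_less[of i m s w, OF ist] by simp
      qed
      hence "\<forall>i<m. \<forall>s<w i. vec_index v (offset w i + s) = 0"
        using R[rule_format, of "\<lambda>l t. vec_index v (offset w l + t)"] by blast
      thus "v = 0\<^sub>v ?p"
        by (intro offset_vec_eq[OF v]) (auto simp: offset_less)
    qed
  qed
qed

lemma block_mat_solve:
  assumes m: "m > 0" and M: "\<And>i l. i < m \<Longrightarrow> l < m \<Longrightarrow> M i l \<in> carrier_mat (w i) (w l)"
    and d: "det (block_mat [0..<m] [0..<m] M) \<noteq> 0"
  obtains f where "\<And>i s. i < m \<Longrightarrow> s < w i \<Longrightarrow> (\<Sum>l<m. \<Sum>t<w l. M i l $$ (s, t) * f l t) = g i s"
proof -
  let ?B = "block_mat [0..<m] [0..<m] M" and ?p = "offset w m"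
  have B: "?B \<in> carrier_mat ?p ?p" by (rule block_mat_blocks(1)[OF m m M])
  have Bv: "vec_index (?B *\<^sub>v v) (offset w i + s) =
      (\<Sum>l<m. \<Sum>t<w l. M i l $$ (s, t) * vec_index v (offset w l + t))"
    if "v \<in> carrier_vec ?p" "i < m" "s < w i" for v i s
    using block_mat_mult_vec[where M = M and h = w and w = w and p = m and m = m and v = v and i = i and s = s] m M that by blast
  obtain v where v: "v \<in> carrier_vec ?p" "\<And>i s. i < m \<Longrightarrow> s < w i \<Longrightarrow> vec_index v (offset w i + s) =
      g i s"
    using offset_vec[of w m g] by blast
  define u where "u = mat_inv ?B *\<^sub>v v"
  note I = mat_inv_det_nonzero[OF B d]
  have u: "u \<in> carrier_vec ?p" using I(1) v(1) by (simp add: u_def)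
  have "?B *\<^sub>v u = (?B * mat_inv ?B) *\<^sub>v v" unfolding u_def
    by (rule assoc_mult_mat_vec[OF B I(1) v(1), symmetric])
  hence "?B *\<^sub>v u = v" using I(2) v(1) by simp
  hence "(\<Sum>l<m. \<Sum>t<w l. M i l $$ (s, t) * vec_index u (offset w l + t)) = g i s"
    if "i < m" "s < w i" for i s
    using Bv[OF u that] v(2)[OF that] by simp
  thus ?thesis by (rule that)
qed

lemma mat_eq_if_mult_vec_eq:
  assumes A: "A \<in> carrier_mat n m" and B: "B \<in> carrier_mat n m"
    and e: "\<And>v. v \<in> carrier_vec m \<Longrightarrow> A *\<^sub>v v = B *\<^sub>v (v :: real Matrix.vec)"
  shows "A = B"
proof (rule eq_matI)
  fix i l assume il: "i < dim_row B" "l < dim_col B"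
  have "col A l = col B l"
    using e[of "unit_vec m l"] mult_mat_unit_vec[OF A] mult_mat_unit_vec[OF B] il B by auto
  hence "vec_index (col A l) i = vec_index (col B l) i" by simp
  thus "A $$ (i, l) = B $$ (i, l)" using A B il by simp
qed (use A B in auto)

lemma schur_complement_carrier:
  assumes M: "\<And>i l. i \<le> j \<Longrightarrow> l \<le> j \<Longrightarrow> M i l \<in> carrier_mat (w i) (w l)"
    and d: "j > 0 \<Longrightarrow> det (block_mat [0..<j] [0..<j] M) \<noteq> 0"
  shows "schur_complement M j \<in> carrier_mat (w j) (w j)"
proof (cases "j = 0")
  case False
  hence j: "j > 0" by simp
  have "block_mat [0..<j] [0..<j] M \<in> carrier_mat (offset w j) (offset w j)"
    by (rule block_mat_blocks(1)[OF j j]) (use M in auto)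
  note I = mat_inv_det_nonzero(1)[OF this d[OF j]]
  have "block_mat [j] [0..<j] M \<in> carrier_mat (w j) (offset w j)"
    by (rule block_row_blocks(1)[OF j]) (use M in auto)
  thus ?thesis using I M[of j j] False by (auto simp: schur_complement_def)
qed (use M in \<open>auto simp: schur_complement_def\<close>)

text \<open>Block elimination: if f solves the first j block rows with c in the last block, applying
  the Schur complement to c gives the last block row. The coefficient of c is read from the
  transposed row block, as in \<open>schur_complement\<close>.\<close>

lemma schur_complement_mult_vec:
  assumes j: "j > 0" and M: "\<And>i l. i \<le> j \<Longrightarrow> l \<le> j \<Longrightarrow> M i l \<in> carrier_mat (w i) (w l)"
    and d: "det (block_mat [0..<j] [0..<j] M) \<noteq> 0"
    and c: "c \<in> carrier_vec (w j)"
    and f: "\<And>i s. i < j \<Longrightarrow> s < w i \<Longrightarrow>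
       (\<Sum>l<j. \<Sum>t<w l. M i l $$ (s, t) * f l t) + (\<Sum>t<w j. M j i $$ (t, s) * vec_index c t) = 0"
    and s: "s < w j"
  shows "vec_index (schur_complement M j *\<^sub>v c) s =
     (\<Sum>t<w j. M j j $$ (s, t) * vec_index c t) + (\<Sum>l<j. \<Sum>t<w l. M j l $$ (s, t) * f l t)"
proof -
  let ?B = "block_mat [0..<j] [0..<j] M" and ?C = "block_mat [j] [0..<j] M" and ?p = "offset w j"
  have Mj: "M i l \<in> carrier_mat (w i) (w l)" if "i < j" "l < j" for i l using M that by simp
  have B: "?B \<in> carrier_mat ?p ?p" by (rule block_mat_blocks(1)[OF j j Mj])
  have Bv: "vec_index (?B *\<^sub>v v) (offset w i + s) =
      (\<Sum>l<j. \<Sum>t<w l. M i l $$ (s, t) * vec_index v (offset w l + t))"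
    if "v \<in> carrier_vec ?p" "i < j" "s < w i" for v i s
    using block_mat_mult_vec[where M = M and h = w and w = w and p = j and m = j and v = v and i = i and s = s] j Mj that by blast
  have Mr: "M j l \<in> carrier_mat (w j) (w l)" if "l < j" for l using M that by simp
  have C: "?C \<in> carrier_mat (w j) ?p" by (rule block_row_blocks(1)[OF j]) (rule Mr)
  have Ce: "?C $$ (s, offset w l + t) = M j l $$ (s, t)" if "l < j" "s < w j" "t < w l" for l s t
    using block_row_blocks(2)[where M = M and j = j and m = j and w = w and h = "w j" and l = l and s = s and t = t] j Mr that by blast
  note I = mat_inv_det_nonzero[OF B d]
  obtain y where y: "y \<in> carrier_vec ?p" "\<And>i s. i < j \<Longrightarrow> s < w i \<Longrightarrow> vec_index y (offset w i + s) =
      f i s"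
    using offset_vec[of w j f] by blast
  have CT: "transpose_mat ?C \<in> carrier_mat ?p (w j)" using C by simp
  have By: "?B *\<^sub>v y = - (transpose_mat ?C *\<^sub>v c)"
  proof (rule offset_vec_eq)
    fix i s assume ist: "i < j" "s < w i"
    have "vec_index (transpose_mat ?C *\<^sub>v c) (offset w i + s) =
        (\<Sum>t<w j. M j i $$ (t, s) * vec_index c t)"
      using C Ce c ist offset_less[of i j s w, OF ist]
        by (auto simp: scalar_prod_def atLeast0LessThan intro!: sum.cong)
    moreover have "vec_index (?B *\<^sub>v y) (offset w i + s) = (\<Sum>l<j. \<Sum>t<w l. M i l $$ (s, t) * f l t)"
      unfolding Bv[OF y(1) ist] by (intro sum.cong refl) (simp add: y(2))
    ultimately show "vec_index (?B *\<^sub>v y) (offset w i + s) =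
        vec_index (- (transpose_mat ?C *\<^sub>v c)) (offset w i + s)"
      using f[OF ist] offset_less[of i j s w, OF ist] CT C by simp
  qed (use B y CT c C in auto)
  have "mat_inv ?B *\<^sub>v (transpose_mat ?C *\<^sub>v c) = - y"
  proof -
    have "y = mat_inv ?B *\<^sub>v (?B *\<^sub>v y)"
      using I B y(1) by (simp add: assoc_mult_mat_vec[OF I(1) B y(1), symmetric])
    also have "\<dots> = - (mat_inv ?B *\<^sub>v (transpose_mat ?C *\<^sub>v c))"
      unfolding By by (rule eq_vecI) (use I(1) CT c C in \<open>auto simp: scalar_prod_def sum_negf\<close>)
    finally show ?thesis by simp
  qed
  hence e: "(?C * mat_inv ?B * transpose_mat ?C) *\<^sub>v c = - (?C *\<^sub>v y)"
  proof -
    have "(?C * mat_inv ?B * transpose_mat ?C) *\<^sub>v c = ?C *\<^sub>v (mat_inv ?B *\<^sub>v (transpose_mat ?C *\<^sub>v c))"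
      using C I(1) CT c by (simp add: assoc_mult_mat_vec[of _ "w j" ?p _ "w j"] assoc_mult_mat_vec[of _ "w j" ?p _ ?p])
    also have "\<dots> = - (?C *\<^sub>v y)"
      unfolding \<open>mat_inv ?B *\<^sub>v (transpose_mat ?C *\<^sub>v c) = - y\<close>
      by (rule eq_vecI) (use C y(1) in \<open>auto simp: scalar_prod_def sum_negf\<close>)
    finally show ?thesis .
  qed
  have X: "?C * mat_inv ?B * transpose_mat ?C \<in> carrier_mat (w j) (w j)" using C I(1) by simp
  have "schur_complement M j *\<^sub>v c = M j j *\<^sub>v c - (?C * mat_inv ?B * transpose_mat ?C) *\<^sub>v c"
    using j minus_mult_distrib_mat_vec[OF M[of j j] X c] by (simp add: schur_complement_def)
  hence "vec_index (schur_complement M j *\<^sub>v c) s = vec_index (M j j *\<^sub>v c) s + vec_index (?C *\<^sub>v y) s"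
    unfolding e using s C M[of j j] by simp
  also have "vec_index (M j j *\<^sub>v c) s = (\<Sum>t<w j. M j j $$ (s, t) * vec_index c t)"
    using M[of j j] c s by (auto simp: scalar_prod_def atLeast0LessThan)
  also have "vec_index (?C *\<^sub>v y) s = (\<Sum>l<j. \<Sum>t<w l. M j l $$ (s, t) * f l t)"
    unfolding mult_mat_vec_offset[OF C y(1) s] using Ce s y(2) by simp
  finally show ?thesis .
qed

text \<open>As many orthonormal eigenvectors as the dimension diagonalise S by an orthogonal
  similarity, so the characteristic polynomial splits with the given eigenvalues, counted with
  multiplicity.\<close>

lemma proots_char_poly_orthonormal:
  fixes S :: "real mat"
  assumes S: "S \<in> carrier_mat b b" and T: "finite T" "card T = b"
    and c: "\<And>k. k \<in> T \<Longrightarrow> c k \<in> carrier_vec b"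
    and on: "\<And>k l. k \<in> T \<Longrightarrow> l \<in> T \<Longrightarrow> scalar_prod (c k) (c l) = (if k = l then 1 else 0)"
    and ei: "\<And>k. k \<in> T \<Longrightarrow> S *\<^sub>v c k = lam k \<cdot>\<^sub>v c k"
  shows "image_mset lam (mset_set T) = proots (char_poly S)"
proof -
  obtain ks where ks: "set ks = T" "distinct ks" using finite_distinct_list[OF T(1)] by blast
  have len: "length ks = b" using distinct_card[OF ks(2)] ks(1) T(2) by simp
  have kT: "ks ! i \<in> T" if "i < b" for i using that len ks(1) nth_mem by blast
  define C where "C = Matrix.mat b b (\<lambda>(i, j). vec_index (c (ks ! j)) i)"
  define G where "G = Matrix.mat b b (\<lambda>(i, j). if i = j then lam (ks ! i) else 0)"
  have CG: "C \<in> carrier_mat b b" "G \<in> carrier_mat b b" by (auto simp: C_def G_def)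
  have colC: "col C j = c (ks ! j)" if "j < b" for j
    using that c[OF kT[OF that]] by (intro eq_vecI) (auto simp: C_def)
  have CC: "transpose_mat C * C = 1\<^sub>m b"
  proof (rule eq_matI)
    fix i j assume "i < dim_row (1\<^sub>m b :: real mat)" "j < dim_col (1\<^sub>m b :: real mat)"
    hence ij: "i < b" "j < b" by auto
    have "(transpose_mat C * C) $$ (i, j) = scalar_prod (c (ks ! i)) (c (ks ! j))"
      using ij CG by (simp add: colC)
    thus "(transpose_mat C * C) $$ (i, j) = 1\<^sub>m b $$ (i, j)"
      using on[OF kT[OF ij(1)] kT[OF ij(2)]] ij nth_eq_iff_index_eq[OF ks(2)] len by auto
  qed (use CG in auto)
  have CC': "C * transpose_mat C = 1\<^sub>m b"
    by (rule mat_mult_left_right_inverse[OF _ _ CC]) (use CG in auto)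
  have SC: "S * C = C * G"
  proof (rule eq_matI)
    fix i j assume "i < dim_row (C * G)" "j < dim_col (C * G)"
    hence ij: "i < b" "j < b" using CG by auto
    have "(S * C) $$ (i, j) = vec_index (S *\<^sub>v col C j) i" using S CG ij by simp
    also have "\<dots> = lam (ks ! j) * C $$ (i, j)"
      using ei[OF kT[OF ij(2)]] c[OF kT[OF ij(2)]] ij by (simp add: colC) (simp add: C_def)
    also have "\<dots> = (C * G) $$ (i, j)"
    proof -
      have "(C * G) $$ (i, j) = (\<Sum>l<b. C $$ (i, l) * G $$ (l, j))"
        using CG ij by (simp add: scalar_prod_def atLeast0LessThan)
      also have "\<dots> = (\<Sum>l<b. if l = j then C $$ (i, l) * lam (ks ! l) else 0)"
        using ij by (intro sum.cong refl) (simp add: G_def)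
      also have "\<dots> = lam (ks ! j) * C $$ (i, j)" using ij by simp
      finally show ?thesis ..
    qed
    finally show "(S * C) $$ (i, j) = (C * G) $$ (i, j)" .
  qed (use S CG in auto)
  have "S = S * (C * transpose_mat C)" using S CC' by simp
  also have "\<dots> = C * G * transpose_mat C"
    using assoc_mult_mat[OF S CG(1), of "transpose_mat C" b] CG SC by simp
  finally have SG: "S = C * G * transpose_mat C" .
  have "similar_mat S G"
    by (rule similar_matI[OF _ CC' CC SG]) (use S CG in auto)
  hence "char_poly S = char_poly G" by (rule char_poly_similar)
  also have "\<dots> = (\<Prod>a\<leftarrow>diag_mat G. [:- a, 1:])"
    by (rule char_poly_upper_triangular[OF CG(2)]) (auto simp: G_def upper_triangular_def)
  also have "diag_mat G = map lam ks"
    unfolding diag_mat_def using len by (intro nth_equalityI) (auto simp: G_def)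
  finally have "proots (char_poly S) = proots (\<Prod>a\<leftarrow>map lam ks. [:- a, 1:])" by simp
  also have "\<dots> = image_mset lam (mset ks)"
    by (induction ks) (auto simp: proots_mult prod_list_zero_iff image_iff simp del: mult_pCons_left)
  also have "mset ks = mset_set T" using mset_set_set[OF ks(2)] ks(1) by simp
  finally show ?thesis ..
qed

text \<open>B is injective with the range of the orthogonal projection P. For any pseudoinverse X, B
  X is symmetric and acts as the identity on that range, hence is P; cancelling B gives uniqueness,
  and Y P is a pseudoinverse.\<close>

lemma mult_pseudoinverse_eq_projection:
  assumes B: "B \<in> carrier_mat n c" and P: "P \<in> carrier_mat n n" "transpose_mat P = P" "P * P = P"
    and PB: "P * B = B" and Y: "Y \<in> carrier_mat c n" "P = B * Y"
    and inj: "\<And>v. v \<in> carrier_vec c \<Longrightarrow> B *\<^sub>v v = 0\<^sub>v n \<Longrightarrow> v = 0\<^sub>v c"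
  shows "B * pseudoinverse B = P"
proof -
  have cancel: "X = Z" if X: "X \<in> carrier_mat c m" "Z \<in> carrier_mat c m" "B * X = B * Z" for X Z m
  proof (rule mat_eq_if_mult_vec_eq[OF X(1,2)])
    fix v :: "real Matrix.vec" assume v: "v \<in> carrier_vec m"
    have "B *\<^sub>v (X *\<^sub>v v - Z *\<^sub>v v) = B *\<^sub>v (X *\<^sub>v v) - B *\<^sub>v (Z *\<^sub>v v)"
      by (rule mult_minus_distrib_mat_vec[OF B]) (use X v in auto)
    also have "\<dots> = 0\<^sub>v n"
      using assoc_mult_mat_vec[OF B X(1) v] assoc_mult_mat_vec[OF B X(2) v] X(3) B X v by auto
    finally have z: "X *\<^sub>v v - Z *\<^sub>v v = 0\<^sub>v c" by (intro inj) (use X v in auto)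
    show "X *\<^sub>v v = Z *\<^sub>v v"
    proof (rule eq_vecI)
      fix i assume i: "i < dim_vec (Z *\<^sub>v v)"
      hence "vec_index (X *\<^sub>v v - Z *\<^sub>v v) i = 0" using z X v by auto
      thus "vec_index (X *\<^sub>v v) i = vec_index (Z *\<^sub>v v) i" using i X v by auto
    qed (use X in auto)
  qed
  have BX: "B * X = P \<and> X * B = 1\<^sub>m c" if X: "is_pseudoinverse B X" for X
  proof -
    have Xc: "X \<in> carrier_mat c n" and X1: "B * X * B = B" and X2: "transpose_mat (B * X) = B * X"
      using X B by (auto simp: is_pseudoinverse_def)
    have E: "B * X \<in> carrier_mat n n" using B Xc by simp
    have EP: "(B * X) * P = P"
      unfolding Y(2) using assoc_mult_mat[OF E B Y(1)] X1 by simp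
    have PE: "P * (B * X) = B * X"
      using assoc_mult_mat[OF P(1) B Xc] PB by simp
    \<comment> \<open>E = B X and P have the same range, so E P = P and P E = E; transposing the
      first and using symmetry gives P = P E = E.\<close>
    have "P = transpose_mat ((B * X) * P)" using EP P(2) by simp
    also have "\<dots> = P * (B * X)" using transpose_mult[OF E P(1)] P(2) X2 by simp
    finally have "B * X = P" using PE by simp
    moreover have "X * B = 1\<^sub>m c"
      by (rule cancel) (use B Xc X1 assoc_mult_mat[OF B Xc B] in auto)
    ultimately show ?thesis by simp
  qed
  have YP: "B * (Y * P) = P" using assoc_mult_mat[OF B Y(1) P(1)] Y(2) P(3) by simp
  have YPB: "Y * P * B = 1\<^sub>m c"
  proof (rule cancel)
    have YPc: "Y * P \<in> carrier_mat c n" using Y P by simp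
    show "B * (Y * P * B) = B * 1\<^sub>m c" using assoc_mult_mat[OF B YPc B] YP PB B by simp
  qed (use Y P B in auto)
  have ps: "is_pseudoinverse B (Y * P)"
    unfolding is_pseudoinverse_def YP YPB using Y P B PB by auto
  have "X = Y * P" if "is_pseudoinverse B X" for X
    by (rule cancel) (use BX[OF that] YP that B Y P in \<open>auto simp: is_pseudoinverse_def\<close>)
  hence "pseudoinverse B = Y * P" unfolding pseudoinverse_def using ps by (intro the_equality)
  thus ?thesis using YP by simp
qed

subsection \<open>Leading terms\<close>

text \<open>Both f / t^a and f / t^s have nonzero limits, where s is the subdegree. If the exponents
  differed, the quotient with the smaller one would tend to 0.\<close>

lemma has_leading_term_fps_iff:
  assumes f: "f has_fps_expansion F" and F: "F \<noteq> 0"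
  shows "has_leading_term f a c \<longleftrightarrow> a = subdegree F \<and> c = fps_nth F (subdegree F)"
proof
  define s where "s = subdegree F"
  have lim: "((\<lambda>t. f t / t ^ s) \<longlongrightarrow> fps_nth F s) (at 0)"
    by (rule has_fps_expansion_tendsto_nth[OF f]) (auto simp: s_def)
  have Fs: "fps_nth F s \<noteq> 0" using F by (simp add: s_def)
  assume "has_leading_term f a c"
  then obtain g where c: "c \<noteq> 0" and g: "g \<in> O[at 0](\<lambda>\<epsilon>. \<epsilon>)"
    and fg: "\<forall>\<^sub>F \<epsilon> in at 0. f \<epsilon> = \<epsilon> ^ a * (c + g \<epsilon>)"
    unfolding has_leading_term_def by blast
  obtain C where "\<forall>\<^sub>F \<epsilon> in at 0. norm (g \<epsilon>) \<le> C * norm \<epsilon>" using g by (elim landau_o.bigE)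
  moreover have "((\<lambda>\<epsilon>::real. C * norm \<epsilon>) \<longlongrightarrow> 0) (at 0)" by (auto intro!: tendsto_eq_intros)
  ultimately have g0: "(g \<longlongrightarrow> 0) (at 0)" by (rule Lim_null_comparison)
  have nz: "\<forall>\<^sub>F \<epsilon>::real in at 0. \<epsilon> \<noteq> 0" by (simp add: eventually_at_filter)
  have "((\<lambda>\<epsilon>. c + g \<epsilon>) \<longlongrightarrow> c + 0) (at 0)" by (intro tendsto_intros g0)
  moreover have "\<forall>\<^sub>F \<epsilon> in at 0. c + g \<epsilon> = f \<epsilon> / \<epsilon> ^ a"
    using fg nz by eventually_elim simp
  ultimately have "((\<lambda>t. f t / t ^ a) \<longlongrightarrow> c + 0) (at 0)" by (rule Lim_transform_eventually)
  hence lim2: "((\<lambda>t. f t / t ^ a) \<longlongrightarrow> c) (at 0)" by simp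
  have swap: "((\<lambda>t. f t / t ^ p) \<longlongrightarrow> 0) (at 0)" if "((\<lambda>t. f t / t ^ q) \<longlongrightarrow> e) (at 0)" "p < q" for p q e
  proof -
    have "((\<lambda>t. (f t / t ^ q) * t ^ (q - p)) \<longlongrightarrow> e * 0 ^ (q - p)) (at 0)"
      by (intro tendsto_intros that)
    moreover have "\<forall>\<^sub>F t in at 0. (f t / t ^ q) * t ^ (q - p) = f t / t ^ p"
      using nz
    proof eventually_elim
      case (elim t)
      have "t ^ q = t ^ p * t ^ (q - p)" using that(2) by (simp flip: power_add)
      thus ?case using elim by simp
    qed
    ultimately have "((\<lambda>t. f t / t ^ p) \<longlongrightarrow> e * 0 ^ (q - p)) (at 0)"
      by (rule Lim_transform_eventually)
    thus ?thesis using that(2) by (simp add: power_0_left)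
  qed
  have "\<not> a < s" using swap[OF lim] lim2 c tendsto_unique[OF at_neq_bot] by blast
  moreover have "\<not> s < a" using swap[OF lim2] lim Fs tendsto_unique[OF at_neq_bot] by blast
  ultimately have "a = s" by simp
  with lim lim2 have "c = fps_nth F s" using tendsto_unique[OF at_neq_bot] by blast
  with \<open>a = s\<close> show "a = subdegree F \<and> c = fps_nth F (subdegree F)" by (simp add: s_def)
next
  define s where "s = subdegree F"
  assume "a = subdegree F \<and> c = fps_nth F (subdegree F)"
  hence ac: "a = s" "c = fps_nth F s" by (auto simp: s_def)
  have z: "fps_nth F q = 0" if "q < s" for q using that nth_less_subdegree_zero by (simp add: s_def)
  obtain g where g: "g has_fps_expansion fps_shift s F" and e: "\<forall>\<^sub>F t in nhds 0. f t = t ^ s * g t"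
    using has_fps_expansion_factor[OF f z] by blast
  have "(\<lambda>t. g t - c) has_fps_expansion fps_shift s F - fps_const c"
    using g by (intro fps_expansion_intros)
  then obtain C \<delta> where C: "\<delta> > 0" "C \<ge> 0" "\<And>t. \<bar>t\<bar> < \<delta> \<Longrightarrow> \<bar>g t - c\<bar> \<le> C * \<bar>t\<bar> ^ 1"
    by (rule has_fps_expansion_bigo[where m = 1]) (auto simp: ac)
  have "(\<lambda>t. g t - c) \<in> O[at 0](\<lambda>\<epsilon>. \<epsilon>)"
  proof (rule bigoI)
    show "\<forall>\<^sub>F t in at 0. norm (g t - c) \<le> C * norm t"
      unfolding eventually_at using C by (auto simp: dist_real_def)
  qed
  moreover have "\<forall>\<^sub>F t in at 0. f t = t ^ a * (c + (g t - c))"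
    using e unfolding ac(1) by (simp add: eventually_nhds_conv_at)
  moreover have "c \<noteq> 0" using F ac by (simp add: s_def)
  ultimately show "has_leading_term f a c" unfolding has_leading_term_def by blast
qed

lemma
  assumes f: "f has_fps_expansion F" and F: "F \<noteq> 0"
  shows of_order_fps_iff: "of_order f a \<longleftrightarrow> a = subdegree F"
    and leading_coefficient_fps: "leading_coefficient f = fps_nth F (subdegree F)"
    and leading_term_fps: "leading_term f =
        Polynomial.monom (fps_nth F (subdegree F)) (subdegree F)"
proof -
  show o: "of_order f a \<longleftrightarrow> a = subdegree F" for a
    by (auto simp: of_order_def has_leading_term_fps_iff[OF f F])
  show lc: "leading_coefficient f = fps_nth F (subdegree F)"
    unfolding leading_coefficient_def by (rule the_equality) (auto simp: has_leading_term_fps_iff[OF f F])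
  have "\<not> (\<forall>\<^sub>F \<epsilon> in nhds 0. f \<epsilon> = 0)"
    using fps_expansion_unique_nhds[OF f has_fps_expansion_0] F by blast
  moreover have "(THE a. of_order f a) = subdegree F" by (rule the_equality) (simp_all add: o)
  ultimately show "leading_term f = Polynomial.monom (fps_nth F (subdegree F)) (subdegree F)"
    by (simp add: leading_term_def lc)
qed

section \<open>From analytic eigenpairs to formal power series\<close>

lemma orthogonal_real_complete:
  fixes w :: "nat \<Rightarrow> nat \<Rightarrow> real"
  assumes "\<And>l m. l < n \<Longrightarrow> m < n \<Longrightarrow> (\<Sum>a<n. w l a * w m a) = (if l = m then 1 else 0)"
    and ab: "a < n" "b < n"
  shows "(\<Sum>l<n. w l a * w l b) = (if a = b then 1 else 0)"
proof -
  define A where "A = Matrix.mat n n (\<lambda>(l, a). w l a)"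
  have A: "A \<in> carrier_mat n n" by (simp add: A_def)
  have "A * transpose_mat A = 1\<^sub>m n"
    by (rule eq_matI) (use assms(1) in \<open>auto simp: A_def scalar_prod_def atLeast0LessThan\<close>)
  from mat_mult_left_right_inverse[OF A _ this]
  have "(transpose_mat A * A) $$ (a, b) = 1\<^sub>m n $$ (a, b)" using A by simp
  thus ?thesis using ab by (simp add: A_def scalar_prod_def atLeast0LessThan)
qed

text \<open>Identities valid near \<epsilon> = 0 become identities of series by uniqueness of
  expansions. The sign statement comes from \<epsilon> > 0, where the scaled points are distinct and
  K(\<epsilon>) is positive definite; at \<epsilon> = 0 all points collapse.\<close>

lemma eigensystem_fps:
  fixes x :: "nat \<Rightarrow> real ^ 'd::finite"
  assumes rk: "radial_kernel \<psi> \<Psi> r (k :: real ^ 'd \<Rightarrow> real ^ 'd \<Rightarrow> real)" and inj: "inj_on x {..<n}"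
    and eig: "analytic_eigensystem n (\<lambda>\<epsilon>. Matrix.mat n n (\<lambda>(i, j). \<psi> (\<epsilon> * norm (x i - x j)))) ev u"
  obtains E U where
    "\<And>l. l < n \<Longrightarrow> ev l has_fps_expansion E l"
    "\<And>l a. l < n \<Longrightarrow> a < n \<Longrightarrow> vec_index (u l 0) a = fps_nth (U l a) 0"
    "\<And>l. l < n \<Longrightarrow> u l 0 \<in> carrier_vec n"
    "\<And>l a. l < n \<Longrightarrow> a < n \<Longrightarrow>
       (\<Sum>b<n. Abs_fps (\<lambda>m. fps_nth \<Psi> m * norm (x a - x b) ^ m) * U l b) = E l * U l a"
    "\<And>a b. a < n \<Longrightarrow> b < n \<Longrightarrow> (\<Sum>l<n. U l a * U l b) = (if a = b then 1 else 0)"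
    "\<And>l m. l < n \<Longrightarrow> m < n \<Longrightarrow> (\<Sum>a<n. U l a * U m a) = (if l = m then 1 else 0)"
    "\<And>l. l < n \<Longrightarrow> E l \<noteq> 0 \<and> fps_nth (E l) (subdegree (E l)) > 0"
proof -
  interpret radial_kernel \<psi> \<Psi> r k by fact
  let ?K = "\<lambda>\<epsilon>. Matrix.mat n n (\<lambda>(i, j). \<psi> (\<epsilon> * norm (x i - x j)))"
  have "\<forall>l. \<exists>F. l < n \<longrightarrow> ev l has_fps_expansion F" using eig by (auto simp: analytic_eigensystem_def)
  from choice[OF this] obtain E where E: "\<And>l. l < n \<Longrightarrow> ev l has_fps_expansion E l" by blast
  have "\<forall>p. \<exists>F. fst p < n \<and> snd p < n \<longrightarrow> (\<lambda>\<epsilon>. vec_index (u (fst p) \<epsilon>) (snd p)) has_fps_expansion F"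
    using eig by (auto simp: analytic_eigensystem_def)
  from choice[OF this] obtain U' where
    U': "\<And>p. fst p < n \<and> snd p < n \<Longrightarrow> (\<lambda>\<epsilon>. vec_index (u (fst p) \<epsilon>) (snd p)) has_fps_expansion U' p"
      by blast
  define U where "U l a = U' (l, a)" for l a
  have U: "(\<lambda>\<epsilon>. vec_index (u l \<epsilon>) a) has_fps_expansion U l a" if "l < n" "a < n" for l a
    using U'[of "(l, a)"] that by (simp add: U_def)
  have ev: "\<forall>\<^sub>F \<epsilon> in nhds 0.
        (\<forall>l<n. u l \<epsilon> \<in> carrier_vec n \<and> ?K \<epsilon> *\<^sub>v u l \<epsilon> = ev l \<epsilon> \<cdot>\<^sub>v u l \<epsilon>) \<and>
        (\<forall>k<n. \<forall>l<n. scalar_prod (u k \<epsilon>) (u l \<epsilon>) = (if k = l then 1 else 0))"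
    using eig unfolding analytic_eigensystem_def by blast
  have Keq: "\<forall>\<^sub>F \<epsilon> in nhds 0. \<forall>l<n. \<forall>a<n. (\<Sum>b<n. \<psi> (\<epsilon> * norm (x a - x b)) * vec_index (u l \<epsilon>) b) =
      ev l \<epsilon> * vec_index (u l \<epsilon>) a"
    using ev
  proof eventually_elim
    case (elim \<epsilon>)
    show ?case
    proof (intro allI impI)
      fix l a assume la: "l < n" "a < n"
      have uc: "u l \<epsilon> \<in> carrier_vec n" and ke: "?K \<epsilon> *\<^sub>v u l \<epsilon> = ev l \<epsilon> \<cdot>\<^sub>v u l \<epsilon>" using elim la
        by auto
      have "vec_index (?K \<epsilon> *\<^sub>v u l \<epsilon>) a = (\<Sum>b<n. \<psi> (\<epsilon> * norm (x a - x b)) * vec_index (u l \<epsilon>) b)"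
        using uc la by (simp add: scalar_prod_def atLeast0LessThan)
      thus "(\<Sum>b<n. \<psi> (\<epsilon> * norm (x a - x b)) * vec_index (u l \<epsilon>) b) = ev l \<epsilon> * vec_index (u l \<epsilon>) a"
        unfolding ke using uc la by simp
    qed
  qed
  have on: "\<forall>\<^sub>F \<epsilon> in nhds 0. \<forall>l<n. \<forall>m<n. (\<Sum>a<n. vec_index (u l \<epsilon>) a * vec_index (u m \<epsilon>) a) = (if l =
      m then 1 else 0)"
    using ev
  proof eventually_elim
    case (elim \<epsilon>)
    show ?case
    proof (intro allI impI)
      fix l m assume lm: "l < n" "m < n"
      have "scalar_prod (u l \<epsilon>) (u m \<epsilon>) = (if l = m then 1 else 0)" "u m \<epsilon> \<in> carrier_vec n"
        using elim lm by auto
      thus "(\<Sum>a<n. vec_index (u l \<epsilon>) a * vec_index (u m \<epsilon>) a) = (if l = m then 1 else 0)"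
        by (simp add: scalar_prod_def atLeast0LessThan)
    qed
  qed
  show ?thesis
  proof (rule that[of E U])
    fix l a assume la: "l < n" "a < n"
    show "vec_index (u l 0) a = fps_nth (U l a) 0"
      using U[OF la] eventually_nhds_x_imp_x[of "\<lambda>z. eval_fps (U l a) z = vec_index (u l z) a" 0]
      by (simp add: has_fps_expansion_def eval_fps_at_0)
    have "(\<lambda>\<epsilon>. \<Sum>b<n. \<psi> (\<epsilon> * norm (x a - x b)) * vec_index (u l \<epsilon>) b) has_fps_expansion
        (\<Sum>b<n. Abs_fps (\<lambda>m. fps_nth \<Psi> m * norm (x a - x b) ^ m) * U l b)"
      by (intro has_fps_expansion_sum has_fps_expansion_mult fps_expansion_compose_scale[OF expansion] U la) simp
    moreover have "(\<lambda>\<epsilon>. ev l \<epsilon> * vec_index (u l \<epsilon>) a) has_fps_expansion E l * U l a"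
      by (intro has_fps_expansion_mult E U la)
    ultimately show "(\<Sum>b<n. Abs_fps (\<lambda>m. fps_nth \<Psi> m * norm (x a - x b) ^ m) * U l b) = E l * U l a"
      by (rule fps_expansion_unique_nhds) (use Keq la in \<open>auto elim!: eventually_mono\<close>)
  next
    fix l assume l: "l < n"
    show "u l 0 \<in> carrier_vec n" using eventually_nhds_x_imp_x[OF ev] l by blast
  next
    fix l m assume lm: "l < n" "m < n"
    have "(\<lambda>\<epsilon>. \<Sum>a<n. vec_index (u l \<epsilon>) a * vec_index (u m \<epsilon>) a) has_fps_expansion (\<Sum>a<n. U l a * U m a)"
      by (intro has_fps_expansion_sum has_fps_expansion_mult U lm) simp_all
    moreover have "(\<lambda>\<epsilon>. if l = m then 1 else 0 :: real) has_fps_expansion (if l = m then 1 else 0)"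
      by simp
    ultimately show "(\<Sum>a<n. U l a * U m a) = (if l = m then 1 else 0)"
      by (rule fps_expansion_unique_nhds) (use on lm in \<open>auto elim!: eventually_mono\<close>)
  next
    fix a b assume ab: "a < n" "b < n"
    have "(\<lambda>\<epsilon>. \<Sum>l<n. vec_index (u l \<epsilon>) a * vec_index (u l \<epsilon>) b) has_fps_expansion (\<Sum>l<n. U l a * U l b)"
      by (intro has_fps_expansion_sum has_fps_expansion_mult U ab) simp_all
    moreover have "(\<lambda>\<epsilon>. if a = b then 1 else 0 :: real) has_fps_expansion (if a = b then 1 else 0)"
      by simp
    moreover have "\<forall>\<^sub>F \<epsilon> in nhds 0. (\<Sum>l<n. vec_index (u l \<epsilon>) a * vec_index (u l \<epsilon>) b) = (if a =
        b then 1 else 0)"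
      using on
    proof eventually_elim
      case (elim \<epsilon>)
      show ?case by (rule orthogonal_real_complete[OF _ ab]) (use elim in blast)
    qed
    ultimately show "(\<Sum>l<n. U l a * U l b) = (if a = b then 1 else 0)"
      by (rule fps_expansion_unique_nhds)
  next
    fix l assume l: "l < n"
    have pos: "\<forall>\<^sub>F \<epsilon> in at_right 0. ev l \<epsilon> > 0"
    proof -
      have "\<forall>\<^sub>F \<epsilon> in at_right 0. \<forall>l<n. \<forall>a<n. (\<Sum>b<n. \<psi> (\<epsilon> * norm (x a - x b)) * vec_index (u l \<epsilon>) b) =
          ev l \<epsilon> * vec_index (u l \<epsilon>) a"
        using Keq by (simp add: eventually_nhds_conv_at eventually_at_split)
      moreover have "\<forall>\<^sub>F \<epsilon> in at_right 0. \<forall>l<n. \<forall>m<n. (\<Sum>a<n. vec_index (u l \<epsilon>) a * vec_index (u m \<epsilon>) a) = (if l = m then 1 else 0)"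
        using on by (simp add: eventually_nhds_conv_at eventually_at_split)
      ultimately show ?thesis using eventually_at_right_less[of 0]
      proof eventually_elim
        case (elim \<epsilon>)
        let ?v = "vec_index (u l \<epsilon>)"
        have one: "(\<Sum>a<n. ?v a * ?v a) = 1" using elim(2) l by simp
        have injy: "inj_on (\<lambda>a. \<epsilon> *\<^sub>R x a) {..<n}" using inj elim(3) by (auto simp: inj_on_def)
        \<comment> \<open>Positive definiteness takes weights on points, while the eigenvector has
          weights on indices; injectivity of the scaled family transports one to the other.\<close>
        define c where "c z = ?v (the_inv_into {..<n} (\<lambda>a. \<epsilon> *\<^sub>R x a) z)" for z
        have c: "c (\<epsilon> *\<^sub>R x a) = ?v a" if "a < n" for a
          unfolding c_def using the_inv_into_f_f[OF injy] that by simp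
        have "\<exists>a<n. ?v a \<noteq> 0"
        proof (rule ccontr)
          assume "\<not> ?thesis"
          hence "(\<Sum>a<n. ?v a * ?v a) = 0" by (intro sum.neutral) auto
          thus False using one by simp
        qed
        hence "\<exists>y\<in>(\<lambda>a. \<epsilon> *\<^sub>R x a) ` {..<n}. c y \<noteq> 0" using c by auto
        hence "0 < (\<Sum>y\<in>(\<lambda>a. \<epsilon> *\<^sub>R x a) ` {..<n}. \<Sum>z\<in>(\<lambda>a. \<epsilon> *\<^sub>R x a) ` {..<n}. c y * c z * k y z)"
          by (intro pd[unfolded positive_definite_kernel_def, THEN conjunct2, rule_format] conjI) simp_all
        also have "\<dots> = (\<Sum>a<n. \<Sum>b<n. ?v a * ?v b * \<psi> (\<epsilon> * norm (x a - x b)))"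
          unfolding sum.reindex[OF injy] o_def using elim(3)
          by (intro sum.cong refl) (simp add: c k_def flip: scaleR_diff_right)
        also have "\<dots> = (\<Sum>a<n. ?v a * (\<Sum>b<n. \<psi> (\<epsilon> * norm (x a - x b)) * ?v b))"
          by (simp add: sum_distrib_left mult_ac)
        also have "\<dots> = (\<Sum>a<n. ev l \<epsilon> * (?v a * ?v a))"
          using elim(1) l by (intro sum.cong refl) (simp add: mult_ac)
        also have "\<dots> = ev l \<epsilon>" using one by (simp flip: sum_distrib_left)
        finally show ?case .
      qed
    qed
    have nz: "E l \<noteq> 0"
    proof
      assume "E l = 0"
      hence "ev l has_fps_expansion 0" using E[OF l] by simp
      hence "\<forall>\<^sub>F \<epsilon> in nhds 0. ev l \<epsilon> = 0"
        by (auto simp: has_fps_expansion_def elim!: eventually_mono)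
      hence "\<forall>\<^sub>F \<epsilon> in at_right 0. ev l \<epsilon> = 0"
        by (simp add: eventually_nhds_conv_at eventually_at_split)
      with pos have "\<forall>\<^sub>F \<epsilon>::real in at_right 0. False" by eventually_elim simp
      thus False by simp
    qed
    have "((\<lambda>t. ev l t / t ^ subdegree (E l)) \<longlongrightarrow> fps_nth (E l) (subdegree (E l))) (at 0)"
      by (rule has_fps_expansion_tendsto_nth[OF E[OF l]]) auto
    hence "((\<lambda>t. ev l t / t ^ subdegree (E l)) \<longlongrightarrow> fps_nth (E l) (subdegree (E l))) (at_right 0)"
      by (simp add: filterlim_at_split)
    moreover have "\<forall>\<^sub>F t in at_right 0. ev l t / t ^ subdegree (E l) \<ge> 0"
      using pos eventually_at_right_less[of 0] by eventually_elim simp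
    ultimately have "fps_nth (E l) (subdegree (E l)) \<ge> 0" by (rule tendsto_lowerbound) simp
    thus "E l \<noteq> 0 \<and> fps_nth (E l) (subdegree (E l)) > 0" using nz by (simp add: less_le)
  qed (rule E)
qed

subsection \<open>Block QR decompositions\<close>

locale qr_setting =
  fixes \<psi> :: "real \<Rightarrow> real" and \<Psi> :: "real fps" and r :: nat
    and k :: "real ^ 'd::{finite,linorder} \<Rightarrow> real ^ 'd::{finite,linorder} \<Rightarrow> real"
    and n :: nat and x :: "nat \<Rightarrow> real ^ 'd::{finite,linorder}"
    and mons :: "nat \<Rightarrow> ('d::{finite,linorder} \<Rightarrow> nat) list"
    and Q :: "nat \<Rightarrow> real mat" and R :: "nat \<Rightarrow> nat \<Rightarrow> real mat" and d :: nat
  assumes d: "d = CARD('d)" and rk: "radial_kernel \<psi> \<Psi> r k"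
    and inj: "inj_on x {..<n}"
    and ordering: "monomial_ordering mons"
    and qr: "block_qr d n r (vandermonde_le n x mons) Q R"
begin

interpretation radial_kernel \<psi> \<Psi> r k by (rule rk)

abbreviation "V \<equiv> vandermonde n x mons"
abbreviation "Vle \<equiv> vandermonde_le n x mons"
abbreviation "h l \<equiv> hdim l d"
abbreviation "b \<equiv> rank_increment Vle"
abbreviation "ann \<equiv> annihilates {..<n} x"

lemma set_mons: "set (mons s) = multi_indices s" and distinct_mons: "distinct (mons s)"
  using ordering by (auto simp: monomial_ordering_def multi_indices_def mdeg_def)

lemma length_mons: "length (mons s) = h s"
  using distinct_card[OF distinct_mons, of s] by (simp add: set_mons card_multi_indices d)

lemma sum_multi_indices: "(\<Sum>\<alpha>\<in>multi_indices s. f \<alpha>) = (\<Sum>t<h s. f (mons s ! t))"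
proof -
  have "(\<Sum>\<alpha>\<in>multi_indices s. f \<alpha>) = (\<Sum>\<alpha>\<leftarrow>mons s. f \<alpha>)"
    using sum_list_distinct_conv_sum_set[OF distinct_mons, of f s] by (simp add: set_mons)
  thus ?thesis by (simp add: sum_list_sum_nth length_mons atLeast0LessThan)
qed

lemma V_carrier: "V l \<in> carrier_mat n (h l)"
  by (simp add: vandermonde_def length_mons)

lemma V_index: "a < n \<Longrightarrow> t < h l \<Longrightarrow> V l $$ (a, t) = monomial (mons l ! t) (x a)"
  by (simp add: vandermonde_def length_mons)

lemma Vle_carrier: "Vle j \<in> carrier_mat n (offset h (Suc j))"
  unfolding vandermonde_le_def by (rule hcat_blocks(1)) (auto simp: V_carrier)

lemma Vle_index: "l \<le> j \<Longrightarrow> a < n \<Longrightarrow> t < h l \<Longrightarrow> Vle j $$ (a, offset h l + t) = V l $$ (a, t)"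
  unfolding vandermonde_le_def by (rule hcat_blocks(2)) (auto simp: V_carrier)

text \<open>The link between the function view of moments and the columns of the Vandermonde
  blocks.\<close>

lemma annihilates_iff: "ann s v \<longleftrightarrow> (\<forall>l<s. \<forall>t<h l. (\<Sum>a<n. v a * V l $$ (a, t)) = 0)"
proof -
  have "(\<Sum>a<n. v a * V l $$ (a, t)) = (\<Sum>a<n. v a * monomial (mons l ! t) (x a))" if "t < h l"
    for l t
    using that by (intro sum.cong refl) (simp add: V_index)
  moreover have "(\<forall>\<alpha>. mdeg \<alpha> < s \<longrightarrow> p \<alpha>) \<longleftrightarrow> (\<forall>l<s. \<forall>t<h l. p (mons l ! t))" for p
  proof
    assume *: "\<forall>\<alpha>. mdeg \<alpha> < s \<longrightarrow> p \<alpha>"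
    show "\<forall>l<s. \<forall>t<h l. p (mons l ! t)"
    proof (intro allI impI)
      fix l t assume "l < s" "t < h l"
      hence "mons l ! t \<in> multi_indices l" using set_mons[of l] length_mons[of l] nth_mem by metis
      thus "p (mons l ! t)" using * \<open>l < s\<close> by (simp add: multi_indices_def)
    qed
  next
    assume *: "\<forall>l<s. \<forall>t<h l. p (mons l ! t)"
    show "\<forall>\<alpha>. mdeg \<alpha> < s \<longrightarrow> p \<alpha>"
    proof (intro allI impI)
      fix \<alpha> :: "'d \<Rightarrow> nat" assume "mdeg \<alpha> < s"
      moreover have "\<alpha> \<in> set (mons (mdeg \<alpha>))" by (simp add: set_mons multi_indices_def)
      then obtain t where "t < h (mdeg \<alpha>)" "\<alpha> = mons (mdeg \<alpha>) ! t"
        by (metis in_set_conv_nth length_mons)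
      ultimately show "p \<alpha>" using * by metis
    qed
  qed
  ultimately show ?thesis unfolding annihilates_def by simp
qed

lemma Q_carrier: "i < r \<Longrightarrow> Q i \<in> carrier_mat n (b i)"
  and R_carrier: "i < r \<Longrightarrow> l < r \<Longrightarrow> R i l \<in> carrier_mat (b i) (h l)"
  and R_lower: "i < r \<Longrightarrow> l < i \<Longrightarrow> R i l = 0\<^sub>m (b i) (h l)"
  using qr by (auto simp: block_qr_def)

lemma Q_orth:
  assumes "i < r" "l < r" "s < b i" "t < b l"
  shows "(\<Sum>a<n. Q i $$ (a, s) * Q l $$ (a, t)) = (if i = l \<and> s = t then 1 else 0)"
proof -
  let ?Q = "hcat (map Q [0..<r])"
  have r: "r > 0" using r_pos by simp
  have Qc: "?Q \<in> carrier_mat n (offset b r)" by (rule hcat_blocks(1)[OF r]) (rule Q_carrier)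
  have Qe: "?Q $$ (a, offset b i + s) = Q i $$ (a, s)" if "i < r" "a < n" "s < b i" for i a s
    using hcat_blocks(2)[OF r, of Q n b] Q_carrier that by blast
  have o: "offset b i + s < offset b r" "offset b l + t < offset b r"
    using assms offset_less[of _ r _ b] by auto
  have "transpose_mat ?Q * ?Q = 1\<^sub>m (dim_col ?Q)" using qr by (simp add: block_qr_def Let_def)
  hence "(transpose_mat ?Q * ?Q) $$ (offset b i + s, offset b l + t) =
      1\<^sub>m (dim_col ?Q) $$ (offset b i + s, offset b l + t)" by simp
  also have "\<dots> = (if offset b i + s = offset b l + t then 1 else 0)" using o Qc by simp
  also have "(offset b i + s = offset b l + t) \<longleftrightarrow> (i = l \<and> s = t)"
    using offset_inj[of b i s l t] assms by auto
  also have "(transpose_mat ?Q * ?Q) $$ (offset b i + s, offset b l + t) =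
      (\<Sum>a<n. ?Q $$ (a, offset b i + s) * ?Q $$ (a, offset b l + t))"
    using o Qc by (simp add: scalar_prod_def atLeast0LessThan)
  also have "\<dots> = (\<Sum>a<n. Q i $$ (a, s) * Q l $$ (a, t))"
    by (intro sum.cong refl) (simp add: Qe assms)
  finally show ?thesis .
qed

text \<open>Only the blocks m <= i of Q occur, because R is block upper triangular and l <=
  i.\<close>

lemma V_QR:
  assumes l: "l \<le> i" "i < r" and a: "a < n" and t: "t < h l"
  shows "V l $$ (a, t) = (\<Sum>m<Suc i. \<Sum>s<b m. Q m $$ (a, s) * R m l $$ (s, t))"
proof -
  let ?Q = "hcat (map Q [0..<r])" and ?R = "block_mat [0..<r] [0..<r] R"
  have r: "r > 0" using r_pos by simp
  have Qc: "?Q \<in> carrier_mat n (offset b r)" by (rule hcat_blocks(1)[OF r]) (rule Q_carrier)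
  have Qe: "?Q $$ (a, offset b i + s) = Q i $$ (a, s)" if "i < r" "a < n" "s < b i" for i a s
    using hcat_blocks(2)[OF r, of Q n b] Q_carrier that by blast
  have Rc: "?R \<in> carrier_mat (offset b r) (offset h r)"
    by (rule block_mat_blocks(1)[OF r r]) (rule R_carrier)
  have Re: "?R $$ (offset b i + s, offset h l + t) = R i l $$ (s, t)"
    if "i < r" "l < r" "s < b i" "t < h l" for i l s t
    using block_mat_blocks(2)[OF r r, of R b h] R_carrier that by blast
  have o: "offset h l + t < offset h r" using l t by (intro offset_less) auto
  have "Vle (r - 1) = ?Q * ?R" using qr by (simp add: block_qr_def Let_def)
  hence "V l $$ (a, t) = (?Q * ?R) $$ (a, offset h l + t)"
    using Vle_index[of l "r - 1" a t] l a t by simp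
  also have "\<dots> = (\<Sum>c<offset b r. ?Q $$ (a, c) * ?R $$ (c, offset h l + t))"
    using o Qc Rc a by (simp add: scalar_prod_def atLeast0LessThan)
  also have "\<dots> = (\<Sum>m<r. \<Sum>s<b m. Q m $$ (a, s) * R m l $$ (s, t))"
    unfolding sum_offset using l t a by (intro sum.cong refl) (simp add: Qe Re)
  also have "\<dots> = (\<Sum>m<Suc i. \<Sum>s<b m. Q m $$ (a, s) * R m l $$ (s, t))"
  proof (rule sum.mono_neutral_right)
    show "\<forall>m\<in>{..<r} - {..<Suc i}. (\<Sum>s<b m. Q m $$ (a, s) * R m l $$ (s, t)) = 0"
      using l t by (intro ballI sum.neutral) (simp add: R_lower)
  qed (use l in auto)
  finally show ?thesis .
qed

lemma QV:
  assumes "i < r" "l < r" "s < b i" "t < h l"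
  shows "(\<Sum>a<n. Q i $$ (a, s) * V l $$ (a, t)) = R i l $$ (s, t)"
proof -
  have "(\<Sum>a<n. Q i $$ (a, s) * V l $$ (a, t)) =
     (\<Sum>a<n. \<Sum>m<r. \<Sum>s'<b m. Q i $$ (a, s) * Q m $$ (a, s') * R m l $$ (s', t))"
    using V_QR[of l "r - 1" _ t] assms by (intro sum.cong refl) (simp add: sum_distrib_left mult_ac)
  also have "\<dots> = (\<Sum>m<r. \<Sum>s'<b m. \<Sum>a<n. Q i $$ (a, s) * Q m $$ (a, s') * R m l $$ (s', t))"
    by (subst sum.swap, rule sum.cong[OF refl], rule sum.swap)
  also have "\<dots> = (\<Sum>m<r. \<Sum>s'<b m. if m = i then (if s' = s then R i l $$ (s, t) else 0) else 0)"
    using assms by (intro sum.cong refl) (auto simp: Q_orth simp flip: sum_distrib_right)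
  also have "\<dots> = (\<Sum>m<r. if m = i then R i l $$ (s, t) else 0)"
    using assms by (intro sum.cong refl) auto
  also have "\<dots> = R i l $$ (s, t)" using assms by simp
  finally show ?thesis .
qed

text \<open>The moments of the columns of Q_i of degree l are the entries of R_(i,l), which vanish
  below the diagonal.\<close>

lemma ann_Q: "i < r \<Longrightarrow> s < b i \<Longrightarrow> ann i (\<lambda>a. Q i $$ (a, s))"
  unfolding annihilates_iff by (auto simp: QV R_lower)

lemma ann_if_orth:
  assumes i: "i < r" and v: "\<And>l s. l \<le> i \<Longrightarrow> s < b l \<Longrightarrow> (\<Sum>a<n. Q l $$ (a, s) * v a) = 0"
  shows "ann (Suc i) v"
  unfolding annihilates_iff
proof (intro allI impI)
  fix l t assume lt: "l < Suc i" "t < h l"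
  have "(\<Sum>a<n. v a * V l $$ (a, t)) =
      (\<Sum>a<n. \<Sum>m<Suc i. \<Sum>s<b m. R m l $$ (s, t) * (Q m $$ (a, s) * v a))"
    using V_QR[of l i _ t] lt i by (intro sum.cong refl) (simp add: sum_distrib_left mult_ac del: sum.lessThan_Suc)
  also have "\<dots> = (\<Sum>m<Suc i. \<Sum>s<b m. \<Sum>a<n. R m l $$ (s, t) * (Q m $$ (a, s) * v a))"
    by (subst sum.swap, rule sum.cong[OF refl], rule sum.swap)
  also have "\<dots> = 0" using v by (simp flip: sum_distrib_left del: sum.lessThan_Suc)
  finally show "(\<Sum>a<n. v a * V l $$ (a, t)) = 0" .
qed

end

section \<open>The QR blocks when the Vandermonde matrix has full column rank\<close>

locale qr_full = qr_setting +
  fixes j :: nat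
  assumes j: "j \<le> r - 1" and full: "full_column_rank (vandermonde_le n x mons j)"
begin

interpretation radial_kernel \<psi> \<Psi> r k by (rule rk)

lemma V_injective:
  assumes "i \<le> j" and z: "\<And>a. a < n \<Longrightarrow> (\<Sum>l<Suc i. \<Sum>t<h l. V l $$ (a, t) * f l t) = 0"
    and lt: "l \<le> i" "t < h l"
  shows "f l t = 0"
proof -
  define g where "g l t = (if l \<le> i then f l t else 0)" for l t
  have c: "full_column_rank (hcat (map V [0..<Suc j]))" using full unfolding vandermonde_le_def .
  have inj: "\<forall>f. (\<forall>a<n. (\<Sum>l<Suc j. \<Sum>t<h l. V l $$ (a, t) * f l t) = 0) \<longrightarrow> (\<forall>l<Suc j. \<forall>t<h l. f l t =
      0)"
    by (rule full_column_rank_blocks[THEN iffD1, OF _ _ c]) (simp, rule V_carrier)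
  have "\<forall>a<n. (\<Sum>l<Suc j. \<Sum>t<h l. V l $$ (a, t) * g l t) = 0"
  proof (intro allI impI)
    fix a assume a: "a < n"
    have "(\<Sum>l<Suc j. \<Sum>t<h l. V l $$ (a, t) * g l t) = (\<Sum>l<Suc i. \<Sum>t<h l. V l $$ (a, t) * g l t)"
      by (rule sum.mono_neutral_right) (use assms(1) in \<open>auto simp: g_def\<close>)
    also have "\<dots> = (\<Sum>l<Suc i. \<Sum>t<h l. V l $$ (a, t) * f l t)"
      by (intro sum.cong refl) (simp add: g_def)
    finally show "(\<Sum>l<Suc j. \<Sum>t<h l. V l $$ (a, t) * g l t) = 0" using z[OF a] by simp
  qed
  hence "\<forall>l<Suc j. \<forall>t<h l. g l t = 0" using inj by blast
  hence "g l t = 0" using lt assms(1) by simp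
  thus ?thesis using lt by (simp add: g_def)
qed

lemma rank_Vle: "i \<le> j \<Longrightarrow> mat_rank (Vle i) = offset h (Suc i)"
proof -
  assume i: "i \<le> j"
  have "full_column_rank (hcat (map V [0..<Suc i]))"
  proof (rule full_column_rank_blocks[THEN iffD2])
    show "\<forall>f. (\<forall>a<n. (\<Sum>l<Suc i. \<Sum>t<h l. V l $$ (a, t) * f l t) = 0) \<longrightarrow> (\<forall>l<Suc i. \<forall>t<h l. f l t = 0)"
    proof (intro allI impI)
      fix f :: "nat \<Rightarrow> nat \<Rightarrow> real" and l t
      assume z: "\<forall>a<n. (\<Sum>l<Suc i. \<Sum>t<h l. V l $$ (a, t) * f l t) = 0" and lt: "l < Suc i" "t < h l"
      show "f l t = 0"
        by (rule V_injective[OF i, of f]) (rule z[rule_format], assumption, use lt in simp_all)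
    qed
  qed (simp, rule V_carrier)
  hence "full_column_rank (Vle i)" unfolding vandermonde_le_def .
  thus ?thesis using Vle_carrier[of i] by (auto simp: full_column_rank_def)
qed

text \<open>Full column rank of V_(<= j) passes to all V_(<= i) with i <= j, so the rank increments
  are the full numbers of monomials and the diagonal blocks of R are square.\<close>

lemma b_eq_h: "i \<le> j \<Longrightarrow> b i = h i"
  using rank_Vle[of i] rank_Vle[of "i - 1"] by (cases i) (auto simp: rank_increment_def offset_def)

lemma less_r: "i \<le> j \<Longrightarrow> i < r"
  using j r_pos by linarith

lemma R_upper_carrier:
  assumes "i \<le> j" "m < Suc i" "l < Suc i"
  shows "R m l \<in> carrier_mat (h m) (h l)"
  using R_carrier[of m l] b_eq_h[of m] less_r assms by simp

lemma V_comb: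
  assumes i: "i \<le> j" and a: "a < n"
  shows "(\<Sum>l<Suc i. \<Sum>t<h l. V l $$ (a, t) * f l t) =
      (\<Sum>m<Suc i. \<Sum>s<b m. Q m $$ (a, s) * (\<Sum>l<Suc i. \<Sum>t<h l. R m l $$ (s, t) * f l t))"
proof -
  have "(\<Sum>l<Suc i. \<Sum>t<h l. V l $$ (a, t) * f l t) =
     (\<Sum>l<Suc i. \<Sum>t<h l. \<Sum>m<Suc i. \<Sum>s<b m. Q m $$ (a, s) * (R m l $$ (s, t) * f l t))"
    using V_QR[of _ i a] less_r[OF i] a
    by (intro sum.cong refl) (simp add: sum_distrib_right mult.assoc del: sum.lessThan_Suc)
  also have "\<dots> = (\<Sum>l<Suc i. \<Sum>m<Suc i. \<Sum>t<h l. \<Sum>s<b m. Q m $$ (a, s) * (R m l $$ (s, t) * f l t))"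
    by (rule sum.cong[OF refl]) (rule sum.swap)
  also have "\<dots> = (\<Sum>m<Suc i. \<Sum>l<Suc i. \<Sum>t<h l. \<Sum>s<b m. Q m $$ (a, s) * (R m l $$ (s, t) * f l t))"
    by (rule sum.swap)
  also have "\<dots> = (\<Sum>m<Suc i. \<Sum>l<Suc i. \<Sum>s<b m. \<Sum>t<h l. Q m $$ (a, s) * (R m l $$ (s, t) * f l t))"
    by (rule sum.cong[OF refl], rule sum.cong[OF refl], rule sum.swap)
  also have "\<dots> = (\<Sum>m<Suc i. \<Sum>s<b m. \<Sum>l<Suc i. \<Sum>t<h l. Q m $$ (a, s) * (R m l $$ (s, t) * f l t))"
    by (rule sum.cong[OF refl], rule sum.swap)
  finally show ?thesis by (simp add: sum_distrib_left del: sum.lessThan_Suc)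
qed

text \<open>A kernel vector of the leading part of R is a kernel vector of V_(<= i) = Q R.\<close>

lemma det_R:
  assumes i: "i \<le> j"
  shows "det (block_mat [0..<Suc i] [0..<Suc i] R) \<noteq> 0"
proof (subst det_block_mat_nonzero_iff[of "Suc i" R h])
  show "\<forall>f. (\<forall>m<Suc i. \<forall>s<h m. (\<Sum>l<Suc i. \<Sum>t<h l. R m l $$ (s, t) * f l t) = 0) \<longrightarrow>
      (\<forall>m<Suc i. \<forall>s<h m. f m s = 0)"
  proof (intro allI impI)
    fix f :: "nat \<Rightarrow> nat \<Rightarrow> real" and l t
    assume z: "\<forall>m<Suc i. \<forall>s<h m. (\<Sum>l<Suc i. \<Sum>t<h l. R m l $$ (s, t) * f l t) = 0"
      and lt: "l < Suc i" "t < h l"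
    show "f l t = 0"
    proof (rule V_injective[OF i])
      fix a assume a: "a < n"
      show "(\<Sum>l<Suc i. \<Sum>t<h l. V l $$ (a, t) * f l t) = 0"
        unfolding V_comb[OF i a] using z i b_eq_h
          by (intro sum.neutral ballI) (simp del: sum.lessThan_Suc)
    qed (use lt in auto)
  qed
qed (use R_upper_carrier[OF i] in auto)

lemma Q_in_range_V:
  assumes i: "i \<le> j"
  obtains f where "\<And>a. a < n \<Longrightarrow> (\<Sum>s<b i. c s * Q i $$ (a, s)) =
      (\<Sum>l<Suc i. \<Sum>t<h l. V l $$ (a, t) * f l t)"
proof -
  obtain f where f: "\<And>m s. m < Suc i \<Longrightarrow> s < h m \<Longrightarrow>
      (\<Sum>l<Suc i. \<Sum>t<h l. R m l $$ (s, t) * f l t) = (if m = i then c s else 0)"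
    using block_mat_solve[of "Suc i" R h "\<lambda>m s. if m =
        i then c s else 0"] R_upper_carrier[OF i] det_R[OF i] by blast
  have "(\<Sum>s<b i. c s * Q i $$ (a, s)) = (\<Sum>l<Suc i. \<Sum>t<h l. V l $$ (a, t) * f l t)" if a: "a < n"
    for a
  proof -
    have "(\<Sum>l<Suc i. \<Sum>t<h l. V l $$ (a, t) * f l t) = (\<Sum>m<Suc i. \<Sum>s<b m. Q m $$ (a, s) * (if m =
        i then c s else 0))"
      unfolding V_comb[OF i a] using f i b_eq_h
        by (intro sum.cong refl) (simp del: sum.lessThan_Suc)
    also have "\<dots> = (\<Sum>m<Suc i. if m = i then (\<Sum>s<b m. Q m $$ (a, s) * c s) else 0)"
      by (intro sum.cong refl) simp
    also have "\<dots> = (\<Sum>s<b i. c s * Q i $$ (a, s))" by (simp add: mult.commute)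
    finally show ?thesis ..
  qed
  thus ?thesis by (rule that)
qed

text \<open>A combination of columns of Q_i lies in the range of V_(<= i), by inverting R, and
  annihilation makes it orthogonal to that range. It is therefore 0, and orthonormality recovers the
  coefficients. This is the nondegeneracy that the spectral argument requires of a level.\<close>

lemma ann_Q_comb_imp_0:
  assumes i: "i \<le> j" and an: "ann (Suc i) (\<lambda>a. \<Sum>s<b i. c s * Q i $$ (a, s))" and s: "s < b i"
  shows "c s = 0"
proof -
  let ?y = "\<lambda>a. \<Sum>s<b i. c s * Q i $$ (a, s)"
  obtain f where f: "\<And>a. a < n \<Longrightarrow> ?y a = (\<Sum>l<Suc i. \<Sum>t<h l. V l $$ (a, t) * f l t)"
    using Q_in_range_V[OF i, of c] by blast
  have "(\<Sum>a<n. ?y a * ?y a) = (\<Sum>a<n. \<Sum>l<Suc i. \<Sum>t<h l. f l t * (?y a * V l $$ (a, t)))"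
    by (intro sum.cong refl, subst (2) f) (simp_all add: sum_distrib_left mult_ac del: sum.lessThan_Suc)
  also have "\<dots> = (\<Sum>l<Suc i. \<Sum>t<h l. \<Sum>a<n. f l t * (?y a * V l $$ (a, t)))"
    by (subst sum.swap, rule sum.cong[OF refl], rule sum.swap)
  also have "\<dots> = 0"
    using an unfolding annihilates_iff by (simp flip: sum_distrib_left del: sum.lessThan_Suc)
  finally have "?y a = 0" if "a < n" for a
    using that by (subst (asm) sum_nonneg_eq_0_iff) auto
  hence "0 = (\<Sum>a<n. Q i $$ (a, s) * ?y a)" by simp
  also have "\<dots> = (\<Sum>a<n. \<Sum>t<b i. c t * (Q i $$ (a, s) * Q i $$ (a, t)))"
    by (simp add: sum_distrib_left mult_ac)
  also have "\<dots> = (\<Sum>t<b i. c t * (\<Sum>a<n. Q i $$ (a, s) * Q i $$ (a, t)))"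
    by (subst sum.swap) (simp add: sum_distrib_left)
  also have "\<dots> = (\<Sum>t<b i. if t = s then c t else 0)"
    using s less_r[OF i] by (intro sum.cong refl) (auto simp: Q_orth)
  also have "\<dots> = c s" using s by simp
  finally show ?thesis ..
qed

text \<open>If R_(i,i)^T c = 0, the combination Q_i c annihilates degree i as well as all lower
  degrees, so the previous nondegeneracy applies.\<close>

lemma R_diag_transpose_injective:
  assumes i: "i \<le> j" and z: "\<And>t. t < h i \<Longrightarrow> (\<Sum>s<b i. R i i $$ (s, t) * c s) = 0" and s: "s < b i"
  shows "c s = 0"
proof (rule ann_Q_comb_imp_0[OF i _ s])
  show "ann (Suc i) (\<lambda>a. \<Sum>s<b i. c s * Q i $$ (a, s))"
    unfolding annihilates_iff
  proof (intro allI impI)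
    fix l t assume lt: "l < Suc i" "t < h l"
    have "(\<Sum>a<n. (\<Sum>s<b i. c s * Q i $$ (a, s)) * V l $$ (a, t)) =
        (\<Sum>s<b i. c s * (\<Sum>a<n. Q i $$ (a, s) * V l $$ (a, t)))"
      unfolding sum_distrib_right sum_distrib_left by (subst sum.swap) (simp add: mult_ac)
    also have "\<dots> = (\<Sum>s<b i. c s * R i l $$ (s, t))"
      using lt less_r[OF i] by (intro sum.cong refl) (simp add: QV)
    also have "\<dots> = 0"
    proof (cases "l = i")
      case True
      thus ?thesis using z lt by (simp add: mult.commute)
    next
      case False
      thus ?thesis using lt less_r[OF i] by (intro sum.neutral) (simp add: R_lower)
    qed
    finally show "(\<Sum>a<n. (\<Sum>s<b i. c s * Q i $$ (a, s)) * V l $$ (a, t)) = 0" .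
  qed
qed

lemma R_diag_transpose_surjective:
  assumes i: "i \<le> j"
  obtains c where "\<And>t. t < h i \<Longrightarrow> (\<Sum>s<b i. R i i $$ (s, t) * c s) = g t"
proof -
  have Rc: "R i i \<in> carrier_mat (h i) (h i)"
    using R_carrier[OF less_r[OF i] less_r[OF i]] b_eq_h[OF i] by simp
  let ?A = "transpose_mat (R i i)"
  have A: "?A \<in> carrier_mat (h i) (h i)" using Rc by simp
  have Av: "vec_index (?A *\<^sub>v v) t = (\<Sum>s<b i. R i i $$ (s, t) * vec_index v s)"
    if "v \<in> carrier_vec (h i)" "t < h i" for v t
    using that Rc b_eq_h[OF i] by (simp add: scalar_prod_def atLeast0LessThan)
  have "det ?A \<noteq> 0"
    unfolding det_nonzero_iff_injective[OF A]
  proof (intro ballI impI)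
    fix v assume v: "v \<in> carrier_vec (h i)" and z: "?A *\<^sub>v v = 0\<^sub>v (h i)"
    show "v = 0\<^sub>v (h i)"
    proof (rule eq_vecI)
      fix s assume "s < dim_vec (0\<^sub>v (h i) :: real Matrix.vec)"
      hence s: "s < h i" by simp
      have "vec_index v s = 0"
        by (rule R_diag_transpose_injective[OF i]) (use Av[OF v] z s b_eq_h[OF i] in auto)
      thus "vec_index v s = vec_index (0\<^sub>v (h i)) s" using s by simp
    qed (use v in auto)
  qed
  note I = mat_inv_det_nonzero[OF A this]
  define c where "c = mat_inv ?A *\<^sub>v vec (h i) g"
  have c: "c \<in> carrier_vec (h i)" using I(1) by (simp add: c_def)
  have "?A *\<^sub>v c = (?A * mat_inv ?A) *\<^sub>v vec (h i) g"
    unfolding c_def by (rule assoc_mult_mat_vec[OF A I(1), symmetric]) simp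
  hence "?A *\<^sub>v c = vec (h i) g" using I(2) by simp
  hence "(\<Sum>s<b i. R i i $$ (s, t) * vec_index c s) = g t" if "t < h i" for t
    using Av[OF c that] that by simp
  thus ?thesis by (rule that)
qed

end

lemma mult_mat_index_sum:
  assumes "A \<in> carrier_mat n m" "B \<in> carrier_mat m p" "i < n" "l < p"
  shows "(A * B) $$ (i, l) = (\<Sum>c<m. A $$ (i, c) * B $$ (c, l))"
  using assms by (simp add: scalar_prod_def atLeast0LessThan)

section \<open>The compressed Wronskian blocks\<close>

context qr_full
begin

abbreviation "W \<equiv> wronskian k mons"
abbreviation "H i l \<equiv> R i i * W i l * transpose_mat (R l l)"

lemma W_carrier: "W i l \<in> carrier_mat (h i) (h l)"
  by (simp add: wronskian_def length_mons)

lemma W_index: "s < h i \<Longrightarrow> t < h l \<Longrightarrow> W i l $$ (s, t) = wronskian_coeff k (mons i ! s) (mons l ! t)"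
  by (simp add: wronskian_def wronskian_coeff_def length_mons)

lemma R_diag_carrier: "i \<le> j \<Longrightarrow> R i i \<in> carrier_mat (b i) (h i)"
  using R_carrier less_r by simp

lemma H_carrier: "i \<le> j \<Longrightarrow> l \<le> j \<Longrightarrow> H i l \<in> carrier_mat (b i) (b l)"
  using R_diag_carrier[of i] R_diag_carrier[of l] W_carrier[of i l] by simp

lemma H_index:
  assumes "i \<le> j" "l \<le> j" "s < b i" "t < b l"
  shows "H i l $$ (s, t) = (\<Sum>\<alpha><h i. \<Sum>\<beta><h l. R i i $$ (s, \<alpha>) * W i l $$ (\<alpha>, \<beta>) * R l l $$ (t, \<beta>))"
proof -
  note Ri = R_diag_carrier[OF assms(1)] and Rl = R_diag_carrier[OF assms(2)]
    and Wil = W_carrier[of i l]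
  have RW: "R i i * W i l \<in> carrier_mat (b i) (h l)"
    and RT: "transpose_mat (R l l) \<in> carrier_mat (h l) (b l)"
    using Ri Rl Wil by auto
  have "H i l $$ (s, t) = (\<Sum>\<beta><h l. (R i i * W i l) $$ (s, \<beta>) * R l l $$ (t, \<beta>))"
    unfolding mult_mat_index_sum[OF RW RT assms(3,4)] using Rl assms by (intro sum.cong refl) simp
  also have "\<dots> = (\<Sum>\<beta><h l. \<Sum>\<alpha><h i. R i i $$ (s, \<alpha>) * W i l $$ (\<alpha>, \<beta>) * R l l $$ (t, \<beta>))"
    using mult_mat_index_sum[OF Ri Wil assms(3)]
      by (intro sum.cong refl) (simp add: sum_distrib_right)
  finally show ?thesis by (subst sum.swap)
qed

text \<open>Identifies the blocks of H with the coefficient forms of the kernel on the columns of Q;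
  through it the definiteness results apply to H.\<close>

lemma H_form:
  assumes "i \<le> j" "l \<le> j" "s < b i" "t < b l"
  shows "H i l $$ (s, t) = kernel_form \<Psi> {..<n} x (i + l) (\<lambda>a. Q i $$ (a, s)) (\<lambda>a. Q l $$ (a, t))"
proof -
  have il: "i < r" "l < r" "i + l \<le> 2 * r - 2" using assms less_r by (auto dest!: less_r)
  have QR: "(\<Sum>a<n. Q i $$ (a, s) * monomial (mons i ! \<alpha>) (x a)) = R i i $$ (s, \<alpha>)"
    if "i < r" "s < b i" "\<alpha> < h i" for i s \<alpha>
    using QV[of i i s \<alpha>] that by (simp add: V_index)
  have "kernel_form \<Psi> {..<n} x (i + l) (\<lambda>a. Q i $$ (a, s)) (\<lambda>a. Q l $$ (a, t)) =
    (\<Sum>\<alpha><h i. \<Sum>\<beta><h l. wronskian_coeff k (mons i ! \<alpha>) (mons l ! \<beta>) * R i i $$ (s, \<alpha>) * R l l $$ (t, \<beta>))"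
    unfolding kernel_form_wronskian[OF rk ann_Q[OF il(1) assms(3)] ann_Q[OF il(2) assms(4)] il(3)] sum_multi_indices
    using il assms by (intro sum.cong refl) (simp add: QR)
  thus ?thesis unfolding H_index[OF assms]
    by (simp add: W_index mult_ac)
qed

lemma H_sym: "i \<le> j \<Longrightarrow> l \<le> j \<Longrightarrow> s < b i \<Longrightarrow> t < b l \<Longrightarrow> H i l $$ (s, t) = H l i $$ (t, s)"
  using kernel_form_commute by (simp only: H_form add.commute)

lemma H_comb:
  assumes il: "i \<le> j" "l \<le> j" "s < b i"
    and y: "\<And>\<beta>. \<beta> < h l \<Longrightarrow> (\<Sum>t<b l. R l l $$ (t, \<beta>) * y t) = f \<beta>"
  shows "(\<Sum>t<b l. H i l $$ (s, t) * y t) =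
      (\<Sum>\<alpha><h i. R i i $$ (s, \<alpha>) * (\<Sum>\<beta><h l. W i l $$ (\<alpha>, \<beta>) * f \<beta>))"
proof -
  have "(\<Sum>t<b l. H i l $$ (s, t) * y t) =
     (\<Sum>t<b l. \<Sum>\<alpha><h i. \<Sum>\<beta><h l. R i i $$ (s, \<alpha>) * (W i l $$ (\<alpha>, \<beta>) * (R l l $$ (t, \<beta>) * y t)))"
    using il by (intro sum.cong refl) (simp add: H_index sum_distrib_right mult.assoc)
  also have "\<dots> =
      (\<Sum>\<alpha><h i. \<Sum>t<b l. \<Sum>\<beta><h l. R i i $$ (s, \<alpha>) * (W i l $$ (\<alpha>, \<beta>) * (R l l $$ (t, \<beta>) * y t)))"
    by (rule sum.swap)
  also have "\<dots> =
      (\<Sum>\<alpha><h i. \<Sum>\<beta><h l. \<Sum>t<b l. R i i $$ (s, \<alpha>) * (W i l $$ (\<alpha>, \<beta>) * (R l l $$ (t, \<beta>) * y t)))"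
    by (rule sum.cong[OF refl], rule sum.swap)
  also have "\<dots> = (\<Sum>\<alpha><h i. \<Sum>\<beta><h l. R i i $$ (s, \<alpha>) * (W i l $$ (\<alpha>, \<beta>) * f \<beta>))"
    by (intro sum.cong refl) (simp add: y flip: sum_distrib_left)
  finally show ?thesis by (simp add: sum_distrib_left)
qed

text \<open>The variant with transposed blocks, as \<open>schur_complement\<close> takes the
  transpose of the row block for the blocks in column j.\<close>

lemma H_comb_left:
  assumes il: "i \<le> j" "l \<le> j" "s < b i"
    and y: "\<And>\<beta>. \<beta> < h l \<Longrightarrow> (\<Sum>t<b l. R l l $$ (t, \<beta>) * y t) = f \<beta>"
  shows "(\<Sum>t<b l. H l i $$ (t, s) * y t) =
      (\<Sum>\<alpha><h i. R i i $$ (s, \<alpha>) * (\<Sum>\<beta><h l. W l i $$ (\<beta>, \<alpha>) * f \<beta>))"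
proof -
  have "(\<Sum>t<b l. H l i $$ (t, s) * y t) =
     (\<Sum>t<b l. \<Sum>\<beta><h l. \<Sum>\<alpha><h i. R i i $$ (s, \<alpha>) * (W l i $$ (\<beta>, \<alpha>) * (R l l $$ (t, \<beta>) * y t)))"
  proof (rule sum.cong[OF refl])
    fix t assume "t \<in> {..<b l}"
    hence t: "t < b l" by simp
    show "H l i $$ (t, s) * y t =
        (\<Sum>\<beta><h l. \<Sum>\<alpha><h i. R i i $$ (s, \<alpha>) * (W l i $$ (\<beta>, \<alpha>) * (R l l $$ (t, \<beta>) * y t)))"
      unfolding H_index[OF il(2,1) t il(3)] sum_distrib_right
        by (intro sum.cong refl) (simp add: mult_ac)
  qed
  also have "\<dots> =
      (\<Sum>\<beta><h l. \<Sum>t<b l. \<Sum>\<alpha><h i. R i i $$ (s, \<alpha>) * (W l i $$ (\<beta>, \<alpha>) * (R l l $$ (t, \<beta>) * y t)))"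
    by (rule sum.swap)
  also have "\<dots> =
      (\<Sum>\<beta><h l. \<Sum>\<alpha><h i. \<Sum>t<b l. R i i $$ (s, \<alpha>) * (W l i $$ (\<beta>, \<alpha>) * (R l l $$ (t, \<beta>) * y t)))"
    by (rule sum.cong[OF refl], rule sum.swap)
  also have "\<dots> = (\<Sum>\<beta><h l. \<Sum>\<alpha><h i. R i i $$ (s, \<alpha>) * (W l i $$ (\<beta>, \<alpha>) * f \<beta>))"
    by (intro sum.cong refl) (simp add: y flip: sum_distrib_left)
  also have "\<dots> = (\<Sum>\<alpha><h i. \<Sum>\<beta><h l. R i i $$ (s, \<alpha>) * (W l i $$ (\<beta>, \<alpha>) * f \<beta>))"
    by (rule sum.swap)
  finally show ?thesis by (simp add: sum_distrib_left)
qed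

lemma solve_R_diag_transpose:
  obtains y where "\<And>l \<beta>. l \<le> j \<Longrightarrow> \<beta> < h l \<Longrightarrow> (\<Sum>t<b l. R l l $$ (t, \<beta>) * y l t) = f l \<beta>"
proof -
  have "\<forall>l. \<exists>y. l \<le> j \<longrightarrow> (\<forall>\<beta><h l. (\<Sum>t<b l. R l l $$ (t, \<beta>) * y t) = f l \<beta>)"
  proof
    fix l
    show "\<exists>y. l \<le> j \<longrightarrow> (\<forall>\<beta><h l. (\<Sum>t<b l. R l l $$ (t, \<beta>) * y t) = f l \<beta>)"
    proof (cases "l \<le> j")
      case True
      obtain y where "\<And>t. t < h l \<Longrightarrow> (\<Sum>s<b l. R l l $$ (s, t) * y s) = f l t"
        using R_diag_transpose_surjective[OF True, of "f l"] by blast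
      thus ?thesis by blast
    qed simp
  qed
  from choice[OF this] show ?thesis using that by blast
qed

text \<open>The substitution f_l = R_(l,l)^T y_l turns the system of W into that of H, and each
  R_(l,l)^T is surjective.\<close>

lemma det_W:
  assumes jp: "j > 0" and detH: "det (block_mat [0..<j] [0..<j] H) \<noteq> 0"
  shows "det (block_mat [0..<j] [0..<j] W) \<noteq> 0"
proof (rule det_block_mat_nonzero_iff[THEN iffD2])
  have injH: "\<forall>f. (\<forall>i<j. \<forall>s<b i. (\<Sum>l<j. \<Sum>t<b l. H i l $$ (s, t) * f l t) = 0) \<longrightarrow> (\<forall>i<j. \<forall>s<b i. f i s =
      0)"
    by (rule det_block_mat_nonzero_iff[THEN iffD1, OF jp _ detH]) (rule H_carrier; simp)
  show "\<forall>f. (\<forall>i<j. \<forall>s<h i. (\<Sum>l<j. \<Sum>t<h l. W i l $$ (s, t) * f l t) = 0) \<longrightarrow> (\<forall>i<j. \<forall>s<h i. f i s = 0)"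
  proof (intro allI impI)
    fix f :: "nat \<Rightarrow> nat \<Rightarrow> real" and i s
    assume z: "\<forall>i<j. \<forall>s<h i. (\<Sum>l<j. \<Sum>t<h l. W i l $$ (s, t) * f l t) = 0" and is': "i < j" "s < h i"
    obtain y where y: "\<And>l \<beta>. l \<le> j \<Longrightarrow> \<beta> < h l \<Longrightarrow> (\<Sum>t<b l. R l l $$ (t, \<beta>) * y l t) = f l \<beta>"
      using solve_R_diag_transpose[of f] by blast
    have "(\<Sum>l<j. \<Sum>t<b l. H i l $$ (s, t) * y l t) = 0" if is': "i < j" "s < b i" for i s
    proof -
      have "(\<Sum>l<j. \<Sum>t<b l. H i l $$ (s, t) * y l t) =
         (\<Sum>l<j. \<Sum>\<alpha><h i. R i i $$ (s, \<alpha>) * (\<Sum>\<beta><h l. W i l $$ (\<alpha>, \<beta>) * f l \<beta>))"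
        using is' y by (intro sum.cong refl H_comb) auto
      also have "\<dots> = (\<Sum>\<alpha><h i. R i i $$ (s, \<alpha>) * (\<Sum>l<j. \<Sum>\<beta><h l. W i l $$ (\<alpha>, \<beta>) * f l \<beta>))"
        by (subst sum.swap) (simp only: sum_distrib_left)
      also have "\<dots> = 0" using z is' by simp
      finally show ?thesis .
    qed
    hence "\<forall>i<j. \<forall>s<b i. y i s = 0" using injH by blast
    hence "(\<Sum>t<b i. R i i $$ (t, s) * y i t) = 0" using is' by (intro sum.neutral) auto
    thus "f i s = 0" using y[of i s] is' by simp
  qed
qed (use jp in simp, rule W_carrier)

text \<open>Both sides are compared on a vector c. Eliminating in the system of W with R_(j,j)^T c
  in the last block gives f; its preimage y under the transposed diagonal blocks solves the
  elimination problem of H, and the last block rows differ by the factor R_(j,j).\<close>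

lemma schur_H:
  assumes jp: "j > 0" and detH: "det (block_mat [0..<j] [0..<j] H) \<noteq> 0"
  shows "schur_complement H j = R j j * schur_complement W j * transpose_mat (R j j)"
proof -
  note detW = det_W[OF jp detH]
  have Sc: "schur_complement H j \<in> carrier_mat (b j) (b j)"
    by (rule schur_complement_carrier[OF _ detH]) (rule H_carrier)
  have SW: "schur_complement W j \<in> carrier_mat (h j) (h j)"
    by (rule schur_complement_carrier[OF _ detW]) (rule W_carrier)
  have Rj: "R j j \<in> carrier_mat (b j) (h j)" by (rule R_diag_carrier) simp
  show ?thesis
  proof (rule mat_eq_if_mult_vec_eq[OF Sc])
    show "R j j * schur_complement W j * transpose_mat (R j j) \<in> carrier_mat (b j) (b j)"
      using Rj SW by simp
    fix c :: "real Matrix.vec" assume c: "c \<in> carrier_vec (b j)"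
    define c' where "c' = transpose_mat (R j j) *\<^sub>v c"
    have c': "c' \<in> carrier_vec (h j)" using Rj c by (simp add: c'_def)
    have c'i: "vec_index c' \<beta> = (\<Sum>t<b j. R j j $$ (t, \<beta>) * vec_index c t)" if "\<beta> < h j" for \<beta>
      using that Rj c by (simp add: c'_def scalar_prod_def atLeast0LessThan)
    obtain f where f: "\<And>i s. i < j \<Longrightarrow> s < h i \<Longrightarrow> (\<Sum>l<j. \<Sum>t<h l. W i l $$ (s, t) * f l t) =
        - (\<Sum>t<h j. W j i $$ (t, s) * vec_index c' t)"
      using block_mat_solve[OF jp _ detW, of h "\<lambda>i s. - (\<Sum>t<h j. W j i $$ (t, s) * vec_index c' t)"] W_carrier by blast
    obtain y where y: "\<And>l \<beta>. l \<le> j \<Longrightarrow> \<beta> < h l \<Longrightarrow> (\<Sum>t<b l. R l l $$ (t, \<beta>) * y l t) = f l \<beta>"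
      using solve_R_diag_transpose[of f] by blast
    have Hy: "(\<Sum>l<j. \<Sum>t<b l. H i l $$ (s, t) * y l t) =
        (\<Sum>\<alpha><h i. R i i $$ (s, \<alpha>) * (\<Sum>l<j. \<Sum>\<beta><h l. W i l $$ (\<alpha>, \<beta>) * f l \<beta>))"
      if is': "i \<le> j" "s < b i" for i s
    proof -
      have "(\<Sum>l<j. \<Sum>t<b l. H i l $$ (s, t) * y l t) =
         (\<Sum>l<j. \<Sum>\<alpha><h i. R i i $$ (s, \<alpha>) * (\<Sum>\<beta><h l. W i l $$ (\<alpha>, \<beta>) * f l \<beta>))"
        using is' y by (intro sum.cong refl H_comb) auto
      thus ?thesis by (subst (asm) sum.swap) (simp only: sum_distrib_left)
    qed
    show "schur_complement H j *\<^sub>v c = (R j j * schur_complement W j * transpose_mat (R j j)) *\<^sub>v c"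
    proof (rule eq_vecI)
      fix s assume "s < dim_vec ((R j j * schur_complement W j * transpose_mat (R j j)) *\<^sub>v c)"
      hence s: "s < b j" using Rj by simp
      have "vec_index (schur_complement H j *\<^sub>v c) s =
         (\<Sum>t<b j. H j j $$ (s, t) * vec_index c t) + (\<Sum>l<j. \<Sum>t<b l. H j l $$ (s, t) * y l t)"
      proof (rule schur_complement_mult_vec[where M = "\<lambda>i l. H i l" and w = b and f = y, OF jp _ detH c _ s])
        fix i s assume is': "i < j" "s < b i"
        have "(\<Sum>t<b j. H j i $$ (t, s) * vec_index c t) =
            (\<Sum>\<alpha><h i. R i i $$ (s, \<alpha>) * (\<Sum>\<beta><h j. W j i $$ (\<beta>, \<alpha>) * vec_index c' \<beta>))"
          by (rule H_comb_left) (use is' c'i in auto)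
        thus "(\<Sum>l<j. \<Sum>t<b l. H i l $$ (s, t) * y l t) + (\<Sum>t<b j. H j i $$ (t, s) * vec_index c t) =
            0"
          using Hy[of i s] is' f[of i] by (simp add: sum_negf)
      qed (rule H_carrier)
      also have "(\<Sum>t<b j. H j j $$ (s, t) * vec_index c t) =
          (\<Sum>\<alpha><h j. R j j $$ (s, \<alpha>) * (\<Sum>\<beta><h j. W j j $$ (\<alpha>, \<beta>) * vec_index c' \<beta>))"
        by (rule H_comb) (use s c'i in auto)
      also have "(\<Sum>l<j. \<Sum>t<b l. H j l $$ (s, t) * y l t) =
          (\<Sum>\<alpha><h j. R j j $$ (s, \<alpha>) * (\<Sum>l<j. \<Sum>\<beta><h l. W j l $$ (\<alpha>, \<beta>) * f l \<beta>))"
        by (rule Hy) (use s in auto)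
      also have "(\<Sum>\<alpha><h j. R j j $$ (s, \<alpha>) * (\<Sum>\<beta><h j. W j j $$ (\<alpha>, \<beta>) * vec_index c' \<beta>)) +
          (\<Sum>\<alpha><h j. R j j $$ (s, \<alpha>) * (\<Sum>l<j. \<Sum>\<beta><h l. W j l $$ (\<alpha>, \<beta>) * f l \<beta>)) =
          (\<Sum>\<alpha><h j. R j j $$ (s, \<alpha>) * vec_index (schur_complement W j *\<^sub>v c') \<alpha>)"
        unfolding sum.distrib[symmetric] distrib_left[symmetric]
      proof (intro sum.cong refl arg_cong2[where f = "(*)"])
        fix \<alpha> assume "\<alpha> \<in> {..<h j}"
        hence \<alpha>: "\<alpha> < h j" by simp
        show "(\<Sum>\<beta><h j. W j j $$ (\<alpha>, \<beta>) * vec_index c' \<beta>) + (\<Sum>l<j. \<Sum>\<beta><h l. W j l $$ (\<alpha>, \<beta>) * f l \<beta>) =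
           vec_index (schur_complement W j *\<^sub>v c') \<alpha>"
          by (rule schur_complement_mult_vec[where M = W and w = h and f = f, OF jp _ detW c' _ \<alpha>, symmetric]) (rule W_carrier, simp add: f)
      qed
      also have "\<dots> = vec_index (R j j *\<^sub>v (schur_complement W j *\<^sub>v c')) s"
        using Rj SW c' s by (simp add: scalar_prod_def atLeast0LessThan)
      also have "R j j *\<^sub>v (schur_complement W j *\<^sub>v c') =
          (R j j * schur_complement W j * transpose_mat (R j j)) *\<^sub>v c"
        unfolding c'_def using Rj SW c
        by (simp add: assoc_mult_mat_vec[of _ "b j" "h j" _ "b j"] assoc_mult_mat_vec[of _ "b j" "h j" _ "h j"])
      finally show "vec_index (schur_complement H j *\<^sub>v c) s =
          vec_index ((R j j * schur_complement W j * transpose_mat (R j j)) *\<^sub>v c) s" .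
    qed (use Sc Rj in auto)
  qed
qed

lemma QT_V: "i \<le> j \<Longrightarrow> transpose_mat (Q i) * V i = R i i"
proof -
  assume i: "i \<le> j"
  have Qc: "Q i \<in> carrier_mat n (b i)" using Q_carrier less_r[OF i] by simp
  show ?thesis
  proof (rule eq_matI)
    fix s t assume "s < dim_row (R i i)" "t < dim_col (R i i)"
    hence st: "s < b i" "t < h i" using R_diag_carrier[OF i] by auto
    thus "(transpose_mat (Q i) * V i) $$ (s, t) = R i i $$ (s, t)"
      using QV[of i i s t] less_r[OF i] Qc V_carrier[of i]
        by (simp add: scalar_prod_def atLeast0LessThan)
  qed (use R_diag_carrier[OF i] Qc V_carrier[of i] in auto)
qed

lemma V_0: "V 0 = Q 0 * R 0 0"
proof -
  have Qc: "Q 0 \<in> carrier_mat n (b 0)" using Q_carrier less_r[of 0] by simp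
  have Rc: "R 0 0 \<in> carrier_mat (b 0) (h 0)" by (rule R_diag_carrier) simp
  show ?thesis
  proof (rule eq_matI)
    fix a t assume "a < dim_row (Q 0 * R 0 0)" "t < dim_col (Q 0 * R 0 0)"
    hence at: "a < n" "t < h 0" using Qc Rc by auto
    thus "V 0 $$ (a, t) = (Q 0 * R 0 0) $$ (a, t)"
      using V_QR[of 0 0 a t] less_r[of 0] Qc Rc by (simp add: scalar_prod_def atLeast0LessThan)
  qed (use Qc Rc V_carrier[of 0] in auto)
qed

text \<open>Everything rests on Q_j^T V_j = R_(j,j); for j > 0 the product Q_j R_(j,j) is only the
  projection of V_j onto the columns of Q_j.\<close>

lemma Q_R_sandwich:
  assumes S: "S \<in> carrier_mat (h j) (h j)"
  shows "Q j * (R j j * S * transpose_mat (R j j)) * transpose_mat (Q j) =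
     Q j * transpose_mat (Q j) * V j * S * transpose_mat (V j) * Q j * transpose_mat (Q j)"
proof -
  have Qc: "Q j \<in> carrier_mat n (b j)" using Q_carrier less_r[of j] by simp
  have Rc: "R j j \<in> carrier_mat (b j) (h j)" by (rule R_diag_carrier) simp
  note Vc = V_carrier[of j]
  have QT: "transpose_mat (Q j) \<in> carrier_mat (b j) n"
    and VT: "transpose_mat (V j) \<in> carrier_mat (h j) n"
    and RT: "transpose_mat (R j j) \<in> carrier_mat (h j) (b j)" using Qc Vc Rc by auto
  have 1: "Q j * transpose_mat (Q j) * V j = Q j * R j j"
    using assoc_mult_mat[OF Qc QT Vc] QT_V[of j] by simp
  have QR: "Q j * R j j \<in> carrier_mat n (h j)" "Q j * R j j * S \<in> carrier_mat n (h j)" using Qc Rc S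
    by auto
  have "transpose_mat (V j) * Q j = transpose_mat (transpose_mat (Q j) * V j)"
    using transpose_mult[OF QT Vc] by simp
  hence 2: "transpose_mat (V j) * Q j = transpose_mat (R j j)" using QT_V[of j] by simp
  have "Q j * R j j * S * transpose_mat (V j) * Q j = Q j * R j j * S * transpose_mat (R j j)"
    using assoc_mult_mat[OF QR(2) VT Qc] 2 by simp
  also have "\<dots> = Q j * (R j j * S * transpose_mat (R j j))"
  proof -
    have RS: "R j j * S \<in> carrier_mat (b j) (h j)" using Rc S by simp
    show ?thesis using assoc_mult_mat[OF Qc Rc S] assoc_mult_mat[OF Qc RS RT] by simp
  qed
  finally show ?thesis unfolding 1 by simp
qed

lemma Q_R_sandwich_0:
  assumes S: "S \<in> carrier_mat (h 0) (h 0)"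
  shows "Q 0 * (R 0 0 * S * transpose_mat (R 0 0)) * transpose_mat (Q 0) =
      V 0 * S * transpose_mat (V 0)"
proof -
  have Qc: "Q 0 \<in> carrier_mat n (b 0)" using Q_carrier less_r[of 0] by simp
  have Rc: "R 0 0 \<in> carrier_mat (b 0) (h 0)" by (rule R_diag_carrier) simp
  have QT: "transpose_mat (Q 0) \<in> carrier_mat (b 0) n"
    and RT: "transpose_mat (R 0 0) \<in> carrier_mat (h 0) (b 0)"
    using Qc Rc by auto
  have RS: "R 0 0 * S \<in> carrier_mat (b 0) (h 0)" and QRS: "Q 0 * R 0 0 * S \<in> carrier_mat n (h 0)"
    using Qc Rc S by auto
  have "V 0 * S * transpose_mat (V 0) =
      Q 0 * R 0 0 * S * (transpose_mat (R 0 0) * transpose_mat (Q 0))"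
    unfolding V_0 using transpose_mult[OF Qc Rc] by simp
  also have "\<dots> = Q 0 * R 0 0 * S * transpose_mat (R 0 0) * transpose_mat (Q 0)"
    using assoc_mult_mat[OF QRS RT QT] by simp
  also have "Q 0 * R 0 0 * S * transpose_mat (R 0 0) = Q 0 * (R 0 0 * S * transpose_mat (R 0 0))"
    using assoc_mult_mat[OF Qc Rc S] assoc_mult_mat[OF Qc RS RT] by simp
  finally show ?thesis ..
qed

end

subsection \<open>The spectral equivalent\<close>

lemma mult_mat_vec_index_sum:
  assumes "A \<in> carrier_mat n m" "v \<in> carrier_vec m" "i < n"
  shows "vec_index (A *\<^sub>v v) i = (\<Sum>c<m. A $$ (i, c) * vec_index v c)"
  using assms by (simp add: scalar_prod_def atLeast0LessThan)

text \<open>The parameters E and U are the series supplied by \<open>eigensystem_fps\<close>; they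
  are fixed here so that the theorem can use one interpretation for each j.\<close>

locale qr_spectrum = qr_full +
  fixes ev :: "nat \<Rightarrow> real \<Rightarrow> real" and u :: "nat \<Rightarrow> real \<Rightarrow> real Matrix.vec"
    and E :: "nat \<Rightarrow> real fps" and U :: "nat \<Rightarrow> nat \<Rightarrow> real fps"
  assumes ev_E: "\<And>l. l < n \<Longrightarrow> ev l has_fps_expansion E l"
    and u_U: "\<And>l a. l < n \<Longrightarrow> a < n \<Longrightarrow> vec_index (u l 0) a = fps_nth (U l a) 0"
    and u_carrier: "\<And>l. l < n \<Longrightarrow> u l 0 \<in> carrier_vec n"
    and eigen: "\<And>l a. l < n \<Longrightarrow> a < n \<Longrightarrow>
       (\<Sum>b<n. Abs_fps (\<lambda>m. fps_nth \<Psi> m * norm (x a - x b) ^ m) * U l b) = E l * U l a"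
    and complete: "\<And>a b. a < n \<Longrightarrow> b < n \<Longrightarrow> (\<Sum>l<n. U l a * U l b) = (if a = b then 1 else 0)"
    and orthonormal: "\<And>l m. l < n \<Longrightarrow> m < n \<Longrightarrow> (\<Sum>a<n. U l a * U m a) = (if l = m then 1 else 0)"
    and E_positive: "\<And>l. l < n \<Longrightarrow> E l \<noteq> 0 \<and> fps_nth (E l) (subdegree (E l)) > 0"
begin

lemma sum_level:
  assumes "i \<le> j"
  shows "(\<Sum>p | p \<in> Sigma {..j} (\<lambda>i. {..<b i}) \<and> fst p = i. f p) = (\<Sum>s<b i. f (i, s))"
  by (rule sum.reindex_bij_witness[where i = "\<lambda>s. (i, s)" and j = snd]) (use assms in auto)

text \<open>Columns are indexed by pairs of a block and a position, the block being the level. The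
  assumptions on the levels are supplied by \<open>Q_orth\<close>, \<open>ann_Q\<close>,
  \<open>ann_if_orth\<close> and \<open>ann_Q_comb_imp_0\<close>.\<close>

interpretation S: kernel_spectrum \<psi> \<Psi> r k n x "Sigma {..j} (\<lambda>i. {..<b i})"
  "\<lambda>p a. Q (fst p) $$ (a, snd p)" fst j E U
proof (intro kernel_spectrum.intro rk kernel_spectrum_axioms.intro inj j)
  show "finite (Sigma {..j} (\<lambda>i. {..<b i}))" by simp
  show "\<And>s. s \<in> Sigma {..j} (\<lambda>i. {..<b i}) \<Longrightarrow> fst s \<le> j" by auto
  show "(\<Sum>a<n. Q (fst s) $$ (a, snd s) * Q (fst t) $$ (a, snd t)) = (if s = t then 1 else 0)"
    if "s \<in> Sigma {..j} (\<lambda>i. {..<b i})" "t \<in> Sigma {..j} (\<lambda>i. {..<b i})" for s t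
    using Q_orth[of "fst s" "fst t" "snd s" "snd t"] less_r that by (auto simp: prod_eq_iff)
  show "annihilates {..<n} x (fst s) (\<lambda>a. Q (fst s) $$ (a, snd s))"
    if "s \<in> Sigma {..j} (\<lambda>i. {..<b i})" for s
    using ann_Q[of "fst s" "snd s"] less_r that by auto
  show "annihilates {..<n} x (Suc i) v"
    if i: "i \<le> j" and v: "\<And>s. s \<in> Sigma {..j} (\<lambda>i. {..<b i}) \<Longrightarrow> fst s \<le> i \<Longrightarrow>
        (\<Sum>a<n. Q (fst s) $$ (a, snd s) * v a) = 0" for i v
  proof (rule ann_if_orth[OF less_r[OF i]])
    fix l s assume "l \<le> i" "s < b l"
    thus "(\<Sum>a<n. Q l $$ (a, s) * v a) = 0" using v[of "(l, s)"] i by simp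
  qed
  show "c s = 0" if an: "annihilates {..<n} x (Suc i) (\<lambda>a. \<Sum>s | s \<in> Sigma {..j} (\<lambda>i. {..<b i}) \<and> fst s = i. c s * Q (fst s) $$ (a, snd s))"
      and s: "s \<in> Sigma {..j} (\<lambda>i. {..<b i})" "fst s = i" for i c s
  proof -
    have i: "i \<le> j" "snd s < b i" using s by auto
    have "annihilates {..<n} x (Suc i) (\<lambda>a. \<Sum>t<b i. c (i, t) * Q i $$ (a, t))"
      using an unfolding sum_level[OF i(1)] by simp
    from ann_Q_comb_imp_0[OF i(1) this i(2)] show ?thesis using s by (cases s) simp
  qed
qed (fact eigen complete orthonormal E_positive)+

lemma lvl_eq: "S.lvl i = {p. p \<in> Sigma {..j} (\<lambda>i. {..<b i}) \<and> fst p = i}"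
  by (simp add: S.lvl_def)

lemma sum_lvl: "i \<le> j \<Longrightarrow> (\<Sum>p\<in>S.lvl i. f p) = (\<Sum>s<b i. f (i, s))"
  unfolding lvl_eq by (rule sum_level)

lemma sum_lvls: "i \<le> j \<Longrightarrow> (\<Sum>p\<in>S.lvls i. f p) = (\<Sum>l<Suc i. \<Sum>s<b l. f (l, s))"
proof -
  assume i: "i \<le> j"
  have "(\<Sum>p\<in>S.lvls i. f p) = (\<Sum>l\<le>i. \<Sum>p\<in>S.lvl l. f p)" by (rule S.sum_lvls[symmetric])
  also have "\<dots> = (\<Sum>l\<le>i. \<Sum>s<b l. f (l, s))" using i by (intro sum.cong refl) (simp add: sum_lvl)
  finally show ?thesis by (simp only: lessThan_Suc_atMost)
qed

abbreviation "idx m \<equiv> {i. i < n \<and> of_order (ev i) m}"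
abbreviation "KK \<equiv> mat_coeff (spectral_equivalent n ev u)"

lemma order_iff: "l < n \<Longrightarrow> of_order (ev l) m \<longleftrightarrow> S.ord l = m"
  using of_order_fps_iff[OF ev_E] E_positive by (auto simp: S.ord_def)

lemma idx_eq: "idx m = {l. l < n \<and> S.ord l = m}"
  using order_iff by auto

lemma leading_coefficient_eq: "l < n \<Longrightarrow> leading_coefficient (ev l) = S.lead l"
  using leading_coefficient_fps[OF ev_E] E_positive by (simp add: S.ord_def S.lead_def)

lemma u_eq: "l < n \<Longrightarrow> a < n \<Longrightarrow> vec_index (u l 0) a = S.u0 l a"
  by (simp add: u_U S.u0_def)

lemma KK_carrier: "KK m \<in> carrier_mat n n"
  by (simp add: mat_coeff_def spectral_equivalent_def)

lemma KK_index:
  assumes "a < n" "c < n"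
  shows "KK m $$ (a, c) = (\<Sum>l\<in>idx m. S.lead l * (S.u0 l a * S.u0 l c))"
proof -
  have "KK m $$ (a, c) =
      (\<Sum>l<n. Polynomial.coeff (Polynomial.smult (S.u0 l a * S.u0 l c) (leading_term (ev l))) m)"
    using assms by (simp add: mat_coeff_def spectral_equivalent_def Polynomial.coeff_sum u_eq)
  also have "\<dots> = (\<Sum>l<n. if S.ord l = m then S.lead l * (S.u0 l a * S.u0 l c) else 0)"
    using leading_term_fps[OF ev_E] E_positive
      by (intro sum.cong refl) (simp add: S.ord_def S.lead_def)
  also have "\<dots> = (\<Sum>l\<in>idx m. S.lead l * (S.u0 l a * S.u0 l c))"
    unfolding idx_eq by (subst sum.inter_filter[symmetric]) auto
  finally show ?thesis .
qed

text \<open>The coefficient of \<epsilon>^m is diagonal in the orthonormal limiting eigenvectors,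
  with the leading coefficients of the group as its nonzero eigenvalues.\<close>

lemma KK_eigenvector:
  assumes i: "i \<in> idx m"
  shows "leading_coefficient (ev i) \<noteq> 0 \<and> eigenvector (KK m) (u i 0) (leading_coefficient (ev i))"
proof -
  have n: "i < n" using i by simp
  have lc: "leading_coefficient (ev i) = S.lead i" by (rule leading_coefficient_eq[OF n])
  have "KK m *\<^sub>v u i 0 = S.lead i \<cdot>\<^sub>v u i 0"
  proof (rule eq_vecI)
    fix a assume "a < dim_vec (S.lead i \<cdot>\<^sub>v u i 0)"
    hence a: "a < n" using u_carrier[OF n] by simp
    have "vec_index (KK m *\<^sub>v u i 0) a = (\<Sum>c<n. KK m $$ (a, c) * S.u0 i c)"
      using KK_carrier[of m] u_carrier[OF n] a n
        by (simp add: scalar_prod_def atLeast0LessThan u_eq)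
    also have "\<dots> = (\<Sum>c<n. \<Sum>l\<in>idx m. S.lead l * S.u0 l a * (S.u0 l c * S.u0 i c))"
    proof (rule sum.cong[OF refl])
      fix c assume "c \<in> {..<n}"
      hence c: "c < n" by simp
      show "KK m $$ (a, c) * S.u0 i c = (\<Sum>l\<in>idx m. S.lead l * S.u0 l a * (S.u0 l c * S.u0 i c))"
        unfolding KK_index[OF a c] sum_distrib_right by (intro sum.cong refl) (simp add: mult_ac)
    qed
    also have "\<dots> = (\<Sum>l\<in>idx m. S.lead l * S.u0 l a * (\<Sum>c<n. S.u0 l c * S.u0 i c))"
      by (subst sum.swap) (simp only: sum_distrib_left)
    also have "\<dots> = (\<Sum>l\<in>idx m. if l = i then S.lead l * S.u0 l a else 0)"
      using n by (intro sum.cong refl) (auto simp: S.u0_orth)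
    also have "\<dots> = S.lead i * S.u0 i a" using i by simp
    finally show "vec_index (KK m *\<^sub>v u i 0) a = vec_index (S.lead i \<cdot>\<^sub>v u i 0) a"
      using a n u_carrier[OF n] by (simp add: u_eq)
  qed (use KK_carrier[of m] u_carrier[OF n] in auto)
  moreover have "u i 0 \<noteq> 0\<^sub>v n"
  proof
    assume "u i 0 = 0\<^sub>v n"
    hence "S.u0 i a = 0" if "a < n" for a using u_eq[OF n that] that by simp
    hence "(\<Sum>a<n. S.u0 i a * S.u0 i a) = 0" by simp
    thus False using S.u0_orth[OF n n] by simp
  qed
  ultimately show ?thesis
    using u_carrier[OF n] KK_carrier[of m] S.lead_pos[OF n] by (auto simp: eigenvector_def lc)
qed

lemma card_idx: "card (idx (2 * j)) = hdim j d"
proof -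
  have "S.lvl j = Pair j ` {..<b j}" unfolding lvl_eq by auto
  hence "card (S.lvl j) = b j" by (simp add: card_image inj_on_def)
  thus ?thesis unfolding idx_eq using S.card_ord[of j] b_eq_h[of j] by simp
qed

lemma det_H:
  assumes jp: "j > 0"
  shows "det (block_mat [0..<j] [0..<j] H) \<noteq> 0"
proof (rule det_block_mat_nonzero_iff[THEN iffD2])
  show "\<forall>f. (\<forall>i<j. \<forall>s<b i. (\<Sum>l<j. \<Sum>t<b l. H i l $$ (s, t) * f l t) = 0) \<longrightarrow> (\<forall>i<j. \<forall>s<b i. f i s = 0)"
  proof (intro allI impI)
    fix f :: "nat \<Rightarrow> nat \<Rightarrow> real" and i s
    assume z: "\<forall>i<j. \<forall>s<b i. (\<Sum>l<j. \<Sum>t<b l. H i l $$ (s, t) * f l t) = 0" and is': "i < j" "s < b i"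
    have "(\<lambda>p. f (fst p) (snd p)) (i, s) = 0"
    \<comment> \<open>The first j blocks are the levels up to j - 1.\<close>
    proof (rule S.gram_nondegenerate[of "j - 1"])
      fix p assume "p \<in> S.lvls (j - 1)"
      hence p: "fst p < j" "snd p < b (fst p)" using jp by (auto simp: S.lvls_def)
      have "(\<Sum>q\<in>S.lvls (j - 1). S.form (fst p +
          fst q) (\<lambda>a. Q (fst p) $$ (a, snd p)) (\<lambda>a. Q (fst q) $$ (a, snd q)) * f (fst q) (snd q)) =
        (\<Sum>l<j. \<Sum>t<b l. S.form (fst p + l) (\<lambda>a. Q (fst p) $$ (a, snd p)) (\<lambda>a. Q l $$ (a, t)) * f l t)"
        by (subst sum_lvls) (use jp in simp_all)
      also have "\<dots> = (\<Sum>l<j. \<Sum>t<b l. H (fst p) l $$ (snd p, t) * f l t)"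
        using p by (intro sum.cong refl) (simp add: H_form)
      also have "\<dots> = 0" using z p by blast
      finally show "(\<Sum>q\<in>S.lvls (j - 1). S.form (fst p +
          fst q) (\<lambda>a. Q (fst p) $$ (a, snd p)) (\<lambda>a. Q (fst q) $$ (a, snd q)) * f (fst q) (snd q)) = 0" .
    qed (use is' in \<open>auto simp: S.lvls_def\<close>)
    thus "f i s = 0" by simp
  qed
qed (rule jp, rule H_carrier, simp_all)

lemma S_carrier: "schur_complement H j \<in> carrier_mat (b j) (b j)"
  by (rule schur_complement_carrier) (rule H_carrier, assumption+, rule det_H)

text \<open>The coordinates Q_j^T u_l(0) of the limiting eigenvector in the columns of Q_j.\<close>

definition "cvec l = vec (b j) (\<lambda>s. \<Sum>a<n. Q j $$ (a, s) * S.u0 l a)"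

lemma cvec_carrier: "cvec l \<in> carrier_vec (b j)"
  by (simp add: cvec_def)

lemma Q_cvec:
  assumes "l \<in> idx (2 * j)" "c < n"
  shows "(\<Sum>s<b j. (\<Sum>a<n. Q j $$ (a, s) * S.u0 l a) * Q j $$ (c, s)) = S.u0 l c"
proof -
  have l: "l < n" "S.ord l = 2 * j" using assms(1) unfolding idx_eq by auto
  show ?thesis
    using S.block_projection_u0[OF l(1) order_refl assms(2)] l(2)
    by (subst (asm) sum_lvl[OF order_refl]) simp
qed

text \<open>By \<open>block_eigen\<close> the coefficients c solve the block system of H with zero
  right side in the rows i < j. They are thus the elimination vector for the Schur complement, and
  the last block row gives the eigenvalue.\<close>

lemma S_eigen:
  assumes l: "l \<in> idx (2 * j)"
  shows "schur_complement H j *\<^sub>v cvec l = S.lead l \<cdot>\<^sub>v cvec l"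
proof -
  have l': "l < n" "S.ord l = 2 * j" using l unfolding idx_eq by auto
  obtain c where c: "\<And>t. t \<in> S.lvl j \<Longrightarrow> c t = (\<Sum>a<n. Q (fst t) $$ (a, snd t) * S.u0 l a)"
    "\<And>t. t \<in> S.lvls j \<Longrightarrow> (\<Sum>s\<in>S.lvls j. S.form (fst t +
        fst s) (\<lambda>a. Q (fst t) $$ (a, snd t)) (\<lambda>a. Q (fst s) $$ (a, snd s)) * c s)
       = (if t \<in> S.lvl j then S.lead l * c t else 0)"
    using S.block_eigen[OF l'(1) order_refl l'(2)] by blast
  have cj: "vec_index (cvec l) s = c (j, s)" if "s < b j" for s
    using c(1)[of "(j, s)"] that by (simp add: cvec_def lvl_eq)
  have eqn: "(\<Sum>l<j. \<Sum>t<b l. H i l $$ (s, t) * c (l, t)) +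
      (\<Sum>t<b j. H i j $$ (s, t) * vec_index (cvec l) t)
     = (if i = j then S.lead l * c (j, s) else 0)" if is': "i \<le> j" "s < b i" for i s
  proof -
    have p: "(i, s) \<in> S.lvls j" "(i, s) \<in> S.lvl j \<longleftrightarrow> i = j" using is'
      by (auto simp: S.lvls_def lvl_eq)
    have "(\<Sum>l<Suc j. \<Sum>t<b l. S.form (i + l) (\<lambda>a. Q i $$ (a, s)) (\<lambda>a. Q l $$ (a, t)) * c (l, t)) =
        (if i = j then S.lead l * c (j, s) else 0)"
    proof -
      have "(\<Sum>q\<in>S.lvls j. S.form (i +
          fst q) (\<lambda>a. Q i $$ (a, s)) (\<lambda>a. Q (fst q) $$ (a, snd q)) * c q) =
         (if i = j then S.lead l * c (j, s) else 0)"
        using c(2)[OF p(1)] p(2) by auto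
      thus ?thesis by (subst (asm) sum_lvls[OF order_refl]) (simp del: sum.lessThan_Suc)
    qed
    moreover have "(\<Sum>l<Suc j. \<Sum>t<b l. S.form (i +
        l) (\<lambda>a. Q i $$ (a, s)) (\<lambda>a. Q l $$ (a, t)) * c (l, t)) =
       (\<Sum>l<Suc j. \<Sum>t<b l. H i l $$ (s, t) * c (l, t))"
      using is' by (intro sum.cong refl) (simp add: H_form)
    ultimately show ?thesis by (simp add: cj)
  qed
  have cv: "cvec l \<in> carrier_vec (b j)" by (simp add: cvec_def)
  show ?thesis
  proof (rule eq_vecI)
    fix s assume "s < dim_vec (S.lead l \<cdot>\<^sub>v cvec l)"
    hence s: "s < b j" using cv by simp
    have "vec_index (schur_complement H j *\<^sub>v cvec l) s =
       (\<Sum>t<b j. H j j $$ (s, t) * vec_index (cvec l) t) + (\<Sum>l<j. \<Sum>t<b l. H j l $$ (s, t) * c (l, t))"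
    proof (cases "j = 0")
      case True
      hence e: "schur_complement H j = H j j" by (simp add: schur_complement_def)
      have "(\<Sum>l<j. \<Sum>t<b l. H j l $$ (s, t) * c (l, t)) = 0" using True by simp
      thus ?thesis unfolding e mult_mat_vec_index_sum[OF H_carrier[OF order_refl order_refl] cv s]
        by simp
    next
      case False
      show ?thesis
      proof (rule schur_complement_mult_vec[where M = "\<lambda>i l. H i l" and w = b and f = "\<lambda>l t. c (l, t)", OF _ _ _ cv _ s])
        show "det (block_mat [0..<j] [0..<j] H) \<noteq> 0" using det_H False by simp
        fix i s assume is': "i < j" "s < b i"
        have "(\<Sum>t<b j. H j i $$ (t, s) * vec_index (cvec l) t) =
            (\<Sum>t<b j. H i j $$ (s, t) * vec_index (cvec l) t)"
          using is' H_sym[of j i] by (intro sum.cong refl) simp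
        thus "(\<Sum>l<j. \<Sum>t<b l. H i l $$ (s, t) * c (l, t)) +
            (\<Sum>t<b j. H j i $$ (t, s) * vec_index (cvec l) t) = 0"
          using eqn[of i s] is' by simp
      qed (use False H_carrier in auto)
    qed
    also have "\<dots> = S.lead l * c (j, s)" using eqn[OF order_refl s] by simp
    finally show "vec_index (schur_complement H j *\<^sub>v cvec l) s = vec_index (S.lead l \<cdot>\<^sub>v cvec l) s"
      using s cv by (simp add: cj)
  qed (use S_carrier cv in auto)
qed

lemma cvec_orthonormal:
  assumes "l \<in> idx (2 * j)" "m \<in> idx (2 * j)"
  shows "scalar_prod (cvec l) (cvec m) = (if l = m then 1 else 0)"
proof -
  have lm: "l < n" "m < n" "S.ord m = 2 * j" using assms unfolding idx_eq by auto
  have "scalar_prod (cvec l) (cvec m) =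
      (\<Sum>s<b j. (\<Sum>a<n. Q j $$ (a, s) * S.u0 l a) * (\<Sum>a<n. Q j $$ (a, s) * S.u0 m a))"
    by (simp add: scalar_prod_def cvec_def atLeast0LessThan)
  also have "\<dots> = (\<Sum>s<b j. \<Sum>a<n. S.u0 l a * ((\<Sum>a<n. Q j $$ (a, s) * S.u0 m a) * Q j $$ (a, s)))"
    by (intro sum.cong refl) (subst sum_distrib_right, simp add: mult_ac)
  also have "\<dots> = (\<Sum>a<n. S.u0 l a * (\<Sum>s<b j. (\<Sum>a<n. Q j $$ (a, s) * S.u0 m a) * Q j $$ (a, s)))"
    by (subst sum.swap) (simp only: sum_distrib_left)
  also have "\<dots> = (\<Sum>a<n. S.u0 l a * S.u0 m a)"
    by (intro sum.cong refl) (simp add: Q_cvec[OF assms(2)])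
  finally show ?thesis using S.u0_orth lm by simp
qed

lemma proots_S:
  "image_mset (\<lambda>i. leading_coefficient (ev i)) (mset_set (idx (2 * j))) =
      proots (char_poly (schur_complement H j))"
proof (rule proots_char_poly_orthonormal[OF S_carrier, where c = cvec])
  show "card (idx (2 * j)) = b j" using card_idx b_eq_h[of j] by simp
  show "schur_complement H j *\<^sub>v cvec l = leading_coefficient (ev l) \<cdot>\<^sub>v cvec l" if "l \<in> idx (2 * j)"
    for l
    using S_eigen[OF that] leading_coefficient_eq[of l] that by simp
qed (simp_all add: cvec_orthonormal cvec_carrier)

text \<open>Q_j S_j Q_j^T is expanded by writing the columns of Q_j in the limiting eigenvectors, of
  which only those of order 2j contribute, and by using \<open>S_eigen\<close>.\<close>

lemma KK_even: "KK (2 * j) = Q j * schur_complement H j * transpose_mat (Q j)"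
proof (rule eq_matI)
  have Qc: "Q j \<in> carrier_mat n (b j)" using Q_carrier less_r[of j] by simp
  note Sc = S_carrier
  show "dim_row (KK (2 * j)) = dim_row (Q j * schur_complement H j * transpose_mat (Q j))"
    "dim_col (KK (2 * j)) = dim_col (Q j * schur_complement H j * transpose_mat (Q j))"
    using Qc KK_carrier[of "2 * j"] by auto
  fix a c assume "a < dim_row (Q j * schur_complement H j * transpose_mat (Q j))"
    "c < dim_col (Q j * schur_complement H j * transpose_mat (Q j))"
  hence ac: "a < n" "c < n" using Qc by auto
  let ?X = "Q j * schur_complement H j"
  have Xc: "?X \<in> carrier_mat n (b j)" using Qc Sc by simp
  have Qe: "Q j $$ (c, s) = (\<Sum>l\<in>idx (2 * j). vec_index (cvec l) s * S.u0 l c)" if s: "s < b j" for s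
  proof -
    have "Q j $$ (c, s) = (\<Sum>l<n. (\<Sum>a<n. Q j $$ (a, s) * S.u0 l a) * S.u0 l c)"
      using S.expand_u0[OF ac(2), of "(j, s)"] by simp
    also have "\<dots> = (\<Sum>l\<in>idx (2 * j). (\<Sum>a<n. Q j $$ (a, s) * S.u0 l a) * S.u0 l c)"
    proof (rule sum.mono_neutral_right)
      show "\<forall>l\<in>{..<n} - idx (2 * j). (\<Sum>a<n. Q j $$ (a, s) * S.u0 l a) * S.u0 l c = 0"
      proof
        fix l assume "l \<in> {..<n} - idx (2 * j)"
        hence "l < n" "S.ord l \<noteq> 2 * j" unfolding idx_eq by auto
        thus "(\<Sum>a<n. Q j $$ (a, s) * S.u0 l a) * S.u0 l c = 0"
          using S.block_coord_eq_0[of l j "(j, s)"] s by (simp add: lvl_eq)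
      qed
    qed auto
    finally show ?thesis using s by (simp add: cvec_def)
  qed
  have "(?X * transpose_mat (Q j)) $$ (a, c) = (\<Sum>s<b j. ?X $$ (a, s) * Q j $$ (c, s))"
  proof -
    have QT: "transpose_mat (Q j) \<in> carrier_mat (b j) n" using Qc by simp
    show ?thesis unfolding mult_mat_index_sum[OF Xc QT ac] using Qc ac by (intro sum.cong refl) simp
  qed
  also have "\<dots> = (\<Sum>s<b j. \<Sum>l\<in>idx (2 * j). S.u0 l c * (?X $$ (a, s) * vec_index (cvec l) s))"
    by (intro sum.cong refl) (simp add: Qe sum_distrib_left mult_ac)
  also have "\<dots> = (\<Sum>l\<in>idx (2 * j). S.u0 l c * vec_index (?X *\<^sub>v cvec l) a)"
    unfolding mult_mat_vec_index_sum[OF Xc cvec_carrier ac(1)] sum_distrib_left by (rule sum.swap)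
  also have "\<dots> = (\<Sum>l\<in>idx (2 * j). S.lead l * (S.u0 l a * S.u0 l c))"
  proof (intro sum.cong refl)
    fix l assume l: "l \<in> idx (2 * j)"
    have cv: "cvec l \<in> carrier_vec (b j)" by (simp add: cvec_def)
    have "?X *\<^sub>v cvec l = Q j *\<^sub>v (S.lead l \<cdot>\<^sub>v cvec l)"
      using assoc_mult_mat_vec[OF Qc Sc cv] S_eigen[OF l] by simp
    hence "vec_index (?X *\<^sub>v cvec l) a = S.lead l * (\<Sum>s<b j. Q j $$ (a, s) * vec_index (cvec l) s)"
      using Qc cv ac by (simp add: scalar_prod_def atLeast0LessThan sum_distrib_left mult_ac)
    also have "(\<Sum>s<b j. Q j $$ (a, s) * vec_index (cvec l) s) = S.u0 l a"
      using Q_cvec[OF l ac(1)] by (simp add: cvec_def mult.commute)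
    finally show "S.u0 l c * vec_index (?X *\<^sub>v cvec l) a = S.lead l * (S.u0 l a * S.u0 l c)" by simp
  qed
  finally show "KK (2 * j) $$ (a, c) = (?X * transpose_mat (Q j)) $$ (a, c)"
    using KK_index[OF ac] by simp
qed

lemma card_idx_top:
  assumes jr: "j = r - 1"
  shows "card (idx (2 * r - 1)) = n - pdim (r - 1) d"
proof -
  have "card (Sigma {..j} (\<lambda>i. {..<b i})) = (\<Sum>i\<le>j. h i)"
    using b_eq_h by simp
  also have "\<dots> = pdim j d" by (rule sum_hdim) (simp add: d Suc_leI)
  finally show ?thesis unfolding idx_eq using S.card_top[OF jr] jr by simp
qed

lemma KK_top:
  assumes jr: "j = r - 1" and P: "P =
      1\<^sub>m n - hcat (map Q [0..<r]) * transpose_mat (hcat (map Q [0..<r]))"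
  shows "KK (2 * r - 1) = fps_nth \<Psi> (2 * r - 1) \<cdot>\<^sub>m
     (P * Matrix.mat n n (\<lambda>(i, j). norm (x i - x j) ^ (2 * r - 1)) * P)"
proof -
  let ?Q = "hcat (map Q [0..<r])" and ?D = "Matrix.mat n n (\<lambda>(i, j). norm (x i - x j) ^ (2 * r - 1))"
  have r: "r > 0" using less_r[of 0] by simp
  have Qc: "?Q \<in> carrier_mat n (offset b r)" by (rule hcat_blocks(1)[OF r]) (rule Q_carrier)
  have QT: "transpose_mat ?Q \<in> carrier_mat (offset b r) n" using Qc by simp
  have Qe: "?Q $$ (a, offset b i + s) = Q i $$ (a, s)" if "i < r" "a < n" "s < b i" for i a s
    using hcat_blocks(2)[OF r, of Q n b] Q_carrier that by blast
  have Pc: "P \<in> carrier_mat n n" using Qc unfolding P by auto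
  have Pe: "P $$ (a, c) = (if a =
      c then 1 else 0) - (\<Sum>p\<in>Sigma {..j} (\<lambda>i. {..<b i}). Q (fst p) $$ (a, snd p) * Q (fst p) $$ (c, snd p))"
    if ac: "a < n" "c < n" for a c
  proof -
    have "(?Q * transpose_mat ?Q) $$ (a, c) = (\<Sum>q<offset b r. ?Q $$ (a, q) * ?Q $$ (c, q))"
      unfolding mult_mat_index_sum[OF Qc QT ac] using Qc ac by (intro sum.cong refl) simp
    also have "\<dots> = (\<Sum>i<r. \<Sum>s<b i. Q i $$ (a, s) * Q i $$ (c, s))"
      unfolding sum_offset using ac by (intro sum.cong refl) (simp add: Qe)
    also have "{..<r} = {..j}" using jr r by auto
    finally show ?thesis using ac Qc unfolding P by (simp add: sum.Sigma case_prod_unfold)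
  qed
  have PD: "P * ?D \<in> carrier_mat n n" and Dc: "?D \<in> carrier_mat n n" using Pc by auto
  show ?thesis
  proof (rule eq_matI)
    fix a c assume "a < dim_row (fps_nth \<Psi> (2 * r - 1) \<cdot>\<^sub>m (P * ?D * P))" "c < dim_col (fps_nth \<Psi> (2 * r - 1) \<cdot>\<^sub>m (P * ?D * P))"
    hence ac: "a < n" "c < n" using Pc by auto
    have PDe: "(P * ?D) $$ (a, q) = (\<Sum>p<n. P $$ (a, p) * norm (x p - x q) ^ (2 * r - 1))" if "q < n"
      for q
      unfolding mult_mat_index_sum[OF Pc Dc ac(1) that] using that by (intro sum.cong refl) simp
    have "(fps_nth \<Psi> (2 * r - 1) \<cdot>\<^sub>m (P * ?D * P)) $$ (a, c) =
        fps_nth \<Psi> (2 * r - 1) * (\<Sum>q<n. (P * ?D) $$ (a, q) * P $$ (q, c))"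
      using ac Pc mult_mat_index_sum[OF PD Pc ac] by simp
    also have "\<dots> =
        (\<Sum>q<n. \<Sum>p<n. P $$ (a, p) * (fps_nth \<Psi> (2 * r - 1) * norm (x p - x q) ^ (2 * r - 1)) * P $$ (q, c))"
    proof (subst sum_distrib_left, rule sum.cong[OF refl])
      fix q assume "q \<in> {..<n}"
      hence q: "q < n" by simp
      show "fps_nth \<Psi> (2 * r - 1) * ((P * ?D) $$ (a, q) * P $$ (q, c)) =
          (\<Sum>p<n. P $$ (a, p) * (fps_nth \<Psi> (2 * r - 1) * norm (x p - x q) ^ (2 * r - 1)) * P $$ (q, c))"
        unfolding PDe[OF q] sum_distrib_right sum_distrib_left
          by (intro sum.cong refl) (simp only: mult_ac)
    qed
    also have "\<dots> =
        (\<Sum>p<n. \<Sum>q<n. P $$ (a, p) * (fps_nth \<Psi> (2 * r - 1) * norm (x p - x q) ^ (2 * r - 1)) * P $$ (q, c))"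
      by (rule sum.swap)
    also have "\<dots> = (\<Sum>l | l < n \<and> S.ord l = 2 * r - 1. S.lead l * (S.u0 l a * S.u0 l c))"
      using ac Pe by (subst S.top_form[OF jr refl ac, symmetric]) (intro sum.cong refl, simp)
    finally show "KK (2 * r - 1) $$ (a, c) = (fps_nth \<Psi> (2 * r - 1) \<cdot>\<^sub>m (P * ?D * P)) $$ (a, c)"
      using KK_index[OF ac, of "2 * r - 1"] unfolding idx_eq by simp
  qed (use Pc KK_carrier[of "2 * r - 1"] in auto)
qed

end

section \<open>The projection determined by the complement A\<close>

lemma complementary_projection:
  fixes Q :: "real mat"
  assumes Q: "Q \<in> carrier_mat n p" and on: "transpose_mat Q * Q = 1\<^sub>m p"
    and P: "P = 1\<^sub>m n - Q * transpose_mat Q"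
  shows "P \<in> carrier_mat n n" "transpose_mat P = P" "P * Q = 0\<^sub>m n p" "P * P = P"
proof -
  have QT: "transpose_mat Q \<in> carrier_mat p n" and QQ: "Q * transpose_mat Q \<in> carrier_mat n n"
    using Q by auto
  show Pc: "P \<in> carrier_mat n n" unfolding P by (rule minus_carrier_mat[OF QQ])
  have "transpose_mat (Q * transpose_mat Q) = Q * transpose_mat Q" using transpose_mult[OF Q QT]
    by simp
  thus "transpose_mat P = P" unfolding P using transpose_minus[OF one_carrier_mat QQ] by simp
  have "P * Q = 1\<^sub>m n * Q - Q * transpose_mat Q * Q" unfolding P
    by (rule minus_mult_distrib_mat[OF _ QQ Q]) simp
  also have "Q * transpose_mat Q * Q = Q" using assoc_mult_mat[OF Q QT Q] on Q by simp
  finally show PQ: "P * Q = 0\<^sub>m n p" using Q by simp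
  have "P * P = P * 1\<^sub>m n - P * (Q * transpose_mat Q)"
    by (subst (2) P) (rule mult_minus_distrib_mat[OF Pc _ QQ], simp)
  also have "P * (Q * transpose_mat Q) = 0\<^sub>m n n"
    using assoc_mult_mat[OF Pc Q QT] PQ QT by simp
  finally show "P * P = P" using Pc by auto
qed

lemma col_span_eq:
  assumes A: "A \<in> carrier_mat n m"
  shows "col_span A = {y \<in> carrier_vec n. \<exists>v\<in>carrier_vec m. A *\<^sub>v v = y}"
proof -
  interpret vec_space "TYPE(real)" n .
  have "col_span A = col_space A" using A by (simp add: col_span_def col_space_def)
  thus ?thesis using col_space_eq[OF A] A by simp
qed

lemma square_surjective_imp_injective:
  fixes M :: "real mat"
  assumes M: "M \<in> carrier_mat n n" and surj: "\<And>y. y \<in> carrier_vec n \<Longrightarrow> \<exists>v\<in>carrier_vec n. M *\<^sub>v v = y"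
    and v: "v \<in> carrier_vec n" "M *\<^sub>v v = 0\<^sub>v n"
  shows "v = 0\<^sub>v n"
proof -
  have "\<forall>l. \<exists>z. z \<in> carrier_vec n \<and> M *\<^sub>v z = unit_vec n l" using surj by (meson unit_vec_carrier)
  from choice[OF this] obtain z where z: "\<And>l. z l \<in> carrier_vec n" "\<And>l. M *\<^sub>v z l = unit_vec n l"
    by blast
  define Z where "Z = Matrix.mat n n (\<lambda>(i, l). vec_index (z l) i)"
  have Zc: "Z \<in> carrier_mat n n" by (simp add: Z_def)
  have colZ: "col Z l = z l" if "l < n" for l
    using that z(1)[of l] by (intro eq_vecI) (auto simp: Z_def)
  have "M * Z = 1\<^sub>m n"
  proof (rule eq_matI)
    fix i l assume "i < dim_row (1\<^sub>m n :: real mat)" "l < dim_col (1\<^sub>m n :: real mat)"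
    hence il: "i < n" "l < n" by auto
    have "(M * Z) $$ (i, l) = vec_index (M *\<^sub>v col Z l) i" using M Zc il by simp
    thus "(M * Z) $$ (i, l) = 1\<^sub>m n $$ (i, l)" using il by (simp add: colZ z(2))
  qed (use M Zc in auto)
  hence "Z * M = 1\<^sub>m n" by (rule mat_mult_left_right_inverse[OF M Zc])
  hence "v = Z *\<^sub>v (M *\<^sub>v v)" using assoc_mult_mat_vec[OF Zc M v(1)] v(1) by simp
  also have "\<dots> = 0\<^sub>v n" unfolding v(2) using Zc by (intro eq_vecI) auto
  finally show ?thesis .
qed

lemma append_cols_mult_vec:
  assumes V: "V \<in> carrier_mat n p" and A: "A \<in> carrier_mat n c"
    and u: "u \<in> carrier_vec p" and w: "w \<in> carrier_vec c"
  shows "append_cols V A *\<^sub>v vec (p + c) (\<lambda>i. if i < p then vec_index u i else vec_index w (i - p)) =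
      V *\<^sub>v u + A *\<^sub>v w"
proof (rule eq_vecI)
  let ?v = "vec (p + c) (\<lambda>i. if i < p then vec_index u i else vec_index w (i - p))"
  have M: "append_cols V A \<in> carrier_mat n (p + c)" using V A by (auto simp: append_cols_def)
  fix a assume "a < dim_vec (V *\<^sub>v u + A *\<^sub>v w)"
  hence a: "a < n" using A by simp
  have Me: "append_cols V A $$ (a, i) = (if i < p then V $$ (a, i) else A $$ (a, i - p))"
    if "i < p + c" for i
    using V A a that by (simp add: append_cols_def)
  have "vec_index (append_cols V A *\<^sub>v ?v) a = (\<Sum>i<p +
      c. append_cols V A $$ (a, i) * vec_index ?v i)"
    by (rule mult_mat_vec_index_sum[OF M _ a]) simp
  also have "\<dots> = (\<Sum>i<p +
      c. if i < p then V $$ (a, i) * vec_index u i else A $$ (a, i - p) * vec_index w (i - p))"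
    by (intro sum.cong refl) (simp add: Me)
  also have "\<dots> = (\<Sum>i<p. V $$ (a, i) * vec_index u i) + (\<Sum>i\<in>{p..<p +
      c}. A $$ (a, i - p) * vec_index w (i - p))"
  proof -
    have "{..<p + c} = {..<p} \<union> {p..<p + c}" "{..<p} \<inter> {p..<p + c} = {}" by auto
    thus ?thesis by (simp add: sum.union_disjoint cong: sum.cong_simp)
  qed
  also have "(\<Sum>i\<in>{p..<p + c}. A $$ (a, i - p) * vec_index w (i - p)) =
      (\<Sum>i<c. A $$ (a, i) * vec_index w i)"
    by (rule sum.reindex_bij_witness[where i = "\<lambda>i. p + i" and j = "\<lambda>i. i - p"]) auto
  also have "(\<Sum>i<p. V $$ (a, i) * vec_index u i) = vec_index (V *\<^sub>v u) a"
    by (rule mult_mat_vec_index_sum[OF V u a, symmetric])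
  also have "(\<Sum>i<c. A $$ (a, i) * vec_index w i) = vec_index (A *\<^sub>v w) a"
    by (rule mult_mat_vec_index_sum[OF A w a, symmetric])
  finally show "vec_index (append_cols V A *\<^sub>v ?v) a = vec_index (V *\<^sub>v u + A *\<^sub>v w) a" using A a
    by simp
qed (use V A in \<open>simp add: append_cols_def\<close>)

text \<open>With P the projection onto the complement of the range of V, the matrix P A is injective
  and has the range of P, so multiplying it by its pseudoinverse gives P, whatever complement A was
  chosen.\<close>

lemma orthogonal_component_projection:
  assumes Q: "Q \<in> carrier_mat n p" and on: "transpose_mat Q * Q = 1\<^sub>m p"
    and R: "R \<in> carrier_mat p p" and d: "det R \<noteq> 0" and V: "V = Q * R"
    and A: "A \<in> carrier_mat n c" and n: "p + c = n"
    and span: "col_span (append_cols V A) = carrier_vec n"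
    and P: "P = 1\<^sub>m n - Q * transpose_mat Q"
  shows "orthogonal_component Q A * pseudoinverse (orthogonal_component Q A) = P"
    and "transpose_mat V * A = 0\<^sub>m p c \<Longrightarrow> orthogonal_component Q A = A"
proof -
  note Pp = complementary_projection[OF Q on P]
  note I = mat_inv_det_nonzero[OF R d]
  have QT: "transpose_mat Q \<in> carrier_mat p n" using Q by simp
  have Vc: "V \<in> carrier_mat n p" unfolding V using Q R by simp
  have QV: "Q = V * mat_inv R" unfolding V using assoc_mult_mat[OF Q R I(1)] I(2) Q by simp
  have PV: "P * V = 0\<^sub>m n p" unfolding V using assoc_mult_mat[OF Pp(1) Q R] Pp(3) R by simp
  have oc: "orthogonal_component Q A = P * A" using A unfolding orthogonal_component_def P by simp
  have Bc: "P * A \<in> carrier_mat n c" using Pp(1) A by simp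
  have Mc: "append_cols V A \<in> carrier_mat n n" using Vc A n by (auto simp: append_cols_def)
  have surj: "\<exists>v\<in>carrier_vec n. append_cols V A *\<^sub>v v = y" if "y \<in> carrier_vec n" for y
    using span that unfolding col_span_eq[OF Mc] by blast
  \<comment> \<open>If P A v = 0, then A v lies in the range of Q, hence A v = V w, and (-w, v) is
    in the kernel of [V A]. This matrix is square because p + c = n, so spanning makes it
    injective.\<close>
  have inj: "v = 0\<^sub>v c" if v: "v \<in> carrier_vec c" and z: "(P * A) *\<^sub>v v = 0\<^sub>v n" for v
  proof -
    define w where "w = mat_inv R *\<^sub>v (transpose_mat Q *\<^sub>v (A *\<^sub>v v))"
    have Av: "A *\<^sub>v v \<in> carrier_vec n" using A v by simp
    have QAv: "transpose_mat Q *\<^sub>v (A *\<^sub>v v) \<in> carrier_vec p" using QT Av by simp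
    have w: "w \<in> carrier_vec p" unfolding w_def using I(1) QAv by simp
    have "V *\<^sub>v w = Q *\<^sub>v (transpose_mat Q *\<^sub>v (A *\<^sub>v v))"
      unfolding w_def using assoc_mult_mat_vec[OF Vc I(1) QAv] QV by simp
    also have "\<dots> = (Q * transpose_mat Q) *\<^sub>v (A *\<^sub>v v)" using assoc_mult_mat_vec[OF Q QT Av] by simp
    finally have Vw: "V *\<^sub>v w = (Q * transpose_mat Q) *\<^sub>v (A *\<^sub>v v)" .
    have QQ: "Q * transpose_mat Q \<in> carrier_mat n n" using Q by simp
    have "0\<^sub>v n = P *\<^sub>v (A *\<^sub>v v)" using z assoc_mult_mat_vec[OF Pp(1) A v] by simp
    also have "\<dots> = 1\<^sub>m n *\<^sub>v (A *\<^sub>v v) - (Q * transpose_mat Q) *\<^sub>v (A *\<^sub>v v)"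
      unfolding P by (rule minus_mult_distrib_mat_vec[OF _ QQ Av]) simp
    finally have e: "A *\<^sub>v v - V *\<^sub>v w = 0\<^sub>v n" using Av Vw by simp
    let ?u = "vec (p + c) (\<lambda>i. if i < p then vec_index (- w) i else vec_index v (i - p))"
    have "append_cols V A *\<^sub>v ?u = V *\<^sub>v (- w) + A *\<^sub>v v"
      by (rule append_cols_mult_vec[OF Vc A _ v]) (use w in simp)
    also have "\<dots> = 0\<^sub>v n"
    proof (rule eq_vecI)
      fix i assume "i < dim_vec (0\<^sub>v n :: real Matrix.vec)"
      hence i: "i < n" by simp
      have "vec_index (A *\<^sub>v v - V *\<^sub>v w) i = 0" using e i by simp
      moreover have "vec_index (V *\<^sub>v (- w)) i = - vec_index (V *\<^sub>v w) i"
        using mult_mat_vec_index_sum[OF Vc _ i, of "- w"] mult_mat_vec_index_sum[OF Vc w i] w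
          by (simp add: sum_negf)
      ultimately show "vec_index (V *\<^sub>v (- w) + A *\<^sub>v v) i = vec_index (0\<^sub>v n) i" using i A Vc by simp
    qed (use A in simp)
    finally have "append_cols V A *\<^sub>v ?u = 0\<^sub>v n" .
    from square_surjective_imp_injective[OF Mc surj _ this]
    have u0: "?u = 0\<^sub>v n" using n by (simp del: index_uminus_vec)
    show ?thesis
    proof (rule eq_vecI)
      fix i assume "i < dim_vec (0\<^sub>v c :: real Matrix.vec)"
      hence i: "i < c" by simp
      have "vec_index ?u (p + i) = vec_index (0\<^sub>v n) (p + i)" unfolding u0 ..
      thus "vec_index v i = vec_index (0\<^sub>v c) i" using i n by simp
    qed (use v in simp)
  qed
  \<comment> \<open>Each unit vector is V w1 + A w2, and P V = 0. The vectors w2 form the columns of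
    a matrix Y with P = P A Y.\<close>
  have "\<forall>l. \<exists>y. y \<in> carrier_vec c \<and> P *\<^sub>v unit_vec n l = (P * A) *\<^sub>v y"
  proof
    fix l
    obtain v where v: "v \<in> carrier_vec n" "append_cols V A *\<^sub>v v = unit_vec n l"
      using surj[of "unit_vec n l"] by auto
    define w1 w2 where "w1 = vec p (vec_index v)" and "w2 = vec c (\<lambda>i. vec_index v (p + i))"
    have ws: "w1 \<in> carrier_vec p" "w2 \<in> carrier_vec c" by (auto simp: w1_def w2_def)
    have "v = vec (p + c) (\<lambda>i. if i < p then vec_index w1 i else vec_index w2 (i - p))"
      using v(1) n by (intro eq_vecI) (auto simp: w1_def w2_def)
    hence u: "unit_vec n l = V *\<^sub>v w1 + A *\<^sub>v w2" using append_cols_mult_vec[OF Vc A ws] v(2) by simp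
    have "P *\<^sub>v unit_vec n l = P *\<^sub>v (V *\<^sub>v w1) + P *\<^sub>v (A *\<^sub>v w2)"
      unfolding u by (rule mult_add_distrib_mat_vec[OF Pp(1)]) (use Vc A ws in auto)
    also have "P *\<^sub>v (V *\<^sub>v w1) = 0\<^sub>v n"
      unfolding assoc_mult_mat_vec[OF Pp(1) Vc ws(1), symmetric] PV
      using ws(1) by (intro eq_vecI) (simp_all add: scalar_prod_def)
    also have "P *\<^sub>v (A *\<^sub>v w2) = (P * A) *\<^sub>v w2" using assoc_mult_mat_vec[OF Pp(1) A ws(2)] by simp
    finally have "P *\<^sub>v unit_vec n l = (P * A) *\<^sub>v w2" using Bc ws(2) by simp
    thus "\<exists>y. y \<in> carrier_vec c \<and> P *\<^sub>v unit_vec n l = (P * A) *\<^sub>v y" using ws(2) by blast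
  qed
  from choice[OF this] obtain y where y: "\<And>l. y l \<in> carrier_vec c" "\<And>l. P *\<^sub>v unit_vec n l =
      (P * A) *\<^sub>v y l" by blast
  define Y where "Y = Matrix.mat c n (\<lambda>(i, l). vec_index (y l) i)"
  have Yc: "Y \<in> carrier_mat c n" by (simp add: Y_def)
  have colY: "col Y l = y l" if "l < n" for l
    using that y(1)[of l] by (intro eq_vecI) (auto simp: Y_def)
  have PY: "P = P * A * Y"
  proof (rule eq_matI)
    fix i l assume "i < dim_row (P * A * Y)" "l < dim_col (P * A * Y)"
    hence il: "i < n" "l < n" using Pp(1) Yc by auto
    have "vec_index (col P l) i = vec_index ((P * A) *\<^sub>v col Y l) i"
      using y(2)[of l] mult_mat_unit_vec[OF Pp(1) il(2)] colY[OF il(2)] by simp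
    thus "P $$ (i, l) = (P * A * Y) $$ (i, l)" using il Pp(1) Bc Yc by simp
  qed (use Pp(1) Yc in auto)
  show "orthogonal_component Q A * pseudoinverse (orthogonal_component Q A) = P"
    unfolding oc
    by (rule mult_pseudoinverse_eq_projection[OF Bc Pp(1,2,4) _ Yc PY inj])
       (use assoc_mult_mat[OF Pp(1) Pp(1) A] Pp(4) in simp)
  assume VA: "transpose_mat V * A = 0\<^sub>m p c"
  have IT: "transpose_mat (mat_inv R) \<in> carrier_mat p p" and VT: "transpose_mat V \<in> carrier_mat p n"
    using I(1) Vc by auto
  have "transpose_mat Q = transpose_mat (mat_inv R) * transpose_mat V"
    using transpose_mult[OF Vc I(1)] QV by simp
  hence "transpose_mat Q * A = 0\<^sub>m p c"
    using assoc_mult_mat[OF IT VT A] VA IT by simp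
  hence "Q * transpose_mat Q * A = 0\<^sub>m n c" using assoc_mult_mat[OF Q QT A] Q by simp
  moreover have "P * A = 1\<^sub>m n * A - Q * transpose_mat Q * A"
    unfolding P by (rule minus_mult_distrib_mat[OF _ _ A]) (use Q in auto)
  ultimately show "orthogonal_component Q A = A" unfolding oc using A by auto
qed

context qr_spectrum
begin

lemma invertible_blocks:
  assumes jp: "j > 0"
  shows "invertible_mat (block_mat [0..<j] [0..<j] H)" "invertible_mat (block_mat [0..<j] [0..<j] W)"
proof -
  have "block_mat [0..<j] [0..<j] H \<in> carrier_mat (offset b j) (offset b j)"
    by (rule block_mat_blocks(1)[OF jp jp]) (rule H_carrier; simp)
  thus "invertible_mat (block_mat [0..<j] [0..<j] H)" using det_H[OF jp]
    by (rule mat_inv_det_nonzero(4))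
  have "block_mat [0..<j] [0..<j] W \<in> carrier_mat (offset h j) (offset h j)"
    by (rule block_mat_blocks(1)[OF jp jp]) (rule W_carrier)
  thus "invertible_mat (block_mat [0..<j] [0..<j] W)"
    using det_W[OF jp det_H[OF jp]] by (rule mat_inv_det_nonzero(4))
qed

lemma schur_W_carrier: "schur_complement W j \<in> carrier_mat (h j) (h j)"
  by (rule schur_complement_carrier) (rule W_carrier, rule det_W, assumption, rule det_H)

lemma spectral_term:
  "Q j * schur_complement H j * transpose_mat (Q j) =
     (if j = 0 then V 0 * W 0 0 * transpose_mat (V 0)
      else Q j * transpose_mat (Q j) * V j * schur_complement W j * transpose_mat (V j) * Q j * transpose_mat (Q j))"
proof (cases "j = 0")
  case True
  thus ?thesis using Q_R_sandwich_0[OF W_carrier] by (simp add: schur_complement_def)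
next
  case False
  hence jp: "j > 0" by simp
  show ?thesis unfolding schur_H[OF jp det_H[OF jp]] using Q_R_sandwich[OF schur_W_carrier] False
    by simp
qed

text \<open>The general A, through its orthogonal component, and an A orthogonal to the Vandermonde
  columns are treated together: in both cases B times its pseudoinverse is the projection P of
  \<open>KK_top\<close>.\<close>

lemma top_term:
  assumes jr: "j = r - 1"
    and A: "A \<in> carrier_mat n (n - mat_rank (Vle j))" and rank: "mat_rank (Vle j) \<le> n"
    and spans: "col_span (append_cols (Vle j) A) = carrier_vec n"
    and B: "B = orthogonal_component (hcat (map Q [0..<r])) A \<or>
      (transpose_mat (Vle j) * A = 0\<^sub>m (dim_col (Vle j)) (n - mat_rank (Vle j)) \<and> B = A)"
  shows "KK (2 * r - 1) = fps_nth \<Psi> (2 * r - 1) \<cdot>\<^sub>m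
    (B * pseudoinverse B * Matrix.mat n n (\<lambda>(i, j). norm (x i - x j) ^ (2 * r - 1)) * (B * pseudoinverse B))"
proof -
  let ?Q = "hcat (map Q [0..<r])" and ?R = "block_mat [0..<r] [0..<r] R"
  define P where "P = 1\<^sub>m n - ?Q * transpose_mat ?Q"
  have r: "r > 0" and sr: "Suc j = r" using less_r[of 0] jr by auto
  have bh: "b i = h i" if "i < r" for i using b_eq_h[of i] that sr by simp
  have p: "mat_rank (Vle j) = offset h r" using rank_Vle[of j] sr by simp
  have off: "offset b r = offset h r" using bh by (simp add: offset_def)
  have Qc: "?Q \<in> carrier_mat n (offset h r)"
    unfolding off[symmetric] by (rule hcat_blocks(1)[OF r]) (rule Q_carrier)
  have Rc: "?R \<in> carrier_mat (offset h r) (offset h r)"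
    by (rule block_mat_blocks(1)[OF r r]) (use R_carrier bh in force)
  have on: "transpose_mat ?Q * ?Q = 1\<^sub>m (offset h r)" and VQR: "Vle j = ?Q * ?R"
    using qr Qc jr by (auto simp: block_qr_def Let_def)
  have dR: "det ?R \<noteq> 0" using det_R[of j] sr by simp
  have n: "offset h r + (n - offset h r) = n" using rank p by simp
  note oc = orthogonal_component_projection[OF Qc on Rc dR VQR A[unfolded p] n spans P_def]
  have "dim_col (Vle j) = offset h r" using VQR Rc by simp
  hence "B * pseudoinverse B = P" using B oc unfolding p by metis
  thus ?thesis using KK_top[OF jr P_def] by simp
qed

end

theorem corollary6p16:
  fixes \<psi> :: "real \<Rightarrow> real" and \<Psi> :: "real fps"
    and x :: "nat \<Rightarrow> real ^ 'd::{finite,linorder}"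
    and mons :: "nat \<Rightarrow> ('d \<Rightarrow> nat) list"
    and n r c :: nat
    and Q :: "nat \<Rightarrow> real mat" and R :: "nat \<Rightarrow> nat \<Rightarrow> real mat" and A :: "real mat"
    and ev :: "nat \<Rightarrow> real \<Rightarrow> real" and u :: "nat \<Rightarrow> real \<Rightarrow> real Matrix.vec"
    and d :: nat and k :: "real ^ 'd::{finite,linorder} \<Rightarrow> real ^ 'd::{finite,linorder} \<Rightarrow> real"
    and K :: "real \<Rightarrow> real mat" and D Qf :: "real mat" and V Vle :: "nat \<Rightarrow> real mat"
    and W H :: "nat \<Rightarrow> nat \<Rightarrow> real mat" and S :: "nat \<Rightarrow> real mat"
    and idx :: "nat \<Rightarrow> nat set" and KK :: "nat \<Rightarrow> real mat"
  defines "d \<equiv> CARD('d)"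
    and "k \<equiv> \<lambda>y z :: real ^ 'd::{finite,linorder}. \<psi> (norm (y - z))"
    and "K \<equiv> \<lambda>\<epsilon>. Matrix.mat n n (\<lambda>(i, j). \<psi> (\<epsilon> * norm (x i - x j)))"
    and "D \<equiv> Matrix.mat n n (\<lambda>(i, j). norm (x i - x j) ^ (2 * r - 1))"
    and "V \<equiv> vandermonde n x mons"
    and "Vle \<equiv> vandermonde_le n x mons"
    and "W \<equiv> wronskian k mons"
    and "H \<equiv> \<lambda>i l. R i i * W i l * transpose_mat (R l l)"
    and "S \<equiv> schur_complement H"
    and "Qf \<equiv> hcat (map Q [0..<r])"
    and "idx \<equiv> \<lambda>a. {i. i < n \<and> of_order (ev i) a}"
    and "KK \<equiv> mat_coeff (spectral_equivalent n ev u)"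
  assumes pd: "positive_definite_kernel k"
    and analytic: "\<psi> has_fps_expansion \<Psi>"
    and reg: "regularity_index \<Psi> r"
    and points: "inj_on x {..<n}"
    and ordering: "monomial_ordering mons"
    and rank: "mat_rank (Vle (r - 1)) < n"
    and c: "c = n - mat_rank (Vle (r - 1))"
    and A: "A \<in> carrier_mat n c" "full_column_rank A"
    and spans: "col_span (append_cols (Vle (r - 1)) A) = carrier_vec n"
    and qr: "block_qr d n r Vle Q R"
    and eig: "analytic_eigensystem n K ev u"
  shows
    "(\<forall>j \<le> r - 1. full_column_rank (Vle j) \<longrightarrow>
        card (idx (2 * j)) = hdim j d \<and>
        (j = 0 \<longrightarrow> S j = R 0 0 * W 0 0 * transpose_mat (R 0 0)) \<and>
        (j > 0 \<longrightarrow>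
           invertible_mat (block_mat [0..<j] [0..<j] H) \<and>
           invertible_mat (block_mat [0..<j] [0..<j] W) \<and>
           S j = R j j * schur_complement W j * transpose_mat (R j j)) \<and>
        image_mset (\<lambda>i. leading_coefficient (ev i)) (mset_set (idx (2 * j)))
          = proots (char_poly (S j)) \<and>
        KK (2 * j) = Q j * S j * transpose_mat (Q j) \<and>
        Q j * S j * transpose_mat (Q j) =
          (if j = 0 then V 0 * W 0 0 * transpose_mat (V 0)
           else Q j * transpose_mat (Q j) * V j * schur_complement W j
                  * transpose_mat (V j) * Q j * transpose_mat (Q j)) \<and>
        (\<forall>i \<in> idx (2 * j). leading_coefficient (ev i) \<noteq> 0 \<and>
           eigenvector (KK (2 * j)) (u i 0) (leading_coefficient (ev i)))) \<and>
     (full_column_rank (Vle (r - 1)) \<longrightarrow>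
        card (idx (2 * r - 1)) = n - pdim (r - 1) d \<and>
        (let B = orthogonal_component Qf A in
           KK (2 * r - 1) =
             fps_nth \<Psi> (2 * r - 1) \<cdot>\<^sub>m (B * pseudoinverse B * D * (B * pseudoinverse B))) \<and>
        (transpose_mat (Vle (r - 1)) * A = 0\<^sub>m (dim_col (Vle (r - 1))) c \<longrightarrow>
           KK (2 * r - 1) =
             fps_nth \<Psi> (2 * r - 1) \<cdot>\<^sub>m (A * pseudoinverse A * D * (A * pseudoinverse A))) \<and>
        (\<forall>i \<in> idx (2 * r - 1). leading_coefficient (ev i) \<noteq> 0 \<and>
           eigenvector (KK (2 * r - 1)) (u i 0) (leading_coefficient (ev i))))"
proof -
  have rk: "radial_kernel \<psi> \<Psi> r k"
    using pd analytic reg by (intro radial_kernel.intro) (simp_all add: k_def)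
  from eigensystem_fps[OF rk points eig[unfolded K_def]] obtain E U where EU:
    "\<And>l. l < n \<Longrightarrow> ev l has_fps_expansion E l"
    "\<And>l a. l < n \<Longrightarrow> a < n \<Longrightarrow> vec_index (u l 0) a = fps_nth (U l a) 0"
    "\<And>l. l < n \<Longrightarrow> u l 0 \<in> carrier_vec n"
    "\<And>l a. l < n \<Longrightarrow> a < n \<Longrightarrow>
       (\<Sum>b<n. Abs_fps (\<lambda>m. fps_nth \<Psi> m * norm (x a - x b) ^ m) * U l b) = E l * U l a"
    "\<And>a b. a < n \<Longrightarrow> b < n \<Longrightarrow> (\<Sum>l<n. U l a * U l b) = (if a = b then 1 else 0)"
    "\<And>l m. l < n \<Longrightarrow> m < n \<Longrightarrow> (\<Sum>a<n. U l a * U m a) = (if l = m then 1 else 0)"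
    "\<And>l. l < n \<Longrightarrow> E l \<noteq> 0 \<and> fps_nth (E l) (subdegree (E l)) > 0"
    by blast
  \<comment> \<open>The index j is a locale parameter: the first part interprets the locale for each
    admissible j, the second for j = r - 1.\<close>
  have loc: "qr_spectrum \<psi> \<Psi> r k n x mons Q R d j ev u E U"
    if "j \<le> r - 1" "full_column_rank (Vle j)" for j
    using that rk points ordering qr unfolding d_def Vle_def
    by (intro qr_spectrum.intro qr_full.intro qr_setting.intro qr_full_axioms.intro qr_spectrum_axioms.intro)
       (assumption | rule refl EU)+
  show ?thesis
  proof (intro conjI allI impI)
    fix j assume j: "j \<le> r - 1" "full_column_rank (Vle j)"
    interpret qr_spectrum \<psi> \<Psi> r k n x mons Q R d j ev u E U by (rule loc[OF j])
    note defs = H_def W_def V_def S_def KK_def idx_def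
    show "card (idx (2 * j)) = hdim j d" unfolding defs by (rule card_idx)
    show "S j = R 0 0 * W 0 0 * transpose_mat (R 0 0)" if "j = 0"
      using that by (simp add: defs schur_complement_def)
    show "invertible_mat (block_mat [0..<j] [0..<j] H)" if "j > 0"
      unfolding defs by (rule invertible_blocks(1)[OF that])
    show "invertible_mat (block_mat [0..<j] [0..<j] W)" if "j > 0"
      unfolding defs by (rule invertible_blocks(2)[OF that])
    show "S j = R j j * schur_complement W j * transpose_mat (R j j)" if "j > 0"
      unfolding defs by (rule schur_H[OF that det_H[OF that]])
    show "image_mset (\<lambda>i. leading_coefficient (ev i)) (mset_set (idx (2 * j))) = proots (char_poly (S j))"
      unfolding defs by (rule proots_S)
    show "KK (2 * j) = Q j * S j * transpose_mat (Q j)"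
      unfolding defs by (rule KK_even)
    show "Q j * S j * transpose_mat (Q j) =
        (if j = 0 then V 0 * W 0 0 * transpose_mat (V 0)
         else Q j * transpose_mat (Q j) * V j * schur_complement W j
                * transpose_mat (V j) * Q j * transpose_mat (Q j))"
      unfolding defs by (rule spectral_term)
    show "\<forall>i\<in>idx (2 * j). leading_coefficient (ev i) \<noteq> 0 \<and>
        eigenvector (KK (2 * j)) (u i 0) (leading_coefficient (ev i))"
      unfolding defs by (rule ballI) (rule KK_eigenvector)
  next
    assume full: "full_column_rank (Vle (r - 1))"
    interpret qr_spectrum \<psi> \<Psi> r k n x mons Q R d "r - 1" ev u E U by (rule loc[OF order_refl full])
    note defs = H_def W_def V_def S_def KK_def idx_def Qf_def D_def
    note top = top_term[OF refl A(1)[unfolded c Vle_def] less_imp_le[OF rank[unfolded Vle_def]] spans[unfolded Vle_def]]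
    show "card (idx (2 * r - 1)) = n - pdim (r - 1) d" unfolding defs by (rule card_idx_top[OF refl])
    show "let B = orthogonal_component Qf A in
        KK (2 * r - 1) = fps_nth \<Psi> (2 * r - 1) \<cdot>\<^sub>m (B * pseudoinverse B * D * (B * pseudoinverse B))"
      unfolding defs Let_def by (rule top) simp
    show "KK (2 * r - 1) = fps_nth \<Psi> (2 * r - 1) \<cdot>\<^sub>m (A * pseudoinverse A * D * (A * pseudoinverse A))"
      if "transpose_mat (Vle (r - 1)) * A = 0\<^sub>m (dim_col (Vle (r - 1))) c"
      unfolding defs by (rule top) (use that c in \<open>simp add: Vle_def\<close>)
    show "\<forall>i\<in>idx (2 * r - 1). leading_coefficient (ev i) \<noteq> 0 \<and>
        eigenvector (KK (2 * r - 1)) (u i 0) (leading_coefficient (ev i))"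
      unfolding defs by (rule ballI) (rule KK_eigenvector)
  qed
qed

end
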